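(* Let $n\ge1$ and let $S\in\mathbb{Z}^{n\times n}$ be symmetric, positive definite, maximal even with $\det S=1$; let $\Gamma_S$, the Maaß space $\mathcal{M}_k^*(\Gamma_S)$, $f^*$, $\mathcal{T}_S(q)$ and $\mathcal{T}(m)$ be as in the context. Let $f\in\mathcal{M}_k^*(\Gamma_S)$ and let $q$ be a prime ($q\nmid\det S$). Then $f$ is an eigenform under $\mathcal{T}_S(q)$ if and only if $f^*$ is an eigenform under $\mathcal{T}(q^2)$ (acting in weight $k-n/2$).
   Context: Write $A[B]:=B^{tr}AB$. $S_0=\begin{pmatrix}0&0&1\\0&-S&0\\1&0&0\end{pmatrix}$, $S_1=\begin{pmatrix}0&0&1\\0&S_0&0\\1&0&0\end{pmatrix}$, $L_0^{\#}=S_0^{-1}\mathbb{Z}^{n+2}$. For $\lambda\in\mathbb{R}^{n+2}$, $\lambda\ge0$ means $\lambda_1\ge0,\lambda_{n+2}\ge0,S_0[\lambda]\ge0$. $\mathcal{H}$ is the upper half-plane, $\mathcal{H}_S=\{w=(\tau,z,\tau')^{tr}=u+iv\in\mathbb{C}^{n+2}:\tau,\tau'\in\mathcal{H},S_0[v]>0\}$. For $M=\begin{pmatrix}\alpha&a^{tr}&\beta\\ b&K&c\\ \gamma&d^{tr}&\delta\end{pmatrix}$, $M\{w\}=-\frac{\gamma}{2}S_0[w]+d^{tr}w+\delta$, $M\langle w\rangle=(-\frac12S_0[w]b+Kw+c)M\{w\}^{-1}$, $(f|_kM)(w)=f(M\langle w\rangle)M\{w\}^{-k}$. $SO^+(S_1;\mathbb{R})$: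 real $M$ with $S_1[M]=S_1$, $\det M=1$, mapping $\mathcal{H}_S$ onto itself. $\Gamma_S=\{M\in SO^+(S_1;\mathbb{R}):M\in I+\mathbb{Z}^{(n+4)\times(n+4)}S_1\}$. $\mathcal{M}_k(\Gamma_S)$: holomorphic $f$ on $\mathcal{H}_S$ with $f|_kM=f$ for all $M\in\Gamma_S$, with Fourier expansion $f(w)=\sum_{\lambda\in L_0^{\#},\lambda\ge0}\alpha_f(\lambda)e^{2\pi i\lambda^{tr}S_0w}$ ($\alpha_f(\lambda):=0$ otherwise). $\epsilon(\lambda)=\gcd(S_0\lambda)$. Maaß space $\mathcal{M}_k^*(\Gamma_S)$: all $f\in\mathcal{M}_k(\Gamma_S)$ with $\alpha_f(\lambda)=\sum_{d\mid\epsilon(\lambda)}d^{k-1}\alpha_f((1,\mu/d,lm/d^2)^{tr})$ for all $0\ne\lambda=(m,\mu,l)^{tr}\in L_0^{\#}$. For $f\in\mathcal{M}_k^*(\Gamma_S)$ put $f^*(\tau)=\sum_{l=0}^\infty\alpha_f((l,0,1)^{tr})e^{2\pi il\tau}$; when $\det S=1$, $f\mapsto f^*$ is an isomorphism of $\mathcal{M}_k^*(\Gamma_S)$ onto the space of elliptic modular forms of weight $k-n/2$ for $SL_2(\mathbb{Z})$. For $r\in\mathbb{N}$, $\Delta_S(r)=\{R\in\mathbb{Z}^{(n+4)\times(n+4)}:r^{-1/2}R\in SO^+(S_1;\mathbb{R})\}$; for a prime $q$, $\mathcal{T}_S(q)=\Gamma_S\,\mathrm{diag}(1,q,\dots,q,q^2)\,\Gamma_S$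 ($n+2$ entries $q$) acting by $f|_k\mathcal{T}_S(q)=\sum_{M\in\Gamma_S\backslash\mathcal{T}_S(q)}f|_kM$ (no normalizing factor). $\mathcal{T}(m)$ is the elliptic Hecke operator without normalizing factor: for an elliptic modular form $h$ of weight $k'$, $h|\mathcal{T}(m)=\sum_{M}h|_{k'}M$, $M=\begin{pmatrix}a&b\\c&d\end{pmatrix}$ running over $SL_2(\mathbb{Z})\backslash\{M\in\mathbb{Z}^{2\times2}:\det M=m\}$, $(h|_{k'}M)(\tau)=h(\frac{a\tau+b}{c\tau+d})(c\tau+d)^{-k'}$. A form $g$ is an eigenform under an operator $T$ if $g|T=cg$ for some $c\in\mathbb{C}$. *)

theory Defs
  imports "HOL-Analysis.Analysis" "HOL-Computational_Algebra.Primes"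
begin

text \<open>
  Coordinates \<open>1, 2, \<dots>, m + 1, m + 2\<close> are indexed by the three summands of \<open>unit + 'm + unit\<close>, so
  a \<open>3 \<times> 3\<close> block decomposition of a matrix is just a case distinction on its two indices.
\<close>

type_synonym 'm bord = "unit + 'm + unit"

abbreviation fst_ix :: "'m bord" where "fst_ix \<equiv> Inl ()"
abbreviation mid_ix :: "'m \<Rightarrow> 'm bord" where "mid_ix j \<equiv> Inr (Inl j)"
abbreviation lst_ix :: "'m bord" where "lst_ix \<equiv> Inr (Inr ())"

definition bvec :: "'a \<Rightarrow> 'a^'m::finite \<Rightarrow> 'a \<Rightarrow> 'a^'m bord" where
  "bvec a x b = (\<chi> i. case i of Inl _ \<Rightarrow> a | Inr (Inl j) \<Rightarrow> x $ j | Inr (Inr _) \<Rightarrow> b)"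

definition mid :: "'a^'m bord \<Rightarrow> 'a^'m::finite" where
  "mid x = (\<chi> j. x $ mid_ix j)"

definition hyp_ext :: "'a::zero_neq_one^'m^'m::finite \<Rightarrow> 'a^'m bord^'m bord" where
  "hyp_ext A = (\<chi> i. case i of
      Inl _ \<Rightarrow> bvec 0 0 1
    | Inr (Inl j) \<Rightarrow> bvec 0 (A $ j) 0
    | Inr (Inr _) \<Rightarrow> bvec 1 0 0)"

text \<open>\<open>qform A x\<close> is \<open>A[x] = x\<^sup>t\<^sup>r A x\<close>; over the complex numbers there is no conjugation.\<close>

definition qform :: "'a::comm_semiring_1^'m^'m::finite \<Rightarrow> 'a^'m \<Rightarrow> 'a" where
  "qform A x = (\<Sum>i\<in>UNIV. x $ i * (A *v x) $ i)"

definition ivec :: "int^'m::finite \<Rightarrow> 'a::ring_1^'m" where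
  "ivec g = (\<chi> i. of_int (g $ i))"

definition S0 :: "int^'n^'n::finite \<Rightarrow> 'a::ring_1^'n bord^'n bord" where
  "S0 S = map_matrix of_int (hyp_ext (- S))"

definition S1 :: "int^'n^'n::finite \<Rightarrow> 'a::ring_1^'n bord bord^'n bord bord" where
  "S1 S = map_matrix of_int (hyp_ext (S0 S))"

definition pos_def :: "int^'n^'n::finite \<Rightarrow> bool" where
  "pos_def S \<longleftrightarrow> (\<forall>x::real^'n. x \<noteq> 0 \<longrightarrow> qform (map_matrix of_int S) x > 0)"

text \<open>
  An additive group \<open>L\<close> containing the integer vectors on which the positive definite form \<open>S\<close> only
  takes values in \<open>2\<int>\<close> is discrete, hence a lattice; so discreteness need not be required below.
\<close>

definition maximal_even :: "int^'n^'n::finite \<Rightarrow> bool" where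
  "maximal_even S \<longleftrightarrow>
     (\<forall>x::int^'n. even (qform S x)) \<and>
     (\<forall>L::(real^'n) set.
        range ivec \<subseteq> L \<and> (\<forall>x\<in>L. \<forall>y\<in>L. x - y \<in> L) \<and>
        (\<forall>x\<in>L. \<exists>m::int. qform (map_matrix of_int S) x = of_int (2 * m))
        \<longrightarrow> L = range ivec)"

definition L0_dual :: "int^'n^'n::finite \<Rightarrow> (real^'n bord) set" where
  "L0_dual S = range (\<lambda>g. matrix_inv (S0 S) *v ivec g)"

definition nonneg :: "int^'n^'n::finite \<Rightarrow> real^'n bord \<Rightarrow> bool" where
  "nonneg S l \<longleftrightarrow> l $ fst_ix \<ge> 0 \<and> l $ lst_ix \<ge> 0 \<and> qform (S0 S) l \<ge> 0"

text \<open>On \<open>L0_dual S\<close> the entries of \<open>S0 S *v l\<close> are integers, so the floor only changes the type.\<close>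

definition eps :: "int^'n^'n::finite \<Rightarrow> real^'n bord \<Rightarrow> nat" where
  "eps S l = Gcd (range (\<lambda>i. nat \<bar>\<lfloor>(S0 S *v l) $ i\<rfloor>\<bar>))"

definition upper_half_plane :: "complex set" where
  "upper_half_plane = {t. Im t > 0}"

definition half_space :: "int^'n^'n::finite \<Rightarrow> (complex^'n bord) set" where
  "half_space S = {w. w $ fst_ix \<in> upper_half_plane \<and> w $ lst_ix \<in> upper_half_plane \<and>
                      qform (S0 S) (\<chi> i. Im (w $ i)) > 0}"

definition cfactor ::
    "int^'n^'n::finite \<Rightarrow> real^'n bord bord^'n bord bord \<Rightarrow> complex^'n bord \<Rightarrow> complex" where
  "cfactor S M w =
     - of_real (M $ lst_ix $ fst_ix) / 2 * qform (S0 S) w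
     + (\<Sum>j\<in>UNIV. of_real (M $ lst_ix $ mid_ix j) * w $ j)
     + of_real (M $ lst_ix $ lst_ix)"

definition orth_act ::
    "int^'n^'n::finite \<Rightarrow> real^'n bord bord^'n bord bord \<Rightarrow> complex^'n bord \<Rightarrow> complex^'n bord" where
  "orth_act S M w = (\<chi> i.
     (- 1 / 2 * qform (S0 S) w * of_real (M $ mid_ix i $ fst_ix)
      + (\<Sum>j\<in>UNIV. of_real (M $ mid_ix i $ mid_ix j) * w $ j)
      + of_real (M $ mid_ix i $ lst_ix)) * inverse (cfactor S M w))"

definition slash ::
    "int^'n^'n::finite \<Rightarrow> int \<Rightarrow> (complex^'n bord \<Rightarrow> complex) \<Rightarrow> real^'n bord bord^'n bord bord
      \<Rightarrow> complex^'n bord \<Rightarrow> complex" where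
  "slash S k f M w = f (orth_act S M w) * cfactor S M w powi (- k)"

definition SO_plus :: "int^'n^'n::finite \<Rightarrow> (real^'n bord bord^'n bord bord) set" where
  "SO_plus S = {M. transpose M ** S1 S ** M = S1 S \<and> det M = 1 \<and>
                   orth_act S M ` half_space S = half_space S}"

definition Gamma_S :: "int^'n^'n::finite \<Rightarrow> (real^'n bord bord^'n bord bord) set" where
  "Gamma_S S = {M \<in> SO_plus S.
     \<exists>A::int^'n bord bord^'n bord bord. M = mat 1 + map_matrix of_int A ** S1 S}"

text \<open>Total differentiability with complex-linear derivative at each point of the open set \<open>U\<close>.\<close>

definition holomorphic_several :: "(complex^'m::finite \<Rightarrow> complex) \<Rightarrow> (complex^'m) set \<Rightarrow> bool" where
  "holomorphic_several f U \<longleftrightarrow>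
     (\<forall>w\<in>U. \<exists>D. (f has_derivative D) (at w) \<and> (\<forall>c x. D (c *s x) = c * D x))"

definition fourier_expansion ::
    "int^'n^'n::finite \<Rightarrow> (complex^'n bord \<Rightarrow> complex) \<Rightarrow> (real^'n bord \<Rightarrow> complex) \<Rightarrow> bool" where
  "fourier_expansion S f a \<longleftrightarrow>
     (\<forall>l. \<not> (l \<in> L0_dual S \<and> nonneg S l) \<longrightarrow> a l = 0) \<and>
     (\<forall>w\<in>half_space S.
        ((\<lambda>l. a l * exp (2 * of_real pi * \<i> * (\<Sum>i\<in>UNIV. of_real (l $ i) * (S0 S *v w) $ i)))
          has_sum f w) {l \<in> L0_dual S. nonneg S l})"

definition modular_forms :: "int^'n^'n::finite \<Rightarrow> int \<Rightarrow> (complex^'n bord \<Rightarrow> complex) set" where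
  "modular_forms S k = {f. holomorphic_several f (half_space S) \<and>
     (\<forall>M\<in>Gamma_S S. \<forall>w\<in>half_space S. slash S k f M w = f w) \<and>
     (\<exists>a. fourier_expansion S f a)}"

definition fourier_coeff ::
    "int^'n^'n::finite \<Rightarrow> (complex^'n bord \<Rightarrow> complex) \<Rightarrow> real^'n bord \<Rightarrow> complex" where
  "fourier_coeff S f = (THE a. fourier_expansion S f a)"

text \<open>
  The relation is imposed for \<open>l \<ge> 0\<close> only: for negative \<open>l\<close> the left-hand side is \<open>0\<close> by convention,
  whereas the right-hand side is a sum of coefficients at vectors that may well be non-negative.
\<close>

definition maass_space :: "int^'n^'n::finite \<Rightarrow> int \<Rightarrow> (complex^'n bord \<Rightarrow> complex) set" where
  "maass_space S k = {f \<in> modular_forms S k.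
     \<forall>l\<in>L0_dual S. l \<noteq> 0 \<and> nonneg S l \<longrightarrow>
       fourier_coeff S f l =
         (\<Sum>d | d dvd eps S l. of_nat d powi (k - 1) *
            fourier_coeff S f
              (bvec 1 ((1 / real d) *s mid l) (l $ lst_ix * l $ fst_ix / (real d)\<^sup>2)))}"

definition star :: "int^'n^'n::finite \<Rightarrow> (complex^'n bord \<Rightarrow> complex) \<Rightarrow> complex \<Rightarrow> complex" where
  "star S f t = (\<Sum>l::nat. fourier_coeff S f (bvec (real l) 0 1) *
                            exp (2 * of_real pi * \<i> * of_nat l * t))"

text \<open>
  Sum of \<open>F M\<close> over representatives \<open>M\<close> of the right cosets \<open>G M\<close> contained in \<open>T\<close>. For the groups below
  and functions invariant under \<open>G\<close> the summand does not depend on the representative.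
\<close>

definition coset_sum ::
    "('a::semiring_1^'m^'m::finite) set \<Rightarrow> ('a^'m^'m) set \<Rightarrow> ('a^'m^'m \<Rightarrow> complex) \<Rightarrow> complex" where
  "coset_sum G T F = (\<Sum>C\<in>(\<lambda>M. (\<lambda>A. A ** M) ` G) ` T. F (SOME M. M \<in> C))"

definition hecke_diag :: "nat \<Rightarrow> real^'n::finite bord bord^'n bord bord" where
  "hecke_diag q = (\<chi> i j. if i = j
     then (case i of Inl _ \<Rightarrow> 1 | Inr (Inl _) \<Rightarrow> real q | Inr (Inr _) \<Rightarrow> (real q)\<^sup>2) else 0)"

definition T_S :: "int^'n^'n::finite \<Rightarrow> nat \<Rightarrow> (real^'n bord bord^'n bord bord) set" where
  "T_S S q = {A ** hecke_diag q ** B | A B. A \<in> Gamma_S S \<and> B \<in> Gamma_S S}"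

definition hecke_S ::
    "int^'n^'n::finite \<Rightarrow> int \<Rightarrow> nat \<Rightarrow> (complex^'n bord \<Rightarrow> complex) \<Rightarrow> complex^'n bord \<Rightarrow> complex" where
  "hecke_S S k q f w = coset_sum (Gamma_S S) (T_S S q) (\<lambda>M. slash S k f M w)"

definition slash_ell :: "int \<Rightarrow> (complex \<Rightarrow> complex) \<Rightarrow> int^2^2 \<Rightarrow> complex \<Rightarrow> complex" where
  "slash_ell k h M t =
     h ((of_int (M $ 1 $ 1) * t + of_int (M $ 1 $ 2)) / (of_int (M $ 2 $ 1) * t + of_int (M $ 2 $ 2)))
     * (of_int (M $ 2 $ 1) * t + of_int (M $ 2 $ 2)) powi (- k)"

definition hecke_ell :: "int \<Rightarrow> nat \<Rightarrow> (complex \<Rightarrow> complex) \<Rightarrow> complex \<Rightarrow> complex" where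
  "hecke_ell k m h t =
     coset_sum {M::int^2^2. det M = 1} {M. det M = int m} (\<lambda>M. slash_ell k h M t)"

definition eigenform_on ::
    "'b set \<Rightarrow> (('b \<Rightarrow> complex) \<Rightarrow> 'b \<Rightarrow> complex) \<Rightarrow> ('b \<Rightarrow> complex) \<Rightarrow> bool" where
  "eigenform_on U T g \<longleftrightarrow> (\<exists>c. \<forall>w\<in>U. T g w = c * g w)"

text \<open>
  The weight \<open>k - n/2\<close>; the division is exact for the ranks that occur, since a positive definite even
  unimodular lattice has rank divisible by 8.
\<close>

definition ell_weight :: "int^'n^'n::finite \<Rightarrow> int \<Rightarrow> int" where
  "ell_weight S k = k - int CARD('n) div 2"

end

theory Submission imports Defs "HOL-Complex_Analysis.Complex_Analysis" begin

text \<open>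
  Explicit coset representatives turn \<open>f | T\<^sub>S(q) = c f\<close> into a relation between Fourier
  coefficients; most of them are indexed by the isotropic vectors modulo \<open>q\<close>.
  For \<open>f\<close> in the Maass space every coefficient is a divisor sum of the coefficients of \<open>f\<^sup>*\<close>, and
  once the isotropic vectors orthogonal to a given vector are counted, the coefficients of
  \<open>f | T\<^sub>S(q)\<close> are the same divisor sums of the coefficients of \<open>f\<^sup>* | T(q\<^sup>2)\<close>, plus a constant
  multiple of those of \<open>f\<close>. This gives both directions.

  The counts reduce to the Gauss sum \<open>\<Sum> e(u S[r] / 2q) = q\<^sup>m\<close>, \<open>n = 2m\<close>, and these together with the
  modularity of \<open>f\<^sup>*\<close> come from \<open>f\<close> itself: the first Fourier-Jacobi coefficient of \<open>f\<close> is
  \<open>f\<^sup>*\<close> times the theta series of \<open>S\<close>, and the invariance of \<open>f\<close> under one element of \<open>\<Gamma>\<^sub>S\<close> relates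
  the values of the product at \<open>\<tau>\<close> and \<open>- 1 / \<tau>\<close>. If \<open>f\<^sup>* = 0\<close>, then \<open>f\<close> is constant.
\<close>

section \<open>Bordered vectors and block matrices\<close>

text \<open>Unimodularity makes the dual lattice the integer lattice and \<open>Gamma_S S\<close>
  the integral part of \<open>SO_plus S\<close>; hence a coset of the Hecke operator is an isotropic
  line modulo \<open>q\<close>. Membership in \<open>SO_plus S\<close> needs determinant and
  orientation; writing a generator as the square of a real isometry settles both. Convergence and
  inversion of the theta series, the parity of the rank and the Gauss sums are all read off from one
  \<open>f\<close> with a nonzero coefficient in \<open>star S f\<close>. Only the product of
  \<open>star S f\<close> and theta is known to transform, and the zeros of \<open>star S f\<close>
  are not known. So identities for theta alone are obtained at points \<open>i y\<close> where
  \<open>star S f\<close> does not vanish, and extended by analytic continuation or by a limit along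
  such points. The eigenvalues on the two sides differ by the constant \<open>b0\<close>, which
  comes from the number of isotropic vectors. The index \<open>0\<close> is not covered by the
  divisor sums. Its equation agrees with that of the constant term of \<open>star S f\<close> if the
  latter is nonzero. Otherwise the coefficient of \<open>f\<close> at \<open>0\<close> has to
  vanish: for \<open>k \<noteq> 0\<close> by the action of \<open>sig\<close>, while
  \<open>k = 0\<close> would give \<open>star S f\<close> negative weight.\<close>

lemma sum_bord:
  "(\<Sum>i\<in>(UNIV::'m::finite bord set). g i) = g fst_ix + (\<Sum>j\<in>UNIV. g (mid_ix j)) + g lst_ix"
proof -
  have U: "(UNIV::'m bord set) = UNIV <+> (UNIV <+> UNIV)" by (simp add: UNIV_Plus_UNIV)
  have U1: "(UNIV :: unit set) = {()}" by auto
  show ?thesis unfolding U by (subst sum.Plus; simp add: sum.Plus U1 add.assoc)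
qed

lemma all_bord: "(\<forall>i::'m bord. P i) \<longleftrightarrow> P fst_ix \<and> (\<forall>j. P (mid_ix j)) \<and> P lst_ix"
  by (metis (full_types) old.unit.exhaust sum.exhaust)

lemma bvec_nth [simp]:
  "bvec a x b $ fst_ix = a" "bvec a x b $ mid_ix j = x $ j" "bvec a x b $ lst_ix = b"
  by (simp_all add: bvec_def)

lemma mid_bvec [simp]: "mid (bvec a x b) = x"
  by (simp add: mid_def vec_eq_iff)

lemma bvec_surj: "bvec (v $ fst_ix) (mid v) (v $ lst_ix) = v"
  unfolding vec_eq_iff by (subst all_bord) (simp add: mid_def)

lemma bvec_cases [cases type]:
  obtains a x b where "v = bvec a x b"
  using bvec_surj by metis

lemma bvec_eq_iff [simp]: "bvec a x b = bvec c y d \<longleftrightarrow> a = c \<and> x = y \<and> b = d"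
  by (metis bvec_nth(1,3) mid_bvec)

lemma bvec_add: "bvec a x b + bvec c y d = bvec (a + c) (x + y) (b + d)"
  and bvec_diff: "bvec a' x' b' - bvec c' y' d' = bvec (a' - c') (x' - y') (b' - d')"
  and bvec_uminus: "- bvec a' x' b' = bvec (- a') (- x') (- b')"
  and bvec_scale: "s *s bvec a'' x'' b'' = bvec (s * a'') (s *s x'') (s * b'')"
  unfolding vec_eq_iff by (subst all_bord; simp)+

lemma bvec_0: "(0::'a::zero^'m::finite bord) = bvec 0 0 0"
  unfolding vec_eq_iff by (subst all_bord) simp

lemma mid_scale: "mid (s *s z) = s *s mid z"
  and mid_0: "mid 0 = 0"
  by (simp_all add: mid_def vec_eq_iff)

lemmas bvec_arith = bvec_add bvec_diff bvec_uminus bvec_scale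

definition vdot :: "'a::comm_semiring_1^'m::finite \<Rightarrow> 'a^'m \<Rightarrow> 'a" where
  "vdot x y = (\<Sum>i\<in>UNIV. x $ i * y $ i)"

lemma vdot_bvec: "vdot (bvec a x b) (bvec c y d) = a * c + vdot x y + b * d"
  by (simp add: vdot_def sum_bord)

lemma vdot_0 [simp]: "vdot 0 x = 0" "vdot x 0 = 0"
  by (simp_all add: vdot_def)

lemma vdot_commute: "vdot x y = vdot y x"
  by (simp add: vdot_def mult.commute)

lemma vdot_add: "vdot (x + y) z = vdot x z + vdot y z" "vdot z (x + y) = vdot z x + vdot z y"
  by (simp_all add: vdot_def algebra_simps sum.distrib)

lemma vdot_scale: "vdot (c *s x) y = c * vdot x y" "vdot x (c *s y) = c * vdot x y"
  by (simp_all add: vdot_def sum_distrib_left mult_ac)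

lemma vdot_uminus: fixes x :: "'a::comm_ring_1^'m::finite"
  shows "vdot (- x) y = - vdot x y" "vdot x (- y) = - vdot x y"
  by (simp_all add: vdot_def sum_negf)

lemma vdot_axis [simp]: "vdot (axis i 1) x = x $ i" "vdot x (axis i 1) = x $ i"
  by (simp_all add: vdot_def axis_def if_distrib if_distribR cong: if_cong)

definition vmap :: "('a \<Rightarrow> 'b) \<Rightarrow> 'a^'m::finite \<Rightarrow> 'b^'m" where
  "vmap h x = (\<chi> i. h (x $ i))"

lemma vmap_nth [simp]: "vmap h x $ i = h (x $ i)"
  by (simp add: vmap_def)

lemma vmap_bvec [simp]: "vmap h (bvec a x b) = bvec (h a) (vmap h x) (h b)"
  unfolding vec_eq_iff by (subst all_bord) simp

lemma ivec_vmap: "ivec = vmap of_int"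
  by (simp add: ivec_def vmap_def fun_eq_iff)

lemma ivec_nth [simp]: "ivec x $ i = of_int (x $ i)"
  by (simp add: ivec_def)

lemma ivec_bvec [simp]: "ivec (bvec a x b) = bvec (of_int a) (ivec x) (of_int b)"
  by (simp add: ivec_vmap)

lemma ivec_arith: "ivec (x + y) = ivec x + ivec y" "ivec (x - y) = ivec x - ivec y"
  "ivec (- x) = - ivec x" "ivec (c *s x) = of_int c *s ivec x" "ivec 0 = 0"
  by (simp_all add: vec_eq_iff)

lemma ivec_inj: "inj (ivec :: int^'m::finite \<Rightarrow> 'a::ring_char_0^'m)"
  by (auto simp: inj_def vec_eq_iff)

lemma ivec_eq_iff [simp]: "(ivec x :: 'a::ring_char_0^'m::finite) = ivec y \<longleftrightarrow> x = y"
  using ivec_inj by (auto simp: inj_def)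

lemma map_matrix_id [simp]: "map_matrix id A = A"
  by (simp add: vec_eq_iff)

definition blk :: "'a \<Rightarrow> 'a^'m \<Rightarrow> 'a \<Rightarrow> 'a^'m \<Rightarrow> 'a^'m^'m \<Rightarrow> 'a^'m \<Rightarrow> 'a \<Rightarrow> 'a^'m \<Rightarrow> 'a
    \<Rightarrow> 'a^'m::finite bord^'m bord" where
  "blk \<alpha> a \<beta> b K c \<gamma> d \<delta> = (\<chi> i. case i of
      Inl _ \<Rightarrow> bvec \<alpha> a \<beta>
    | Inr (Inl j) \<Rightarrow> bvec (b $ j) (K $ j) (c $ j)
    | Inr (Inr _) \<Rightarrow> bvec \<gamma> d \<delta>)"

lemma blk_nth [simp]:
  "blk \<alpha> a \<beta> b K c \<gamma> d \<delta> $ fst_ix = bvec \<alpha> a \<beta>"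
  "blk \<alpha> a \<beta> b K c \<gamma> d \<delta> $ mid_ix j = bvec (b $ j) (K $ j) (c $ j)"
  "blk \<alpha> a \<beta> b K c \<gamma> d \<delta> $ lst_ix = bvec \<gamma> d \<delta>"
  by (simp_all add: blk_def)

lemma mv_nth: "(M *v x) $ i = vdot (M $ i) x"
  by (simp add: matrix_vector_mult_def vdot_def)

lemma blk_mult: fixes x :: "'a::comm_semiring_1"
  shows "blk \<alpha> a \<beta> b K c \<gamma> d \<delta> *v bvec x y z =
    bvec (\<alpha> * x + vdot a y + \<beta> * z) (x *s b + K *v y + z *s c) (\<gamma> * x + vdot d y + \<delta> * z)"
  unfolding vec_eq_iff by (subst all_bord) (simp add: mv_nth vdot_bvec mult.commute)

lemma map_blk: "map_matrix h (blk \<alpha> a \<beta> b K c \<gamma> d \<delta>) =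
    blk (h \<alpha>) (vmap h a) (h \<beta>) (vmap h b) (map_matrix h K) (vmap h c) (h \<gamma>) (vmap h d) (h \<delta>)"
  unfolding vec_eq_iff by (simp add: all_bord vec_eq_iff)

lemma hyp_ext_blk: "hyp_ext A = blk 0 0 1 0 A 0 1 0 0"
  unfolding vec_eq_iff by (simp add: all_bord hyp_ext_def)

lemma hyp_ext_mult: fixes x :: "'a::comm_ring_1"
  shows "hyp_ext A *v bvec x y z = bvec z (A *v y) x"
  by (simp add: hyp_ext_blk blk_mult)

lemma map_hyp_ext: "h 0 = 0 \<Longrightarrow> h 1 = 1 \<Longrightarrow> map_matrix h (hyp_ext A) = hyp_ext (map_matrix h A)"
  by (simp add: hyp_ext_blk map_blk vec_eq_iff all_bord)

section \<open>Bilinear forms\<close>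

definition bil :: "'a::comm_ring_1^'m^'m::finite \<Rightarrow> 'a^'m \<Rightarrow> 'a^'m \<Rightarrow> 'a" where
  "bil A x y = vdot x (A *v y)"

lemma qform_bil: "qform A x = bil A x x"
  by (simp add: qform_def bil_def vdot_def)

lemma bil_add: "bil A (x + y) z = bil A x z + bil A y z" "bil A z (x + y) = bil A z x + bil A z y"
  by (simp_all add: bil_def vdot_add matrix_vector_right_distrib)

lemma mv_scale: fixes A :: "'a::comm_semiring_1^'m^'k::finite" shows "A *v (c *s x) = c *s (A *v x)"
  by (simp add: vec_eq_iff mv_nth vdot_scale)

lemma bil_scale: "bil A (c *s x) y = c * bil A x y" "bil A x (c *s y) = c * bil A x y"
  by (simp_all add: bil_def vdot_scale mv_scale)

lemma mv_uminus: fixes A :: "'a::comm_ring_1^'m^'k::finite" shows "A *v (- x) = - (A *v x)"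
  by (simp add: vec_eq_iff mv_nth vdot_uminus)

lemma bil_uminus: "bil A (- x) y = - bil A x y" "bil A x (- y) = - bil A x y"
  by (simp_all add: bil_def vdot_uminus mv_uminus)

lemma bil_diff: "bil A (x - y) z = bil A x z - bil A y z" "bil A z (x - y) = bil A z x - bil A z y"
  using bil_add(1)[of A x "-y" z] bil_add(2)[of A z x "-y"] by (simp_all add: bil_uminus)

lemma bil_0 [simp]: "bil A 0 x = 0" "bil A x 0 = 0"
  by (simp_all add: bil_def)

lemmas bil_simps = bil_add bil_diff bil_scale bil_uminus

lemma bil_transpose: "bil A x y = bil (transpose A) y x"
proof -
  have "bil A x y = (\<Sum>i\<in>UNIV. \<Sum>j\<in>UNIV. x$i * A$i$j * y$j)"
    by (simp add: bil_def vdot_def mv_nth sum_distrib_left mult_ac)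
  also have "\<dots> = (\<Sum>j\<in>UNIV. \<Sum>i\<in>UNIV. x$i * A$i$j * y$j)" by (rule sum.swap)
  also have "\<dots> = bil (transpose A) y x"
    by (simp add: bil_def vdot_def mv_nth sum_distrib_left mult_ac transpose_def)
  finally show ?thesis .
qed

lemma bil_commute: "transpose A = A \<Longrightarrow> bil A x y = bil A y x"
  by (metis bil_transpose)

lemma bil_matrix:
  fixes A M :: "'a::comm_ring_1^'m^'m::finite"
  shows "bil A (M *v x) (M *v y) = bil (transpose M ** A ** M) x y"
proof -
  have "bil A (M *v x) (M *v y) = vdot (A *v (M *v y)) (M *v x)" by (simp add: bil_def vdot_commute)
  also have "\<dots> = bil M (A *v (M *v y)) x" by (simp add: bil_def)
  also have "\<dots> = bil (transpose M) x (A *v (M *v y))" by (rule bil_transpose)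
  also have "\<dots> = bil (transpose M ** A ** M) x y"
    by (simp add: bil_def matrix_vector_mul_assoc matrix_mul_assoc)
  finally show ?thesis .
qed

lemma bil_axis: "bil A (axis i 1) (axis j 1) = A $ i $ j"
  by (simp add: bil_def mv_nth)

lemma bil_eq_iff: "A = B \<longleftrightarrow> (\<forall>x y. bil A x y = bil B x y)"
  by (metis bil_axis vec_eq_iff)

lemma bil_hyp_ext: "bil (hyp_ext A) (bvec a x b) (bvec c y d) = a * d + b * c + bil A x y"
  by (simp add: bil_def hyp_ext_mult vdot_bvec)

lemma transpose_hyp_ext: "transpose A = A \<Longrightarrow> transpose (hyp_ext A) = hyp_ext A"
  by (auto simp: hyp_ext_blk vec_eq_iff all_bord transpose_def)

abbreviation bS :: "int^'n^'n::finite \<Rightarrow> 'a::comm_ring_1^'n \<Rightarrow> 'a^'n \<Rightarrow> 'a" where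
  "bS S \<equiv> bil (map_matrix of_int S)"

lemma S0_hyp: "S0 S = hyp_ext (- map_matrix of_int S)"
  by (simp add: S0_def map_hyp_ext vec_eq_iff hyp_ext_blk all_bord)

lemma S1_hyp: "S1 S = hyp_ext (S0 S)"
proof -
  have "(map_matrix of_int (S0 S :: int^_^_) :: 'a::ring_1^_^_) = S0 S" by (simp add: S0_def vec_eq_iff)
  thus ?thesis by (simp add: S1_def map_hyp_ext)
qed

lemma bil_minus_matrix: "bil (- A) x y = - bil A x y"
proof -
  have "(- A) *v y = - (A *v y)"
    by (simp add: vec_eq_iff matrix_vector_mult_def sum_negf)
  thus ?thesis by (simp add: bil_def vdot_uminus)
qed

lemma bil_S0: "bil (S0 S) (bvec a x b) (bvec c y d) = a * d + b * c - bS S x y"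
  by (simp add: S0_hyp bil_hyp_ext bil_minus_matrix)

lemma bil_S0': "bil (S0 S) v w = v $ fst_ix * w $ lst_ix + v $ lst_ix * w $ fst_ix - bS S (mid v) (mid w)"
  by (metis bil_S0 bvec_surj)

lemma bil_S1: "bil (S1 S) (bvec a x b) (bvec c y d) = a * d + b * c + bil (S0 S) x y"
  by (simp add: S1_hyp bil_hyp_ext)

text \<open>\<open>S\<close>, \<open>S0 S\<close> and \<open>S1 S\<close> have integer entries, so
  their bilinear forms commute with every ring homomorphism. The instances are
  \<open>of_int\<close>, the inclusion of the reals in the complex numbers, and \<open>cnj\<close>;
  they carry identities between the integral, real and complex versions of the forms.\<close>

locale ring_hom_of_int =
  fixes h :: "'a::comm_ring_1 \<Rightarrow> 'b::comm_ring_1"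
  assumes h_add: "h (x + y) = h x + h y" and h_mult: "h (x * y) = h x * h y" and h_1: "h 1 = 1"
begin

lemma h_0: "h 0 = 0" using h_add[of 0 0] by simp
lemma h_minus: "h (- x) = - h x" using h_add[of x "- x"] by (simp add: h_0 eq_neg_iff_add_eq_0 add.commute)
lemma h_diff: "h (x - y) = h x - h y" using h_add[of x "- y"] by (simp add: h_minus)
lemma h_of_nat: "h (of_nat n) = of_nat n" by (induction n) (simp_all add: h_0 h_1 h_add)
lemma h_of_int: "h (of_int n) = of_int n"
  by (cases n) (simp_all add: h_of_nat h_minus h_diff h_1)
lemma h_sum: "h (sum f A) = (\<Sum>i\<in>A. h (f i))"
  by (induction A rule: infinite_finite_induct) (simp_all add: h_0 h_add)
lemma h_vdot: "h (vdot x y) = vdot (vmap h x) (vmap h y)"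
  by (simp add: vdot_def h_sum h_mult)
lemma h_mv: "vmap h (M *v x) = map_matrix h M *v vmap h x"
  by (simp add: vec_eq_iff matrix_vector_mult_def h_sum h_mult)
lemma h_bil: "h (bil A x y) = bil (map_matrix h A) (vmap h x) (vmap h y)"
  by (simp add: bil_def h_vdot h_mv)
lemma h_mm: "map_matrix h (A ** B) = map_matrix h A ** map_matrix h B"
  by (simp add: vec_eq_iff matrix_matrix_mult_def h_sum h_mult)
lemma h_map_of_int: "map_matrix h (map_matrix of_int A) = map_matrix of_int A"
  by (simp add: vec_eq_iff h_of_int)
lemma h_bS: "h (bS S x y) = bS S (vmap h x) (vmap h y)"
  by (simp add: h_bil h_map_of_int)
lemma h_bS0: "h (bil (S0 S) x y) = bil (S0 S) (vmap h x) (vmap h y)"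
  by (simp add: h_bil h_map_of_int S0_def)
lemma h_bS1: "h (bil (S1 S) x y) = bil (S1 S) (vmap h x) (vmap h y)"
  by (simp add: h_bil h_map_of_int S1_def)
lemma h_mat: "map_matrix h (mat 1) = mat 1"
  by (simp add: vec_eq_iff mat_def h_0 h_1)

end

interpretation hom_int: ring_hom_of_int "of_int :: int \<Rightarrow> 'a::comm_ring_1"
  by unfold_locales simp_all

interpretation hom_real: ring_hom_of_int "of_real :: real \<Rightarrow> complex"
  by unfold_locales simp_all

lemma of_int_bS: "of_int (bS S x y) = bS S (ivec x) (ivec y)"
  unfolding ivec_vmap by (rule hom_int.h_bS)

lemma of_int_bS0: "of_int (bil (S0 S) x y) = bil (S0 S) (ivec x) (ivec y)"
  unfolding ivec_vmap by (rule hom_int.h_bS0)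

lemma of_int_bS1: "of_int (bil (S1 S) x y) = bil (S1 S) (ivec x) (ivec y)"
  unfolding ivec_vmap by (rule hom_int.h_bS1)

lemma mv_ivec: "map_matrix of_int M *v ivec x = (ivec (M *v x) :: 'a::comm_ring_1^'m::finite)"
  unfolding ivec_vmap by (rule hom_int.h_mv[symmetric])

lemma map_matrix_int_inj:
  "map_matrix (of_int :: int \<Rightarrow> 'a::ring_char_0) A = map_matrix of_int B \<longleftrightarrow> A = B"
  by (simp add: vec_eq_iff)

section \<open>Even unimodular forms\<close>

locale even_unimodular =
  fixes S :: "int^'n^'n::finite"
  assumes sym: "transpose S = S" and pd: "pos_def S"
    and even_diag: "even (qform S x)" and det_S: "det S = 1"
begin

text \<open>The quadratic form with polarisation \<open>bS S\<close>. Working with it rather than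
  with \<open>S[x]\<close> treats the prime 2 like all others.\<close>

definition qS :: "int^'n \<Rightarrow> int" where "qS x = qform S x div 2"

lemma two_qS: "2 * qS x = bS S x x"
  using even_diag[of x] by (simp add: qS_def qform_bil)

lemma sym': "transpose (map_matrix of_int S) = map_matrix of_int S"
  using sym by (simp add: transpose_def vec_eq_iff)

lemma bS_commute: "bS S x y = bS S y x"
  by (rule bil_commute[OF sym'])

lemma sym_S0: "transpose (S0 S) = S0 S"
proof -
  have "transpose (- map_matrix of_int S) = - (map_matrix of_int S)"
    using sym' by (simp add: transpose_def vec_eq_iff)
  thus ?thesis unfolding S0_hyp by (rule transpose_hyp_ext)
qed

lemma bS0_commute: "bil (S0 S) x y = bil (S0 S) y x"
  by (rule bil_commute[OF sym_S0])

lemma bS1_commute: "bil (S1 S) x y = bil (S1 S) y x"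
  unfolding S1_hyp by (rule bil_commute, rule transpose_hyp_ext, rule sym_S0)

lemma vdot_S: "vdot (map_matrix of_int S *v x) y = bS S x y"
  by (metis bS_commute bil_def vdot_commute)

lemma vdot_S0: "vdot (S0 S *v x) y = bil (S0 S) x y"
  by (metis bS0_commute bil_def vdot_commute)

lemma bS_pos: "(x::real^'n) \<noteq> 0 \<Longrightarrow> bS S x x > 0"
  using pd unfolding pos_def_def qform_bil by blast

lemma bS_nonneg: "bS S (x::real^'n) x \<ge> 0"
  using bS_pos[of x] by (cases "x = 0") auto

lemma qS_real: "real_of_int (qS x) = bS S (ivec x) (ivec x) / 2"
proof -
  have "real_of_int (2 * qS x) = bS S (ivec x) (ivec x)" by (simp only: two_qS of_int_bS)
  thus ?thesis by simp
qed

lemma qS_nonneg: "qS x \<ge> 0"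
  using bS_nonneg[of "ivec x"] qS_real[of x] by linarith

lemma qS_eq_0: "qS x = 0 \<longleftrightarrow> x = 0"
proof
  assume "qS x = 0"
  hence "bS S (ivec x :: real^'n) (ivec x) = 0" using qS_real[of x] by simp
  hence "(ivec x :: real^'n) = 0" using bS_pos by fastforce
  thus "x = 0" by (simp add: vec_eq_iff)
qed (simp add: qS_def qform_bil)

lemma qS_add: "qS (x + y) = qS x + bS S x y + qS y"
  using two_qS[of "x + y"] two_qS[of x] two_qS[of y] bS_commute[of y x] by (simp add: bil_simps)

lemma qS_scale: "qS (c *s x) = c\<^sup>2 * qS x"
proof -
  have "2 * qS (c *s x) = c * (c * (2 * qS x))" unfolding two_qS by (simp add: bil_simps)
  thus ?thesis by (simp add: power2_eq_square)
qed

lemma inverse_S: obtains Si :: "int^'n^'n" where "S ** Si = mat 1" "Si ** S = mat 1"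
proof -
  let ?R = "map_matrix real_of_int S"
  have dR: "det ?R = 1"
  proof -
    have "det ?R = real_of_int (det S)" by (simp add: det_def)
    thus ?thesis by (simp add: det_S)
  qed
  then obtain B where B: "?R ** B = mat 1" "B ** ?R = mat 1"
    using invertible_det_nz[of ?R] by (auto simp: invertible_def)
  have int: "B $ k $ j \<in> \<int>" for k j
  proof -
    let ?x = "B *v axis j 1"
    have eq: "?R *v ?x = axis j 1" by (simp add: matrix_vector_mul_assoc B)
    \<comment> \<open>Cramer's rule with determinant 1: the entries of the real inverse are
      determinants of integer matrices.\<close>
    have "?x $ k = det (\<chi> i l. if l = k then axis j 1 $ i else ?R $ i $ l)"
      using cramer_lemma[where A = ?R and x = ?x and k = k] unfolding eq dR by simp
    also have "\<dots> \<in> \<int>" unfolding det_def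
      by (auto intro!: Ints_sum Ints_mult Ints_prod simp: axis_def)
    finally show ?thesis by (simp add: mv_nth)
  qed
  define Si where "Si = (\<chi> i j. \<lfloor>B $ i $ j\<rfloor>)"
  have Si: "map_matrix real_of_int Si = B" using int by (simp add: Si_def vec_eq_iff)
  have "map_matrix real_of_int (S ** Si) = map_matrix of_int (mat 1)"
    "map_matrix real_of_int (Si ** S) = map_matrix of_int (mat 1)"
    using B by (simp_all add: hom_int.h_mm Si hom_int.h_mat)
  thus ?thesis using that map_matrix_int_inj by blast
qed

end

section \<open>The orthogonal group acting on the half-space\<close>

interpretation hom_cnj: ring_hom_of_int cnj
  by unfold_locales simp_all

abbreviation cM :: "real^'m^'k \<Rightarrow> complex^'m^'k::finite" where "cM \<equiv> map_matrix of_real"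

lemma vmap_Re_cM: "vmap Re (cM M *v W) = M *v vmap Re W"
  and vmap_Im_cM: "vmap Im (cM M *v W) = M *v vmap Im W"
  by (simp_all add: vec_eq_iff matrix_vector_mult_def)

lemma complex_vec_decomp: "W = vmap of_real (vmap Re W) + \<i> *s vmap of_real (vmap Im W)"
  by (simp add: vec_eq_iff complex_eq_iff)

lemma map_matrix_real_mult: "cM (A ** B) = cM A ** cM B"
  by (rule hom_real.h_mm)

context even_unimodular
begin

lemma Re_bS0: "Re (bil (S0 S) w w) =
    bil (S0 S) (vmap Re w) (vmap Re w) - bil (S0 S) (vmap Im w) (vmap Im w)"
  and Im_bS0: "Im (bil (S0 S) w w) = 2 * bil (S0 S) (vmap Re w) (vmap Im w)"
proof -
  have "bil (S0 S) w w = of_real (bil (S0 S) (vmap Re w) (vmap Re w)) -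
    of_real (bil (S0 S) (vmap Im w) (vmap Im w)) + 2 * \<i> * of_real (bil (S0 S) (vmap Re w) (vmap Im w))"
    by (subst (1 2) complex_vec_decomp[of w])
       (simp add: bil_simps hom_real.h_bS0 algebra_simps
         bS0_commute[of "vmap of_real (vmap Im w)" "vmap of_real (vmap Re w)"])
  thus "Re (bil (S0 S) w w) = bil (S0 S) (vmap Re w) (vmap Re w) - bil (S0 S) (vmap Im w) (vmap Im w)"
    "Im (bil (S0 S) w w) = 2 * bil (S0 S) (vmap Re w) (vmap Im w)" by simp_all
qed

lemma Re_bS1: "Re (bil (S1 S) w w) =
    bil (S1 S) (vmap Re w) (vmap Re w) - bil (S1 S) (vmap Im w) (vmap Im w)"
  and Im_bS1: "Im (bil (S1 S) w w) = 2 * bil (S1 S) (vmap Re w) (vmap Im w)"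
proof -
  have "bil (S1 S) w w = of_real (bil (S1 S) (vmap Re w) (vmap Re w)) -
    of_real (bil (S1 S) (vmap Im w) (vmap Im w)) + 2 * \<i> * of_real (bil (S1 S) (vmap Re w) (vmap Im w))"
    by (subst (1 2) complex_vec_decomp[of w])
       (simp add: bil_simps hom_real.h_bS1 algebra_simps
         bS1_commute[of "vmap of_real (vmap Im w)" "vmap of_real (vmap Re w)"])
  thus "Re (bil (S1 S) w w) = bil (S1 S) (vmap Re w) (vmap Re w) - bil (S1 S) (vmap Im w) (vmap Im w)"
    "Im (bil (S1 S) w w) = 2 * bil (S1 S) (vmap Re w) (vmap Im w)" by simp_all
qed

text \<open>The point \<open>w\<close> is identified with an isotropic line: \<open>M *v emb w\<close> is \<open>cfactor S M w\<close> times
  \<open>emb (orth_act S M w)\<close>, which gives the cocycle relation without computation.\<close>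

definition emb :: "complex^'n bord \<Rightarrow> complex^'n bord bord" where
  "emb w = bvec (- bil (S0 S) w w / 2) w 1"

lemma emb_isotropic: "bil (S1 S) (emb w) (emb w) = 0"
  by (simp add: emb_def bil_S1)

lemma cfactor_emb: "cfactor S M w = (cM M *v emb w) $ lst_ix"
  by (simp add: cfactor_def mv_nth vdot_def sum_bord emb_def qform_bil)

lemma orth_act_emb: "orth_act S M w = inverse (cfactor S M w) *s mid (cM M *v emb w)"
  by (simp add: orth_act_def mv_nth vdot_def sum_bord emb_def qform_bil mid_def vec_eq_iff mult.commute)

text \<open>The Hermitian form attached to \<open>S1 S\<close>, in real and imaginary parts. It is
  preserved by real isometries and equals \<open>2 S0[Im w]\<close> on \<open>emb w\<close>, which
  is how positivity survives the action.\<close>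

definition herm :: "complex^'n bord bord \<Rightarrow> real" where
  "herm W = bil (S1 S) (vmap Re W) (vmap Re W) + bil (S1 S) (vmap Im W) (vmap Im W)"

lemma herm_scale: "herm (c *s W) = (cmod c)\<^sup>2 * herm W"
proof -
  have R: "vmap Re (c *s W) = Re c *s vmap Re W - Im c *s vmap Im W"
    and I: "vmap Im (c *s W) = Re c *s vmap Im W + Im c *s vmap Re W"
    by (simp_all add: vec_eq_iff)
  show ?thesis unfolding herm_def R I cmod_power2
    by (simp add: bil_simps bS1_commute[of "vmap Im W" "vmap Re W"] power2_eq_square algebra_simps)
qed

lemma herm_emb: "herm (emb w) = 2 * bil (S0 S) (vmap Im w) (vmap Im w)"
  by (simp add: herm_def emb_def bil_S1 Re_bS0 field_simps)

text \<open>\<open>S0 S\<close> has signature \<open>(1, n + 1)\<close>, and a vector with first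
  coordinate 0 has value at most 0. Applied to the combination \<open>p' - t p\<close> with that
  property, this is a weak reversed Cauchy-Schwarz inequality: the sign of the product of two
  positive vectors is that of the product of their first coordinates.\<close>

lemma lorentz:
  assumes p: "bil (S0 S) p p > (0::real)" and p': "bil (S0 S) p' p' > 0"
  shows "p $ fst_ix * p $ lst_ix > 0"
    and "p $ fst_ix * p' $ fst_ix > 0 \<Longrightarrow> bil (S0 S) p p' > 0"
    and "bil (S0 S) p p' \<noteq> 0"
proof -
  have pos: "r $ fst_ix * r $ lst_ix > 0" if "bil (S0 S) r r > (0::real)" for r
    using that bS_nonneg[of "mid r"] by (simp add: bil_S0' mult.commute)
  show 1: "p $ fst_ix * p $ lst_ix > 0" by (rule pos[OF p])
  hence nz: "p $ fst_ix \<noteq> 0" by auto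
  define t where "t = p' $ fst_ix / p $ fst_ix"
  define r where "r = p' - t *s p"
  have "r $ fst_ix = 0" using nz by (simp add: r_def t_def)
  hence "bil (S0 S) r r \<le> 0" using bS_nonneg[of "mid r"] by (simp add: bil_S0')
  moreover have "bil (S0 S) r r = bil (S0 S) p' p' + t\<^sup>2 * bil (S0 S) p p - 2 * t * bil (S0 S) p p'"
    by (simp add: r_def bil_simps bS0_commute[of p' p] power2_eq_square algebra_simps)
  moreover have "t\<^sup>2 * bil (S0 S) p p \<ge> 0" using p by simp
  ultimately have *: "t * bil (S0 S) p p' > 0" using p' by linarith
  thus "bil (S0 S) p p' \<noteq> 0" by auto
  show "bil (S0 S) p p' > 0" if "p $ fst_ix * p' $ fst_ix > 0"
  proof -
    have "t > 0" using that unfolding t_def by (auto simp: zero_less_mult_iff zero_less_divide_iff)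
    thus ?thesis using * by (simp add: zero_less_mult_iff)
  qed
qed

definition iso :: "real^'n bord bord^'n bord bord \<Rightarrow> bool" where
  "iso M \<longleftrightarrow> (\<forall>x y. bil (S1 S) (M *v x) (M *v y) = bil (S1 S) x y)"

lemma iso_alt: "iso M \<longleftrightarrow> transpose M ** S1 S ** M = S1 S"
  by (simp add: iso_def bil_matrix bil_eq_iff)

lemma isoI:
  assumes "\<And>x. bil (S1 S) (M *v x) (M *v x) = bil (S1 S) x x"
  shows "iso M"
  unfolding iso_def
proof (intro allI)
  fix x y
  have "bil (S1 S) (M *v (x + y)) (M *v (x + y)) = bil (S1 S) (x + y) (x + y)" by (rule assms)
  thus "bil (S1 S) (M *v x) (M *v y) = bil (S1 S) x y"
    using assms[of x] assms[of y] bS1_commute[of y x] bS1_commute[of "M *v y" "M *v x"]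
    by (simp add: bil_simps matrix_vector_right_distrib)
qed

lemma iso_mult: "iso M \<Longrightarrow> iso N \<Longrightarrow> iso (M ** N)"
  by (simp add: iso_def matrix_vector_mul_assoc[symmetric])

lemma iso_one: "iso (mat 1)"
  by (simp add: iso_def)

lemma herm_iso: "iso M \<Longrightarrow> herm (cM M *v W) = herm W"
  by (simp add: herm_def iso_def vmap_Re_cM vmap_Im_cM)

lemma isotropic_iso:
  assumes "iso M" and "bil (S1 S) W W = 0"
  shows "bil (S1 S) (cM M *v W) (cM M *v W) = 0"
proof -
  have "Re (bil (S1 S) W W) = 0" "Im (bil (S1 S) W W) = 0" using assms(2) by simp_all
  thus ?thesis using assms(1)
    by (simp add: complex_eq_iff Re_bS1 Im_bS1 vmap_Re_cM vmap_Im_cM iso_def)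
qed

text \<open>The half-space together with its complex conjugate. Isometries act here without any
  condition on orientation, so the cocycle rules need nothing but \<open>iso\<close>.\<close>

definition Hpm :: "(complex^'n bord) set" where
  "Hpm = {w. bil (S0 S) (vmap Im w) (vmap Im w) > 0}"

lemma half_space_iff: "w \<in> half_space S \<longleftrightarrow> w \<in> Hpm \<and> Im (w $ fst_ix) > 0"
proof -
  have v: "(\<chi> i. Im (w $ i)) = vmap Im w" by (simp add: vmap_def)
  show ?thesis
    using lorentz(1)[of "vmap Im w" "vmap Im w"]
    unfolding half_space_def Hpm_def upper_half_plane_def qform_bil mem_Collect_eq v
    by (auto simp: zero_less_mult_iff)
qed

lemma half_space_Hpm: "w \<in> half_space S \<Longrightarrow> w \<in> Hpm" by (simp add: half_space_iff)

lemma Hpm_cases: "w \<in> Hpm \<Longrightarrow> w \<in> half_space S \<or> vmap cnj w \<in> half_space S"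
proof -
  assume w: "w \<in> Hpm"
  have v: "vmap Im (vmap cnj w) = - vmap Im w" by (simp add: vec_eq_iff)
  have "vmap cnj w \<in> Hpm" using w unfolding Hpm_def by (simp add: v bil_uminus)
  moreover have "Im (w $ fst_ix) \<noteq> 0"
    using w lorentz(1)[of "vmap Im w" "vmap Im w"] by (auto simp: Hpm_def)
  ultimately show ?thesis using w by (auto simp: half_space_iff)
qed

text \<open>The image of \<open>emb w\<close> is isotropic with positive Hermitian value. If its
  last coordinate were 0, the real and imaginary parts of its middle block would be two orthogonal
  positive vectors of \<open>S0 S\<close>, against \<open>lorentz\<close>. After division by the
  last coordinate, isotropy determines the first one.\<close>

lemma act:
  assumes M: "iso M" and w: "w \<in> Hpm"
  shows cfactor_nz: "cfactor S M w \<noteq> 0"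
    and cM_emb: "cM M *v emb w = cfactor S M w *s emb (orth_act S M w)"
    and orth_act_Hpm: "orth_act S M w \<in> Hpm"
proof -
  define X where "X = cM M *v emb w"
  have X0: "bil (S1 S) X X = 0" unfolding X_def by (intro isotropic_iso M emb_isotropic)
  have hX: "herm X > 0" using w by (simp add: X_def herm_iso[OF M] herm_emb Hpm_def)
  have e: "bil (S1 S) (vmap Re X) (vmap Re X) = bil (S1 S) (vmap Im X) (vmap Im X)"
    "bil (S1 S) (vmap Re X) (vmap Im X) = 0"
    using X0 Re_bS1[of X] Im_bS1[of X] by simp_all
  show nz: "cfactor S M w \<noteq> 0"
  proof
    assume "cfactor S M w = 0"
    hence X3: "X $ lst_ix = 0" by (simp add: cfactor_emb X_def)
    obtain x p r where X: "X = bvec x p r" by (cases X)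
    have r: "r = 0" using X X3 by simp
    have "bil (S0 S) (vmap Re p) (vmap Re p) > 0" "bil (S0 S) (vmap Im p) (vmap Im p) > 0"
      using e(1) hX by (simp_all add: X r herm_def bil_S1)
    moreover have "bil (S0 S) (vmap Re p) (vmap Im p) = 0" using e(2) by (simp add: X r bil_S1)
    ultimately show False using lorentz(3) by blast
  qed
  define c where "c = cfactor S M w"
  obtain x p r where X: "X = bvec x p r" by (cases X)
  have r: "r = c" using X by (simp add: c_def cfactor_emb X_def)
  have p: "p = c *s orth_act S M w" using nz X by (simp add: orth_act_emb X_def c_def)
  have c: "c \<noteq> 0" using nz by (simp add: c_def)
  have "2 * x * c + bil (S0 S) p p = 0" using X0 by (simp add: X r bil_S1 algebra_simps)
  hence "c * (2 * x + c * bil (S0 S) (orth_act S M w) (orth_act S M w)) = 0"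
    by (simp add: p bil_scale algebra_simps)
  hence "2 * x + c * bil (S0 S) (orth_act S M w) (orth_act S M w) = 0" using c by simp
  hence "x = c * (- bil (S0 S) (orth_act S M w) (orth_act S M w) / 2)"
    by (simp add: field_simps eq_neg_iff_add_eq_0)
  thus eq: "cM M *v emb w = cfactor S M w *s emb (orth_act S M w)"
    unfolding X_def[symmetric] c_def[symmetric] unfolding X emb_def bvec_scale by (simp add: r p)
  have "herm X = (cmod c)\<^sup>2 * (2 * bil (S0 S) (vmap Im (orth_act S M w)) (vmap Im (orth_act S M w)))"
    by (simp add: X_def eq herm_scale herm_emb c_def)
  thus "orth_act S M w \<in> Hpm" using hX c by (simp add: Hpm_def zero_less_mult_iff)
qed

lemma act_mult:
  assumes "iso M" "iso N" "w \<in> Hpm"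
  shows cfactor_mult: "cfactor S (M ** N) w = cfactor S M (orth_act S N w) * cfactor S N w"
    and orth_act_mult: "orth_act S (M ** N) w = orth_act S M (orth_act S N w)"
proof -
  have "cfactor S (M ** N) w *s emb (orth_act S (M ** N) w) = cM M *v (cM N *v emb w)"
    using cM_emb[OF iso_mult[OF assms(1,2)] assms(3)]
    by (simp add: map_matrix_real_mult matrix_vector_mul_assoc)
  also have "\<dots> = cfactor S N w *s (cfactor S M (orth_act S N w) *s emb (orth_act S M (orth_act S N w)))"
    by (simp add: cM_emb[OF assms(2,3)] mv_scale cM_emb[OF assms(1) orth_act_Hpm[OF assms(2,3)]])
  finally have eq: "cfactor S (M ** N) w *s emb (orth_act S (M ** N) w) =
    (cfactor S N w * cfactor S M (orth_act S N w)) *s emb (orth_act S M (orth_act S N w))"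
    by (simp add: vec_eq_iff mult.assoc)
  thus c: "cfactor S (M ** N) w = cfactor S M (orth_act S N w) * cfactor S N w"
    by (simp add: emb_def bvec_scale mult.commute)
  have "cfactor S (M ** N) w \<noteq> 0" by (intro cfactor_nz iso_mult assms)
  thus "orth_act S (M ** N) w = orth_act S M (orth_act S N w)"
    using eq unfolding emb_def bvec_scale bvec_eq_iff c[symmetric] mult.commute[of "cfactor S N w"]
    by (simp add: vec_eq_iff)
qed

lemma orth_act_one [simp]: "orth_act S (mat 1) w = w"
proof -
  have "cM (mat 1) *v emb w = emb w" by (simp add: hom_real.h_mat)
  hence 1: "cfactor S (mat 1) w = 1" by (simp add: cfactor_emb emb_def)
  show "orth_act S (mat 1) w = w" by (simp add: orth_act_emb 1) (simp add: hom_real.h_mat emb_def)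
qed

section \<open>Complex conjugation, connectedness and orientation\<close>

lemma vmap_cnj_cM: "vmap cnj (cM M *v W) = cM M *v vmap cnj W"
proof -
  have "map_matrix cnj (cM M) = cM M" by (simp add: vec_eq_iff)
  thus ?thesis by (simp add: hom_cnj.h_mv)
qed

lemma emb_cnj: "emb (vmap cnj w) = vmap cnj (emb w)"
  by (simp add: emb_def hom_cnj.h_bS0)

lemma cfactor_cnj: "cfactor S M (vmap cnj w) = cnj (cfactor S M w)"
  by (simp add: cfactor_emb emb_cnj vmap_cnj_cM[symmetric])

lemma orth_act_cnj: "orth_act S M (vmap cnj w) = vmap cnj (orth_act S M w)"
  by (simp add: orth_act_emb emb_cnj vmap_cnj_cM[symmetric] cfactor_cnj vec_eq_iff mid_def)

text \<open>By \<open>lorentz\<close> the cross term of two positive vectors in the same half of the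
  cone is positive. Convexity is wanted for the connectedness used in
  \<open>sign_constant\<close>.\<close>

lemma convex_half_space: "convex (half_space S)"
proof (rule convexI)
  fix x y :: "complex^'n bord" and u v :: real
  assume x: "x \<in> half_space S" and y: "y \<in> half_space S" and uv: "0 \<le> u" "0 \<le> v" "u + v = 1"
  let ?p = "vmap Im x" and ?r = "vmap Im y"
  have e: "vmap Im (u *\<^sub>R x + v *\<^sub>R y) = u *s ?p + v *s ?r" by (simp add: vec_eq_iff)
  have xy: "bil (S0 S) ?p ?p > 0" "bil (S0 S) ?r ?r > 0" "?p $ fst_ix > 0" "?r $ fst_ix > 0"
    using x y by (simp_all add: half_space_iff Hpm_def)
  have "bil (S0 S) ?p ?r > 0" using lorentz(2)[OF xy(1,2)] xy(3,4) by simp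
  hence *: "u * v * bil (S0 S) ?p ?r \<ge> 0" using uv by simp
  have "u > 0 \<or> v > 0" using uv by linarith
  hence "u * u * bil (S0 S) ?p ?p + v * v * bil (S0 S) ?r ?r > 0"
    using xy(1,2) by (smt (verit) mult_pos_pos zero_le_square mult_nonneg_nonneg)
  moreover have "bil (S0 S) (u *s ?p + v *s ?r) (u *s ?p + v *s ?r) =
     u * u * bil (S0 S) ?p ?p + v * v * bil (S0 S) ?r ?r + 2 * (u * v * bil (S0 S) ?p ?r)"
    by (simp add: bil_simps bS0_commute[of ?r ?p] algebra_simps)
  ultimately have 1: "bil (S0 S) (u *s ?p + v *s ?r) (u *s ?p + v *s ?r) > 0" using * by linarith
  have 2: "u * ?p $ fst_ix + v * ?r $ fst_ix > 0"
    using xy(3,4) uv \<open>u > 0 \<or> v > 0\<close>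
    by (smt (verit) mult_pos_pos mult_nonneg_nonneg)
  show "u *\<^sub>R x + v *\<^sub>R y \<in> half_space S"
    using 1 2 by (simp add: half_space_iff Hpm_def e)
qed

lemma continuous_orth_act:
  assumes "iso M"
  shows "continuous_on (half_space S) (\<lambda>w. orth_act S M w $ i)"
proof -
  have q: "continuous_on (half_space S) (\<lambda>w. qform (S0 S) w)"
    unfolding qform_def matrix_vector_mult_def by (auto intro!: continuous_intros)
  have c: "continuous_on (half_space S) (\<lambda>w. cfactor S M w)"
    unfolding cfactor_def by (auto intro!: continuous_intros q)
  have "cfactor S M w \<noteq> 0" if "w \<in> half_space S" for w
    using assms that by (simp add: cfactor_nz half_space_iff)
  thus ?thesis
    unfolding orth_act_def by (auto intro!: continuous_intros q c)
qed

text \<open>The imaginary part of the first coordinate of the image never vanishes, so it keeps its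
  sign on the connected half-space. A single point therefore decides whether an isometry preserves
  the half-space or moves it to its conjugate.\<close>

lemma sign_constant:
  assumes M: "iso M" and w0: "w0 \<in> half_space S" "orth_act S M w0 \<in> half_space S"
    and w: "w \<in> half_space S"
  shows "orth_act S M w \<in> half_space S"
proof -
  let ?g = "\<lambda>w. Im (orth_act S M w $ fst_ix)"
  have conn: "connected (?g ` half_space S)"
    by (intro connected_continuous_image continuous_on_Im continuous_orth_act M
        convex_connected convex_half_space)
  have nz: "?g v \<noteq> 0" if "v \<in> half_space S" for v
    using orth_act_Hpm[OF M half_space_Hpm[OF that]]
      lorentz(1)[of "vmap Im (orth_act S M v)" "vmap Im (orth_act S M v)"]
    by (auto simp: Hpm_def)
  have "?g w > 0"
  proof (rule ccontr)
    assume "\<not> ?g w > 0"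
    hence "?g w \<le> 0" "0 \<le> ?g w0" using w0 by (simp_all add: half_space_iff)
    hence "0 \<in> ?g ` half_space S"
      using conn w w0 unfolding connected_iff_interval by blast
    thus False using nz by auto
  qed
  thus ?thesis using orth_act_Hpm[OF M half_space_Hpm[OF w]] by (simp add: half_space_iff)
qed

lemma base_point: "bvec \<i> 0 \<i> \<in> half_space S"
  by (simp add: half_space_def upper_half_plane_def qform_bil bil_S0' mid_def flip: zero_vec_def)

lemma iso_inverse:
  assumes "iso M" "M' ** M = mat 1"
  shows "iso M'" "M ** M' = mat 1"
proof -
  show 1: "M ** M' = mat 1" using assms(2) matrix_left_right_inverse by blast
  have "M *v (M' *v x) = x" for x by (simp add: matrix_vector_mul_assoc 1)
  thus "iso M'" using assms(1) unfolding iso_def by metis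
qed

lemma SO_plusI:
  assumes M: "iso M" and d: "det M = 1" and w0: "w0 \<in> half_space S" "orth_act S M w0 \<in> half_space S"
  shows "M \<in> SO_plus S"
proof -
  have "invertible M" using d by (simp add: invertible_det_nz)
  then obtain M' where M': "M' ** M = mat 1" by (auto simp: invertible_def)
  note M2 = iso_inverse[OF M M']
  have inv1: "orth_act S M' (orth_act S M w) = w" if "w \<in> Hpm" for w
    using orth_act_mult[OF M2(1) M that] by (simp add: M')
  have inv2: "orth_act S M (orth_act S M' w) = w" if "w \<in> Hpm" for w
    using orth_act_mult[OF M M2(1) that] by (simp add: M2(2))
  have s: "orth_act S M w \<in> half_space S" if "w \<in> half_space S" for w
    by (rule sign_constant[OF M w0 that])
  have s': "orth_act S M' w \<in> half_space S" if "w \<in> half_space S" for w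
    by (rule sign_constant[OF M2(1) w0(2) _ that]) (use w0 inv1 half_space_Hpm in auto)
  have "orth_act S M ` half_space S = half_space S"
    using s s' inv2 half_space_Hpm by (metis (no_types, lifting) image_subsetI image_eqI subsetI subset_antisym)
  thus ?thesis using M d by (simp add: SO_plus_def iso_alt)
qed

lemma SO_plusD:
  assumes "M \<in> SO_plus S"
  shows "iso M" "det M = 1" "w \<in> half_space S \<Longrightarrow> orth_act S M w \<in> half_space S"
  using assms by (auto simp: SO_plus_def iso_alt)

lemma SO_plus_mult: "M \<in> SO_plus S \<Longrightarrow> N \<in> SO_plus S \<Longrightarrow> M ** N \<in> SO_plus S"
  by (rule SO_plusI[OF _ _ base_point])
     (auto simp: SO_plusD iso_mult det_mul orth_act_mult half_space_Hpm base_point)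

lemma SO_plus_one: "mat 1 \<in> SO_plus S"
  by (rule SO_plusI[OF _ _ base_point]) (auto simp: iso_one base_point)

lemma SO_plus_inverse: assumes "M \<in> SO_plus S"
  obtains M' where "M' \<in> SO_plus S" "M' ** M = mat 1" "M ** M' = mat 1"
proof -
  have "invertible M" using SO_plusD(2)[OF assms] by (simp add: invertible_det_nz)
  then obtain M' where M': "M' ** M = mat 1" by (auto simp: invertible_def)
  note M2 = iso_inverse[OF SO_plusD(1)[OF assms] M']
  obtain w where w: "w \<in> half_space S" "orth_act S M w = bvec \<i> 0 \<i>"
    using assms base_point unfolding SO_plus_def by (auto simp: image_iff set_eq_iff) metis
  have "orth_act S M' (bvec \<i> 0 \<i>) = w"
    using orth_act_mult[OF M2(1) SO_plusD(1)[OF assms] half_space_Hpm[OF w(1)]] w(2) by (simp add: M')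
  moreover have "det M' * det M = 1" using M' by (simp flip: det_mul)
  ultimately have "M' \<in> SO_plus S"
    using M2(1) w(1) SO_plusD(2)[OF assms] base_point by (intro SO_plusI[OF _ _ base_point]) auto
  thus ?thesis using that M' M2(2) by blast
qed

lemma hyp_ext_inverse:
  fixes A B :: "'a::comm_ring_1^'m^'m::finite"
  assumes "A ** B = mat 1" shows "hyp_ext A ** hyp_ext B = mat 1"
proof (unfold matrix_eq, intro allI)
  fix x :: "'a^'m bord"
  show "hyp_ext A ** hyp_ext B *v x = mat 1 *v x"
    by (cases x) (simp add: matrix_vector_mul_assoc[symmetric] hyp_ext_mult,
      simp add: matrix_vector_mul_assoc assms)
qed

lemma inverse_S1: obtains T :: "int^'n bord bord^'n bord bord"
  where "S1 S ** T = mat 1" "T ** S1 S = mat 1"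
proof -
  obtain Si where Si: "S ** Si = mat 1" "Si ** S = mat 1" by (rule inverse_S)
  have neg: "(- A) ** (- B) = A ** B" for A B :: "int^'n^'n"
    by (simp add: vec_eq_iff matrix_matrix_mult_def)
  have "S1 S ** hyp_ext (hyp_ext (- Si)) = mat 1" "hyp_ext (hyp_ext (- Si)) ** S1 S = mat 1"
    unfolding S1_hyp S0_hyp by (intro hyp_ext_inverse; simp add: neg Si)+
  thus ?thesis using that by blast
qed

lemma map_S1: "map_matrix of_int (S1 S) = S1 S"
  by (simp add: S1_def vec_eq_iff)

lemma map_S0: "map_matrix of_int (S0 S) = S0 S"
  by (simp add: S0_def vec_eq_iff)

text \<open>Squaring makes the determinant and the orientation positive at once.\<close>

lemma SO_plus_square: assumes "iso N" shows "N ** N \<in> SO_plus S"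
proof (rule SO_plusI[OF iso_mult[OF assms assms] _ base_point])
  obtain T :: "int^'n bord bord^'n bord bord" where "S1 S ** T = mat 1" by (rule inverse_S1)
  hence "map_matrix real_of_int (S1 S ** T) = mat 1" by (simp add: hom_int.h_mat)
  hence "det (S1 S :: real^_^_) * det (map_matrix real_of_int T) = 1"
    by (simp add: hom_int.h_mm map_S1 flip: det_mul)
  hence nz: "det (S1 S :: real^'n bord bord^'n bord bord) \<noteq> 0" by auto
  have "det (transpose N ** S1 S ** N) = det (S1 S :: real^'n bord bord^'n bord bord)"
    using assms by (simp add: iso_alt)
  thus "det (N ** N) = 1" using nz by (simp add: det_mul)
  let ?w = "bvec \<i> 0 \<i> :: complex^'n bord"
  have w: "?w \<in> half_space S" by (rule base_point)
  have e: "orth_act S (N ** N) ?w = orth_act S N (orth_act S N ?w)"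
    by (intro orth_act_mult assms half_space_Hpm w)
  consider "orth_act S N ?w \<in> half_space S" | "orth_act S N ?w \<notin> half_space S"
      "vmap cnj (orth_act S N ?w) \<in> half_space S"
    using Hpm_cases[OF orth_act_Hpm[OF assms half_space_Hpm[OF w]]] by blast
  thus "orth_act S (N ** N) ?w \<in> half_space S"
  proof cases
    case 1 thus ?thesis unfolding e using sign_constant[OF assms w 1] by blast
  next
    case 2
    \<comment> \<open>Here \<open>N\<close> exchanges the two components. Conjugating the image of
      the base point returns to the half-space, and since the action commutes with
      \<open>cnj\<close>, the second application of \<open>N\<close> exchanges back.\<close>
    let ?v = "vmap cnj (orth_act S N ?w)"
    have "orth_act S N ?v \<notin> half_space S"
      using sign_constant[OF assms 2(2) _ w] 2(1) by blast
    moreover have "orth_act S N ?v \<in> Hpm" by (intro orth_act_Hpm assms half_space_Hpm 2)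
    ultimately have "vmap cnj (orth_act S N ?v) \<in> half_space S" using Hpm_cases by blast
    moreover have "vmap cnj (orth_act S N ?v) = orth_act S N (orth_act S N ?w)"
      by (simp add: orth_act_cnj) (simp add: vec_eq_iff)
    ultimately show ?thesis by (simp add: e)
  qed
qed

text \<open>\<open>S1 S\<close> is invertible over the integers, so its integral left multiples are
  all integral matrices and the defining congruence reduces to integrality.\<close>

lemma Gamma_S_iff: "M \<in> Gamma_S S \<longleftrightarrow> M \<in> SO_plus S \<and> (\<exists>A. M = map_matrix of_int A)"
proof -
  obtain T :: "int^'n bord bord^'n bord bord" where T: "T ** S1 S = mat 1" by (rule inverse_S1)
  have "(\<exists>A. M = mat 1 + map_matrix of_int A ** S1 S) \<longleftrightarrow> (\<exists>A. M = map_matrix of_int A)"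
  proof
    assume "\<exists>A. M = mat 1 + map_matrix of_int A ** S1 S"
    then obtain A :: "int^'n bord bord^'n bord bord" where A: "M = mat 1 + map_matrix of_int A ** S1 S" by blast
    have "map_matrix real_of_int (mat 1 + A ** S1 S) = mat 1 + map_matrix of_int (A ** S1 S)"
      by (simp add: vec_eq_iff mat_def)
    also have "\<dots> = M" by (simp add: A hom_int.h_mm map_S1)
    finally show "\<exists>A. M = map_matrix of_int A" by metis
  next
    assume "\<exists>A. M = map_matrix of_int A"
    then obtain A :: "int^'n bord bord^'n bord bord" where A: "M = map_matrix of_int A" by blast
    have "(A - mat 1) ** T ** S1 S = A - mat 1"
      by (simp add: matrix_mul_assoc[symmetric] T)
    hence "map_matrix real_of_int ((A - mat 1) ** T) ** S1 S = map_matrix of_int (A - mat 1)"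
      by (metis hom_int.h_mm map_S1)
    moreover have "map_matrix real_of_int (A - mat 1) = M - mat 1"
      by (simp add: A vec_eq_iff mat_def)
    ultimately show "\<exists>A. M = mat 1 + map_matrix of_int A ** S1 S"
      by (intro exI[of _ "(A - mat 1) ** T"]) simp
  qed
  thus ?thesis by (auto simp: Gamma_S_def)
qed

lemma Gamma_S_SO: "M \<in> Gamma_S S \<Longrightarrow> M \<in> SO_plus S"
  by (simp add: Gamma_S_iff)

lemma Gamma_S_mult: "M \<in> Gamma_S S \<Longrightarrow> N \<in> Gamma_S S \<Longrightarrow> M ** N \<in> Gamma_S S"
  unfolding Gamma_S_iff by (metis SO_plus_mult hom_int.h_mm)

lemma Gamma_S_one: "mat 1 \<in> Gamma_S S"
  unfolding Gamma_S_iff by (metis SO_plus_one hom_int.h_mat)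

lemma Gamma_S_inverse: assumes "M \<in> Gamma_S S"
  obtains M' where "M' \<in> Gamma_S S" "M' ** M = mat 1" "M ** M' = mat 1"
proof -
  obtain M' where M': "M' \<in> SO_plus S" "M' ** M = mat 1" "M ** M' = mat 1"
    using SO_plus_inverse assms Gamma_S_iff by metis
  obtain A where A: "M = map_matrix of_int A" using assms Gamma_S_iff by blast
  obtain T :: "int^'n bord bord^'n bord bord" where T: "T ** S1 S = mat 1" by (rule inverse_S1)
  have TR: "map_matrix real_of_int T ** S1 S = mat 1"
    by (metis T hom_int.h_mat hom_int.h_mm map_S1)
  have tA: "map_matrix real_of_int (transpose A) = transpose M"
    by (simp add: A transpose_def vec_eq_iff)
  have i: "transpose M ** S1 S ** M = S1 S" using SO_plusD(1)[of M] assms Gamma_S_SO iso_alt by blast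
  \<comment> \<open>The inverse of an isometry is \<open>S1^-1 M^tr S1\<close>, a product of
    integral matrices.\<close>
  have "M' = map_matrix real_of_int T ** (transpose M ** S1 S ** M) ** M'"
    by (simp add: i TR)
  also have "\<dots> = map_matrix real_of_int T ** transpose M ** S1 S ** (M ** M')"
    by (simp add: matrix_mul_assoc)
  also have "\<dots> = map_matrix real_of_int (T ** transpose A ** S1 S)"
    by (simp add: M'(3) hom_int.h_mm map_S1 tA)
  finally have "M' \<in> Gamma_S S" using M'(1) Gamma_S_iff by blast
  thus ?thesis using that M' by blast
qed

end

section \<open>Special elements of the orthogonal group\<close>

lemma matrix_eqI3:
  fixes M N :: "'a::comm_ring_1^'m::finite bord^'k::finite"
  assumes "\<And>a y b. M *v bvec a y b = N *v bvec a y b" shows "M = N"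
  unfolding matrix_eq by (metis assms bvec_surj)

lemma matrix_eqI5:
  fixes M N :: "'a::comm_ring_1^'m::finite bord bord^'k::finite"
  assumes "\<And>a s z t b. M *v bvec a (bvec s z t) b = N *v bvec a (bvec s z t) b"
  shows "M = N"
  by (rule matrix_eqI3) (metis assms bvec_surj)

lemma ivec_0 [simp]: "ivec 0 = 0" by (simp add: vec_eq_iff)

section \<open>Congruence of integral vectors\<close>

definition vcong :: "int \<Rightarrow> int^'m::finite \<Rightarrow> int^'m \<Rightarrow> bool" where
  "vcong q x y \<longleftrightarrow> (\<forall>i. q dvd x $ i - y $ i)"

lemma vcong_refl [simp]: "vcong q x x" by (simp add: vcong_def)
lemma vcong_sym: "vcong q x y \<Longrightarrow> vcong q y x"
  by (simp add: vcong_def dvd_diff_commute)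
lemma vcong_trans: "vcong q x y \<Longrightarrow> vcong q y z \<Longrightarrow> vcong q x z"
  unfolding vcong_def by (metis diff_add_cancel dvd_add add_diff_eq)
lemma vcong_scale: "vcong q x y \<Longrightarrow> vcong q (c *s x) (c *s y)"
  by (simp add: vcong_def right_diff_distrib[symmetric])
lemma vcong_scale_left: "q dvd c - d \<Longrightarrow> vcong q (c *s x) (d *s x)"
  by (simp add: vcong_def left_diff_distrib[symmetric])
lemma vcong_mv: "vcong q x y \<Longrightarrow> vcong q (M *v x) (M *v y)"
  by (auto simp: vcong_def matrix_vector_mult_def sum_subtractf[symmetric] right_diff_distrib[symmetric] intro!: dvd_sum)
lemma vcong_bvec: "vcong q (bvec a x b) (bvec c y d) \<longleftrightarrow> q dvd a - c \<and> vcong q x y \<and> q dvd b - d"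
  by (simp add: vcong_def all_bord)
lemma vcong_add: "vcong q x y \<Longrightarrow> vcong q x' y' \<Longrightarrow> vcong q (x + x') (y + y')"
  unfolding vcong_def by (metis add_diff_add dvd_add vector_add_component)
lemma vcong_bil: "vcong q x y \<Longrightarrow> q dvd bil A z x - bil A z y"
  by (drule vcong_mv[of q x y A])
     (auto simp: bil_def vdot_def vcong_def sum_subtractf[symmetric] right_diff_distrib[symmetric] intro!: dvd_sum)
lemma vcong_0: "vcong q x 0 \<longleftrightarrow> (\<forall>i. q dvd x $ i)"
  by (simp add: vcong_def)

text \<open>The Levi part of the stabiliser of an isotropic line: it acts linearly on the
  half-space, with automorphy factor 1 (\<open>act_lev\<close>).\<close>

definition lev :: "'a::comm_ring_1^'m^'m \<Rightarrow> 'a^'m::finite bord^'m bord" where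
  "lev K = blk 1 0 0 0 K 0 0 0 1"

lemma lev_mult: "lev K *v bvec a y b = bvec a (K *v y) b"
  by (simp add: lev_def blk_mult)

lemma lev_comp: "lev K ** lev L = lev (K ** L)"
  by (rule matrix_eqI3) (simp add: lev_mult matrix_vector_mul_assoc[symmetric])

lemma map_lev: "h 0 = 0 \<Longrightarrow> h 1 = 1 \<Longrightarrow> map_matrix h (lev K) = lev (map_matrix h K)"
  by (simp add: lev_def map_blk vec_eq_iff all_bord)

definition diagb :: "'a::comm_ring_1 \<Rightarrow> 'a \<Rightarrow> 'a^'m::finite bord^'m bord" where
  "diagb r s = blk r 0 0 0 (mat 1) 0 0 0 s"

lemma diagb_mult: "diagb r s *v bvec a y b = bvec (r * a) y (s * b)"
  by (simp add: diagb_def blk_mult)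

lemma map_diagb: "h 0 = 0 \<Longrightarrow> h 1 = 1 \<Longrightarrow> map_matrix h (diagb r s) = diagb (h r) (h s)"
  by (simp add: diagb_def map_blk vec_eq_iff all_bord mat_def)

lemma vmap_0: "h 0 = 0 \<Longrightarrow> vmap h 0 = 0" by (simp add: vec_eq_iff)
lemma map_mat_1: "h 0 = 0 \<Longrightarrow> h 1 = 1 \<Longrightarrow> map_matrix h (mat 1) = mat 1" by (simp add: vec_eq_iff mat_def)

text \<open>Matrices that fix the coordinates belonging to \<open>S\<close> and act on the two
  hyperbolic planes; the sixteen arguments are the rows of this 4 by 4 matrix in order.\<close>

definition four :: "'a::comm_ring_1 \<Rightarrow> 'a \<Rightarrow> 'a \<Rightarrow> 'a \<Rightarrow> 'a \<Rightarrow> 'a \<Rightarrow> 'a \<Rightarrow> 'a \<Rightarrow> 'a \<Rightarrow> 'a \<Rightarrow> 'a \<Rightarrow> 'a \<Rightarrow> 'a \<Rightarrow> 'a \<Rightarrow> 'a \<Rightarrow> 'a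
   \<Rightarrow> 'a^'m::finite bord bord^'m bord bord" where
  "four \<alpha> a1 a3 \<beta> b1 k11 k13 c1 b3 k31 k33 c3 \<gamma> d1 d3 \<delta> =
     blk \<alpha> (bvec a1 0 a3) \<beta> (bvec b1 0 b3) (blk k11 0 k13 0 (mat 1) 0 k31 0 k33) (bvec c1 0 c3)
       \<gamma> (bvec d1 0 d3) \<delta>"

lemma four_mult:
  "four \<alpha> a1 a3 \<beta> b1 k11 k13 c1 b3 k31 k33 c3 \<gamma> d1 d3 \<delta> *v bvec a (bvec s z t) b =
   bvec (\<alpha> * a + a1 * s + a3 * t + \<beta> * b)
     (bvec (b1 * a + k11 * s + k13 * t + c1 * b) z (b3 * a + k31 * s + k33 * t + c3 * b))
     (\<gamma> * a + d1 * s + d3 * t + \<delta> * b)"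
  by (simp add: four_def blk_mult vdot_bvec bvec_arith algebra_simps)

lemma map_four: fixes h :: "'a::comm_ring_1 \<Rightarrow> 'b::comm_ring_1" assumes "h 0 = 0" "h 1 = 1"
  shows "map_matrix h (four \<alpha> a1 a3 \<beta> b1 k11 k13 c1 b3 k31 k33 c3 \<gamma> d1 d3 \<delta>) =
   four (h \<alpha>) (h a1) (h a3) (h \<beta>) (h b1) (h k11) (h k13) (h c1) (h b3) (h k31) (h k33) (h c3)
     (h \<gamma>) (h d1) (h d3) (h \<delta>)"
  using assms by (simp add: four_def map_blk vmap_0 map_mat_1)

text \<open>The half turn of the positive definite plane spanned by the sums of the two hyperbolic
  pairs. It exchanges the first and last coordinates up to sign and so reverses the Hecke
  diagonal.\<close>

definition Jm :: "'a::comm_ring_1^'m::finite bord bord^'m bord bord" where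
  "Jm = four 0 0 0 (-1)  0 0 (-1) 0  0 (-1) 0 0  (-1) 0 0 0"

lemma Jm_mult: "Jm *v bvec a (bvec s z t) b = bvec (-b) (bvec (-t) z (-s)) (-a)"
  by (simp add: Jm_def four_mult)

text \<open>On the half-space this is \<open>(tau, z, tau') -> (tau - S[z] / (2 tau'), z / tau', - 1
  / tau')\<close>, the inversion in the last variable (\<open>act_sig\<close>). All transformation
  laws of theta below come from this element.\<close>

definition sig :: "'a::comm_ring_1^'m::finite bord bord^'m bord bord" where
  "sig = four 0 1 0 0  (-1) 0 0 0  0 0 0 (-1)  0 0 1 0"

lemma sig_mult: "sig *v bvec a (bvec s z t) b = bvec s (bvec (-a) z (-b)) t"
  by (simp add: sig_def four_mult)

lemma map_Jm: "map_matrix of_int Jm = Jm" and map_sig: "map_matrix of_int sig = sig"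
  by (simp_all add: Jm_def sig_def map_four)

context even_unimodular
begin

text \<open>The argument \<open>h\<close> is left free so that one formula serves over the integers,
  with \<open>Q0 x\<close>, and over the reals, with half of \<open>S0[x]\<close>. For these values
  it is the translation by \<open>x\<close>. The definitions \<open>gz\<close> and
  \<open>gz'\<close> follow the same pattern one level down.\<close>

definition tr :: "'a::comm_ring_1^'n bord \<Rightarrow> 'a \<Rightarrow> 'a^'n bord bord^'n bord bord" where
  "tr x h = blk 1 (- (S0 S *v x)) (- h) 0 (mat 1) x 0 0 1"

lemma tr_mult: "tr x h *v bvec a y b = bvec (a - bil (S0 S) x y - h * b) (y + b *s x) b"
  by (simp add: tr_def blk_mult vdot_uminus vdot_S0)

definition gz :: "'a::comm_ring_1^'n \<Rightarrow> 'a \<Rightarrow> 'a^'n bord^'n bord" where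
  "gz z h = blk 1 (map_matrix of_int S *v z) h 0 (mat 1) z 0 0 1"

lemma gz_mult: "gz z h *v bvec s p t = bvec (s + bS S z p + h * t) (p + t *s z) t"
  by (simp add: gz_def blk_mult vdot_S)

definition gz' :: "'a::comm_ring_1^'n \<Rightarrow> 'a \<Rightarrow> 'a^'n bord^'n bord" where
  "gz' z h = blk 1 0 0 z (mat 1) 0 h (map_matrix of_int S *v z) 1"

lemma gz'_mult: "gz' z h *v bvec s p t = bvec s (p + s *s z) (h * s + bS S z p + t)"
  by (simp add: gz'_def blk_mult vdot_S add.commute)

definition Q0 :: "int^'n bord \<Rightarrow> int" where
  "Q0 v = v $ fst_ix * v $ lst_ix - qS (mid v)"

lemma two_Q0: "2 * Q0 v = bil (S0 S) v v"
  using two_qS[of "mid v"] by (simp add: Q0_def bil_S0' algebra_simps)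

lemma Q0_bvec: "Q0 (bvec a x b) = a * b - qS x"
  by (simp add: Q0_def)

lemma Q0_add: "Q0 (x + y) = Q0 x + bil (S0 S) x y + Q0 y"
  using two_Q0[of "x + y"] two_Q0[of x] two_Q0[of y] bS0_commute[of y x] by (simp add: bil_simps)

lemma Q0_scale: "Q0 (c *s x) = c\<^sup>2 * Q0 x"
proof -
  have "2 * Q0 (c *s x) = c * (c * (2 * Q0 x))" unfolding two_Q0 by (simp add: bil_simps)
  thus ?thesis by (simp add: power2_eq_square)
qed

lemma Q0_real: "real_of_int (Q0 x) = bil (S0 S) (ivec x) (ivec x) / 2"
proof -
  have "real_of_int (2 * Q0 x) = bil (S0 S) (ivec x) (ivec x)" by (simp only: two_Q0 of_int_bS0)
  thus ?thesis by simp
qed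

lemma Q0_cong: assumes "vcong q x y" shows "q dvd Q0 x - Q0 y"
proof -
  obtain d where d: "x - y = q *s d"
  proof -
    have "\<exists>c. (x - y) $ i = q * c" for i using assms by (simp add: vcong_def dvd_def)
    then obtain c where "\<And>i. (x - y) $ i = q * c i" by metis
    thus ?thesis by (intro that[of "\<chi> i. c i"]) (simp add: vec_eq_iff)
  qed
  have "x = y + q *s d" using d by (simp add: algebra_simps)
  hence "Q0 x - Q0 y = q * (bil (S0 S) y d + q * Q0 d)"
    by (simp add: Q0_add Q0_scale bil_simps power2_eq_square algebra_simps)
  thus ?thesis by simp
qed

definition Q1 :: "int^'n bord bord \<Rightarrow> int" where
  "Q1 v = v $ fst_ix * v $ lst_ix + Q0 (mid v)"

abbreviation TR :: "real^'n bord \<Rightarrow> real^'n bord bord^'n bord bord" where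
  "TR x \<equiv> tr x (bil (S0 S) x x / 2)"

lemma iso_lev: assumes "\<And>x. bil (S0 S) (K *v x) (K *v x) = bil (S0 S) x x" shows "iso (lev K)"
proof (rule isoI)
  fix v show "bil (S1 S) (lev K *v v) (lev K *v v) = bil (S1 S) v v"
    by (cases v) (simp add: lev_mult bil_S1 assms)
qed

lemma TR_SO: "TR x \<in> SO_plus S"
proof -
  have i: "iso (TR y)" for y
  proof (rule isoI)
    fix v show "bil (S1 S) (TR y *v v) (TR y *v v) = bil (S1 S) v v"
    proof (cases v)
      case (1 a x b)
      show ?thesis by (simp add: 1 tr_mult bil_S1 bil_simps bS0_commute[of y x] algebra_simps)
    qed
  qed
  \<comment> \<open>Translations add up, so halving \<open>x\<close> gives a square root;
    \<open>gz\<close> and \<open>gz'\<close> are treated in the same way.\<close>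
  have "TR x = TR ((1/2) *s x) ** TR ((1/2) *s x)"
    by (rule matrix_eqI3)
      (simp add: matrix_vector_mul_assoc[symmetric] tr_mult bil_simps algebra_simps, simp add: vec_eq_iff)
  thus ?thesis using SO_plus_square[OF i[of "(1/2) *s x"]] by simp
qed

lemma TR_Gamma: "TR (ivec x) \<in> Gamma_S S"
proof -
  have "TR (ivec x) = map_matrix of_int (tr x (Q0 x))"
    unfolding tr_def map_blk
    by (simp add: Q0_real vec_eq_iff all_bord mat_def mv_nth vdot_def S0_def)
  thus ?thesis using TR_SO Gamma_S_iff by blast
qed

lemma lev_gz_SO: "lev (gz z (bS S z z / 2)) \<in> SO_plus S"
proof -
  let ?G = "\<lambda>z. gz z (bS S z z / 2) :: real^'n bord^'n bord"
  have i: "iso (lev (?G y))" for y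
  proof (rule iso_lev)
    fix v show "bil (S0 S) (?G y *v v) (?G y *v v) = bil (S0 S) v v"
    proof (cases v)
      case (1 a x b)
      show ?thesis by (simp add: 1 gz_mult bil_S0 bil_simps bS_commute[of y x] algebra_simps)
    qed
  qed
  have "?G z = ?G ((1/2) *s z) ** ?G ((1/2) *s z)"
    by (rule matrix_eqI3)
      (simp add: matrix_vector_mul_assoc[symmetric] gz_mult bil_simps algebra_simps, simp add: vec_eq_iff)
  thus ?thesis using SO_plus_square[OF i[of "(1/2) *s z"]] by (simp add: lev_comp)
qed

lemma lev_gz'_SO: "lev (gz' z (bS S z z / 2)) \<in> SO_plus S"
proof -
  let ?G = "\<lambda>z. gz' z (bS S z z / 2) :: real^'n bord^'n bord"
  have i: "iso (lev (?G y))" for y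
  proof (rule iso_lev)
    fix v show "bil (S0 S) (?G y *v v) (?G y *v v) = bil (S0 S) v v"
    proof (cases v)
      case (1 a x b)
      show ?thesis by (simp add: 1 gz'_mult bil_S0 bil_simps bS_commute[of y x] algebra_simps)
    qed
  qed
  have "?G z = ?G ((1/2) *s z) ** ?G ((1/2) *s z)"
    by (rule matrix_eqI3)
      (simp add: matrix_vector_mul_assoc[symmetric] gz'_mult bil_simps algebra_simps, simp add: vec_eq_iff)
  thus ?thesis using SO_plus_square[OF i[of "(1/2) *s z"]] by (simp add: lev_comp)
qed

lemma Jm_Gamma: "Jm \<in> Gamma_S S"
proof -
  \<comment> \<open>The quarter turn of the plane that \<open>Jm\<close> turns by 180 degrees: the
    sum of the outer pair goes to the sum of the inner pair, that one to minus the first, and the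
    differences are fixed.\<close>
  define N :: "real^'n bord bord^'n bord bord" where
    "N = four (1/2) (-1/2) (-1/2) (-1/2)  (1/2) (1/2) (-1/2) (1/2)  (1/2) (-1/2) (1/2) (1/2)  (-1/2) (-1/2) (-1/2) (1/2)"
  have "iso N"
  proof (rule isoI)
    fix v show "bil (S1 S) (N *v v) (N *v v) = bil (S1 S) v v"
    proof (cases v)
      case (1 a x b)
      thus ?thesis by (cases x) (simp add: N_def four_mult bil_S1 bil_S0 algebra_simps)
    qed
  qed
  moreover have "Jm = N ** N"
    by (rule matrix_eqI5) (simp add: matrix_vector_mul_assoc[symmetric] N_def four_mult Jm_mult field_simps)
  ultimately have "Jm \<in> SO_plus S" by (metis SO_plus_square)
  thus ?thesis using map_Jm Gamma_S_iff by metis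
qed

lemma sig_Gamma: "sig \<in> Gamma_S S"
proof -
  define c where "c = 1 / sqrt (2::real)"
  have c: "c * c = 1/2" by (simp add: c_def)
  have c': "c * (c * x) = x / 2" for x using c by (simp add: mult.assoc[symmetric])
  \<comment> \<open>Rotation by 45 degrees, where \<open>sig\<close> rotates by 90.\<close>
  define N :: "real^'n bord bord^'n bord bord" where
    "N = four c c 0 0  (-c) c 0 0  0 0 c (-c)  0 0 c c"
  have "iso N"
  proof (rule isoI)
    fix v show "bil (S1 S) (N *v v) (N *v v) = bil (S1 S) v v"
    proof (cases v)
      case (1 a x b)
      thus ?thesis by (cases x) (simp add: N_def four_mult bil_S1 bil_S0 algebra_simps c')
    qed
  qed
  moreover have "sig = N ** N"
    by (rule matrix_eqI5)
       (simp add: matrix_vector_mul_assoc[symmetric] N_def four_mult sig_mult algebra_simps c')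
  ultimately have "sig \<in> SO_plus S" by (metis SO_plus_square)
  thus ?thesis using map_sig Gamma_S_iff by metis
qed

lemma diagb_SO: assumes "r > 0" shows "diagb r (1/r) \<in> SO_plus S"
proof -
  define N :: "real^'n bord bord^'n bord bord" where "N = diagb (sqrt r) (1 / sqrt r)"
  have r: "sqrt r * sqrt r = r" "sqrt r * (1 / sqrt r) = 1" using assms by auto
  have "iso N"
  proof (rule isoI)
    fix v show "bil (S1 S) (N *v v) (N *v v) = bil (S1 S) v v"
      using assms by (cases v) (simp add: N_def diagb_mult bil_S1)
  qed
  moreover have "diagb r (1/r) = N ** N"
    using assms
    by (intro matrix_eqI3) (simp add: matrix_vector_mul_assoc[symmetric] N_def diagb_mult field_simps)
  ultimately show ?thesis by (metis SO_plus_square)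
qed

lemma lev_diagb_SO: assumes "r > 0" shows "lev (diagb r (1/r)) \<in> SO_plus S"
proof -
  define N :: "real^'n bord^'n bord" where "N = diagb (sqrt r) (1 / sqrt r)"
  have "iso (lev N)"
  proof (rule iso_lev)
    fix v show "bil (S0 S) (N *v v) (N *v v) = bil (S0 S) v v"
      using assms by (cases v) (simp add: N_def diagb_mult bil_S0)
  qed
  moreover have "diagb r (1/r) = N ** N"
    using assms
    by (intro matrix_eqI3) (simp add: matrix_vector_mul_assoc[symmetric] N_def diagb_mult field_simps)
  ultimately show ?thesis using SO_plus_square lev_comp by metis
qed

section \<open>Explicit actions\<close>

lemma act_TR: "cfactor S (TR x) w = 1" "orth_act S (TR x) w = w + vmap of_real x"
proof -
  have e: "cM (TR x) = tr (vmap of_real x) (of_real (bil (S0 S) x x / 2))"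
    unfolding tr_def map_blk
    by (simp add: vec_eq_iff all_bord mat_def mv_nth vdot_def S0_def)
  show 1: "cfactor S (TR x) w = 1" by (simp add: cfactor_emb e emb_def tr_mult)
  show "orth_act S (TR x) w = w + vmap of_real x" unfolding orth_act_emb 1 by (simp add: e emb_def tr_mult)
qed

lemma act_lev: "cfactor S (lev K) w = 1" "orth_act S (lev K) w = cM K *v w"
proof -
  show 1: "cfactor S (lev K) w = 1" by (simp add: cfactor_emb map_lev emb_def lev_mult)
  show "orth_act S (lev K) w = cM K *v w" unfolding orth_act_emb 1 by (simp add: map_lev emb_def lev_mult)
qed

lemma act_diagb: assumes "r > 0"
  shows "cfactor S (diagb r (1/r)) w = of_real (1/r)" "orth_act S (diagb r (1/r)) w = of_real r *s w"
proof -
  show 1: "cfactor S (diagb r (1/r)) w = of_real (1/r)" by (simp add: cfactor_emb map_diagb emb_def diagb_mult)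
  show "orth_act S (diagb r (1/r)) w = of_real r *s w"
    using assms unfolding orth_act_emb 1 by (simp add: map_diagb emb_def diagb_mult)
qed

lemma act_sig:
  "cfactor S sig (bvec s z t) = t"
  "orth_act S sig (bvec s z t) = bvec (s - bS S z z / (2 * t)) (inverse t *s z) (- 1 / t)" if "t \<noteq> 0"
proof -
  have e: "cM sig = sig" by (simp add: sig_def map_four)
  show 1: "cfactor S sig (bvec s z t) = t" by (simp add: cfactor_emb e emb_def sig_mult)
  show "orth_act S sig (bvec s z t) = bvec (s - bS S z z / (2 * t)) (inverse t *s z) (- 1 / t)"
    unfolding orth_act_emb 1
    using that by (simp add: e emb_def sig_mult bil_S0 bvec_scale field_simps)
qed

lemma cfactor_scaleR: "cfactor S (c *\<^sub>R M) w = of_real c * cfactor S M w"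
  by (simp add: cfactor_def sum_distrib_left algebra_simps)

lemma orth_act_scaleR: "c \<noteq> 0 \<Longrightarrow> orth_act S (c *\<^sub>R M) w = orth_act S M w"
proof -
  assume c: "c \<noteq> 0"
  have e: "cM (c *\<^sub>R M) *v W = of_real c *s (cM M *v W)" for W
    by (simp add: vec_eq_iff mv_nth vdot_def sum_distrib_left mult.assoc)
  show ?thesis using c by (simp add: orth_act_emb cfactor_scaleR e mid_scale)
qed

lemma matrix_scaleR_mult:
  fixes A :: "real^'k::finite^'l::finite" and B :: "real^'m::finite^'k"
  shows "A ** (c *\<^sub>R B) = c *\<^sub>R (A ** B)" "(c *\<^sub>R A) ** B = c *\<^sub>R (A ** B)"
  by (simp_all add: vec_eq_iff matrix_matrix_mult_def sum_distrib_left mult_ac)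

lemma slash_scaleR:
  assumes "c \<noteq> 0"
  shows "slash S k f (c *\<^sub>R M) w = of_real c powi (- k) * slash S k f M w"
  using assms by (simp add: slash_def cfactor_scaleR orth_act_scaleR power_int_mult_distrib)

lemma slash_mult_Gamma:
  assumes f: "\<And>M w. M \<in> Gamma_S S \<Longrightarrow> w \<in> half_space S \<Longrightarrow> slash S k f M w = f w"
    and A: "A \<in> Gamma_S S" and M: "M \<in> SO_plus S" and w: "w \<in> half_space S"
  shows "slash S k f (A ** M) w = slash S k f M w"
proof -
  have i: "iso A" "iso M" using A M SO_plusD(1) Gamma_S_SO by blast+
  have w': "orth_act S M w \<in> half_space S" using SO_plusD(3)[OF M w] .
  have "slash S k f (A ** M) w = slash S k f A (orth_act S M w) * cfactor S M w powi (- k)"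
    by (simp add: slash_def act_mult[OF i half_space_Hpm[OF w]] power_int_mult_distrib)
  thus ?thesis unfolding f[OF A w'] by (simp only: slash_def)
qed

section \<open>Cosets\<close>

abbreviation dq :: "nat \<Rightarrow> real^'n bord bord^'n bord bord" where
  "dq q \<equiv> diagb (1 / real q) (real q)"

text \<open>Without the scalar \<open>q\<close> the Hecke diagonal lies in \<open>SO_plus S\<close>;
  the scalar only adds the factor \<open>q^(-k)\<close> to the slash action.\<close>

lemma hecke_diag_eq: "q > 0 \<Longrightarrow> hecke_diag q = real q *\<^sub>R dq q"
  by (simp add: vec_eq_iff all_bord hecke_diag_def diagb_def mat_def power2_eq_square)

lemma dq_SO: "q > 0 \<Longrightarrow> dq q \<in> SO_plus S"
  using diagb_SO[of "1 / real q"] by simp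

definition coset :: "nat \<Rightarrow> real^'n bord bord^'n bord bord \<Rightarrow> (real^'n bord bord^'n bord bord) set" where
  "coset q B = (\<lambda>A. A ** (hecke_diag q ** B)) ` Gamma_S S"

lemma T_S_cosets: "(\<lambda>M. (\<lambda>A. A ** M) ` Gamma_S S) ` T_S S q = coset q ` Gamma_S S"
proof -
  have *: "(\<lambda>A. A ** (A0 ** hecke_diag q ** B)) ` Gamma_S S = coset q B" if A0: "A0 \<in> Gamma_S S" for A0 B
  proof -
    obtain A' where A': "A' \<in> Gamma_S S" "A' ** A0 = mat 1" "A0 ** A' = mat 1" using Gamma_S_inverse A0 by blast
    show ?thesis
    proof (intro equalityI subsetI)
      fix X assume "X \<in> (\<lambda>A. A ** (A0 ** hecke_diag q ** B)) ` Gamma_S S"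
      then obtain A where A: "A \<in> Gamma_S S" "X = A ** (A0 ** hecke_diag q ** B)" by blast
      have "X = (A ** A0) ** (hecke_diag q ** B)" by (simp add: A matrix_mul_assoc)
      thus "X \<in> coset q B" unfolding coset_def using Gamma_S_mult[OF A(1) A0] by blast
    next
      fix X assume "X \<in> coset q B"
      then obtain A where A: "A \<in> Gamma_S S" "X = A ** (hecke_diag q ** B)" unfolding coset_def by blast
      have "X = (A ** (A' ** A0)) ** (hecke_diag q ** B)" by (simp add: A A')
      also have "\<dots> = (A ** A') ** (A0 ** hecke_diag q ** B)" by (simp only: matrix_mul_assoc)
      finally show "X \<in> (\<lambda>A. A ** (A0 ** hecke_diag q ** B)) ` Gamma_S S"
        using Gamma_S_mult[OF A(1) A'(1)] by blast
    qed
  qed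
  show ?thesis
  proof (intro equalityI subsetI)
    fix X assume "X \<in> (\<lambda>M. (\<lambda>A. A ** M) ` Gamma_S S) ` T_S S q"
    thus "X \<in> coset q ` Gamma_S S" unfolding T_S_def using * by auto
  next
    fix X assume "X \<in> coset q ` Gamma_S S"
    then obtain B where B: "B \<in> Gamma_S S" "X = coset q B" by blast
    have "mat 1 ** hecke_diag q ** B \<in> T_S S q" unfolding T_S_def using B Gamma_S_one by blast
    moreover have "X = (\<lambda>A. A ** (mat 1 ** hecke_diag q ** B)) ` Gamma_S S" using *[OF Gamma_S_one] B by simp
    ultimately show "X \<in> (\<lambda>M. (\<lambda>A. A ** M) ` Gamma_S S) ` T_S S q" by blast
  qed
qed

lemma Gamma_S_int:
  assumes "M \<in> Gamma_S S"
  obtains A where "M = map_matrix of_int A" "\<And>x y. bil (S1 S) (A *v x) (A *v y) = bil (S1 S) x y"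
proof -
  obtain A where A: "M = map_matrix of_int A" using assms Gamma_S_iff by blast
  have "bil (S1 S) (A *v x) (A *v y) = bil (S1 S) x y" for x y
  proof -
    have "real_of_int (bil (S1 S) (A *v x) (A *v y)) = bil (S1 S) (M *v ivec x) (M *v ivec y)"
      by (simp add: A mv_ivec of_int_bS1)
    also have "\<dots> = real_of_int (bil (S1 S) x y)"
      using SO_plusD(1)[OF Gamma_S_SO[OF assms]] by (simp add: iso_def of_int_bS1)
    finally show ?thesis by simp
  qed
  thus ?thesis using that A by blast
qed

abbreviation elst :: "'a::zero_neq_one^'n bord bord" where "elst \<equiv> bvec 0 0 1"

lemma dconj_nth:
  fixes i j :: "'n bord bord"
  shows "(diagb r s ** M ** diagb r' s') $ i $ j = diagb r s $ i $ i * M $ i $ j * diagb r' s' $ j $ j"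
proof -
  have d: "diagb r s $ i $ j = (if i = j then diagb r s $ i $ i else 0)" for r s and i j :: "'n bord bord"
    by (cases i rule: sum.exhaust; cases j rule: sum.exhaust)
       (auto simp: diagb_def blk_def bvec_def mat_def split: sum.splits)
  have 1: "(diagb r s ** N) $ i $ j = diagb r s $ i $ i * N $ i $ j" for r s N and i j :: "'n bord bord"
  proof -
    have "(\<Sum>k\<in>UNIV. diagb r s $ i $ k * N $ k $ j) = (\<Sum>k\<in>UNIV. if i = k then diagb r s $ i $ i * N $ k $ j else 0)"
      by (intro sum.cong refl, subst d) simp
    thus ?thesis by (simp add: matrix_matrix_mult_def)
  qed
  have 2: "(N ** diagb r s) $ i $ j = N $ i $ j * diagb r s $ j $ j" for r s N and i j :: "'n bord bord"
  proof -
    have "(\<Sum>k\<in>UNIV. N $ i $ k * diagb r s $ k $ j) = (\<Sum>k\<in>UNIV. if k = j then N $ i $ k * diagb r s $ j $ j else 0)"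
      by (intro sum.cong refl, subst d) simp
    thus ?thesis by (simp add: matrix_matrix_mult_def)
  qed
  show ?thesis by (simp add: 1 2)
qed

text \<open>With \<open>g = B B'^-1\<close>, the cosets coincide exactly if the conjugate of
  \<open>g\<close> by the Hecke diagonal is still integral. Conjugation divides the entries of the
  last column above the corner by \<open>q\<close> or \<open>q^2\<close>, so that column, which is
  \<open>B u'\<close>, must be congruent to a multiple of the last basis vector. Undoing
  \<open>B\<close> turns this into a relation between \<open>u'\<close> and \<open>u\<close>: a
  coset is a line modulo \<open>q\<close>.\<close>

lemma coset_eq_iff:
  assumes q: "prime (q::nat)" and B: "B \<in> Gamma_S S" "B' \<in> Gamma_S S"
    and u: "B *v ivec u = elst" "B' *v ivec u' = elst"
  shows "coset q B = coset q B' \<longleftrightarrow> (\<exists>t. \<not> int q dvd t \<and> vcong (int q) u' (t *s u))"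
proof
  have qp: "prime (int q)" using q by simp
  have q0: "q > 0" using prime_gt_0_nat[OF q] .
  obtain Bi where Bi: "B = map_matrix of_int Bi" using B Gamma_S_iff by blast
  obtain Bi' where Bi': "B' = map_matrix of_int Bi'" using B Gamma_S_iff by blast
  have ue: "Bi *v u = elst" "Bi' *v u' = elst"
  proof -
    have "(ivec (Bi *v u) :: real^_) = ivec elst" "(ivec (Bi' *v u') :: real^_) = ivec elst"
      using u by (simp_all add: Bi Bi' mv_ivec ivec_arith)
    thus "Bi *v u = elst" "Bi' *v u' = elst" by (simp_all only: ivec_eq_iff)
  qed
  obtain V where V: "V \<in> Gamma_S S" "V ** B' = mat 1" "B' ** V = mat 1" using Gamma_S_inverse B by metis
  define g where "g = B ** V"
  have g: "g \<in> Gamma_S S" using Gamma_S_mult B V by (simp add: g_def)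
  obtain A where A: "g = map_matrix of_int A" "\<And>x y. bil (S1 S) (A *v x) (A *v y) = bil (S1 S) x y"
    using Gamma_S_int g by metis
  have gB: "g ** B' = B" by (simp add: g_def matrix_mul_assoc[symmetric] V)
  have "(ivec (A *v elst) :: real^_) = ivec (Bi *v u')"
  proof -
    have "(ivec (A *v elst) :: real^_) = g *v (B' *v ivec u')"
      unfolding u(2) by (simp add: A(1) mv_ivec[symmetric] ivec_arith)
    also have "\<dots> = ivec (Bi *v u')" by (simp add: matrix_vector_mul_assoc gB Bi mv_ivec)
    finally show ?thesis .
  qed
  hence Ae: "A *v elst = Bi *v u'" by simp
  have en: "(A *v elst) $ i = A $ i $ lst_ix" for i
    by (simp add: mv_nth vdot_def sum_bord)
  have not0: "\<not> vcong (int q) u' 0"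
  proof
    assume "vcong (int q) u' 0"
    from vcong_mv[OF this, of Bi'] have "vcong (int q) elst 0" by (simp add: ue)
    thus False using qp by (auto simp: vcong_0 all_bord)
  qed
  {
    assume "coset q B = coset q B'"
    moreover have "hecke_diag q ** B \<in> coset q B"
      unfolding coset_def using Gamma_S_one by (auto intro!: image_eqI[of _ _ "mat 1"])
    ultimately obtain E where E: "E \<in> Gamma_S S" "hecke_diag q ** B = E ** (hecke_diag q ** B')"
      unfolding coset_def by blast
    obtain Ei where Ei: "E = map_matrix of_int Ei" using E Gamma_S_iff by blast
    have "hecke_diag q ** g = hecke_diag q ** B ** V" by (simp add: g_def matrix_mul_assoc)
    also have "\<dots> = E ** hecke_diag q ** (B' ** V)" by (simp add: E matrix_mul_assoc)
    finally have "hecke_diag q ** g = E ** hecke_diag q" by (simp add: V)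
    hence "dq q ** g = E ** dq q"
      using q0 by (simp add: hecke_diag_eq matrix_scaleR_mult)
    hence "diagb (real q) (1 / real q) ** (dq q ** g) = diagb (real q) (1 / real q) ** E ** dq q"
      by (simp add: matrix_mul_assoc)
    moreover have "diagb (real q) (1 / real q) ** dq q = (mat 1 :: real^'n bord bord^_)"
      using q0 by (intro matrix_eqI3) (simp add: matrix_vector_mul_assoc[symmetric] diagb_mult)
    ultimately have gE: "g = diagb (real q) (1 / real q) ** E ** dq q"
      by (simp add: matrix_mul_assoc)
    have e1: "A $ fst_ix $ lst_ix = int q * int q * Ei $ fst_ix $ lst_ix"
    proof -
      have "real_of_int (A $ fst_ix $ lst_ix) = real_of_int (int q * int q * Ei $ fst_ix $ lst_ix)"
        using arg_cong[OF gE, of "\<lambda>M. M $ fst_ix $ lst_ix"] unfolding dconj_nth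
        by (simp add: A(1) Ei diagb_def mult_ac)
      thus ?thesis by linarith
    qed
    have e2: "A $ mid_ix j $ lst_ix = int q * Ei $ mid_ix j $ lst_ix" for j
    proof -
      have "real_of_int (A $ mid_ix j $ lst_ix) = real_of_int (int q * Ei $ mid_ix j $ lst_ix)"
        using arg_cong[OF gE, of "\<lambda>M. M $ mid_ix j $ lst_ix"] unfolding dconj_nth
        by (simp add: A(1) Ei diagb_def mult_ac mat_def)
      thus ?thesis by linarith
    qed
    define t where "t = A $ lst_ix $ lst_ix"
    have c: "vcong (int q) (Bi *v u') (t *s (Bi *v u))"
      unfolding Ae[symmetric] ue by (simp add: vcong_def en all_bord e1 e2 t_def)
    have c2: "vcong (int q) u' (t *s u)"
    proof -
      obtain W where W: "W \<in> Gamma_S S" "W ** B = mat 1" "B ** W = mat 1" using Gamma_S_inverse B by metis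
      obtain Wi where Wi: "W = map_matrix of_int Wi" using W Gamma_S_iff by blast
      have "map_matrix real_of_int (Wi ** Bi) = map_matrix real_of_int (mat 1)"
        using W by (simp add: hom_int.h_mm Wi Bi hom_int.h_mat)
      hence "Wi ** Bi = mat 1" using map_matrix_int_inj by blast
      thus ?thesis using vcong_mv[OF c, of Wi] by (simp add: mv_scale matrix_vector_mul_assoc)
    qed
    moreover have "\<not> int q dvd t"
    proof
      assume "int q dvd t"
      hence "vcong (int q) u' 0" using vcong_trans[OF c2 vcong_scale_left[of "int q" t 0 u]] by simp
      thus False using not0 by simp
    qed
    ultimately show "\<exists>t. \<not> int q dvd t \<and> vcong (int q) u' (t *s u)" by blast
  }
  {
    assume "\<exists>t. \<not> int q dvd t \<and> vcong (int q) u' (t *s u)"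
    then obtain t where t: "\<not> int q dvd t" "vcong (int q) u' (t *s u)" by blast
    have c: "vcong (int q) (A *v elst) (t *s elst)"
      using vcong_mv[OF t(2), of Bi] by (simp add: Ae mv_scale ue)
    obtain a y b where Ab: "A *v elst = bvec a y b" by (cases "A *v elst")
    have ab: "int q dvd a" "vcong (int q) y 0" "int q dvd b - t"
      using c by (simp_all add: Ab bvec_scale vcong_bvec)
    have bu: "\<not> int q dvd b" using ab(3) t(1) dvd_diff[of "int q" b "b - t"] by auto
    \<comment> \<open>The corner entry \<open>a\<close> has to be divisible by \<open>q^2\<close>,
      while the congruence only gives \<open>q\<close>. Isotropy of the column, with
      \<open>q\<close> dividing \<open>y\<close> and \<open>b\<close> prime to \<open>q\<close>,
      supplies the second factor.\<close>
    have "2 * (a * b + Q0 y) = 0"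
      using A(2)[of elst elst] by (simp add: Ab bil_S1 two_Q0[symmetric] algebra_simps)
    moreover have "int q * int q dvd Q0 y"
    proof -
      have "\<exists>c. y $ i = int q * c" for i using ab(2) by (simp add: vcong_0 dvd_def)
      then obtain c where "\<And>i. y $ i = int q * c i" by metis
      hence "y = int q *s (\<chi> i. c i)" by (simp add: vec_eq_iff)
      thus ?thesis by (simp add: Q0_scale power2_eq_square)
    qed
    ultimately have "int q * int q dvd a * b" by (smt (verit) dvd_minus_iff)
    moreover have "coprime (int q * int q) b"
      using bu qp by (simp add: prime_imp_coprime)
    ultimately have a2: "int q * int q dvd a" by (simp add: coprime_dvd_mult_left_iff)
    \<comment> \<open>The first row is also divided by \<open>q\<close>. Its divisibility follows
      from the orthogonality of the corresponding column to the last one.\<close>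
    have row: "int q dvd A $ fst_ix $ mid_ix j" for j
    proof -
      obtain a' y' b' where Aj: "A *v axis (mid_ix j) 1 = bvec a' y' b'" by (cases "A *v axis (mid_ix j) 1")
      have ax: "(axis (mid_ix j) 1 :: int^'n bord bord) = bvec 0 (axis j 1) 0"
        unfolding vec_eq_iff by (auto simp: all_bord axis_def)
      have "a * b' + b * a' + bil (S0 S) y y' = 0"
        using A(2)[of elst "axis (mid_ix j) 1"] by (simp add: Ab Aj) (simp add: ax bil_S1)
      moreover have "int q dvd bil (S0 S) y y'"
        using vcong_bil[OF ab(2), of "S0 S" y'] by (simp add: bS0_commute)
      ultimately have "int q dvd b * a'" using ab(1)
        by (metis add.commute add.left_commute dvd_add_right_iff dvd_mult2 dvd_0_right add_cancel_right_right)
      hence "int q dvd a'" using bu qp by (simp add: prime_dvd_mult_iff)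
      moreover have "a' = A $ fst_ix $ mid_ix j"
        using arg_cong[OF Aj, of "\<lambda>v. v $ fst_ix"] by (simp add: mv_nth)
      ultimately show ?thesis by simp
    qed
    have colA: "A $ fst_ix $ lst_ix = a" "A $ mid_ix j $ lst_ix = y $ j" "A $ lst_ix $ lst_ix = b" for j
      using en[symmetric] by (simp_all add: Ab)
    define E where "E = dq q ** g ** diagb (real q) (1 / real q)"
    have "E \<in> SO_plus S" unfolding E_def
      using g q0 dq_SO diagb_SO[of "real q"] SO_plus_mult Gamma_S_SO by simp
    moreover have "E $ i $ j \<in> \<int>" for i j
    proof -
      have int_div: "real_of_int x / real q \<in> \<int>" if "int q dvd x" for x
        using that q0 by (auto simp: dvd_def)
      have int_div2: "real_of_int x / (real q * real q) \<in> \<int>" if "int q * int q dvd x" for x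
        using that q0 by (auto simp: dvd_def)
      have "\<forall>i j. E $ i $ j \<in> \<int>"
        unfolding E_def dconj_nth all_bord[where 'm = "'n bord"]
        using int_div[OF row] int_div[of "y $ _"] int_div2[OF a2] ab(2) q0
        by (simp add: diagb_def mat_def A(1) colA vcong_0)
      thus ?thesis by blast
    qed
    hence "E = map_matrix of_int (\<chi> i j. \<lfloor>E $ i $ j\<rfloor>)"
      by (simp add: vec_eq_iff)
    ultimately have EG: "E \<in> Gamma_S S" using Gamma_S_iff by blast
    have one: "diagb (real q) (1 / real q) ** dq q = (mat 1 :: real^'n bord bord^_)"
      using q0 by (intro matrix_eqI3) (simp add: matrix_vector_mul_assoc[symmetric] diagb_mult)
    have "E ** dq q = dq q ** g ** (diagb (real q) (1 / real q) ** dq q)"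
      unfolding E_def by (simp only: matrix_mul_assoc)
    hence "E ** dq q ** B' = dq q ** (g ** B')" by (simp add: one matrix_mul_assoc)
    hence eq: "hecke_diag q ** B = E ** (hecke_diag q ** B')"
      using q0 by (simp add: hecke_diag_eq matrix_scaleR_mult gB matrix_mul_assoc)
    obtain E' where E': "E' \<in> Gamma_S S" "E' ** E = mat 1" "E ** E' = mat 1" using Gamma_S_inverse EG by blast
    show "coset q B = coset q B'"
    proof (intro equalityI subsetI)
      fix X assume "X \<in> coset q B"
      then obtain F where F: "F \<in> Gamma_S S" "X = F ** (hecke_diag q ** B)" unfolding coset_def by blast
      hence "X = (F ** E) ** (hecke_diag q ** B')" by (simp add: eq matrix_mul_assoc)
      thus "X \<in> coset q B'" unfolding coset_def using Gamma_S_mult[OF F(1) EG] by blast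
    next
      fix X assume "X \<in> coset q B'"
      then obtain F where F: "F \<in> Gamma_S S" "X = F ** (hecke_diag q ** B')" unfolding coset_def by blast
      hence "X = F ** (E' ** E) ** (hecke_diag q ** B')" by (simp add: E')
      also have "\<dots> = (F ** E') ** (E ** (hecke_diag q ** B'))" by (simp only: matrix_mul_assoc)
      finally show "X \<in> coset q B" unfolding coset_def eq[symmetric] using Gamma_S_mult[OF F(1) E'(1)] by blast
    qed
  }
qed

end

section \<open>Coset representatives of the orthogonal Hecke operator\<close>

definition ibox :: "nat \<Rightarrow> (int^'m::finite) set" where
  "ibox q = {x. \<forall>i. 0 \<le> x $ i \<and> x $ i < int q}"

lemma ibox_PiE: "ibox q = vec_lambda ` (UNIV \<rightarrow>\<^sub>E {0..<int q})"
proof (intro equalityI subsetI)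
  fix x :: "int^'m" assume "x \<in> ibox q"
  hence "vec_nth x \<in> UNIV \<rightarrow>\<^sub>E {0..<int q}" by (auto simp: ibox_def PiE_def)
  moreover have "x = vec_lambda (vec_nth x)" by simp
  ultimately show "x \<in> vec_lambda ` (UNIV \<rightarrow>\<^sub>E {0..<int q})" by blast
qed (auto simp: ibox_def PiE_def)

lemma finite_ibox [simp]: "finite (ibox q)"
  unfolding ibox_PiE by (intro finite_imageI finite_PiE) auto

lemma sum_box_prod:
  "(\<Sum>x\<in>(ibox q::(int^'m::finite) set). \<Prod>i\<in>UNIV. h i (x $ i)) = (\<Prod>i\<in>UNIV. \<Sum>v\<in>{0..<int q}. h i v :: 'a::comm_semiring_1)"
proof -
  have inj: "inj_on (vec_lambda :: ('m \<Rightarrow> int) \<Rightarrow> int^'m) A" for A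
    by (rule inj_onI) (metis vec_lambda_inverse UNIV_I)
  show ?thesis
    unfolding ibox_PiE by (subst sum.reindex[OF inj]) (simp add: prod_sum_PiE)
qed

definition red :: "nat \<Rightarrow> int^'m::finite \<Rightarrow> int^'m" where
  "red q x = (\<chi> i. x $ i mod int q)"

lemma red_box: "q > 0 \<Longrightarrow> red q x \<in> ibox q"
  by (simp add: red_def ibox_def)

lemma red_cong: "vcong (int q) (red q x) x"
  by (simp add: red_def vcong_def mod_eq_dvd_iff[symmetric])

lemma box_eqI: assumes "x \<in> ibox q" "y \<in> ibox q" "vcong (int q) x y" shows "x = y"
proof -
  have "x $ i = y $ i" for i
  proof -
    have "x $ i mod int q = y $ i mod int q" using assms(3) by (simp add: vcong_def mod_eq_dvd_iff)
    thus ?thesis using assms(1,2) by (simp add: ibox_def)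
  qed
  thus ?thesis by (simp add: vec_eq_iff)
qed

lemma red_eq_iff: "q > 0 \<Longrightarrow> red q x = red q y \<longleftrightarrow> vcong (int q) x y"
  by (simp add: red_def vcong_def vec_eq_iff mod_eq_dvd_iff)

lemma unit_inverse_mod:
  assumes "prime (q::nat)" "\<not> int q dvd t" obtains t' where "int q dvd t' * t - 1" "\<not> int q dvd t'"
proof -
  have "coprime t (int q)" using assms by (metis coprime_commute prime_imp_coprime prime_nat_int_transfer)
  moreover obtain u v where "u * t + v * int q = gcd t (int q)" using bezout_int by blast
  ultimately have "u * t - 1 = int q * (- v)" by (simp add: algebra_simps)
  then obtain t' where d: "int q dvd t' * t - 1" by (metis dvd_triv_left)
  moreover have "\<not> int q dvd t'"
  proof
    assume "int q dvd t'"
    hence "int q dvd t' * t" by simp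
    hence "int q dvd 1" using d by (metis dvd_diff_right_iff)
    thus False using assms(1) by simp
  qed
  ultimately show ?thesis using that by blast
qed

context even_unimodular
begin

section \<open>Integral isometries of \<open>S0 S\<close> and isotropic lines modulo a prime\<close>

definition nn :: "int^'n bord \<Rightarrow> bool" where
  "nn v \<longleftrightarrow> v $ fst_ix \<ge> 0 \<and> v $ lst_ix \<ge> 0 \<and> Q0 v \<ge> 0"

text \<open>Preservation of \<open>nn\<close> and an integral inverse are recorded together with
  membership in the modular group, so that Fourier indices can be moved by such a \<open>K\<close>
  without going back to the half-space.\<close>

definition KG :: "(int^'n bord^'n bord) set" where
  "KG = {K. lev (map_matrix of_int K) \<in> Gamma_S S \<and> (\<forall>v. nn (K *v v) \<longleftrightarrow> nn v) \<and>
            (\<exists>K'. K' ** K = mat 1 \<and> K ** K' = mat 1)}"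

lemma KG_mult: assumes "K \<in> KG" "L \<in> KG" shows "K ** L \<in> KG"
proof -
  have "lev (map_matrix of_int (K ** L)) \<in> Gamma_S S"
    using assms Gamma_S_mult by (simp add: KG_def hom_int.h_mm flip: lev_comp)
  moreover obtain K' L' where KL: "K' ** K = mat 1" "K ** K' = mat 1" "L' ** L = mat 1" "L ** L' = mat 1"
    using assms by (auto simp: KG_def)
  have "(L' ** K') ** (K ** L) = L' ** (K' ** K) ** L" "(K ** L) ** (L' ** K') = K ** (L ** L') ** K'"
    by (simp_all only: matrix_mul_assoc)
  hence "(L' ** K') ** (K ** L) = mat 1" "(K ** L) ** (L' ** K') = mat 1" by (simp_all add: KL)
  ultimately show ?thesis using assms by (auto simp: KG_def matrix_vector_mul_assoc[symmetric])
qed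

lemma KG_bil: assumes "K \<in> KG" shows "bil (S0 S) (K *v x) (K *v y) = bil (S0 S) x y"
proof -
  have "lev (map_matrix real_of_int K) \<in> Gamma_S S" using assms by (simp add: KG_def)
  hence i: "iso (lev (map_matrix real_of_int K))" using SO_plusD(1) Gamma_S_SO by blast
  have "bil (S1 S) (lev (map_matrix real_of_int K) *v bvec 0 (ivec x) 0) (lev (map_matrix real_of_int K) *v bvec 0 (ivec y) 0)
    = bil (S1 S) (bvec 0 (ivec x) 0) (bvec 0 (ivec y) 0)" using i by (simp only: iso_def)
  hence "real_of_int (bil (S0 S) (K *v x) (K *v y)) = real_of_int (bil (S0 S) x y)"
    by (simp add: lev_mult bil_S1 mv_ivec of_int_bS0)
  thus ?thesis by simp
qed

lemma KG_Q0: "K \<in> KG \<Longrightarrow> Q0 (K *v x) = Q0 x"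
  using two_Q0[of "K *v x"] two_Q0[of x] KG_bil[of K x x] by simp

text \<open>Beyond computation, only the sign of the new first coordinate is at stake. If
  \<open>t > 0\<close>, its product with \<open>t\<close> is at least a value of \<open>qS\<close>.
  If \<open>t = 0\<close>, then \<open>nn\<close> gives \<open>qS p = 0\<close>, hence
  \<open>p = 0\<close>, and the vector does not move.\<close>

lemma gz_KG: "gz z (qS z) \<in> KG"
proof -
  have e: "map_matrix of_int (gz z (qS z)) = gz (ivec z) (bS S (ivec z) (ivec z) / 2 :: real)" for z
    unfolding gz_def map_blk
    by (simp add: qS_real vec_eq_iff all_bord mat_def mv_nth vdot_def)
  have G: "lev (map_matrix of_int (gz z (qS z))) \<in> Gamma_S S"
  proof -
    have "lev (map_matrix real_of_int (gz z (qS z))) = map_matrix of_int (lev (gz z (qS z)))"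
      by (simp add: map_lev)
    thus ?thesis unfolding Gamma_S_iff using lev_gz_SO e by metis
  qed
  have inv: "gz (- z) (qS (- z)) ** gz z (qS z) = mat 1" for z
  proof (rule matrix_eqI3)
    fix a y b
    have "qS (- z) = qS z" using two_qS[of z] two_qS[of "- z"] by (simp add: bil_uminus)
    thus "gz (- z) (qS (- z)) ** gz z (qS z) *v bvec a y b = mat 1 *v bvec a y b"
      using two_qS[of z]
      by (simp add: matrix_vector_mul_assoc[symmetric] gz_mult bil_simps algebra_simps)
  qed
  have inv': "gz z (qS z) ** gz (- z) (qS (- z)) = mat 1" using inv[of "- z"] by simp
  have q: "Q0 (gz z (qS z) *v v) = Q0 v" for z v
  proof (cases v)
    case (1 s p t)
    show ?thesis by (simp add: 1 gz_mult Q0_bvec qS_add qS_scale bil_commute[OF sym, of z p] bil_simps power2_eq_square algebra_simps)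
  qed
  have n: "nn (gz z (qS z) *v v)" if "nn v" for z v
  proof (cases v)
    case (1 s p t)
    have st: "s \<ge> 0" "t \<ge> 0" "s * t \<ge> qS p" using that by (simp_all add: 1 nn_def Q0_bvec)
    have "s + bS S z p + qS z * t \<ge> 0"
    proof (cases "t = 0")
      case True
      hence "qS p = 0" using st qS_nonneg[of p] by simp
      hence "p = 0" using qS_eq_0 by simp
      thus ?thesis using True st by simp
    next
      case False
      have "Q0 (gz z (qS z) *v v) \<ge> 0" using that by (simp add: q nn_def)
      hence "(s + bS S z p + qS z * t) * t \<ge> qS (p + t *s z)" by (simp add: 1 gz_mult Q0_bvec)
      hence "(s + bS S z p + qS z * t) * t \<ge> 0" using qS_nonneg[of "p + t *s z"] by linarith
      thus ?thesis using False st by (simp add: zero_le_mult_iff)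
    qed
    thus ?thesis using that st q[of z v] by (simp add: 1 nn_def gz_mult)
  qed
  have "nn v" if "nn (gz z (qS z) *v v)" for v
    using n[OF that, of "- z"] by (simp add: matrix_vector_mul_assoc inv)
  hence "\<forall>v. nn (gz z (qS z) *v v) \<longleftrightarrow> nn v" using n by blast
  thus ?thesis unfolding KG_def using G inv[of z] inv' by blast
qed

lemma gz'_KG: "gz' z (qS z) \<in> KG"
proof -
  have e: "map_matrix of_int (gz' z (qS z)) = gz' (ivec z) (bS S (ivec z) (ivec z) / 2 :: real)" for z
    unfolding gz'_def map_blk
    by (simp add: qS_real vec_eq_iff all_bord mat_def mv_nth vdot_def)
  have G: "lev (map_matrix of_int (gz' z (qS z))) \<in> Gamma_S S"
  proof -
    have "lev (map_matrix real_of_int (gz' z (qS z))) = map_matrix of_int (lev (gz' z (qS z)))"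
      by (simp add: map_lev)
    thus ?thesis unfolding Gamma_S_iff using lev_gz'_SO e by metis
  qed
  have inv: "gz' (- z) (qS (- z)) ** gz' z (qS z) = mat 1" for z
  proof (rule matrix_eqI3)
    fix a y b
    have "qS (- z) = qS z" using two_qS[of z] two_qS[of "- z"] by (simp add: bil_uminus)
    thus "gz' (- z) (qS (- z)) ** gz' z (qS z) *v bvec a y b = mat 1 *v bvec a y b"
      using two_qS[of z]
      by (simp add: matrix_vector_mul_assoc[symmetric] gz'_mult bil_simps algebra_simps)
  qed
  have inv': "gz' z (qS z) ** gz' (- z) (qS (- z)) = mat 1" using inv[of "- z"] by simp
  have q: "Q0 (gz' z (qS z) *v v) = Q0 v" for z v
  proof (cases v)
    case (1 s p t)
    show ?thesis by (simp add: 1 gz'_mult Q0_bvec qS_add qS_scale bil_commute[OF sym, of z p] bil_simps power2_eq_square algebra_simps)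
  qed
  have n: "nn (gz' z (qS z) *v v)" if "nn v" for z v
  proof (cases v)
    case (1 s p t)
    have st: "s \<ge> 0" "t \<ge> 0" "s * t \<ge> qS p" using that by (simp_all add: 1 nn_def Q0_bvec)
    have "qS z * s + bS S z p + t \<ge> 0"
    proof (cases "s = 0")
      case True
      hence "qS p = 0" using st qS_nonneg[of p] by simp
      hence "p = 0" using qS_eq_0 by simp
      thus ?thesis using True st by simp
    next
      case False
      have "Q0 (gz' z (qS z) *v v) \<ge> 0" using that by (simp add: q nn_def)
      hence "s * (qS z * s + bS S z p + t) \<ge> qS (p + s *s z)" by (simp add: 1 gz'_mult Q0_bvec)
      hence "s * (qS z * s + bS S z p + t) \<ge> 0" using qS_nonneg[of "p + s *s z"] by linarith
      thus ?thesis using False st by (simp add: zero_le_mult_iff)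
    qed
    thus ?thesis using that st q[of z v] by (simp add: 1 nn_def gz'_mult)
  qed
  have "nn v" if "nn (gz' z (qS z) *v v)" for v
    using n[OF that, of "- z"] by (simp add: matrix_vector_mul_assoc inv)
  hence "\<forall>v. nn (gz' z (qS z) *v v) \<longleftrightarrow> nn v" using n by blast
  thus ?thesis unfolding KG_def using G inv[of z] inv' by blast
qed

text \<open>An integral inverse of \<open>S\<close> leaves no radical modulo any integer.\<close>

lemma unimodular_mod: assumes "\<And>z. q dvd bS S z p" shows "vcong q p 0"
proof -
  obtain Si where Si: "Si ** S = mat 1" using inverse_S by metis
  have "q dvd (S *v p) $ i" for i using assms[of "axis i 1"] by (simp add: bil_def)
  hence "vcong q (S *v p) 0" by (simp add: vcong_0)
  from vcong_mv[OF this, of Si] show ?thesis by (simp add: matrix_vector_mul_assoc Si)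
qed

lemma unimodular_mod_S0: assumes "\<And>x. q dvd bil (S0 S) x y" shows "vcong q y 0"
proof (cases y)
  case (1 s p t)
  have "q dvd s" using assms[of "bvec 0 0 1"] by (simp add: 1 bil_S0)
  moreover have "q dvd t" using assms[of "bvec 1 0 0"] by (simp add: 1 bil_S0)
  moreover have "vcong q p 0"
    by (rule unimodular_mod) (use assms[of "bvec 0 _ 0"] in \<open>simp add: 1 bil_S0\<close>)
  ultimately show ?thesis by (simp add: 1 bvec_0 vcong_bvec)
qed

lemma qS_cong: "vcong q x y \<Longrightarrow> q dvd qS x - qS y"
  using Q0_cong[of q "bvec 0 x 0" "bvec 0 y 0"] by (simp add: vcong_bvec Q0_bvec dvd_diff_commute)

text \<open>If the last coordinate of \<open>y\<close> is a unit modulo \<open>q\<close>, one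
  transformation \<open>gz\<close> clears everything else. If not, a transformation
  \<open>gz'\<close> first makes it a unit.\<close>

lemma isotropic_line_transitive:
  assumes q: "prime (q::nat)" and y: "\<not> vcong (int q) y 0" "int q dvd Q0 y"
  obtains K t where "K \<in> KG" "\<not> int q dvd t" "vcong (int q) (K *v y) (t *s bvec 0 0 1)"
proof -
  have qp: "prime (int q)" using q by simp
  have A: "\<exists>K\<in>KG. \<exists>t. \<not> int q dvd t \<and> vcong (int q) (K *v y) (t *s bvec 0 0 1)"
    if y: "int q dvd Q0 y" "\<not> int q dvd y $ lst_ix" for y
  proof -
    obtain s p t where Y: "y = bvec s p t" by (cases y)
    have t: "\<not> int q dvd t" using y by (simp add: Y)
    obtain t' where t': "int q dvd t' * t - 1" using unit_inverse_mod[OF q t] by blast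
    \<comment> \<open>Modulo \<open>q\<close> this is \<open>- p / t\<close>, which clears the
      middle block; isotropy and the unit \<open>t\<close> then clear the first coordinate.\<close>
    define z where "z = - t' *s p"
    define s' where "s' = s + bS S z p + qS z * t"
    have K: "gz z (qS z) *v y = bvec s' (p + t *s z) t" by (simp add: Y gz_mult s'_def)
    have p': "vcong (int q) (p + t *s z) 0"
    proof -
      have "p $ i + t * (z $ i) = - (t' * t - 1) * p $ i" for i by (simp add: z_def algebra_simps)
      thus ?thesis using t' unfolding vcong_0 by (metis dvd_minus_iff dvd_mult2 vector_add_component vector_smult_component)
    qed
    have "int q dvd qS (p + t *s z)" using qS_cong[OF p'] by (simp add: qS_def qform_bil)
    moreover have "int q dvd s' * t - qS (p + t *s z)"
      using y(1) KG_Q0[OF gz_KG, of z y] by (simp add: K Q0_bvec)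
    ultimately have "int q dvd s' * t" by (metis dvd_add diff_add_cancel)
    hence "int q dvd s'" using qp t by (simp add: prime_dvd_mult_iff)
    hence "vcong (int q) (gz z (qS z) *v y) (t *s bvec 0 0 1)"
      using p' by (simp add: K bvec_scale vcong_bvec)
    thus ?thesis using gz_KG t by blast
  qed
  show ?thesis
  proof (cases "int q dvd y $ lst_ix")
    case False thus ?thesis using A[OF y(2)] that by blast
  next
    case True
    obtain s p t where Y: "y = bvec s p t" by (cases y)
    have t: "int q dvd t" using True by (simp add: Y)
    \<comment> \<open>The expression is the last coordinate after \<open>gz'\<close>. If
      \<open>q\<close> divides \<open>s\<close>, the linear term can be made a unit by
      nondegeneracy. Otherwise multiply by \<open>s\<close> and complete the square: it remains to
      find a value of \<open>qS\<close> prime to \<open>q\<close>, and if there were none the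
      polarisation would vanish modulo \<open>q\<close>.\<close>
    have "\<exists>z. \<not> int q dvd qS z * s + bS S z p + t"
    proof (cases "int q dvd s")
      case True
      have "\<not> vcong (int q) p 0" using y(1) True t by (simp add: Y bvec_0 vcong_bvec)
      then obtain z where z: "\<not> int q dvd bS S z p" using unimodular_mod by blast
      have "\<not> int q dvd qS z * s + bS S z p + t"
        using z True t by (simp add: dvd_add_left_iff dvd_add_right_iff)
      thus ?thesis by blast
    next
      case False
      have "\<exists>v. \<not> int q dvd qS v"
      proof (rule ccontr)
        assume "\<nexists>v. \<not> int q dvd qS v"
        hence all: "int q dvd qS v" for v by blast
        have bd: "int q dvd bS S x v" for x v
        proof -
          have "bS S x v = qS (x + v) - qS x - qS v" unfolding qS_add by simp
          thus ?thesis using all by simp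
        qed
        have "vcong (int q) (axis undefined 1 :: int^'n) 0" by (rule unimodular_mod) (rule bd)
        hence "int q dvd (axis undefined 1 :: int^'n) $ undefined" unfolding vcong_0 by blast
        hence "int q dvd 1" by (simp add: axis_def)
        thus False using qp not_prime_unit by blast
      qed
      then obtain v where v: "\<not> int q dvd qS v" by blast
      obtain s' where s': "int q dvd s' * s - 1" using unit_inverse_mod[OF q False] by blast
      define z where "z = s' *s (v - p)"
      have "vcong (int q) (p + s *s z) v"
      proof -
        have "(p + s *s z) $ i - v $ i = (s' * s - 1) * (v $ i - p $ i)" for i
          by (simp add: z_def algebra_simps)
        thus ?thesis using s' unfolding vcong_def by simp
      qed
      hence "int q dvd qS (p + s *s z) - qS v" by (rule qS_cong)
      hence "\<not> int q dvd qS (p + s *s z)" using v dvd_diff[of "int q" "qS (p + s *s z)" "qS (p + s *s z) - qS v"] by auto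
      moreover have "s * (qS z * s + bS S z p + t) = qS (p + s *s z) + Q0 y"
        by (simp add: Y Q0_bvec qS_add qS_scale bil_commute[OF sym, of z p] bil_simps power2_eq_square algebra_simps)
      ultimately have "\<not> int q dvd s * (qS z * s + bS S z p + t)" using y(2) by (metis dvd_add_left_iff)
      thus ?thesis by (metis dvd_mult)
    qed
    then obtain z where z: "\<not> int q dvd qS z * s + bS S z p + t" by blast
    let ?y = "gz' z (qS z) *v y"
    have "int q dvd Q0 ?y" using y KG_Q0[OF gz'_KG] by simp
    moreover have "\<not> int q dvd ?y $ lst_ix" using z by (simp add: Y gz'_mult)
    ultimately obtain K t where K: "K \<in> KG" "\<not> int q dvd t" "vcong (int q) (K *v ?y) (t *s bvec 0 0 1)"
      using A by blast
    show ?thesis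
      by (rule that[of "K ** gz' z (qS z)" t])
         (use K KG_mult gz'_KG in \<open>auto simp: matrix_vector_mul_assoc[symmetric]\<close>)
  qed
qed

text \<open>Vectors are kept instead of lines, so every isotropic line occurs \<open>q - 1\<close>
  times; this is the source of the denominators \<open>q - 1\<close> below.\<close>

definition Yq :: "nat \<Rightarrow> (int^'n bord) set" where
  "Yq q = {y \<in> ibox q. y \<noteq> 0 \<and> int q dvd Q0 y}"

lemma finite_Yq [simp]: "finite (Yq q)" by (simp add: Yq_def)

lemma zero_box: "q > 0 \<Longrightarrow> 0 \<in> ibox q" by (simp add: ibox_def)

lemma Yq_not0: "q > 0 \<Longrightarrow> y \<in> Yq q \<Longrightarrow> \<not> vcong (int q) y 0"
  using box_eqI zero_box by (auto simp: Yq_def)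

text \<open>\<open>K y\<close> moves the isotropic line of \<open>y\<close> modulo \<open>q\<close> to the last coordinate axis, and the
  translations by \<open>x a y\<close> exhaust the cosets belonging to that line.\<close>

definition good_sel :: "nat \<Rightarrow> (int^'n bord \<Rightarrow> int^'n bord^'n bord) \<Rightarrow> (int \<Rightarrow> int^'n bord \<Rightarrow> int^'n bord) \<Rightarrow> bool" where
  "good_sel q K x \<longleftrightarrow> (\<forall>y\<in>Yq q. K y \<in> KG \<and>
     (\<exists>t. \<not> int q dvd t \<and> vcong (int q) (K y *v y) (t *s bvec 0 0 1)) \<and>
     (\<forall>a. int q dvd bil (S0 S) (x a y) y - a))"

lemma good_sel_exists:
  assumes q: "prime (q::nat)" obtains K x where "good_sel q K x"
proof -
  have q0: "q > 0" using prime_gt_0_nat[OF q] .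
  have "\<exists>K. K \<in> KG \<and> (\<exists>t. \<not> int q dvd t \<and> vcong (int q) (K *v y) (t *s bvec 0 0 1))" if "y \<in> Yq q" for y
    using isotropic_line_transitive[OF q Yq_not0[OF q0 that]] that unfolding Yq_def by blast
  then obtain K where K: "K y \<in> KG \<and> (\<exists>t. \<not> int q dvd t \<and> vcong (int q) (K y *v y) (t *s bvec 0 0 1))"
    if "y \<in> Yq q" for y by metis
  have "\<exists>x. int q dvd bil (S0 S) x y - a" if y: "y \<in> Yq q" for y a
  proof -
    obtain x0 where x0: "\<not> int q dvd bil (S0 S) x0 y"
      using Yq_not0[OF q0 y] unimodular_mod_S0 by blast
    obtain c where c: "int q dvd c * bil (S0 S) x0 y - 1" using unit_inverse_mod[OF q x0] by blast
    have "bil (S0 S) ((a * c) *s x0) y - a = a * (c * bil (S0 S) x0 y - 1)"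
      by (simp add: bil_simps algebra_simps)
    thus ?thesis using c by (metis dvd_mult)
  qed
  hence "y \<in> Yq q \<Longrightarrow> int q dvd bil (S0 S) (SOME x. int q dvd bil (S0 S) x y - a) y - a" for y a
    by (metis (mono_tags, lifting) someI_ex)
  hence "good_sel q K (\<lambda>a y. SOME x. int q dvd bil (S0 S) x y - a)"
    using K unfolding good_sel_def by blast
  thus ?thesis using that by blast
qed

text \<open>The unit multiples of \<open>(a, y)\<close>, reduced modulo \<open>q\<close>, are
  pairwise distinct because some coordinate of \<open>y\<close> is prime to
  \<open>q\<close>.\<close>

lemma fibre_card:
  assumes q: "prime (q::nat)" and p: "a \<in> {0..<int q}" "y \<in> Yq q"
  shows "card {p \<in> {0..<int q} \<times> Yq q. \<exists>t. \<not> int q dvd t \<and> int q dvd fst p - t * a \<and> vcong (int q) (snd p) (t *s y)} = q - 1"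
    (is "card ?F = _")
proof -
  have q0: "q > 0" using prime_gt_0_nat[OF q] .
  have qp: "prime (int q)" using q by simp
  let ?h = "\<lambda>t. ((t * a) mod int q, red q (t *s y))"
  obtain i where i: "\<not> int q dvd y $ i" using Yq_not0[OF q0 p(2)] by (auto simp: vcong_0)
  have "bij_betw ?h {1..<int q} ?F"
  proof (rule bij_betw_imageI)
    show "inj_on ?h {1..<int q}"
    proof (rule inj_onI)
      fix t t' assume t: "t \<in> {1..<int q}" "t' \<in> {1..<int q}" "?h t = ?h t'"
      hence "vcong (int q) (t *s y) (t' *s y)" by (simp add: red_eq_iff q0)
      hence "int q dvd (t - t') * y $ i" by (simp add: vcong_def left_diff_distrib)
      hence "int q dvd t - t'" using i qp by (simp add: prime_dvd_mult_iff)
      hence "t mod int q = t' mod int q" by (simp add: mod_eq_dvd_iff)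
      thus "t = t'" using t by simp
    qed
    show "?h ` {1..<int q} = ?F"
    proof (intro equalityI subsetI)
      fix p' assume "p' \<in> ?h ` {1..<int q}"
      then obtain t where t: "t \<in> {1..<int q}" "p' = ?h t" by blast
      have td: "\<not> int q dvd t" using t(1) by (auto dest: zdvd_imp_le)
      have "\<not> vcong (int q) (red q (t *s y)) 0"
      proof
        assume "vcong (int q) (red q (t *s y)) 0"
        hence "vcong (int q) (t *s y) 0" using red_cong vcong_sym vcong_trans by metis
        hence "int q dvd t * y $ i" by (simp add: vcong_0)
        thus False using td i qp by (simp add: prime_dvd_mult_iff)
      qed
      hence "red q (t *s y) \<noteq> 0" by auto
      moreover have "int q dvd Q0 (red q (t *s y))"
      proof -
        have "int q dvd Q0 (t *s y)" using p(2) by (simp add: Q0_scale Yq_def)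
        thus ?thesis using Q0_cong[OF red_cong[of q "t *s y"]] by (metis dvd_add diff_add_cancel)
      qed
      ultimately have "red q (t *s y) \<in> Yq q" using red_box[OF q0] by (simp add: Yq_def)
      moreover have "int q dvd (t * a) mod int q - t * a" by (simp add: mod_eq_dvd_iff[symmetric])
      ultimately show "p' \<in> ?F" using t(2) td red_cong[of q "t *s y"] q0 by auto
    next
      fix p' assume p': "p' \<in> ?F"
      then obtain t where t: "\<not> int q dvd t" "int q dvd fst p' - t * a" "vcong (int q) (snd p') (t *s y)" by blast
      define t' where "t' = t mod int q"
      have tt: "int q dvd t' - t" by (simp add: t'_def mod_eq_dvd_iff[symmetric])
      have "t' \<noteq> 0" using t(1) by (auto simp: t'_def)
      hence tr: "t' \<in> {1..<int q}" using q0 by (simp add: t'_def) (smt (verit) pos_mod_sign of_nat_0_less_iff)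
      have "vcong (int q) (snd p') (t' *s y)"
        using t(3) vcong_scale_left[OF tt, of y] vcong_sym vcong_trans by blast
      hence "snd p' = red q (t' *s y)"
        using p' box_eqI[of "snd p'" q "red q (t' *s y)"] red_box[OF q0] red_cong vcong_sym vcong_trans
        by (metis (no_types, lifting) Yq_def mem_Collect_eq mem_Sigma_iff prod.collapse)
      moreover have "fst p' = (t' * a) mod int q"
      proof -
        have "t' * a - t * a = (t' - t) * a" by (simp add: algebra_simps)
        hence "int q dvd t' * a - t * a" using tt by simp
        hence "int q dvd fst p' - t' * a" using dvd_diff[OF t(2), of "t' * a - t * a"] by simp
        hence "fst p' mod int q = (t' * a) mod int q" by (simp add: mod_eq_dvd_iff)
        thus ?thesis using p' by auto
      qed
      ultimately show "p' \<in> ?h ` {1..<int q}" using tr by (metis (no_types, lifting) image_eqI prod.collapse)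
    qed
  qed
  hence "card ?F = card {1..<int q}" by (rule bij_betw_same_card[symmetric])
  also have "\<dots> = q - 1" by simp
  finally show ?thesis .
qed

text \<open>By \<open>coset_eq_iff\<close> the cosets are isotropic lines \<open>(a, y, b)\<close>
  modulo \<open>q\<close>, of three kinds. If \<open>b\<close> is a unit, normalise it to 1; then
  \<open>y\<close> is arbitrary and determines \<open>a\<close>. If \<open>b\<close> and
  \<open>y\<close> vanish, there is one line. If only \<open>b\<close> vanishes, \<open>y\<close> is
  a nonzero isotropic vector and \<open>a\<close> is arbitrary. These are realised by translations,
  by \<open>Jm\<close>, and by \<open>sig\<close> after a translation and \<open>K y\<close>, and
  yield the three terms in this order.\<close>

lemma hecke_S_expand:
  assumes f: "\<And>M w. M \<in> Gamma_S S \<Longrightarrow> w \<in> half_space S \<Longrightarrow> slash S k f M w = f w"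
    and q: "prime (q::nat)" and g: "good_sel q K x" and w: "w \<in> half_space S"
  shows "hecke_S S k q f w =
     of_nat q powi (- 2 * k) * (\<Sum>v\<in>ibox q. f (of_real (1 / real q) *s (w + ivec v)))
     + f (of_nat q *s w)
     + of_nat q powi (- k) / of_nat (q - 1) *
       (\<Sum>y\<in>Yq q. \<Sum>a\<in>{0..<int q}.
          f (cM (diagb (1 / real q) (real q) ** map_matrix of_int (K y)) *v (w + ivec (x a y))))"
proof -
  have q0: "q > 0" using prime_gt_0_nat[OF q] .
  have qp: "prime (int q)" using q by simp
  define B3 where "B3 = (\<lambda>p. sig ** lev (map_matrix of_int (K (snd p))) ** TR (ivec (x (fst p) (snd p))))"
  define P where "P = {0..<int q} \<times> Yq q"
  define C1 where "C1 = (\<lambda>v. coset q (TR (ivec v)))"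
  define C2 where "C2 = coset q Jm"
  define C3 where "C3 = (\<lambda>p. coset q (B3 p))"
  define val where "val = (\<lambda>C. slash S k f (SOME M. M \<in> C) w)"
  have val: "val (coset q B) = slash S k f (hecke_diag q ** B) w" if B: "B \<in> Gamma_S S" for B
  proof -
    have "hecke_diag q ** B \<in> coset q B"
      unfolding coset_def using Gamma_S_one by (auto intro!: image_eqI[of _ _ "mat 1"])
    hence "(SOME M. M \<in> coset q B) \<in> coset q B" by (metis someI)
    then obtain A where A: "A \<in> Gamma_S S" "(SOME M. M \<in> coset q B) = A ** (hecke_diag q ** B)"
      unfolding coset_def by blast
    have e: "A ** (hecke_diag q ** B) = real q *\<^sub>R (A ** (dq q ** B))"
      "hecke_diag q ** B = real q *\<^sub>R (dq q ** B)"
      by (simp_all add: hecke_diag_eq q0 matrix_scaleR_mult)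
    have "dq q ** B \<in> SO_plus S" using SO_plus_mult[OF dq_SO[OF q0] Gamma_S_SO[OF B]] .
    thus ?thesis unfolding val_def A(2) e(1) unfolding e(2)
      using slash_mult_Gamma[OF f A(1) _ w] q0 by (simp add: slash_scaleR)
  qed
  have B1G: "TR (ivec v) \<in> Gamma_S S" for v by (rule TR_Gamma)
  have B3G: "B3 p \<in> Gamma_S S" if "p \<in> P" for p
  proof -
    have "K (snd p) \<in> KG" using that g by (auto simp: P_def good_sel_def)
    thus ?thesis unfolding B3_def by (intro Gamma_S_mult sig_Gamma TR_Gamma) (simp add: KG_def)
  qed
  \<comment> \<open>The vectors that classify the cosets: preimages of the last basis vector under
    each family of representatives.\<close>
  have u1: "TR (ivec v) *v ivec (bvec (- Q0 v) (- v) 1) = elst" for v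
    by (simp add: tr_mult Q0_real ivec_arith bil_simps)
  have u2: "Jm *v ivec (bvec (-1) 0 0) = (elst :: real^'n bord bord)"
    by (simp add: bvec_0 Jm_mult)
  \<comment> \<open>For the third family the preimage is needed only modulo \<open>q\<close> and up
    to a unit: \<open>K y\<close> takes \<open>y\<close> to a unit multiple of the last axis modulo
    \<open>q\<close>, and \<open>x a y\<close> was chosen to have pairing \<open>a\<close> with
    \<open>y\<close>.\<close>
  have u3: "\<exists>t u. \<not> int q dvd t \<and> B3 (a, y) *v ivec u = elst \<and> vcong (int q) u (t *s bvec a y 0)"
    if p: "(a, y) \<in> P" for a y
  proof -
    have y: "y \<in> Yq q" using p by (simp add: P_def)
    obtain t where t: "K y \<in> KG" "\<not> int q dvd t" "vcong (int q) (K y *v y) (t *s bvec 0 0 1)"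
      "int q dvd bil (S0 S) (x a y) y - a" using g y unfolding good_sel_def by blast
    obtain K' where K': "K' ** K y = mat 1" "K y ** K' = mat 1" using t(1) by (auto simp: KG_def)
    define y' where "y' = K' *v bvec 0 0 1"
    have Ky': "K y *v y' = bvec 0 0 1" by (simp add: y'_def matrix_vector_mul_assoc K')
    have "vcong (int q) y (t *s y')"
      using vcong_mv[OF t(3), of K'] by (simp add: matrix_vector_mul_assoc K' y'_def mv_scale)
    obtain t' where t': "int q dvd t' * t - 1" "\<not> int q dvd t'" using unit_inverse_mod[OF q t(2)] by blast
    have y't: "vcong (int q) y' (t' *s y)"
    proof -
      have "vcong (int q) (t' *s y) ((t' * t) *s y')"
        using vcong_scale[OF \<open>vcong (int q) y (t *s y')\<close>, of t'] by (simp add: vec_eq_iff)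
      moreover have "vcong (int q) ((t' * t) *s y') (1 *s y')" by (rule vcong_scale_left[OF t'(1)])
      ultimately show ?thesis using vcong_sym vcong_trans by (metis vector_smult_lid)
    qed
    define u where "u = bvec (bil (S0 S) (x a y) y') y' 0"
    have "B3 (a, y) *v ivec u = elst"
    proof -
      have "TR (ivec (x a y)) *v ivec u = bvec 0 (ivec y') 0"
        by (simp add: u_def tr_mult of_int_bS0)
      moreover have "lev (map_matrix real_of_int (K y)) *v bvec 0 (ivec y') 0 = bvec 0 (bvec 0 0 1) 0"
        by (simp add: lev_mult mv_ivec Ky')
      moreover have "sig *v bvec 0 (bvec 0 0 1) 0 = (elst :: real^'n bord bord)"
        by (simp add: sig_mult bvec_0)
      ultimately show ?thesis by (simp add: B3_def matrix_vector_mul_assoc[symmetric])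
    qed
    moreover have "int q dvd bil (S0 S) (x a y) y' - t' * a"
    proof -
      have "int q dvd bil (S0 S) (x a y) y' - t' * bil (S0 S) (x a y) y"
        using vcong_bil[OF y't, of "S0 S" "x a y"] by (simp add: bil_scale)
      moreover have "int q dvd t' * bil (S0 S) (x a y) y - t' * a"
        using t(4) by (simp add: right_diff_distrib[symmetric])
      ultimately have "int q dvd (bil (S0 S) (x a y) y' - t' * bil (S0 S) (x a y) y) + (t' * bil (S0 S) (x a y) y - t' * a)"
        by (rule dvd_add)
      thus ?thesis by simp
    qed
    ultimately show ?thesis using t'(2) y't
      by (intro exI[of _ t'] exI[of _ u]) (simp add: u_def bvec_scale vcong_bvec)
  qed
  have t1: "int q dvd s - 1 \<Longrightarrow> vcong (int q) (s *s v) v" for s and v :: "int^'n bord"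
    using vcong_scale_left[of "int q" s 1 v] by simp
  have inj1: "inj_on C1 (ibox q)"
  proof (rule inj_onI)
    fix v v' assume v: "v \<in> ibox q" "v' \<in> ibox q" "C1 v = C1 v'"
    then obtain t where t: "vcong (int q) (bvec (- Q0 v') (- v') 1) (t *s bvec (- Q0 v) (- v) 1)"
      using coset_eq_iff[OF q B1G B1G u1 u1] unfolding C1_def by blast
    hence "int q dvd t - 1" "vcong (int q) (- v') (t *s (- v))"
      by (simp_all add: bvec_scale vcong_bvec dvd_diff_commute)
    hence "vcong (int q) (- v') (- v)" using t1 vcong_trans by blast
    hence "vcong (int q) v' v" by (simp add: vcong_def dvd_diff_commute)
    thus "v = v'" using box_eqI v vcong_sym by blast
  qed
  have dis12: "C2 \<notin> C1 ` ibox q"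
  proof
    assume "C2 \<in> C1 ` ibox q"
    then obtain v where "coset q (TR (ivec v)) = coset q Jm" unfolding C1_def C2_def by auto
    then obtain t where t: "\<not> int q dvd t" "vcong (int q) (bvec (-1) 0 0) (t *s bvec (- Q0 v) (- v) 1)"
      using coset_eq_iff[OF q B1G Jm_Gamma u1 u2] by blast
    thus False by (simp add: bvec_scale vcong_bvec)
  qed
  have dis13: "C1 ` ibox q \<inter> C3 ` P = {}"
  proof (rule ccontr)
    assume "C1 ` ibox q \<inter> C3 ` P \<noteq> {}"
    then obtain v a y where v: "(a, y) \<in> P" "coset q (TR (ivec v)) = coset q (B3 (a, y))" unfolding C1_def C3_def by auto
    obtain r u where u: "B3 (a, y) *v ivec u = elst" "vcong (int q) u (r *s bvec a y 0)" using u3[OF v(1)] by blast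
    then obtain t where t: "\<not> int q dvd t" "vcong (int q) u (t *s bvec (- Q0 v) (- v) 1)"
      using coset_eq_iff[OF q B1G B3G[OF v(1)] u1 u(1)] v(2) by blast
    have "vcong (int q) (r *s bvec a y 0) (t *s bvec (- Q0 v) (- v) 1)" using u(2) t(2) vcong_sym vcong_trans by blast
    thus False using t(1) by (simp add: bvec_scale vcong_bvec)
  qed
  have dis23: "C2 \<notin> C3 ` P"
  proof
    assume "C2 \<in> C3 ` P"
    then obtain a y where v: "(a, y) \<in> P" "coset q Jm = coset q (B3 (a, y))" unfolding C2_def C3_def by auto
    obtain r u where u: "\<not> int q dvd r" "B3 (a, y) *v ivec u = elst" "vcong (int q) u (r *s bvec a y 0)" using u3[OF v(1)] by blast
    then obtain t where t: "vcong (int q) u (t *s bvec (-1) 0 0)"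
      using coset_eq_iff[OF q Jm_Gamma B3G[OF v(1)] u2 u(2)] v(2) by blast
    have "vcong (int q) (r *s bvec a y 0) (t *s bvec (-1) 0 0)" using u(3) t vcong_sym vcong_trans by blast
    hence "vcong (int q) (r *s y) 0" by (simp add: bvec_scale vcong_bvec)
    hence "vcong (int q) y 0" using u(1) qp by (auto simp: vcong_0 prime_dvd_mult_iff)
    thus False using Yq_not0[OF q0] v(1) by (simp add: P_def)
  qed
  have cosets: "coset q ` Gamma_S S = C1 ` ibox q \<union> {C2} \<union> C3 ` P"
  proof (intro equalityI subsetI)
    fix C assume "C \<in> coset q ` Gamma_S S"
    then obtain B where B: "B \<in> Gamma_S S" "C = coset q B" by blast
    obtain V where V: "V \<in> Gamma_S S" "V ** B = mat 1" "B ** V = mat 1" using Gamma_S_inverse B by metis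
    obtain Vi where Vi: "V = map_matrix of_int Vi" "\<And>x y. bil (S1 S) (Vi *v x) (Vi *v y) = bil (S1 S) x y"
      using Gamma_S_int V by metis
    obtain Bi where Bi: "B = map_matrix of_int Bi" using B Gamma_S_iff by blast
    define u where "u = Vi *v elst"
    have Bu: "B *v ivec u = elst"
    proof -
      have "ivec u = V *v ivec elst" unfolding u_def Vi(1) by (rule mv_ivec[symmetric])
      hence "B *v ivec u = ivec elst" by (simp add: matrix_vector_mul_assoc V)
      thus ?thesis by simp
    qed
    have un: "\<not> vcong (int q) u 0"
    proof
      assume "vcong (int q) u 0"
      from vcong_mv[OF this, of Bi] have "vcong (int q) (Bi *v u) 0" by simp
      moreover have "Bi *v u = elst"
      proof -
        have "(ivec (Bi *v u) :: real^_) = ivec elst" using Bu by (simp add: Bi mv_ivec)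
        thus ?thesis by (simp only: ivec_eq_iff)
      qed
      ultimately show False using qp by (simp add: vcong_0 all_bord)
    qed
    obtain a y b where U: "u = bvec a y b" by (cases u)
    have "2 * (a * b + Q0 y) = 0"
      using Vi(2)[of elst elst] by (simp add: u_def[symmetric] U bil_S1 two_Q0[symmetric] algebra_simps)
    hence ab: "a * b + Q0 y = 0" by simp
    show "C \<in> C1 ` ibox q \<union> {C2} \<union> C3 ` P"
    proof (cases "int q dvd b")
      case False
      obtain b' where b': "int q dvd b' * b - 1" using unit_inverse_mod[OF q False] by blast
      define v where "v = red q (- b' *s y)"
      have vy: "vcong (int q) (b *s (- v)) y"
      proof -
        have "vcong (int q) (- b *s v) (- b *s (- b' *s y))" unfolding v_def by (intro vcong_scale red_cong)
        moreover have "- b *s (- b' *s y) = (b' * b) *s y" by (simp add: vec_eq_iff)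
        moreover have "b *s (- v) = - b *s v" by (simp add: vec_eq_iff)
        ultimately show ?thesis using t1[OF b'] vcong_trans by metis
      qed
      have "int q dvd a - b * (- Q0 v)"
      proof -
        have "int q dvd Q0 (b *s (- v)) - Q0 y" by (rule Q0_cong[OF vy])
        moreover have "Q0 (b *s (- v)) = b * (b * Q0 v)"
        proof -
          have "b *s (- v) = (- b) *s v" by (simp add: vec_eq_iff)
          thus ?thesis using Q0_scale[of "- b" v] by (simp only: power2_eq_square mult_minus_left mult_minus_right minus_minus mult.assoc)
        qed
        moreover have "b * (a - b * (- Q0 v)) = b * (b * Q0 v) - Q0 y"
        proof -
          have "b * (a - b * (- Q0 v)) = a * b + b * (b * Q0 v)" by (simp add: algebra_simps)
          thus ?thesis using ab by linarith
        qed
        ultimately have "int q dvd b * (a - b * (- Q0 v))" by simp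
        thus ?thesis using False qp by (simp add: prime_dvd_mult_iff)
      qed
      hence "vcong (int q) u (b *s bvec (- Q0 v) (- v) 1)"
        using vcong_sym[OF vy] by (simp add: U bvec_scale vcong_bvec)
      hence "C = C1 v" using coset_eq_iff[OF q B1G B(1) u1 Bu] False unfolding C1_def B(2) by blast
      moreover have "v \<in> ibox q" using red_box[OF q0] by (simp add: v_def)
      ultimately show ?thesis by blast
    next
      case b: True
      show ?thesis
      proof (cases "vcong (int q) y 0")
        case True
        hence "\<not> int q dvd a" using un b by (simp add: U bvec_0[where 'm = "'n bord"] vcong_bvec)
        moreover have "vcong (int q) u ((- a) *s bvec (-1) 0 0)" using True b by (simp add: U bvec_scale vcong_bvec)
        ultimately have "coset q Jm = coset q B"
          using coset_eq_iff[OF q Jm_Gamma B(1) u2 Bu] by (metis dvd_minus_iff)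
        thus ?thesis using B(2) C2_def by simp
      next
        case False
        have "red q y \<noteq> 0" using False red_cong[of q y] vcong_sym by metis
        moreover have "int q dvd Q0 (red q y)"
        proof -
          have "int q dvd Q0 y" using b ab by (metis dvd_add_right_iff dvd_mult dvd_0_right)
          thus ?thesis using Q0_cong[OF red_cong[of q y]] by (metis dvd_add diff_add_cancel)
        qed
        ultimately have P: "(a mod int q, red q y) \<in> P"
          using red_box[OF q0] q0 by (simp add: P_def Yq_def)
        obtain r u' where u': "\<not> int q dvd r" "B3 (a mod int q, red q y) *v ivec u' = elst"
          "vcong (int q) u' (r *s bvec (a mod int q) (red q y) 0)" using u3[OF P] by blast
        have "vcong (int q) (r *s bvec (a mod int q) (red q y) 0) (r *s u)"
          by (rule vcong_scale) (use b red_cong[of q y] in \<open>simp add: U vcong_bvec mod_eq_dvd_iff[symmetric]\<close>)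
        hence "vcong (int q) u' (r *s u)" using u'(3) vcong_trans by blast
        hence "coset q B = coset q (B3 (a mod int q, red q y))"
          using coset_eq_iff[OF q B(1) B3G[OF P] Bu u'(2)] u'(1) by blast
        thus ?thesis using P B(2) C3_def by blast
      qed
    qed
  next
    fix C assume "C \<in> C1 ` ibox q \<union> {C2} \<union> C3 ` P"
    thus "C \<in> coset q ` Gamma_S S" using B1G Jm_Gamma B3G unfolding C1_def C2_def C3_def by blast
  qed
  have finP: "finite P" by (simp add: P_def)
  \<comment> \<open>Pairs \<open>(a, y)\<close> that differ by a unit give the same coset; the
    constant fibre size turns the sum over cosets into a sum over pairs.\<close>
  have fibre: "card {p' \<in> P. C3 p' = C3 p} = q - 1" if p: "p \<in> P" for p
  proof -
    obtain a y where ay: "p = (a, y)" by (cases p)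
    have "{p' \<in> P. C3 p' = C3 p} = {p \<in> {0..<int q} \<times> Yq q. \<exists>t. \<not> int q dvd t \<and> int q dvd fst p - t * a \<and> vcong (int q) (snd p) (t *s y)}"
      unfolding P_def[symmetric]
    proof (intro Collect_cong conj_cong refl)
      fix p' assume p': "p' \<in> P"
      obtain a' y' where ay': "p' = (a', y')" by (cases p')
      obtain r u where u: "\<not> int q dvd r" "B3 (a, y) *v ivec u = elst" "vcong (int q) u (r *s bvec a y 0)"
        using u3 p ay by blast
      obtain r' u' where u': "\<not> int q dvd r'" "B3 (a', y') *v ivec u' = elst" "vcong (int q) u' (r' *s bvec a' y' 0)"
        using u3 p' ay' by blast
      have iff: "C3 p' = C3 p \<longleftrightarrow> (\<exists>t. \<not> int q dvd t \<and> vcong (int q) u' (t *s u))"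
        using coset_eq_iff[OF q B3G[OF p] B3G[OF p'], unfolded ay ay', OF u(2) u'(2)] by (auto simp: C3_def ay ay')
      obtain ri where ri: "int q dvd ri * r - 1" "\<not> int q dvd ri" using unit_inverse_mod[OF q u(1)] by blast
      obtain ri' where ri': "int q dvd ri' * r' - 1" "\<not> int q dvd ri'" using unit_inverse_mod[OF q u'(1)] by blast
      have t1': "int q dvd s - 1 \<Longrightarrow> vcong (int q) (s *s v) v" for s and v :: "int^'n bord bord"
        using vcong_scale_left[of "int q" s 1 v] by simp
      have a1: "vcong (int q) (ri' *s u') (bvec a' y' 0)"
      proof -
        have "ri' *s (r' *s bvec a' y' 0) = (ri' * r') *s bvec a' y' 0" by (simp add: vec_eq_iff)
        thus ?thesis using vcong_scale[OF u'(3), of ri'] t1'[OF ri'(1)] vcong_trans by metis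
      qed
      have a2: "vcong (int q) (ri *s u) (bvec a y 0)"
      proof -
        have "ri *s (r *s bvec a y 0) = (ri * r) *s bvec a y 0" by (simp add: vec_eq_iff)
        thus ?thesis using vcong_scale[OF u(3), of ri] t1'[OF ri(1)] vcong_trans by metis
      qed
      have ss: "c *s (d *s v) = (c * d) *s v" for c d and v :: "int^'n bord bord" by (simp add: vec_eq_iff)
      have "(\<exists>t. \<not> int q dvd t \<and> vcong (int q) u' (t *s u)) \<longleftrightarrow>
            (\<exists>t. \<not> int q dvd t \<and> vcong (int q) (bvec a' y' 0) (t *s bvec a y 0))"
      proof
        assume "\<exists>t. \<not> int q dvd t \<and> vcong (int q) u' (t *s u)"
        then obtain t where t: "\<not> int q dvd t" "vcong (int q) u' (t *s u)" by blast
        have "vcong (int q) (bvec a' y' 0) (ri' *s (t *s u))" using vcong_scale[OF t(2), of ri'] a1 vcong_sym vcong_trans by blast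
        moreover have "vcong (int q) (ri' *s (t *s u)) (ri' *s (t *s (r *s bvec a y 0)))"
          by (intro vcong_scale u(3))
        ultimately have "vcong (int q) (bvec a' y' 0) ((ri' * (t * r)) *s bvec a y 0)" unfolding ss by (rule vcong_trans)
        moreover have "\<not> int q dvd ri' * (t * r)" using qp t(1) u(1) ri'(2) by (simp add: prime_dvd_mult_iff)
        ultimately show "\<exists>t. \<not> int q dvd t \<and> vcong (int q) (bvec a' y' 0) (t *s bvec a y 0)" by blast
      next
        assume "\<exists>t. \<not> int q dvd t \<and> vcong (int q) (bvec a' y' 0) (t *s bvec a y 0)"
        then obtain t where t: "\<not> int q dvd t" "vcong (int q) (bvec a' y' 0) (t *s bvec a y 0)" by blast
        have "vcong (int q) u' (r' *s (t *s bvec a y 0))" using vcong_scale[OF t(2), of r'] u'(3) vcong_trans by blast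
        moreover have "vcong (int q) (r' *s (t *s bvec a y 0)) (r' *s (t *s (ri *s u)))"
          by (intro vcong_scale vcong_sym[OF a2])
        ultimately have "vcong (int q) u' ((r' * (t * ri)) *s u)" unfolding ss by (rule vcong_trans)
        moreover have "\<not> int q dvd r' * (t * ri)" using qp t(1) u'(1) ri(2) by (simp add: prime_dvd_mult_iff)
        ultimately show "\<exists>t. \<not> int q dvd t \<and> vcong (int q) u' (t *s u)" by blast
      qed
      thus "C3 p' = C3 p \<longleftrightarrow> (\<exists>t. \<not> int q dvd t \<and> int q dvd fst p' - t * a \<and> vcong (int q) (snd p') (t *s y))"
        unfolding iff by (simp add: ay' bvec_scale vcong_bvec)
    qed
    thus ?thesis using fibre_card[OF q, of a y] p by (simp add: ay P_def)
  qed
  have q1: "q > 1" using prime_gt_1_nat[OF q] .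
  have s3: "(\<Sum>C\<in>C3 ` P. val C) = 1 / of_nat (q - 1) * (\<Sum>p\<in>P. val (C3 p))"
  proof -
    have "(\<Sum>p\<in>P. val (C3 p)) = (\<Sum>C\<in>C3 ` P. \<Sum>p | p \<in> P \<and> C3 p = C. val (C3 p))"
      by (rule sum.image_gen[OF finP])
    also have "\<dots> = (\<Sum>C\<in>C3 ` P. of_nat (q - 1) * val C)"
    proof (rule sum.cong[OF refl])
      fix C assume "C \<in> C3 ` P"
      then obtain p where p: "p \<in> P" "C = C3 p" by blast
      have "(\<Sum>p' | p' \<in> P \<and> C3 p' = C. val (C3 p')) = (\<Sum>p' | p' \<in> P \<and> C3 p' = C. val C)"
        by (rule sum.cong) auto
      also have "\<dots> = of_nat (q - 1) * val C" using fibre[OF p(1)] by (simp add: p(2))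
      finally show "(\<Sum>p' | p' \<in> P \<and> C3 p' = C. val (C3 p')) = of_nat (q - 1) * val C" .
    qed
    also have "\<dots> = of_nat (q - 1) * (\<Sum>C\<in>C3 ` P. val C)" by (simp add: sum_distrib_left)
    finally have e: "(\<Sum>p\<in>P. val (C3 p)) = of_nat (q - 1) * (\<Sum>C\<in>C3 ` P. val C)" .
    have "(of_nat (q - 1) :: complex) \<noteq> 0" using q1 by simp
    thus ?thesis unfolding e by (simp del: of_nat_diff)
  qed
  have "hecke_S S k q f w = (\<Sum>C\<in>coset q ` Gamma_S S. val C)"
    unfolding hecke_S_def coset_sum_def T_S_cosets val_def ..
  also have "\<dots> = (\<Sum>v\<in>ibox q. val (C1 v)) + val C2 + 1 / of_nat (q - 1) * (\<Sum>p\<in>P. val (C3 p))"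
  proof -
    have "(\<Sum>C\<in>C1 ` ibox q \<union> {C2} \<union> C3 ` P. val C) = (\<Sum>C\<in>C1 ` ibox q. val C) + val C2 + (\<Sum>C\<in>C3 ` P. val C)"
    proof -
      have "(\<Sum>C\<in>(C1 ` ibox q \<union> {C2}) \<union> C3 ` P. val C) = (\<Sum>C\<in>C1 ` ibox q \<union> {C2}. val C) + (\<Sum>C\<in>C3 ` P. val C)"
        using dis13 dis23 finP by (intro sum.union_disjoint) auto
      moreover have "(\<Sum>C\<in>C1 ` ibox q \<union> {C2}. val C) = (\<Sum>C\<in>C1 ` ibox q. val C) + (\<Sum>C\<in>{C2}. val C)"
        using dis12 by (intro sum.union_disjoint) auto
      ultimately show ?thesis by simp
    qed
    thus ?thesis unfolding cosets s3 by (simp add: sum.reindex[OF inj1])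
  qed
  also have "(\<Sum>v\<in>ibox q. val (C1 v)) = of_nat q powi (- 2 * k) * (\<Sum>v\<in>ibox q. f (of_real (1 / real q) *s (w + ivec v)))"
  proof -
    have "val (C1 v) = of_nat q powi (- 2 * k) * f (of_real (1 / real q) *s (w + ivec v))" for v
    proof -
      have iso: "iso (dq q)" "iso (TR (ivec v))"
        using SO_plusD(1)[OF dq_SO[OF q0]] SO_plusD(1)[OF TR_SO] by auto
      have dqe: "cfactor S (dq q) u = of_nat q" "orth_act S (dq q) u = of_real (1 / real q) *s u" for u
        using act_diagb[of "1 / real q" u] q0 by simp_all
      have vi: "vmap of_real (ivec v :: real^'n bord) = (ivec v :: complex^'n bord)" by (simp add: vec_eq_iff)
      have "val (C1 v) = of_nat q powi (- k) * slash S k f (dq q ** TR (ivec v)) w"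
        unfolding C1_def val[OF B1G] using q0
        by (simp add: hecke_diag_eq matrix_scaleR_mult slash_scaleR)
      also have "slash S k f (dq q ** TR (ivec v)) w = f (of_real (1 / real q) *s (w + ivec v)) * of_nat q powi (- k)"
        unfolding slash_def act_mult[OF iso half_space_Hpm[OF w]] act_TR vi
        unfolding dqe by simp
      also have "of_nat q powi (- k) * (f (of_real (1 / real q) *s (w + ivec v)) * of_nat q powi (- k)) =
        of_nat q powi (- 2 * k) * f (of_real (1 / real q) *s (w + ivec v))"
      proof -
        have "(of_nat q :: complex) powi (- 2 * k) = of_nat q powi (- k) * of_nat q powi (- k)"
          using q0 power_int_add[of "of_nat q :: complex" "- k" "- k"] by simp
        thus ?thesis by simp
      qed
      finally show ?thesis .
    qed
    thus ?thesis by (simp add: sum_distrib_left)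
  qed
  also have "val C2 = f (of_nat q *s w)"
  proof -
    \<comment> \<open>Passing through \<open>Jm\<close> reverses the diagonal. The automorphy factor
      \<open>1 / q\<close> then contributes \<open>q^k\<close> and cancels the \<open>q^(-k)\<close>
      of the scalar.\<close>
    have "hecke_diag q ** (Jm :: real^'n bord bord^'n bord bord) = Jm ** (real q *\<^sub>R diagb (real q) (1 / real q))"
    proof -
      have "dq q ** (Jm :: real^'n bord bord^'n bord bord) = Jm ** diagb (real q) (1 / real q)"
        by (rule matrix_eqI5) (simp add: matrix_vector_mul_assoc[symmetric] diagb_mult Jm_mult)
      thus ?thesis by (simp add: hecke_diag_eq q0 matrix_scaleR_mult)
    qed
    hence "val C2 = of_nat q powi (- k) * slash S k f (Jm ** diagb (real q) (1 / real q)) w"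
      unfolding C2_def val[OF Jm_Gamma] using q0 by (simp add: matrix_scaleR_mult slash_scaleR)
    also have "slash S k f (Jm ** diagb (real q) (1 / real q)) w = slash S k f (diagb (real q) (1 / real q)) w"
      using q0 by (intro slash_mult_Gamma f Jm_Gamma diagb_SO w) auto
    also have "\<dots> = f (of_nat q *s w) * of_nat q powi k"
    proof -
      have "cfactor S (diagb (real q) (1 / real q)) w = inverse (of_nat q)"
        "orth_act S (diagb (real q) (1 / real q)) w = of_nat q *s w"
        using act_diagb[of "real q" w] q0 by (simp_all add: inverse_eq_divide)
      thus ?thesis by (simp add: slash_def power_int_minus power_int_inverse)
    qed
    finally show ?thesis using q0 by (simp add: power_int_minus)
  qed
  also have "(\<Sum>p\<in>P. val (C3 p)) = (\<Sum>y\<in>Yq q. \<Sum>a\<in>{0..<int q}. of_nat q powi (- k) *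
          f (cM (diagb (1 / real q) (real q) ** map_matrix of_int (K y)) *v (w + ivec (x a y))))"
  proof -
    have "val (C3 (a, y)) = of_nat q powi (- k) *
          f (cM (diagb (1 / real q) (real q) ** map_matrix of_int (K y)) *v (w + ivec (x a y)))"
      if p: "(a, y) \<in> P" for a y
    proof -
      let ?L = "diagb (1 / real q) (real q) :: real^'n bord^'n bord" and ?K = "map_matrix real_of_int (K y)"
      have KG: "K y \<in> KG" using p g by (auto simp: P_def good_sel_def)
      have LS: "lev ?L \<in> SO_plus S" using lev_diagb_SO[of "1 / real q"] q0 by simp
      have KS: "lev ?K \<in> SO_plus S" using KG Gamma_S_SO by (simp add: KG_def)
      have MS: "lev (?L ** ?K) \<in> SO_plus S" using SO_plus_mult[OF LS KS] by (simp add: lev_comp)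
      have TS: "TR (ivec (x a y)) \<in> SO_plus S" by (rule TR_SO)
      have vi: "vmap of_real (ivec (x a y) :: real^'n bord) = (ivec (x a y) :: complex^'n bord)" by (simp add: vec_eq_iff)
      \<comment> \<open>Once \<open>sig\<close> stands on the left it is absorbed by invariance, and
        the diagonal acts linearly on the half-space.\<close>
      have "dq q ** sig = sig ** lev ?L"
      proof (rule matrix_eqI5)
        fix a s z t b
        show "dq q ** sig *v bvec a (bvec s z t) b = sig ** lev ?L *v bvec a (bvec s z t) b"
          by (simp add: matrix_vector_mul_assoc[symmetric] sig_mult lev_mult diagb_mult)
      qed
      hence "dq q ** B3 (a, y) = sig ** (lev (?L ** ?K) ** TR (ivec (x a y)))"
        by (simp add: B3_def matrix_mul_assoc flip: lev_comp)
      hence "hecke_diag q ** B3 (a, y) = real q *\<^sub>R (sig ** (lev (?L ** ?K) ** TR (ivec (x a y))))"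
        by (simp add: hecke_diag_eq q0 matrix_scaleR_mult)
      hence "val (C3 (a, y)) = of_nat q powi (- k) * slash S k f (sig ** (lev (?L ** ?K) ** TR (ivec (x a y)))) w"
        unfolding C3_def val[OF B3G[OF p]] using q0 by (simp add: slash_scaleR)
      also have "slash S k f (sig ** (lev (?L ** ?K) ** TR (ivec (x a y)))) w =
                 slash S k f (lev (?L ** ?K) ** TR (ivec (x a y))) w"
        by (intro slash_mult_Gamma f sig_Gamma SO_plus_mult MS TS w)
      also have "\<dots> = f (cM (?L ** ?K) *v (w + ivec (x a y)))"
        unfolding slash_def act_mult[OF SO_plusD(1)[OF MS] SO_plusD(1)[OF TS] half_space_Hpm[OF w]] act_TR act_lev vi
        by simp
      finally show ?thesis .
    qed
    moreover have "(\<Sum>p\<in>P. val (C3 p)) = (\<Sum>y\<in>Yq q. \<Sum>a\<in>{0..<int q}. val (C3 (a, y)))"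
      unfolding P_def by (subst sum.swap) (simp add: sum.cartesian_product case_prod_beta)
    ultimately show ?thesis by (auto simp: P_def intro!: sum.cong)
  qed
  finally show ?thesis
    by (simp add: sum_distrib_left[symmetric])
qed

end

section \<open>Uniqueness of Fourier coefficients\<close>

definition ee :: "complex \<Rightarrow> complex" where
  "ee x = exp (2 * of_real pi * \<i> * x)"

lemma ee_add: "ee (x + y) = ee x * ee y"
  by (simp add: ee_def ring_distribs exp_add)

lemma ee_0 [simp]: "ee 0 = 1" by (simp add: ee_def)

lemma ee_nonzero [simp]: "ee x \<noteq> 0" by (simp add: ee_def)

lemma norm_ee: "norm (ee x) = exp (- 2 * pi * Im x)"
  by (simp add: ee_def norm_exp_eq_Re)

lemma ee_sum: "ee (sum f A) = (\<Prod>i\<in>A. ee (f i))"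
  by (induction A rule: infinite_finite_induct) (simp_all add: ee_add)

lemma ee_power: "ee x ^ n = ee (of_nat n * x)"
  by (simp add: ee_def exp_of_nat_mult[symmetric] mult_ac)

lemma ee_eq_1_iff: "ee x = 1 \<longleftrightarrow> x \<in> \<int>"
proof
  assume "ee x = 1"
  then obtain n :: int where n: "Re (2 * of_real pi * \<i> * x) = 0" "Im (2 * of_real pi * \<i> * x) = of_int (2 * n) * pi"
    unfolding ee_def exp_eq_1 by blast
  hence "Im x = 0" "Re x = of_int n" by simp_all
  hence "x = of_int n" by (simp add: complex_eq_iff)
  thus "x \<in> \<int>" by simp
next
  assume "x \<in> \<int>"
  then obtain n where "x = of_int n" by (elim Ints_cases)
  thus "ee x = 1" unfolding ee_def exp_eq_1 by (auto intro!: exI[of _ n])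
qed

lemma ee_of_int [simp]: "ee (of_int n) = 1"
  by (simp add: ee_eq_1_iff)

lemma ee_int_add: "ee (of_int n + x) = ee x" "ee (x + of_int n) = ee x"
  by (simp_all add: ee_add)

lemma ee_frac_cong: "int q dvd a - b \<Longrightarrow> q > 0 \<Longrightarrow> ee (of_int a / of_nat q) = ee (of_int b / of_nat q)"
proof -
  assume "int q dvd a - b" "q > 0"
  then obtain c where "a - b = int q * c" by blast
  hence "a = b + int q * c" by linarith
  hence "of_int a / of_nat q = of_int c + of_int b / (of_nat q :: complex)"
    using \<open>q > 0\<close> by (simp add: field_simps)
  thus ?thesis by (simp only: ee_int_add)
qed

lemma root_sum:
  assumes "N > 0"
  shows "(\<Sum>a\<in>{0..<int N}. ee (of_int (a * d) / of_nat N)) = (if int N dvd d then of_nat N else 0)"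
proof -
  define z where "z = ee (of_int d / of_nat N)"
  have "(\<Sum>a\<in>{0..<int N}. ee (of_int (a * d) / of_nat N)) = (\<Sum>a\<in>int ` {..<N}. ee (of_int (a * d) / of_nat N))"
  proof -
    have "{0..<int N} = int ` {..<N}"
      by (metis atLeast0LessThan image_int_atLeastLessThan of_nat_0)
    thus ?thesis by simp
  qed
  also have "\<dots> = (\<Sum>a<N. z ^ a)"
    by (subst sum.reindex) (auto simp: z_def ee_power o_def)
  also have "\<dots> = (if int N dvd d then of_nat N else 0)"
  proof (cases "int N dvd d")
    case True
    then obtain c where "d = int N * c" by blast
    hence "of_int d / of_nat N = (of_int c :: complex)" using assms by simp
    hence "z = 1" by (simp only: z_def ee_of_int)
    thus ?thesis using True by simp
  next
    case False
    have "z \<noteq> 1"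
    proof
      assume "z = 1"
      then obtain c where c: "of_int d / of_nat N = (of_int c :: complex)"
        unfolding z_def ee_eq_1_iff by (elim Ints_cases)
      hence "(of_int d :: complex) = of_int (int N * c)" using assms by (simp add: field_simps)
      hence "d = int N * c" by (simp only: of_int_eq_iff)
      thus False using False by simp
    qed
    moreover have "z ^ N = 1" using assms by (simp add: z_def ee_power)
    ultimately show ?thesis using False by (simp add: geometric_sum)
  qed
  finally show ?thesis .
qed

lemma has_sum_sum:
  fixes f :: "'i \<Rightarrow> 'a \<Rightarrow> complex"
  assumes "finite I" "\<And>i. i \<in> I \<Longrightarrow> (f i has_sum s i) A"
  shows "((\<lambda>x. \<Sum>i\<in>I. f i x) has_sum (\<Sum>i\<in>I. s i)) A"
  using assms by (induction I rule: finite_induct) (auto intro!: has_sum_add)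

lemma has_sum_diff:
  fixes f g :: "'a \<Rightarrow> complex"
  assumes "(f has_sum s) A" "(g has_sum t) A"
  shows "((\<lambda>x. f x - g x) has_sum (s - t)) A"
  using has_sum_add[OF assms(1), of "\<lambda>x. - g x" "- t"] assms(2) by (simp add: has_sum_uminus)

text \<open>Summability of complex families is absolute, so one finite \<open>F\<close> controls all
  subsets of its complement at once. This uniformity is needed since the residue class in
  \<open>fourier_bound\<close> varies with \<open>N\<close>.\<close>

lemma infsum_small_tail:
  fixes c :: "'a \<Rightarrow> complex"
  assumes c: "c summable_on A" and e: "e > 0"
  obtains F where "finite F" "F \<subseteq> A" "\<And>B s. B \<subseteq> A - F \<Longrightarrow> (c has_sum s) B \<Longrightarrow> norm s \<le> e"
proof -
  have n: "(\<lambda>x. norm (c x)) summable_on A" using c by (simp add: summable_on_iff_abs_summable_on_complex)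
  obtain F where F: "finite F" "F \<subseteq> A" "dist (sum (\<lambda>x. norm (c x)) F) (infsum (\<lambda>x. norm (c x)) A) \<le> e"
    using infsum_finite_approximation[OF n e] by blast
  have "norm s \<le> e" if B: "B \<subseteq> A - F" "(c has_sum s) B" for B s
  proof -
    have nB: "(\<lambda>x. norm (c x)) summable_on B" using n by (rule summable_on_subset_banach) (use B in auto)
    have "norm s \<le> infsum (\<lambda>x. norm (c x)) B"
      using B(2) nB by (meson has_sum_infsum norm_infsum_le order_refl)
    moreover have "infsum (\<lambda>x. norm (c x)) B + sum (\<lambda>x. norm (c x)) F \<le> infsum (\<lambda>x. norm (c x)) A"
    proof -
      have "infsum (\<lambda>x. norm (c x)) (B \<union> F) = infsum (\<lambda>x. norm (c x)) B + infsum (\<lambda>x. norm (c x)) F"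
        using nB F B by (intro infsum_Un_disjoint) auto
      moreover have "infsum (\<lambda>x. norm (c x)) (B \<union> F) \<le> infsum (\<lambda>x. norm (c x)) A"
        using B F by (intro infsum_mono2 n summable_on_subset_banach[OF n]) auto
      ultimately show ?thesis using F by simp
    qed
    ultimately show ?thesis using F(3) by (simp add: dist_real_def)
  qed
  thus ?thesis using that F by blast
qed

text \<open>Averaging over the shifts \<open>t = j / N\<close> isolates the terms with \<open>\<phi> x\<close> congruent to \<open>m\<close> modulo
  \<open>N\<close>; then \<open>N\<close> tends to infinity.\<close>

lemma fourier_bound:
  fixes c :: "'a \<Rightarrow> complex" and \<phi> :: "'a \<Rightarrow> int"
  assumes z: "\<And>t::real. ((\<lambda>x. c x * ee (of_real t * of_int (\<phi> x))) has_sum r t) A"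
    and B: "\<And>t. norm (r t) \<le> B"
  shows "norm (infsum c {x \<in> A. \<phi> x = m}) \<le> B"
proof -
  have sm: "c summable_on A" using z[of 0] by (auto simp: summable_on_def)
  have zN: "\<exists>s. (c has_sum s) {x \<in> A. int N dvd \<phi> x - m} \<and> norm s \<le> B" if N: "N > 0" for N
  proof -
    define s where "s = (\<Sum>j\<in>{0..<int N}. ee (- of_int (j * m) / of_nat N) * r (of_int j / real N))"
    have "((\<lambda>x. \<Sum>j\<in>{0..<int N}. ee (- of_int (j * m) / of_nat N) * (c x * ee (of_real (of_int j / real N) * of_int (\<phi> x))))
        has_sum s) A"
      unfolding s_def by (intro has_sum_sum has_sum_cmult_right z) auto
    moreover have "(\<Sum>j\<in>{0..<int N}. ee (- of_int (j * m) / of_nat N) * (c x * ee (of_real (of_int j / real N) * of_int (\<phi> x))))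
       = (if int N dvd \<phi> x - m then of_nat N * c x else 0)" for x
    proof -
      have "(\<Sum>j\<in>{0..<int N}. ee (- of_int (j * m) / of_nat N) * (c x * ee (of_real (of_int j / real N) * of_int (\<phi> x))))
         = c x * (\<Sum>j\<in>{0..<int N}. ee (of_int (j * (\<phi> x - m)) / of_nat N))"
        unfolding sum_distrib_left
      proof (rule sum.cong[OF refl])
        fix j
        have "of_int (j * (\<phi> x - m)) / of_nat N = - of_int (j * m) / of_nat N + complex_of_real (of_int j / real N) * of_int (\<phi> x)"
          using N by (simp add: field_simps)
        thus "ee (- of_int (j * m) / of_nat N) * (c x * ee (of_real (of_int j / real N) * of_int (\<phi> x)))
          = c x * ee (of_int (j * (\<phi> x - m)) / of_nat N)" by (simp only: ee_add mult_ac)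
      qed
      thus ?thesis unfolding root_sum[OF N] by simp
    qed
    ultimately have "((\<lambda>x. if int N dvd \<phi> x - m then of_nat N * c x else 0) has_sum s) A" by simp
    hence "((\<lambda>x. of_nat N * c x) has_sum s) {x \<in> A. int N dvd \<phi> x - m}"
      by (subst has_sum_cong_neutral[where T = A and g = "\<lambda>x. if int N dvd \<phi> x - m then of_nat N * c x else 0"]) auto
    hence "((\<lambda>x. inverse (of_nat N) * (of_nat N * c x)) has_sum inverse (of_nat N) * s) {x \<in> A. int N dvd \<phi> x - m}"
      by (rule has_sum_cmult_right)
    hence "(c has_sum inverse (of_nat N) * s) {x \<in> A. int N dvd \<phi> x - m}" using N by (simp add: mult.assoc[symmetric])
    moreover have "norm s \<le> of_nat N * B"
    proof -
      have "norm s \<le> (\<Sum>j\<in>{0..<int N}. B)"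
        unfolding s_def
      proof (rule sum_norm_le)
        fix j
        show "norm (ee (- of_int (j * m) / of_nat N) * r (of_int j / real N)) \<le> B"
          using B[of "of_int j / real N"] by (simp add: norm_mult norm_ee)
      qed
      thus ?thesis by simp
    qed
    hence "norm (inverse (of_nat N) * s) \<le> B" using N by (simp add: norm_mult norm_inverse) (simp add: field_simps)
    ultimately show ?thesis by blast
  qed
  let ?T = "{x \<in> A. \<phi> x = m}"
  have smT: "c summable_on ?T" using sm by (rule summable_on_subset_banach) auto
  have "norm (infsum c ?T) \<le> B + e" if e: "e > 0" for e
  proof -
    obtain F where F: "finite F" "F \<subseteq> A" "\<And>B s. B \<subseteq> A - F \<Longrightarrow> (c has_sum s) B \<Longrightarrow> norm s \<le> e"
      using infsum_small_tail[OF sm e] by metis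
    \<comment> \<open>For \<open>N\<close> beyond every \<open>|phi x - m|\<close> on
      \<open>F\<close>, the other elements congruent to \<open>m\<close> modulo \<open>N\<close>
      avoid \<open>F\<close> and belong to the tail.\<close>
    obtain N where N: "N > 0" "\<And>x. x \<in> F \<Longrightarrow> \<bar>\<phi> x - m\<bar> < int N"
    proof -
      have "finite ((\<lambda>x. nat \<bar>\<phi> x - m\<bar>) ` F)" using F by simp
      then obtain N where N: "\<forall>n\<in>(\<lambda>x. nat \<bar>\<phi> x - m\<bar>) ` F. n < N"
        using finite_nat_set_iff_bounded by blast
      thus ?thesis by (intro that[of "Suc N"]) fastforce+
    qed
    let ?B = "{x \<in> A. int N dvd \<phi> x - m \<and> \<phi> x \<noteq> m}"
    have "?B \<subseteq> A - F"
    proof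
      fix x assume x: "x \<in> ?B"
      hence "int N \<le> \<bar>\<phi> x - m\<bar>" using dvd_imp_le_int[of "\<phi> x - m" "int N"] by simp
      thus "x \<in> A - F" using x N(2)[of x] by fastforce
    qed
    moreover have smB: "c summable_on ?B" using sm by (rule summable_on_subset_banach) auto
    ultimately have nB: "norm (infsum c ?B) \<le> e" using F(3) has_sum_infsum by blast
    obtain s where s: "(c has_sum s) {x \<in> A. int N dvd \<phi> x - m}" "norm s \<le> B" using zN[OF N(1)] by blast
    have "{x \<in> A. int N dvd \<phi> x - m} = ?T \<union> ?B" by auto
    hence "(c has_sum s) (?T \<union> ?B)" using s(1) by simp
    moreover have "(c has_sum (infsum c ?T + infsum c ?B)) (?T \<union> ?B)"
      using smT smB by (intro has_sum_Un_disjoint) auto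
    ultimately have "infsum c ?T + infsum c ?B = s" using has_sum_unique by blast
    hence "infsum c ?T = s - infsum c ?B" by (simp only: eq_diff_eq)
    hence "norm (infsum c ?T) \<le> norm s + norm (infsum c ?B)" by (simp only: norm_triangle_ineq4)
    thus ?thesis using s(2) nB by simp
  qed
  thus ?thesis by (rule field_le_epsilon)
qed

lemma fourier_extract:
  fixes c :: "'a \<Rightarrow> complex" and \<phi> :: "'a \<Rightarrow> int"
  assumes z: "\<And>t::real. ((\<lambda>x. c x * ee (of_real t * of_int (\<phi> x))) has_sum 0) A"
  shows "(c has_sum 0) {x \<in> A. \<phi> x = m}"
proof -
  have "c summable_on A" using z[of 0] by (auto simp: summable_on_def)
  hence "c summable_on {x \<in> A. \<phi> x = m}" by (rule summable_on_subset_banach) auto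
  moreover have "norm (infsum c {x \<in> A. \<phi> x = m}) \<le> 0" by (rule fourier_bound[OF z]) simp
  ultimately show ?thesis using has_sum_infsum by fastforce
qed

text \<open>\<open>fourier_extract\<close> applied to one coordinate after another, each time
  varying the matching component of \<open>t\<close>, until a single index is left.\<close>

lemma vec_extract:
  fixes c :: "int^'m::finite \<Rightarrow> complex"
  assumes z: "\<And>t::real^'m. ((\<lambda>v. c v * ee (\<Sum>i\<in>UNIV. of_real (t $ i) * of_int (v $ i))) has_sum 0) UNIV"
  shows "c v = 0"
proof -
  have "((\<lambda>v. c v * ee (\<Sum>i\<in>UNIV. of_real (t $ i) * of_int (v $ i))) has_sum 0) {v'. \<forall>i\<in>I. v' $ i = v $ i}" for I t
  proof (induction I arbitrary: t rule: finite_induct[OF finite])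
    case 1 thus ?case using z by simp
  next
    case (2 j I)
    have "((\<lambda>v. c v * ee (\<Sum>i\<in>UNIV. of_real (t $ i) * of_int (v $ i))) has_sum 0)
        {x \<in> {v'. \<forall>i\<in>I. v' $ i = v $ i}. x $ j = v $ j}"
    proof (rule fourier_extract)
      fix s :: real
      have "(\<Sum>i\<in>UNIV. of_real ((t + s *s axis j 1) $ i) * of_int (v $ i)) =
        (\<Sum>i\<in>UNIV. of_real (t $ i) * of_int (v $ i)) + complex_of_real s * of_int (v $ j)" for v
      proof -
        have "(\<Sum>i\<in>UNIV. of_real ((t + s *s axis j 1) $ i) * of_int (v $ i)) =
          (\<Sum>i\<in>UNIV. of_real (t $ i) * of_int (v $ i) + (if i = j then complex_of_real s * of_int (v $ j) else 0))"
          by (intro sum.cong) (auto simp: axis_def algebra_simps)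
        thus ?thesis by (simp add: sum.distrib)
      qed
      thus "((\<lambda>v. c v * ee (\<Sum>i\<in>UNIV. of_real (t $ i) * of_int (v $ i)) * ee (of_real s * of_int (v $ j))) has_sum 0)
        {v'. \<forall>i\<in>I. v' $ i = v $ i}"
        using 2(3)[of "t + s *s axis j 1"] by (simp only: ee_add mult.assoc)
    qed
    moreover have "{x \<in> {v'. \<forall>i\<in>I. v' $ i = v $ i}. x $ j = v $ j} = {v'. \<forall>i\<in>insert j I. v' $ i = v $ i}" by auto
    ultimately show ?case by simp
  qed
  from this[of 0 UNIV] have "(c has_sum 0) {v'. v' = v}" by (simp add: vec_eq_iff)
  moreover have "(c has_sum c v) {v'. v' = v}" using has_sum_finite[of "{v}" c] by simp
  ultimately show ?thesis using has_sum_unique by blast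
qed

lemma matrix_inv_unique:
  fixes A :: "'a::semiring_1^'m^'m::finite"
  assumes "A ** B = mat 1" "B ** A = mat 1" shows "matrix_inv A = B"
proof -
  have "A ** matrix_inv A = mat 1 \<and> matrix_inv A ** A = mat 1"
    unfolding matrix_inv_def by (rule someI_ex) (use assms in blast)
  hence "matrix_inv A = matrix_inv A ** (A ** B)" "matrix_inv A ** A = mat 1" using assms by simp_all
  thus ?thesis by (simp add: matrix_mul_assoc)
qed

context even_unimodular
begin

section \<open>Fourier expansions indexed by integral vectors\<close>

lemma inverse_S0: obtains T :: "int^'n bord^'n bord"
  where "S0 S ** T = mat 1" "T ** S0 S = mat 1"
proof -
  obtain Si where Si: "S ** Si = mat 1" "Si ** S = mat 1" by (rule inverse_S)
  have neg: "(- A) ** (- B) = A ** B" for A B :: "int^'n^'n"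
    by (simp add: vec_eq_iff matrix_matrix_mult_def)
  have "S0 S ** hyp_ext (- Si) = mat 1" "hyp_ext (- Si) ** S0 S = mat 1"
    unfolding S0_hyp by (intro hyp_ext_inverse; simp add: neg Si)+
  thus ?thesis using that by blast
qed

text \<open>The inverse of \<open>S0 S\<close> is integral and maps the integer lattice onto itself;
  from here on integral vectors serve as Fourier indices.\<close>

lemma L0_dual_eq: "L0_dual S = range ivec"
proof -
  obtain T :: "int^'n bord^'n bord" where T: "S0 S ** T = mat 1" "T ** S0 S = mat 1" by (rule inverse_S0)
  have "matrix_inv (S0 S) = map_matrix real_of_int T"
  proof (rule matrix_inv_unique)
    show "S0 S ** map_matrix real_of_int T = mat 1" "map_matrix real_of_int T ** S0 S = mat 1"
      by (metis T hom_int.h_mat hom_int.h_mm map_S0)+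
  qed
  hence "L0_dual S = range (\<lambda>g. ivec (T *v g))" by (simp add: L0_dual_def mv_ivec)
  also have "\<dots> = range ivec"
  proof (intro equalityI subsetI)
    fix x :: "real^'n bord" assume "x \<in> range ivec"
    then obtain g where g: "x = ivec g" by blast
    have "T *v (S0 S *v g) = g" by (simp add: matrix_vector_mul_assoc T)
    thus "x \<in> range (\<lambda>g. ivec (T *v g))" using g by (metis rangeI)
  qed auto
  finally show ?thesis .
qed

lemma nonneg_ivec: "nonneg S (ivec v) \<longleftrightarrow> nn v"
proof -
  have "qform (S0 S) (ivec v :: real^_) = 2 * real_of_int (Q0 v)" by (simp add: Q0_real qform_bil)
  thus ?thesis by (simp add: nonneg_def nn_def)
qed

definition fx :: "int^'n bord \<Rightarrow> complex^'n bord \<Rightarrow> complex" where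
  "fx v w = ee (bil (S0 S) (ivec v) w)"

lemma fourier_expansion_iff:
  "fourier_expansion S f a \<longleftrightarrow> (\<forall>l. \<not> (\<exists>v. l = ivec v \<and> nn v) \<longrightarrow> a l = 0) \<and>
     (\<forall>w\<in>half_space S. ((\<lambda>v. a (ivec v) * fx v w) has_sum f w) UNIV)"
proof -
  have 1: "(l \<in> L0_dual S \<and> nonneg S l) \<longleftrightarrow> (\<exists>v. l = ivec v \<and> nn v)" for l
    by (auto simp: L0_dual_eq nonneg_ivec)
  have 2: "((\<lambda>l. a l * exp (2 * of_real pi * \<i> * (\<Sum>i\<in>UNIV. of_real (l $ i) * (S0 S *v w) $ i)))
          has_sum f w) {l \<in> L0_dual S. nonneg S l} \<longleftrightarrow> ((\<lambda>v. a (ivec v) * fx v w) has_sum f w) UNIV"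
    if a: "\<forall>l. \<not> (\<exists>v. l = ivec v \<and> nn v) \<longrightarrow> a l = 0" for w
  proof -
    let ?g = "\<lambda>l. a l * exp (2 * of_real pi * \<i> * (\<Sum>i\<in>UNIV. of_real (l $ i) * (S0 S *v w) $ i))"
    have s: "{l \<in> L0_dual S. nonneg S l} = ivec ` {v. nn v}"
      by (auto simp: L0_dual_eq nonneg_ivec)
    have g: "?g (ivec v) = a (ivec v) * fx v w" for v
      by (simp add: fx_def ee_def bil_def vdot_def)
    have "(?g has_sum f w) {l \<in> L0_dual S. nonneg S l} \<longleftrightarrow> ((?g \<circ> ivec) has_sum f w) {v. nn v}"
      unfolding s by (rule has_sum_reindex) (auto intro: inj_on_subset[OF ivec_inj])
    also have "\<dots> \<longleftrightarrow> ((\<lambda>v. a (ivec v) * fx v w) has_sum f w) UNIV"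
      unfolding o_def g using a
      by (intro has_sum_cong_neutral) (auto simp del: g)
    finally show ?thesis .
  qed
  have 3: "(\<forall>l. \<not> (l \<in> L0_dual S \<and> nonneg S l) \<longrightarrow> a l = 0) \<longleftrightarrow> (\<forall>l. \<not> (\<exists>v. l = ivec v \<and> nn v) \<longrightarrow> a l = 0)"
    by (simp only: 1)
  show ?thesis unfolding fourier_expansion_def 3 by (intro conj_cong refl ball_cong 2)
qed

lemma half_space_translate: "w \<in> half_space S \<Longrightarrow> w + vmap of_real x \<in> half_space S"
proof -
  assume w: "w \<in> half_space S"
  have "vmap Im (w + vmap of_real x) = vmap Im w" by (simp add: vec_eq_iff)
  thus ?thesis using w by (simp add: half_space_iff Hpm_def)
qed

text \<open>A real translation of the base point multiplies each term by a character of its index.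
  As \<open>S0 S\<close> is invertible every character arises, and \<open>vec_extract\<close>
  applies.\<close>

lemma fourier_zero:
  assumes z: "\<And>w. w \<in> half_space S \<Longrightarrow> ((\<lambda>v. b v * fx v w) has_sum 0) UNIV"
  shows "b v = 0"
proof -
  obtain T :: "int^'n bord^'n bord" where T: "S0 S ** T = mat 1" by (rule inverse_S0)
  have TC: "S0 S ** map_matrix complex_of_int T = mat 1"
    by (metis T hom_int.h_mat hom_int.h_mm map_S0)
  let ?w = "bvec \<i> 0 \<i> :: complex^'n bord"
  have "b v * fx v ?w = 0"
  proof (rule vec_extract)
    fix t :: "real^'n bord"
    let ?x = "map_matrix real_of_int T *v t"
    have x: "vmap of_real ?x = map_matrix complex_of_int T *v vmap of_real t"
      by (simp add: hom_real.h_mv) (simp add: vec_eq_iff mv_nth vdot_def)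
    have "bil (S0 S) (ivec v) (vmap complex_of_real ?x) = (\<Sum>i\<in>UNIV. of_real (t $ i) * of_int (v $ i))" for v
      unfolding x bil_def by (simp add: matrix_vector_mul_assoc TC) (simp add: vdot_def mult.commute)
    hence "fx v (?w + vmap of_real ?x) = fx v ?w * ee (\<Sum>i\<in>UNIV. of_real (t $ i) * of_int (v $ i))" for v
      by (simp add: fx_def bil_add ee_add)
    thus "((\<lambda>v. b v * fx v ?w * ee (\<Sum>i\<in>UNIV. of_real (t $ i) * of_int (v $ i))) has_sum 0) UNIV"
      using z[OF half_space_translate[OF base_point], of ?x] by (simp add: mult.assoc)
  qed
  thus ?thesis by (simp add: fx_def)
qed

lemma fourier_coeff_eq:
  assumes "fourier_expansion S f a" shows "fourier_coeff S f = a"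
  unfolding fourier_coeff_def
proof (rule the_equality)
  show "fourier_expansion S f a" by fact
  fix b assume b: "fourier_expansion S f b"
  have "b (ivec v) - a (ivec v) = 0" for v
  proof (rule fourier_zero)
    fix w assume w: "w \<in> half_space S"
    have "((\<lambda>v. b (ivec v) * fx v w - a (ivec v) * fx v w) has_sum (f w - f w)) UNIV"
      using assms b w unfolding fourier_expansion_iff by (intro has_sum_diff) auto
    thus "((\<lambda>v. (b (ivec v) - a (ivec v)) * fx v w) has_sum 0) UNIV" by (simp add: left_diff_distrib)
  qed
  moreover have "a l = 0" "b l = 0" if "l \<notin> range ivec" for l
    using that assms b unfolding fourier_expansion_iff by blast+
  ultimately show "b = a" by (intro ext) (metis eq_iff_diff_eq_0 rangeE)
qed

definition al :: "(complex^'n bord \<Rightarrow> complex) \<Rightarrow> int^'n bord \<Rightarrow> complex" where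
  "al f v = fourier_coeff S f (ivec v)"

lemma al:
  assumes "f \<in> modular_forms S k"
  shows al_has_sum: "w \<in> half_space S \<Longrightarrow> ((\<lambda>v. al f v * fx v w) has_sum f w) UNIV"
    and al_nn: "\<not> nn v \<Longrightarrow> al f v = 0"
    and modular: "M \<in> Gamma_S S \<Longrightarrow> w \<in> half_space S \<Longrightarrow> slash S k f M w = f w"
proof -
  obtain a where "fourier_expansion S f a" using assms by (auto simp: modular_forms_def)
  hence "fourier_expansion S f (fourier_coeff S f)" using fourier_coeff_eq by metis
  thus "w \<in> half_space S \<Longrightarrow> ((\<lambda>v. al f v * fx v w) has_sum f w) UNIV" "\<not> nn v \<Longrightarrow> al f v = 0"
    unfolding fourier_expansion_iff al_def by auto
  show "M \<in> Gamma_S S \<Longrightarrow> w \<in> half_space S \<Longrightarrow> slash S k f M w = f w"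
    using assms by (auto simp: modular_forms_def)
qed

section \<open>The Hecke operator on Fourier expansions\<close>

lemma sum_box_fx:
  assumes q: "q > 0"
  shows "(\<Sum>v\<in>ibox q. ee (of_int (bil (S0 S) l v) / of_nat q)) = (if vcong (int q) l 0 then of_nat (q ^ (CARD('n) + 2)) else 0)"
proof -
  let ?s = "S0 S *v l :: int^'n bord"
  have "(\<Sum>v\<in>ibox q. ee (of_int (bil (S0 S) l v) / of_nat q)) = (\<Sum>v\<in>ibox q. \<Prod>i\<in>UNIV. ee (of_int (v $ i * ?s $ i) / of_nat q))"
  proof (rule sum.cong[OF refl])
    fix v :: "int^'n bord"
    have "bil (S0 S) l v = (\<Sum>i\<in>UNIV. v $ i * ?s $ i)" unfolding vdot_S0[symmetric] vdot_def by (simp add: mult.commute)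
    hence "of_int (bil (S0 S) l v) / (of_nat q :: complex) = (\<Sum>i\<in>UNIV. of_int (v $ i * ?s $ i) / of_nat q)"
      by (simp add: sum_divide_distrib)
    thus "ee (of_int (bil (S0 S) l v) / of_nat q) = (\<Prod>i\<in>UNIV. ee (of_int (v $ i * ?s $ i) / of_nat q))"
      by (simp only: ee_sum)
  qed
  also have "\<dots> = (\<Prod>i\<in>UNIV. \<Sum>a\<in>{0..<int q}. ee (of_int (a * ?s $ i) / of_nat q))"
    by (rule sum_box_prod)
  also have "\<dots> = (\<Prod>i\<in>UNIV. if int q dvd ?s $ i then of_nat q else 0)"
    by (simp only: root_sum[OF q])
  also have "\<dots> = (if vcong (int q) l 0 then of_nat (q ^ (CARD('n) + 2)) else 0)"
  proof (cases "vcong (int q) l 0")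
    case True
    hence "int q dvd ?s $ i" for i using vcong_mv[OF True, of "S0 S"] by (simp add: vcong_0)
    thus ?thesis using True by simp
  next
    case False
    then obtain x where x: "\<not> int q dvd bil (S0 S) x l" using unimodular_mod_S0 by blast
    have "\<exists>i. \<not> int q dvd ?s $ i"
    proof (rule ccontr)
      assume "\<nexists>i. \<not> int q dvd ?s $ i"
      hence "int q dvd vdot x ?s" unfolding vdot_def by (intro dvd_sum) auto
      thus False using x by (simp add: bil_def)
    qed
    thus ?thesis using False by (auto intro!: prod_zero)
  qed
  finally show ?thesis .
qed

definition vdiv :: "nat \<Rightarrow> int^'n bord \<Rightarrow> int^'n bord" where
  "vdiv q v = (\<chi> i. v $ i div int q)"

text \<open>The index whose exponential becomes that of \<open>v\<close> under the substitution by
  \<open>diag (1/q, 1, q)\<close>. It is only evaluated where \<open>q\<close> divides the first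
  coordinate, except at the fixed vector 0.\<close>

definition nbr :: "nat \<Rightarrow> int^'n bord \<Rightarrow> int^'n bord" where
  "nbr q v = bvec (v $ fst_ix div int q) (mid v) (int q * v $ lst_ix)"

text \<open>\<open>beta k q K f v\<close> is the coefficient at \<open>v\<close> of the image of \<open>f\<close> under the Hecke operator.\<close>

definition beta :: "int \<Rightarrow> nat \<Rightarrow> (int^'n bord \<Rightarrow> int^'n bord^'n bord) \<Rightarrow> (complex^'n bord \<Rightarrow> complex) \<Rightarrow> int^'n bord \<Rightarrow> complex" where
  "beta k q K f v = (if vcong (int q) v 0 then al f (vdiv q v) else 0)
     + of_nat q powi (int CARD('n) + 2 - 2 * k) * al f (int q *s v)
     + of_nat q powi (1 - k) / of_nat (q - 1) *
       (\<Sum>y\<in>Yq q. if int q dvd (K y *v v) $ fst_ix then al f (nbr q (K y *v v)) else 0)"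

lemma half_space_scale: "r > 0 \<Longrightarrow> w \<in> half_space S \<Longrightarrow> of_real r *s w \<in> half_space S"
proof -
  assume r: "r > 0" and w: "w \<in> half_space S"
  have "vmap Im (of_real r *s w) = r *s vmap Im w" by (simp add: vec_eq_iff)
  thus ?thesis using w r by (simp add: half_space_iff Hpm_def bil_simps zero_less_mult_iff)
qed

lemma vmap_of_real_ivec [simp]: "vmap complex_of_real (ivec v) = ivec v" by (simp add: vec_eq_iff)

lemma KG_complex: "K \<in> KG \<Longrightarrow> bil (S0 S) (map_matrix of_int K *v x) (map_matrix of_int K *v y) = bil (S0 S) x (y :: complex^'n bord)"
proof -
  assume K: "K \<in> KG"
  have "transpose K ** S0 S ** K = S0 S" unfolding bil_eq_iff using KG_bil[OF K] by (simp add: bil_matrix)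
  hence "map_matrix complex_of_int (transpose K ** S0 S ** K) = S0 S" by (simp add: map_S0)
  moreover have "map_matrix complex_of_int (transpose K) = transpose (map_matrix of_int K)"
    by (simp add: transpose_def vec_eq_iff)
  ultimately show ?thesis by (simp add: bil_matrix hom_int.h_mm map_S0)
qed

text \<open>Each family of cosets acts on indices. The term \<open>f (q w)\<close> multiplies them
  by \<open>q\<close>. The sum over the box is a character sum that keeps the multiples of
  \<open>q\<close>, with weight \<open>q^(n + 2)\<close>. For fixed \<open>y\<close>, the sum over
  \<open>a\<close> keeps the indices with last coordinate divisible by \<open>q\<close>, with weight
  \<open>q\<close>.\<close>

lemma hecke_S_fourier:
  assumes f: "f \<in> modular_forms S k" and q: "prime (q::nat)" and g: "good_sel q K x" and w: "w \<in> half_space S"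
  shows "((\<lambda>v. beta k q K f v * fx v w) has_sum hecke_S S k q f w) UNIV"
proof -
  have q0: "q > 0" using prime_gt_0_nat[OF q] .
  have qp: "prime (int q)" using q by simp
  have p1: "((\<lambda>v. (if vcong (int q) v 0 then al f (vdiv q v) else 0) * fx v w) has_sum f (of_nat q *s w)) UNIV"
  proof -
    have "((\<lambda>l. al f l * fx l (of_real (real q) *s w)) has_sum f (of_real (real q) *s w)) UNIV"
      using q0 by (intro al_has_sum[OF f] half_space_scale w) simp
    hence "((\<lambda>l. al f l * fx l (of_nat q *s w)) has_sum f (of_nat q *s w)) UNIV" by simp
    also have "?this \<longleftrightarrow> ((\<lambda>v. al f (vdiv q v) * fx v w) has_sum f (of_nat q *s w)) {v. vcong (int q) v 0}"
    proof (rule has_sum_reindex_bij_witness[where i = "vdiv q" and j = "\<lambda>l. int q *s l"])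
      fix l :: "int^'n bord"
      show 1: "vdiv q (int q *s l) = l" using q0 by (simp add: vdiv_def vec_eq_iff)
      show "int q *s l \<in> {v. vcong (int q) v 0}" by (simp add: vcong_0)
      show "al f (vdiv q (int q *s l)) * fx (int q *s l) w = al f l * fx l (of_nat q *s w)"
        unfolding 1 by (simp add: fx_def ivec_arith bil_scale)
    next
      fix v :: "int^'n bord" assume "v \<in> {v. vcong (int q) v 0}"
      thus "int q *s vdiv q v = v" by (simp add: vdiv_def vec_eq_iff vcong_0)
    qed auto
    also have "\<dots> \<longleftrightarrow> ?thesis" by (rule has_sum_cong_neutral) auto
    finally show ?thesis .
  qed
  have p2: "((\<lambda>v. (of_nat q powi (int CARD('n) + 2 - 2 * k) * al f (int q *s v)) * fx v w) has_sum
     of_nat q powi (- 2 * k) * (\<Sum>v\<in>ibox q. f (of_real (1 / real q) *s (w + ivec v)))) UNIV"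
  proof -
    have "((\<lambda>l. \<Sum>v\<in>ibox q. al f l * fx l (of_real (1 / real q) *s (w + ivec v))) has_sum
       (\<Sum>v\<in>ibox q. f (of_real (1 / real q) *s (w + ivec v)))) UNIV"
      using q0 w half_space_translate[OF w, of "ivec _"]
      by (intro has_sum_sum al_has_sum[OF f] half_space_scale) auto
    moreover have "(\<Sum>v\<in>ibox q. al f l * fx l (of_real (1 / real q) *s (w + ivec v))) =
       (if vcong (int q) l 0 then of_nat (q ^ (CARD('n) + 2)) * (al f l * fx l (of_real (1 / real q) *s w)) else 0)" for l
    proof -
      have "fx l (of_real (1 / real q) *s (w + ivec v)) = fx l (of_real (1 / real q) *s w) * ee (of_int (bil (S0 S) l v) / of_nat q)" for v
        by (simp add: fx_def bil_simps of_int_bS0 add_divide_distrib ee_add)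
      hence "(\<Sum>v\<in>ibox q. al f l * fx l (of_real (1 / real q) *s (w + ivec v))) =
        al f l * fx l (of_real (1 / real q) *s w) * (\<Sum>v\<in>ibox q. ee (of_int (bil (S0 S) l v) / of_nat q))"
        by (simp add: sum_distrib_left mult.assoc)
      thus ?thesis unfolding sum_box_fx[OF q0] by simp
    qed
    ultimately have "((\<lambda>l. if vcong (int q) l 0 then of_nat (q ^ (CARD('n) + 2)) * (al f l * fx l (of_real (1 / real q) *s w)) else 0)
       has_sum (\<Sum>v\<in>ibox q. f (of_real (1 / real q) *s (w + ivec v)))) UNIV" by simp
    also have "?this \<longleftrightarrow> ((\<lambda>l. of_nat (q ^ (CARD('n) + 2)) * (al f l * fx l (of_real (1 / real q) *s w)))
       has_sum (\<Sum>v\<in>ibox q. f (of_real (1 / real q) *s (w + ivec v)))) {l. vcong (int q) l 0}"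
      by (rule has_sum_cong_neutral) auto
    also have "\<dots> \<longleftrightarrow> ((\<lambda>v. of_nat (q ^ (CARD('n) + 2)) * (al f (int q *s v) * fx v w))
       has_sum (\<Sum>v\<in>ibox q. f (of_real (1 / real q) *s (w + ivec v)))) UNIV"
    proof (rule has_sum_reindex_bij_witness[where j = "vdiv q" and i = "\<lambda>l. int q *s l"])
      fix l :: "int^'n bord"
      show 1: "vdiv q (int q *s l) = l" using q0 by (simp add: vdiv_def vec_eq_iff)
      show "int q *s l \<in> {v. vcong (int q) v 0}" by (simp add: vcong_0)
    next
      fix v :: "int^'n bord" assume "v \<in> {v. vcong (int q) v 0}"
      thus 2: "int q *s vdiv q v = v" by (simp add: vdiv_def vec_eq_iff vcong_0)
      have "fx v (of_real (1 / real q) *s w) = fx (int q *s vdiv q v) (of_real (1 / real q) *s w)" by (simp only: 2)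
      also have "\<dots> = fx (vdiv q v) w" using q0 by (simp add: fx_def ivec_arith bil_simps)
      finally show "of_nat (q ^ (CARD('n) + 2)) * (al f (int q *s vdiv q v) * fx (vdiv q v) w) =
        of_nat (q ^ (CARD('n) + 2)) * (al f v * fx v (of_real (1 / real q) *s w))" unfolding 2 by simp
    qed auto
    finally have "((\<lambda>v. of_nat q powi (- 2 * k) * (of_nat (q ^ (CARD('n) + 2)) * (al f (int q *s v) * fx v w)))
       has_sum (of_nat q powi (- 2 * k) * (\<Sum>v\<in>ibox q. f (of_real (1 / real q) *s (w + ivec v))))) UNIV"
      by (rule has_sum_cmult_right)
    moreover have "of_nat q powi (- 2 * k) * of_nat (q ^ (CARD('n) + 2)) = (of_nat q :: complex) powi (int CARD('n) + 2 - 2 * k)"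
    proof -
      have "(of_nat q :: complex) powi (int CARD('n) + 2 - 2 * k) = of_nat q powi (int (CARD('n) + 2)) * of_nat q powi (- 2 * k)"
        using q0 by (subst power_int_add[symmetric]) (auto simp: algebra_simps)
      thus ?thesis by (simp only: power_int_of_nat of_nat_power mult.commute)
    qed
    ultimately show ?thesis by (simp only: mult.assoc[symmetric])
  qed
  let ?L = "diagb (1 / of_nat q) (of_nat q) :: complex^'n bord^'n bord"
  have p3: "((\<lambda>v. (if int q dvd (K y *v v) $ fst_ix then of_nat q * al f (nbr q (K y *v v)) else 0) * fx v w) has_sum
     (\<Sum>a\<in>{0..<int q}. f (cM (diagb (1 / real q) (real q) ** map_matrix of_int (K y)) *v (w + ivec (x a y))))) UNIV"
    if y: "y \<in> Yq q" for y
  proof -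
    obtain t where t: "K y \<in> KG" "\<not> int q dvd t" "vcong (int q) (K y *v y) (t *s bvec 0 0 1)"
      "\<And>a. int q dvd bil (S0 S) (x a y) y - a" using g y unfolding good_sel_def by blast
    obtain K' where K': "K' ** K y = mat 1" "K y ** K' = mat 1" using t(1) by (auto simp: KG_def)
    obtain t' where t': "int q dvd t' * t - 1" "\<not> int q dvd t'" using unit_inverse_mod[OF q t(2)] by blast
    let ?K = "map_matrix complex_of_int (K y)"
    have cMK: "cM (diagb (1 / real q) (real q) ** map_matrix of_int (K y)) *v u = ?L *v (?K *v u)" for u
    proof -
      have "cM (map_matrix of_int (K y)) = ?K" by (simp add: vec_eq_iff)
      thus ?thesis by (simp add: map_matrix_real_mult map_diagb matrix_vector_mul_assoc)
    qed
    have adj: "bil (S0 S) u (?L *v v) = bil (S0 S) (diagb (of_nat q) (1 / of_nat q) *v u) v" for u v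
      by (cases u; cases v) (simp add: diagb_mult bil_S0)
    have inH: "?L *v (?K *v (w + ivec (x a y))) \<in> half_space S" for a
    proof -
      have LS: "lev (diagb (1 / real q) (real q)) \<in> SO_plus S" using lev_diagb_SO[of "1 / real q"] q0 by simp
      have KS: "lev (map_matrix real_of_int (K y)) \<in> SO_plus S" using t(1) Gamma_S_SO by (simp add: KG_def)
      have wt: "w + ivec (x a y) \<in> half_space S" using half_space_translate[OF w, of "ivec (x a y)"] by simp
      have "orth_act S (lev (diagb (1 / real q) (real q) ** map_matrix of_int (K y))) (w + ivec (x a y)) \<in> half_space S"
        using SO_plusD(3)[OF SO_plus_mult[OF LS KS] wt] by (simp add: lev_comp)
      thus ?thesis by (simp add: act_lev cMK)
    qed
    define G where "G = (\<lambda>l. ee (bil (S0 S) (diagb (of_nat q) (1 / of_nat q) *v ivec l) (?K *v w)))"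
    \<comment> \<open>In the pairing with the translated point only the product of the last
      coordinate of \<open>l\<close> and the first coordinate \<open>x1\<close> of
      \<open>K y x\<close> has denominator \<open>q\<close>. Since \<open>K y\<close> is an
      isometry, \<open>t x1\<close> is congruent to the pairing of \<open>x a y\<close> with
      \<open>y\<close>, that is to \<open>a\<close>.\<close>
    have e1: "fx l (?L *v (?K *v (w + ivec (x a y)))) = G l * ee (of_int (a * (t' * l $ lst_ix)) / of_nat q)" for l a
    proof -
      obtain l1 m l3 where l: "l = bvec l1 m l3" by (cases l)
      let ?X = "K y *v x a y"
      obtain x1 xm x3 where X: "?X = bvec x1 xm x3" by (cases ?X)
      have "?K *v ivec (x a y) = ivec ?X" by (rule mv_ivec)
      hence "bil (S0 S) (diagb (of_nat q) (1 / of_nat q) *v ivec l) (?K *v ivec (x a y)) =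
         of_int (int q * l1 * x3 - bS S m xm) + of_int (l3 * x1) / of_nat q"
        unfolding X l using of_int_bS[of S m xm, where 'a = complex] by (simp add: diagb_mult bil_S0)
      hence "fx l (?L *v (?K *v (w + ivec (x a y)))) = G l * ee (of_int (l3 * x1) / of_nat q)"
        unfolding fx_def adj G_def matrix_vector_right_distrib bil_add ee_add
        by (simp only: ee_int_add)
      also have "ee (of_int (l3 * x1) / of_nat q) = ee (of_int (a * (t' * l3)) / of_nat q)"
      proof (rule ee_frac_cong[OF _ q0])
        have 1: "int q dvd bil (S0 S) (K y *v x a y) (K y *v y) - bil (S0 S) (K y *v x a y) (t *s bvec 0 0 1)"
          by (rule vcong_bil[OF t(3)])
        have 2: "bil (S0 S) (K y *v x a y) (t *s bvec 0 0 1) = t * x1"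
          unfolding X by (simp add: bil_simps bil_S0)
        have "int q dvd (bil (S0 S) (x a y) y - a) - (bil (S0 S) (x a y) y - t * x1)"
          by (rule dvd_diff[OF t(4)]) (use 1 in \<open>simp only: 2 KG_bil[OF t(1)]\<close>)
        hence "int q dvd t * x1 - a" by simp
        hence "int q dvd (t' * l3) * (t * x1 - a) - (l3 * x1) * (t' * t - 1)" using t'(1) by (intro dvd_diff) auto
        thus "int q dvd l3 * x1 - a * (t' * l3)" by (simp add: algebra_simps)
      qed
      finally show ?thesis by (simp add: l)
    qed
    have "((\<lambda>l. \<Sum>a\<in>{0..<int q}. al f l * fx l (?L *v (?K *v (w + ivec (x a y))))) has_sum
       (\<Sum>a\<in>{0..<int q}. f (?L *v (?K *v (w + ivec (x a y)))))) UNIV"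
      by (intro has_sum_sum al_has_sum[OF f] inH) auto
    moreover have "(\<Sum>a\<in>{0..<int q}. al f l * fx l (?L *v (?K *v (w + ivec (x a y))))) =
       (if int q dvd l $ lst_ix then of_nat q * (al f l * G l) else 0)" for l
    proof -
      have "(\<Sum>a\<in>{0..<int q}. al f l * fx l (?L *v (?K *v (w + ivec (x a y))))) =
        al f l * G l * (\<Sum>a\<in>{0..<int q}. ee (of_int (a * (t' * l $ lst_ix)) / of_nat q))"
        by (simp only: e1 sum_distrib_left mult.assoc)
      thus ?thesis unfolding root_sum[OF q0] using qp t'(2) by (simp add: prime_dvd_mult_iff)
    qed
    ultimately have "((\<lambda>l. if int q dvd l $ lst_ix then of_nat q * (al f l * G l) else 0) has_sum
       (\<Sum>a\<in>{0..<int q}. f (?L *v (?K *v (w + ivec (x a y)))))) UNIV" by simp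
    also have "?this \<longleftrightarrow> ((\<lambda>l. of_nat q * (al f l * G l)) has_sum
       (\<Sum>a\<in>{0..<int q}. f (?L *v (?K *v (w + ivec (x a y)))))) {l. int q dvd l $ lst_ix}"
      by (rule has_sum_cong_neutral) auto
    also have "\<dots> \<longleftrightarrow> ((\<lambda>v. of_nat q * (al f (nbr q (K y *v v)) * fx v w)) has_sum
       (\<Sum>a\<in>{0..<int q}. f (?L *v (?K *v (w + ivec (x a y)))))) {v. int q dvd (K y *v v) $ fst_ix}"
    proof (rule has_sum_reindex_bij_witness[where i = "\<lambda>v. nbr q (K y *v v)"
          and j = "\<lambda>l. K' *v bvec (int q * l $ fst_ix) (mid l) (l $ lst_ix div int q)"])
      fix l :: "int^'n bord" assume l: "l \<in> {l. int q dvd l $ lst_ix}"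
      obtain l1 m l3 where L: "l = bvec l1 m l3" by (cases l)
      let ?j = "K' *v bvec (int q * l $ fst_ix) (mid l) (l $ lst_ix div int q)"
      have Kj: "K y *v ?j = bvec (int q * l1) m (l3 div int q)"
        by (simp add: matrix_vector_mul_assoc K' L)
      have q3: "int q * (l3 div int q) = l3" using l by (simp add: L)
      show 1: "nbr q (K y *v ?j) = l" unfolding Kj using q0 q3 by (simp add: nbr_def L)
      show "?j \<in> {v. int q dvd (K y *v v) $ fst_ix}" by (simp add: Kj)
      have "fx ?j w = ee (bil (S0 S) (?K *v ivec ?j) (?K *v w))" by (simp add: fx_def KG_complex[OF t(1)])
      also have "?K *v ivec ?j = diagb (of_nat q) (1 / of_nat q) *v ivec l"
      proof -
        have "(of_int (l3 div int q) :: complex) = of_int l3 / of_nat q"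
          using q0 arg_cong[OF q3, of "complex_of_int"] by (simp add: field_simps)
        moreover have "?K *v ivec ?j = ivec (bvec (int q * l1) m (l3 div int q))"
          unfolding Kj[symmetric] by (rule mv_ivec)
        ultimately show ?thesis unfolding L by (simp add: diagb_mult)
      qed
      finally have "fx ?j w = G l" by (simp add: G_def)
      thus "of_nat q * (al f (nbr q (K y *v ?j)) * fx ?j w) = of_nat q * (al f l * G l)"
        by (simp only: 1)
    next
      fix v :: "int^'n bord" assume v: "v \<in> {v. int q dvd (K y *v v) $ fst_ix}"
      let ?l = "nbr q (K y *v v)"
      have "bvec (int q * ?l $ fst_ix) (mid ?l) (?l $ lst_ix div int q) = K y *v v"
        using v q0 by (simp add: nbr_def bvec_surj)
      thus "K' *v bvec (int q * ?l $ fst_ix) (mid ?l) (?l $ lst_ix div int q) = v"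
        by (simp add: matrix_vector_mul_assoc K')
      show "?l \<in> {l. int q dvd l $ lst_ix}" by (simp add: nbr_def)
    qed auto
    also have "\<dots> \<longleftrightarrow> ((\<lambda>v. (if int q dvd (K y *v v) $ fst_ix then of_nat q * al f (nbr q (K y *v v)) else 0) * fx v w) has_sum
       (\<Sum>a\<in>{0..<int q}. f (?L *v (?K *v (w + ivec (x a y)))))) UNIV"
      by (rule has_sum_cong_neutral) auto
    finally show ?thesis by (simp only: cMK)
  qed
  have "((\<lambda>v. \<Sum>y\<in>Yq q. (if int q dvd (K y *v v) $ fst_ix then of_nat q * al f (nbr q (K y *v v)) else 0) * fx v w) has_sum
     (\<Sum>y\<in>Yq q. \<Sum>a\<in>{0..<int q}. f (cM (diagb (1 / real q) (real q) ** map_matrix of_int (K y)) *v (w + ivec (x a y))))) UNIV"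
    by (intro has_sum_sum p3) auto
  note p4' = has_sum_cmult_right[OF this, of "of_nat q powi (- k) / of_nat (q - 1)"]
  have p4: "((\<lambda>v. of_nat q powi (1 - k) / of_nat (q - 1) *
       (\<Sum>y\<in>Yq q. if int q dvd (K y *v v) $ fst_ix then al f (nbr q (K y *v v)) else 0) * fx v w) has_sum
     of_nat q powi (- k) / of_nat (q - 1) * (\<Sum>y\<in>Yq q. \<Sum>a\<in>{0..<int q}. f (cM (diagb (1 / real q) (real q) ** map_matrix of_int (K y)) *v (w + ivec (x a y))))) UNIV"
  proof -
    have "of_nat q powi (- k) / of_nat (q - 1) * (\<Sum>y\<in>Yq q. (if int q dvd (K y *v v) $ fst_ix then of_nat q * al f (nbr q (K y *v v)) else 0) * fx v w)
      = of_nat q powi (1 - k) / of_nat (q - 1) * (\<Sum>y\<in>Yq q. if int q dvd (K y *v v) $ fst_ix then al f (nbr q (K y *v v)) else 0) * fx v w" for v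
    proof -
      have 1: "(of_nat q :: complex) powi (1 - k) = of_nat q powi (- k) * of_nat q"
        using q0 power_int_add[of "of_nat q :: complex" "- k" 1] by (simp add: add.commute)
      have "(\<Sum>y\<in>Yq q. (if int q dvd (K y *v v) $ fst_ix then of_nat q * al f (nbr q (K y *v v)) else 0) * fx v w) =
        of_nat q * (\<Sum>y\<in>Yq q. if int q dvd (K y *v v) $ fst_ix then al f (nbr q (K y *v v)) else 0) * fx v w"
        unfolding sum_distrib_left sum_distrib_right by (rule sum.cong) auto
      thus ?thesis unfolding 1 by (simp only: mult_ac times_divide_eq_left times_divide_eq_right)
    qed
    thus ?thesis using p4' by (simp only:)
  qed
  have "((\<lambda>v. beta k q K f v * fx v w) has_sum
     (f (of_nat q *s w) + of_nat q powi (- 2 * k) * (\<Sum>v\<in>ibox q. f (of_real (1 / real q) *s (w + ivec v)))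
      + of_nat q powi (- k) / of_nat (q - 1) * (\<Sum>y\<in>Yq q. \<Sum>a\<in>{0..<int q}. f (cM (diagb (1 / real q) (real q) ** map_matrix of_int (K y)) *v (w + ivec (x a y)))))) UNIV"
    unfolding beta_def distrib_right by (intro has_sum_add p1 p2 p4)
  moreover have "hecke_S S k q f w =
     of_nat q powi (- 2 * k) * (\<Sum>v\<in>ibox q. f (of_real (1 / real q) *s (w + ivec v)))
     + f (of_nat q *s w)
     + of_nat q powi (- k) / of_nat (q - 1) * (\<Sum>y\<in>Yq q. \<Sum>a\<in>{0..<int q}.
          f (cM (diagb (1 / real q) (real q) ** map_matrix of_int (K y)) *v (w + ivec (x a y))))"
    by (rule hecke_S_expand[OF _ q g w]) (rule modular[OF f])
  ultimately show ?thesis by (simp only: add_ac)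
qed

lemma eigen_iff_beta:
  assumes f: "f \<in> modular_forms S k" and q: "prime (q::nat)" and g: "good_sel q K x"
  shows "eigenform_on (half_space S) (hecke_S S k q) f \<longleftrightarrow> (\<exists>c. \<forall>v. beta k q K f v = c * al f v)"
proof -
  have "(\<forall>w\<in>half_space S. hecke_S S k q f w = c * f w) \<longleftrightarrow> (\<forall>v. beta k q K f v = c * al f v)" for c
  proof
    assume h: "\<forall>w\<in>half_space S. hecke_S S k q f w = c * f w"
    have "beta k q K f v - c * al f v = 0" for v
    proof (rule fourier_zero)
      fix w assume w: "w \<in> half_space S"
      have "((\<lambda>v. beta k q K f v * fx v w - c * (al f v * fx v w)) has_sum (hecke_S S k q f w - c * f w)) UNIV"
        by (intro has_sum_diff has_sum_cmult_right hecke_S_fourier[OF f q g w] al_has_sum[OF f w])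
      thus "((\<lambda>v. (beta k q K f v - c * al f v) * fx v w) has_sum 0) UNIV"
        using h w by (simp add: left_diff_distrib mult.assoc)
    qed
    thus "\<forall>v. beta k q K f v = c * al f v" by simp
  next
    assume b: "\<forall>v. beta k q K f v = c * al f v"
    show "\<forall>w\<in>half_space S. hecke_S S k q f w = c * f w"
    proof
      fix w assume w: "w \<in> half_space S"
      have "((\<lambda>v. c * (al f v * fx v w)) has_sum c * f w) UNIV"
        by (intro has_sum_cmult_right al_has_sum[OF f w])
      moreover have "((\<lambda>v. c * (al f v * fx v w)) has_sum hecke_S S k q f w) UNIV"
        using hecke_S_fourier[OF f q g w] b by (simp add: mult.assoc)
      ultimately show "hecke_S S k q f w = c * f w" using has_sum_unique by blast
    qed
  qed
  thus ?thesis unfolding eigenform_on_def by blast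
qed

end

section \<open>Fourier coefficients in the Maass space\<close>

text \<open>Content of an integral vector. By unimodularity it has the same divisors as
  \<open>eps\<close>; see \<open>dvd_eps_iff\<close>.\<close>

definition cont :: "int^'m::finite \<Rightarrow> nat" where
  "cont v = Gcd (range (\<lambda>i. nat \<bar>v $ i\<bar>))"

lemma dvd_cont_iff: "d dvd cont v \<longleftrightarrow> vcong (int d) v 0"
proof -
  have "d dvd nat \<bar>x\<bar> \<longleftrightarrow> int d dvd x" for x
    by (metis abs_ge_zero dvd_abs_iff int_dvd_int_iff nat_0_le)
  thus ?thesis by (simp add: cont_def dvd_Gcd_iff vcong_0)
qed

lemma cont_eq_0_iff: "cont v = 0 \<longleftrightarrow> v = 0"
  by (simp add: cont_def vec_eq_iff image_subset_iff)

lemma cont_eqI: assumes "\<And>d. vcong (int d) v 0 \<longleftrightarrow> d dvd e" shows "cont v = e"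
  using assms dvd_cont_iff by (metis dvd_antisym dvd_refl)

lemma cont_scale: "cont (int e *s v) = e * cont v"
proof -
  have "cont (int e *s v) = Gcd ((*) e ` range (\<lambda>i. nat \<bar>v $ i\<bar>))"
    unfolding cont_def by (intro arg_cong[of _ _ Gcd]) (auto simp: abs_mult nat_mult_distrib)
  thus ?thesis unfolding cont_def by (simp add: Gcd_mult)
qed

lemma cont_decomp: assumes "v \<noteq> 0" obtains v0 where "v = int (cont v) *s v0" "cont v0 = 1"
proof -
  have "vcong (int (cont v)) v 0" using dvd_cont_iff[of "cont v" v] by simp
  hence d: "int (cont v) dvd v $ i" for i by (simp add: vcong_0)
  define v0 where "v0 = (\<chi> i. v $ i div int (cont v))"
  have v: "v = int (cont v) *s v0" using d by (simp add: v0_def vec_eq_iff)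
  have "cont v \<noteq> 0" using assms cont_eq_0_iff by blast
  moreover have "cont v = cont v * cont v0" using cont_scale[of "cont v" v0] v by simp
  ultimately show ?thesis using that v by simp
qed

text \<open>The divisor sum of the Maass relation detached from the vector: only its content
  \<open>e\<close> and its norm \<open>N\<close> enter.\<close>

definition dsum :: "(int \<Rightarrow> complex) \<Rightarrow> int \<Rightarrow> nat \<Rightarrow> int \<Rightarrow> complex" where
  "dsum a k e N = (\<Sum>d | d dvd e. of_nat d powi (k - 1) * a (N div (int d)\<^sup>2))"

lemma dvd_prime_power_times:
  assumes q: "prime (q::nat)" and e: "\<not> q dvd e"
  shows "{d. d dvd q ^ j * e} = (\<lambda>(i, d). q ^ i * d) ` ({..j} \<times> {d. d dvd e})"
    and "inj_on (\<lambda>(i, d). q ^ i * d) ({..j} \<times> {d. d dvd e})"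
proof -
  show "{d. d dvd q ^ j * e} = (\<lambda>(i, d). q ^ i * d) ` ({..j} \<times> {d. d dvd e})"
  proof (intro equalityI subsetI)
    fix d assume "d \<in> {d. d dvd q ^ j * e}"
    then obtain b c where bc: "d = b * c" "b dvd q ^ j" "c dvd e" using division_decomp by blast
    then obtain i where "i \<le> j" "b = q ^ i" using divides_primepow_nat[OF q] by blast
    thus "d \<in> (\<lambda>(i, d). q ^ i * d) ` ({..j} \<times> {d. d dvd e})" using bc by auto
  next
    fix d assume "d \<in> (\<lambda>(i, d). q ^ i * d) ` ({..j} \<times> {d. d dvd e})"
    thus "d \<in> {d. d dvd q ^ j * e}" by (auto intro!: mult_dvd_mono le_imp_power_dvd)
  qed
  show "inj_on (\<lambda>(i, d). q ^ i * d) ({..j} \<times> {d. d dvd e})"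
  proof (rule inj_onI, clarify)
    fix i d i' d' assume h: "q ^ i * d = q ^ i' * d'" "d dvd e" "d' dvd e"
    have nd: "\<not> q dvd d" "\<not> q dvd d'" using h e dvd_trans by blast+
    have d0: "d > 0" "d' > 0" using nd by (metis dvd_0_right gr0I)+
    have "multiplicity q (q ^ i * d) = i" "multiplicity q (q ^ i' * d') = i'"
      using nd d0 q by (simp_all add: prime_elem_multiplicity_mult_distrib multiplicity_same_power not_dvd_imp_multiplicity_0 prime_gt_0_nat)
    hence i: "i = i'" using h(1) by simp
    have "d = d'" using h(1) i prime_gt_0_nat[OF q] by simp
    thus "i = i' \<and> d = d'" using i by simp
  qed
qed

lemma dsum_prime_power:
  assumes q: "prime (q::nat)" and e: "\<not> q dvd e"
  shows "dsum a k (q ^ j * e) N = (\<Sum>d | d dvd e. of_nat d powi (k - 1) *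
     (\<Sum>i\<le>j. (of_nat q powi (k - 1)) ^ i * a (N div (int (q ^ i * d))\<^sup>2)))"
proof -
  have e0: "e > 0" using e by (cases e) auto
  have fin: "finite {d. d dvd e}" using e0 by simp
  have "dsum a k (q ^ j * e) N = (\<Sum>(i, d)\<in>{..j} \<times> {d. d dvd e}. of_nat (q ^ i * d) powi (k - 1) * a (N div (int (q ^ i * d))\<^sup>2))"
    unfolding dsum_def dvd_prime_power_times(1)[OF q e]
    by (subst sum.reindex[OF dvd_prime_power_times(2)[OF q e]]) (simp add: case_prod_beta o_def)
  also have "\<dots> = (\<Sum>i\<le>j. \<Sum>d | d dvd e. of_nat (q ^ i * d) powi (k - 1) * a (N div (int (q ^ i * d))\<^sup>2))"
    by (rule sum.cartesian_product[symmetric])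
  also have "\<dots> = (\<Sum>d | d dvd e. \<Sum>i\<le>j. of_nat (q ^ i * d) powi (k - 1) * a (N div (int (q ^ i * d))\<^sup>2))"
    by (rule sum.swap)
  also have "\<dots> = (\<Sum>d | d dvd e. of_nat d powi (k - 1) *
     (\<Sum>i\<le>j. (of_nat q powi (k - 1)) ^ i * a (N div (int (q ^ i * d))\<^sup>2)))"
    unfolding sum_distrib_left
  proof (intro sum.cong refl)
    fix d i
    have "(of_nat (q ^ i * d) :: complex) powi (k - 1) = (of_nat q powi (k - 1)) ^ i * of_nat d powi (k - 1)"
      by (simp add: power_int_mult_distrib power_int_power' flip: power_int_of_nat power_int_mult) (simp add: mult.commute)
    thus "of_nat (q ^ i * d) powi (k - 1) * a (N div (int (q ^ i * d))\<^sup>2) =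
      of_nat d powi (k - 1) * ((of_nat q powi (k - 1)) ^ i * a (N div (int (q ^ i * d))\<^sup>2))" by simp
  qed
  finally show ?thesis .
qed

text \<open>The coefficients of \<open>h | T(q\<^sup>2)\<close> if \<open>a\<close> are those of \<open>h\<close>.\<close>

definition bfun :: "int \<Rightarrow> nat \<Rightarrow> (int \<Rightarrow> complex) \<Rightarrow> int \<Rightarrow> complex" where
  "bfun k q a N = (if (int q)\<^sup>2 dvd N then a (N div (int q)\<^sup>2) else 0)
     + (if int q dvd N then of_nat q powi (1 - k) * a N else 0)
     + of_nat q powi (2 - 2 * k) * a ((int q)\<^sup>2 * N)"

text \<open>The algebraic core of the comparison. In the application
  \<open>X i = a (q^(2 i) M)\<close>, \<open>Xm\<close> is the value at \<open>M / q^2\<close>,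
  \<open>B\<close> consists of the values of \<open>bfun\<close>, \<open>x = q^(k - 1)\<close> and
  \<open>w = q^(1 - k) / (q - 1)\<close>. The numbers \<open>A\<close>, \<open>V\<close>,
  \<open>C\<close> count isotropic vectors by their position relative to a primitive vector, and
  \<open>P\<close> says that \<open>q\<close> divides the norm of that vector. The equations for
  \<open>w C\<close> and \<open>w A\<close> are what makes the boundary terms cancel.\<close>

lemma hecke_recursion:
  fixes X :: "nat \<Rightarrow> complex" and x y z w A V C b0 Xm Y :: complex
  assumes B0: "B 0 = Xm + (if P then y * X 0 else 0) + z * X 1"
    and BS: "\<And>i. B (Suc i) = X i + y * X (Suc i) + z * X (Suc (Suc i))"
    and Y: "w * Y = y + b0" and AV: "A + V = Y" and C: "w * C * x * Xm = Xm"
    and A: "w * A = z * x + (if P then 0 else y)"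
  shows "(\<Sum>i<j. x ^ i * X (j - 1 - i)) + z * (\<Sum>i\<le>Suc j. x ^ i * X (Suc j - i))
    + w * (A * (\<Sum>i<j. x ^ i * X (j - i)) + (V - C) * (\<Sum>i\<le>j. x ^ i * X (j - i))
           + C * ((\<Sum>i\<le>j. x ^ i * X (j - i)) + x ^ Suc j * Xm))
    = (\<Sum>i\<le>j. x ^ i * B (j - i)) + b0 * (\<Sum>i\<le>j. x ^ i * X (j - i))"
proof -
  define s where "s = (\<Sum>i\<le>j. x ^ i * X (j - i))"
  define s1 where "s1 = (\<Sum>i<j. x ^ i * X (j - 1 - i))"
  define s2 where "s2 = (\<Sum>i\<le>j. x ^ i * X (Suc j - i))"
  have lt: "(\<Sum>i\<le>j. f i) = (\<Sum>i<j. f i) + f j" for f :: "nat \<Rightarrow> complex"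
    by (simp add: lessThan_Suc_atMost[symmetric])
  have e1: "(\<Sum>i<j. x ^ i * X (j - i)) = s - x ^ j * X 0" unfolding s_def lt by simp
  have e2: "(\<Sum>i\<le>Suc j. x ^ i * X (Suc j - i)) = s2 + x ^ Suc j * X 0" unfolding s2_def by simp
  \<comment> \<open>The generic recursion covers \<open>i < j\<close>. The remaining summand
    contains \<open>B 0\<close>, whose exceptional form leaves the terms with \<open>Xm\<close> and
    \<open>P\<close>.\<close>
  have e3: "(\<Sum>i\<le>j. x ^ i * B (j - i)) = s1 + x ^ j * Xm + y * s - (if P then 0 else y * x ^ j * X 0) + z * s2"
  proof -
    have "(\<Sum>i<j. x ^ i * B (j - i)) = (\<Sum>i<j. x ^ i * X (j - 1 - i) + y * (x ^ i * X (j - i)) + z * (x ^ i * X (Suc j - i)))"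
    proof (rule sum.cong[OF refl])
      fix i assume "i \<in> {..<j}"
      hence "j - i = Suc (j - 1 - i)" "Suc j - i = Suc (Suc (j - 1 - i))" by auto
      thus "x ^ i * B (j - i) = x ^ i * X (j - 1 - i) + y * (x ^ i * X (j - i)) + z * (x ^ i * X (Suc j - i))"
        by (simp add: BS algebra_simps)
    qed
    also have "\<dots> = s1 + y * (s - x ^ j * X 0) + z * (s2 - x ^ j * X 1)"
      unfolding s1_def e1[symmetric] s2_def lt by (simp add: sum.distrib sum_distrib_left)
    finally show ?thesis unfolding lt using B0 by (simp add: algebra_simps)
  qed
  have AA: "w * A * (x ^ j * X 0) = (z * x + (if P then 0 else y)) * (x ^ j * X 0)" unfolding A ..
  have YY: "w * Y * s = (y + b0) * s" unfolding Y ..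
  have CC: "w * C * x * Xm * x ^ j = Xm * x ^ j" unfolding C ..
  have "w * (A * (s - x ^ j * X 0) + (V - C) * s + C * (s + x ^ Suc j * Xm)) =
     w * Y * s - w * A * (x ^ j * X 0) + w * C * x * Xm * x ^ j"
    unfolding AV[symmetric] by (simp add: algebra_simps)
  also have "\<dots> = (y + b0) * s - (z * x + (if P then 0 else y)) * (x ^ j * X 0) + Xm * x ^ j"
    unfolding AA YY CC ..
  finally have W: "w * (A * (s - x ^ j * X 0) + (V - C) * s + C * (s + x ^ Suc j * Xm)) =
    (y + b0) * s - (z * x + (if P then 0 else y)) * (x ^ j * X 0) + Xm * x ^ j" .
  show ?thesis unfolding e1 e2 e3 s_def[symmetric] s1_def[symmetric] W
    by (cases P) (simp_all add: algebra_simps)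
qed

context even_unimodular
begin

lemma al_KG: assumes f: "f \<in> modular_forms S k" and K: "K \<in> KG"
  shows "al f (K *v v) = al f v"
proof -
  obtain K' where K': "K' ** K = mat 1" "K ** K' = mat 1" using K by (auto simp: KG_def)
  have G: "lev (map_matrix real_of_int K) \<in> Gamma_S S" using K by (simp add: KG_def)
  let ?K = "map_matrix complex_of_int K"
  have cK: "cM (map_matrix real_of_int K) = ?K" by (simp add: vec_eq_iff)
  have "al f (K *v v) - al f v = 0"
  proof (rule fourier_zero)
    fix w assume w: "w \<in> half_space S"
    have Kw: "?K *v w \<in> half_space S" using SO_plusD(3)[OF Gamma_S_SO[OF G] w] by (simp add: act_lev cK)
    have "f (?K *v w) = f w" using modular[OF f G w] by (simp add: slash_def act_lev cK)
    moreover have "((\<lambda>l. al f l * fx l (?K *v w)) has_sum f (?K *v w)) UNIV"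
      by (rule al_has_sum[OF f Kw])
    ultimately have 1: "((\<lambda>l. al f l * fx l (?K *v w)) has_sum f w) UNIV" by simp
    also have "?this \<longleftrightarrow> ((\<lambda>v. al f (K *v v) * fx v w) has_sum f w) UNIV"
    proof (rule has_sum_reindex_bij_witness[where i = "\<lambda>v. K *v v" and j = "\<lambda>l. K' *v l"])
      fix l
      show 2: "K *v (K' *v l) = l" by (simp add: matrix_vector_mul_assoc K')
      have "fx (K' *v l) w = ee (bil (S0 S) (?K *v ivec (K' *v l)) (?K *v w))"
        by (simp add: fx_def KG_complex[OF K])
      also have "?K *v ivec (K' *v l) = ivec l" by (simp only: mv_ivec 2)
      finally show "al f (K *v (K' *v l)) * fx (K' *v l) w = al f l * fx l (?K *v w)"
        by (simp only: 2 fx_def)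
      show "K' *v (K *v l) = l" by (simp add: matrix_vector_mul_assoc K')
    qed auto
    finally have "((\<lambda>v. al f (K *v v) * fx v w - al f v * fx v w) has_sum (f w - f w)) UNIV"
      by (intro has_sum_diff al_has_sum[OF f w])
    thus "((\<lambda>v. (al f (K *v v) - al f v) * fx v w) has_sum 0) UNIV" by (simp add: left_diff_distrib)
  qed
  thus ?thesis by simp
qed

section \<open>Coefficients of \<open>f\<close> as divisor sums of those of
  \<open>star S f\<close>\<close>

definition ac :: "(complex^'n bord \<Rightarrow> complex) \<Rightarrow> int \<Rightarrow> complex" where
  "ac f N = al f (bvec N 0 1)"

lemma qS_0 [simp]: "qS 0 = 0" by (simp add: qS_eq_0)

lemma qS_minus: "qS (- x) = qS x"
  using two_qS[of x] two_qS[of "- x"] by (simp add: bil_uminus)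

lemma dvd_eps_iff: "d dvd eps S (ivec v) \<longleftrightarrow> d dvd cont v"
proof -
  obtain T :: "int^'n bord^'n bord" where T: "T ** S0 S = mat 1" using inverse_S0 by metis
  have "(S0 S *v ivec v :: real^'n bord) = ivec (S0 S *v v)"
    using mv_ivec[of "S0 S" v, where 'a = real] by (simp add: map_S0)
  hence "eps S (ivec v) = cont (S0 S *v v)" by (simp add: eps_def cont_def)
  moreover have "vcong (int d) (S0 S *v v) 0 \<longleftrightarrow> vcong (int d) v 0"
    using vcong_mv[of "int d" v 0 "S0 S"] vcong_mv[of "int d" "S0 S *v v" 0 T]
    by (auto simp: matrix_vector_mul_assoc T)
  ultimately show ?thesis by (simp add: dvd_cont_iff)
qed

lemma maass_modular: "f \<in> maass_space S k \<Longrightarrow> f \<in> modular_forms S k"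
  by (simp add: maass_space_def)


lemma maass_al_raw:
  assumes f: "f \<in> maass_space S k" and v: "v \<noteq> 0" "nn v"
  shows "al f v = (\<Sum>d | d dvd cont v. of_nat d powi (k - 1) *
     al f (bvec 1 (\<chi> i. mid v $ i div int d) (v $ lst_ix * v $ fst_ix div (int d)\<^sup>2)))"
proof -
  have "ivec v \<in> L0_dual S" by (simp add: L0_dual_eq)
  moreover have "(ivec v :: real^'n bord) \<noteq> 0" using v(1) by (simp add: vec_eq_iff)
  ultimately have "fourier_coeff S f (ivec v) =
        (\<Sum>d | d dvd eps S (ivec v). of_nat d powi (k - 1) *
            fourier_coeff S f
              (bvec 1 ((1 / real d) *s mid (ivec v)) (ivec v $ lst_ix * ivec v $ fst_ix / (real d)\<^sup>2)))"
    using f v(2) unfolding maass_space_def by (simp add: nonneg_ivec)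
  also have "\<dots> = (\<Sum>d | d dvd cont v. of_nat d powi (k - 1) *
     al f (bvec 1 (\<chi> i. mid v $ i div int d) (v $ lst_ix * v $ fst_ix div (int d)\<^sup>2)))"
  proof (rule sum.cong)
    fix d assume "d \<in> {d. d dvd cont v}"
    hence dv: "vcong (int d) v 0" by (simp add: dvd_cont_iff)
    hence di: "int d dvd v $ i" for i by (simp add: vcong_0)
    have d0: "d > 0"
    proof (rule ccontr)
      assume "\<not> d > 0" hence "v = 0" using di by (simp add: vec_eq_iff)
      thus False using v by simp
    qed
    have "(int d)\<^sup>2 dvd v $ lst_ix * v $ fst_ix" unfolding power2_eq_square by (intro mult_dvd_mono di)
    then obtain c where c: "v $ lst_ix * v $ fst_ix = (int d)\<^sup>2 * c" by blast
    hence "real_of_int (v $ lst_ix * v $ fst_ix) = (real d)\<^sup>2 * real_of_int c" by (simp add: power2_eq_square)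
    hence r: "real_of_int (v $ lst_ix) * real_of_int (v $ fst_ix) / (real d)\<^sup>2 = real_of_int (v $ lst_ix * v $ fst_ix div (int d)\<^sup>2)"
      using d0 c by (simp add: field_simps)
    have m: "(1 / real d) *s mid (ivec v) = (ivec (\<chi> i. mid v $ i div int d) :: real^'n)"
    proof -
      have "real_of_int (v $ i) / real d = real_of_int (v $ i div int d)" for i
        using di[of i] d0 by (auto simp: dvd_def)
      thus ?thesis by (simp add: vec_eq_iff mid_def)
    qed
    show "of_nat d powi (k - 1) * fourier_coeff S f
        (bvec 1 ((1 / real d) *s mid (ivec v)) (ivec v $ lst_ix * ivec v $ fst_ix / (real d)\<^sup>2)) =
      of_nat d powi (k - 1) * al f (bvec 1 (\<chi> i. mid v $ i div int d) (v $ lst_ix * v $ fst_ix div (int d)\<^sup>2))"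
      by (simp add: al_def m r)
  qed (simp add: dvd_eps_iff)
  finally show ?thesis by (simp add: al_def)
qed

text \<open>The isometry \<open>gz'\<close> with parameter \<open>- p\<close> moves the middle block
  into the last coordinate.\<close>

lemma al_shift: assumes f: "f \<in> modular_forms S k"
  shows "al f (bvec 1 p t) = al f (bvec 1 0 (t - qS p))"
proof -
  have "gz' (- p) (qS (- p)) *v bvec 1 p t = bvec 1 0 (t - qS p)"
    using two_qS[of p] by (simp add: gz'_mult bil_uminus qS_minus)
  thus ?thesis using al_KG[OF f gz'_KG[of "- p"], of "bvec 1 p t"] by simp
qed

lemma cont_one: "v $ i = 1 \<Longrightarrow> cont v = 1"
proof -
  assume "v $ i = 1"
  hence "int (cont v) dvd 1" using dvd_cont_iff[of "cont v" v] by (auto simp: vcong_0 dest: spec[of _ i])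
  thus ?thesis by simp
qed

text \<open>An index with last coordinate 1 has content 1, so its Maass relation has the single term
  \<open>d = 1\<close>, and this term is the flipped index.\<close>

lemma al_flip: assumes f: "f \<in> maass_space S k"
  shows "al f (bvec N p 1) = al f (bvec 1 p N)"
proof (cases "nn (bvec N p 1)")
  case True
  have "al f (bvec N p 1) = (\<Sum>d | d dvd cont (bvec N p 1). of_nat d powi (k - 1) *
     al f (bvec 1 (\<chi> i. mid (bvec N p 1) $ i div int d) (bvec N p 1 $ lst_ix * bvec N p 1 $ fst_ix div (int d)\<^sup>2)))"
    by (rule maass_al_raw[OF f _ True]) (simp add: bvec_0)
  also have "cont (bvec N p 1) = 1" by (rule cont_one[of _ lst_ix]) simp
  finally show ?thesis by simp
next
  case False
  hence "\<not> nn (bvec 1 p N)" by (auto simp: nn_def Q0_bvec)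
  thus ?thesis using False al_nn[OF maass_modular[OF f]] by simp
qed

lemma al_first: assumes f: "f \<in> maass_space S k"
  shows "al f (bvec 1 p N) = ac f (N - qS p)"
  using al_flip[OF f, of "N - qS p" 0] al_shift[OF maass_modular[OF f], of p N] by (simp add: ac_def)

lemma al_last: assumes f: "f \<in> maass_space S k"
  shows "al f (bvec N p 1) = ac f (N - qS p)"
  using al_flip[OF f] al_first[OF f] by simp

text \<open>By \<open>al_first\<close> the summand at \<open>d\<close> depends only on the norm of
  \<open>v / d\<close>, which is \<open>Q0 v / d^2\<close>.\<close>

lemma maass_al:
  assumes f: "f \<in> maass_space S k" and v: "v \<noteq> 0" "nn v"
  shows "al f v = dsum (ac f) k (cont v) (Q0 v)"
  unfolding maass_al_raw[OF assms] dsum_def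
proof (rule sum.cong[OF refl])
  fix d assume "d \<in> {d. d dvd cont v}"
  hence dv: "vcong (int d) v 0" by (simp add: dvd_cont_iff)
  hence di: "int d dvd v $ i" for i by (simp add: vcong_0)
  have d0: "d > 0"
  proof (rule ccontr)
    assume "\<not> d > 0" hence "v = 0" using di by (simp add: vec_eq_iff)
    thus False using v by simp
  qed
  define p where "p = (\<chi> i. mid v $ i div int d)"
  have p: "mid v = int d *s p" using di by (simp add: p_def vec_eq_iff mid_def)
  have "(int d)\<^sup>2 dvd v $ lst_ix * v $ fst_ix" unfolding power2_eq_square by (intro mult_dvd_mono di)
  then obtain c where c: "v $ lst_ix * v $ fst_ix = (int d)\<^sup>2 * c" by blast
  have "Q0 v = (int d)\<^sup>2 * (c - qS p)"
    unfolding Q0_def p qS_scale using c by (simp add: mult.commute algebra_simps)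
  thus "of_nat d powi (k - 1) * al f (bvec 1 (\<chi> i. mid v $ i div int d) (v $ lst_ix * v $ fst_ix div (int d)\<^sup>2)) =
     of_nat d powi (k - 1) * ac f (Q0 v div (int d)\<^sup>2)"
    unfolding p_def[symmetric] using d0 c by (simp add: al_first[OF f])
qed

lemma ac_neg: "f \<in> maass_space S k \<Longrightarrow> N < 0 \<Longrightarrow> ac f N = 0"
  unfolding ac_def by (rule al_nn[OF maass_modular]) (auto simp: nn_def)

section \<open>The coefficients of the image under the Hecke operator\<close>

lemma nbr_props:
  assumes q: "q > 0" and v: "int q dvd v $ fst_ix"
  shows "Q0 (nbr q v) = Q0 v" "nn v \<Longrightarrow> nn (nbr q v)" "v \<noteq> 0 \<Longrightarrow> nbr q v \<noteq> 0"
proof -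
  obtain s p t where V: "v = bvec s p t" by (cases v)
  obtain s' where s: "s = int q * s'" using v by (auto simp: V)
  have n: "nbr q v = bvec s' p (int q * t)" using q by (simp add: nbr_def V s)
  show Q: "Q0 (nbr q v) = Q0 v" unfolding n unfolding V s by (simp add: Q0_bvec)
  show "nn v \<Longrightarrow> nn (nbr q v)" using Q q unfolding n unfolding V s by (simp add: nn_def zero_le_mult_iff)
  show "v \<noteq> 0 \<Longrightarrow> nbr q v \<noteq> 0" using q unfolding n unfolding V s by (auto simp: bvec_0)
qed

lemma KG_cont: assumes "K \<in> KG" shows "cont (K *v v) = cont v"
proof (rule cont_eqI)
  fix d
  obtain K' where K': "K' ** K = mat 1" using assms by (auto simp: KG_def)
  show "vcong (int d) (K *v v) 0 \<longleftrightarrow> d dvd cont v"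
    unfolding dvd_cont_iff using vcong_mv[of "int d" v 0 K] vcong_mv[of "int d" "K *v v" 0 K']
    by (auto simp: matrix_vector_mul_assoc K')
qed

lemma cont_bvec_cong:
  assumes "\<And>d. (int d dvd s \<and> vcong (int d) p 0 \<and> int d dvd t) \<longleftrightarrow> d = 1"
  shows "cont (bvec s p t) = 1"
  by (rule cont_eqI) (use assms in \<open>simp add: bvec_0 vcong_bvec\<close>)

text \<open>Passing to the neighbour changes the content only at \<open>q\<close> and by at most one
  factor: it is divided by \<open>q\<close>, kept, or multiplied by \<open>q\<close>. Divisors prime
  to \<open>q\<close> do not notice the change; in the last case a factor \<open>q\<close> splits
  off and what remains is again primitive.\<close>

lemma nbr_cont:
  assumes q: "prime (q::nat)" and u: "cont (bvec s p t) = 1"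
  shows "\<not> int q dvd s \<Longrightarrow> cont (nbr q (int (q * e) *s bvec s p t)) = e"
    and "int q dvd s \<Longrightarrow> \<not> ((int q)\<^sup>2 dvd s \<and> vcong (int q) p 0) \<Longrightarrow> cont (nbr q (int e *s bvec s p t)) = e"
    and "(int q)\<^sup>2 dvd s \<Longrightarrow> vcong (int q) p 0 \<Longrightarrow> cont (nbr q (int e *s bvec s p t)) = q * e"
proof -
  have q0: "q > 0" using prime_gt_0_nat[OF q] .
  have qp: "prime (int q)" using q by simp
  have u1: "int d dvd s \<Longrightarrow> vcong (int d) p 0 \<Longrightarrow> int d dvd t \<Longrightarrow> d = 1" for d
    using dvd_cont_iff[of d "bvec s p t"] u by (simp add: bvec_0 vcong_bvec)
  have vs: "vcong (int d) (c *s x) 0 \<longleftrightarrow> vcong (int d) x 0" if "coprime (int d) c" for d c and x :: "int^'n"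
    using that by (simp add: vcong_0 coprime_dvd_mult_right_iff)
  have one: "int d dvd 1 \<longleftrightarrow> d = 1" for d by simp
  {
    assume s: "\<not> int q dvd s"
    have "cont (bvec s (int q *s p) ((int q)\<^sup>2 * t)) = 1"
    proof (rule cont_bvec_cong, rule iffI)
      fix d assume d: "int d dvd s \<and> vcong (int d) (int q *s p) 0 \<and> int d dvd (int q)\<^sup>2 * t"
      have "\<not> q dvd d" using d s by (meson dvd_trans int_dvd_int_iff)
      hence c: "coprime (int d) (int q)" using q by (metis coprime_commute prime_imp_coprime coprime_int_iff)
      have "vcong (int d) p 0" using d vs[OF c] by blast
      moreover have "int d dvd t" using d c by (simp add: coprime_dvd_mult_right_iff)
      ultimately show "d = 1" using u1 d by blast
    qed (simp add: vcong_0)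
    moreover have "nbr q (int (q * e) *s bvec s p t) = int e *s bvec s (int q *s p) ((int q)\<^sup>2 * t)"
    proof -
      have "int (q * e) *s p = int e *s (int q *s p)" by (simp add: vec_eq_iff)
      thus ?thesis using q0 by (simp add: nbr_def bvec_scale power2_eq_square)
    qed
    ultimately show "cont (nbr q (int (q * e) *s bvec s p t)) = e" by (simp only: cont_scale mult_1_right)
  }
  {
    assume s: "int q dvd s" and n: "\<not> ((int q)\<^sup>2 dvd s \<and> vcong (int q) p 0)"
    obtain s' where s': "s = int q * s'" using s by blast
    have "cont (bvec s' p (int q * t)) = 1"
    proof (rule cont_bvec_cong, rule iffI)
      fix d assume d: "int d dvd s' \<and> vcong (int d) p 0 \<and> int d dvd int q * t"
      have "\<not> q dvd d"
      proof
        assume "q dvd d"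
        hence "int q dvd s'" "vcong (int q) p 0" using d by (auto simp: vcong_0 intro: dvd_trans[of "int q" "int d"])
        thus False using n by (simp add: s' power2_eq_square)
      qed
      hence c: "coprime (int d) (int q)" using q by (metis coprime_commute prime_imp_coprime coprime_int_iff)
      have "int d dvd t" using d c by (simp add: coprime_dvd_mult_right_iff)
      thus "d = 1" using u1[of d] d by (simp add: s')
    qed (simp add: vcong_0)
    moreover have "nbr q (int e *s bvec s p t) = int e *s bvec s' p (int q * t)"
      using q0 by (simp add: nbr_def bvec_scale s' mult.left_commute)
    ultimately show "cont (nbr q (int e *s bvec s p t)) = e" by (simp only: cont_scale mult_1_right)
  }
  {
    assume s: "(int q)\<^sup>2 dvd s" and p: "vcong (int q) p 0"
    obtain c where "s = (int q)\<^sup>2 * c" using s by blast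
    then obtain s' where s': "s = int q * (int q * s')" by (metis power2_eq_square mult.assoc)
    obtain p' where p': "p = int q *s p'"
    proof -
      have "\<exists>c. p $ i = int q * c" for i using p by (simp add: vcong_0 dvd_def)
      then obtain c where "\<And>i. p $ i = int q * c i" by metis
      thus ?thesis by (intro that[of "\<chi> i. c i"]) (simp add: vec_eq_iff)
    qed
    have nt: "\<not> int q dvd t" using u1[of q] p prime_gt_1_nat[OF q] by (auto simp: s')
    have "cont (bvec s' p' t) = 1"
    proof (rule cont_bvec_cong, rule iffI)
      fix d assume d: "int d dvd s' \<and> vcong (int d) p' 0 \<and> int d dvd t"
      thus "d = 1" using u1[of d] by (simp add: s' p' vcong_0)
    qed (simp add: vcong_0)
    moreover have "nbr q (int e *s bvec s p t) = int (q * e) *s bvec s' p' t"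
    proof -
      have "int e *s p = int (q * e) *s p'" by (simp add: p' vec_eq_iff)
      thus ?thesis using q0 by (simp add: nbr_def bvec_scale s' mult.left_commute mult.assoc)
    qed
    ultimately show "cont (nbr q (int e *s bvec s p t)) = q * e" by (simp only: cont_scale mult_1_right)
  }
qed

text \<open>The vectors \<open>y\<close> that have \<open>v\<close> as a multiple are the unit
  multiples of the reduction of \<open>v\<close>; this is \<open>fibre_card\<close> with first
  component 0.\<close>

lemma card_line:
  assumes q: "prime (q::nat)" and v: "\<not> vcong (int q) v 0" "int q dvd Q0 v"
  shows "card {y \<in> Yq q. \<exists>c. vcong (int q) v (c *s y)} = q - 1"
proof -
  have q0: "q > 0" using prime_gt_0_nat[OF q] .
  let ?r = "red q v"
  have rY: "?r \<in> Yq q"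
  proof -
    have "?r \<noteq> 0" using v(1) red_cong[of q v] vcong_sym by metis
    moreover have "int q dvd Q0 ?r" using v(2) Q0_cong[OF red_cong[of q v]] by (metis dvd_add diff_add_cancel)
    ultimately show ?thesis using red_box[OF q0] by (simp add: Yq_def)
  qed
  let ?F = "{p \<in> {0..<int q} \<times> Yq q. \<exists>t. \<not> int q dvd t \<and> int q dvd fst p - t * 0 \<and> vcong (int q) (snd p) (t *s ?r)}"
  have "bij_betw (\<lambda>y. (0::int, y)) {y \<in> Yq q. \<exists>c. vcong (int q) v (c *s y)} ?F"
  proof (rule bij_betw_imageI)
    show "(\<lambda>y. (0::int, y)) ` {y \<in> Yq q. \<exists>c. vcong (int q) v (c *s y)} = ?F"
    proof (intro equalityI subsetI)
      fix p assume "p \<in> (\<lambda>y. (0::int, y)) ` {y \<in> Yq q. \<exists>c. vcong (int q) v (c *s y)}"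
      then obtain y c where y: "p = (0, y)" "y \<in> Yq q" "vcong (int q) v (c *s y)" by blast
      have "\<not> int q dvd c"
      proof
        assume "int q dvd c"
        hence "vcong (int q) (c *s y) 0" by (simp add: vcong_0)
        thus False using v(1) y(3) vcong_trans by blast
      qed
      then obtain c' where c': "int q dvd c' * c - 1" "\<not> int q dvd c'" using unit_inverse_mod[OF q] by blast
      have "vcong (int q) (c' *s ?r) (c' *s (c *s y))" using y(3) red_cong vcong_trans by (blast intro: vcong_scale)
      moreover have "c' *s (c *s y) = (c' * c) *s y" by (simp add: vec_eq_iff)
      moreover have "vcong (int q) ((c' * c) *s y) (1 *s y)" by (rule vcong_scale_left[OF c'(1)])
      ultimately have "vcong (int q) (c' *s ?r) y" using vcong_trans by (metis vector_smult_lid)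
      hence "vcong (int q) y (c' *s ?r)" by (rule vcong_sym)
      thus "p \<in> ?F" using y c'(2) q0 by auto
    next
      fix p assume p: "p \<in> ?F"
      then obtain t where t: "\<not> int q dvd t" "int q dvd fst p - t * 0" "vcong (int q) (snd p) (t *s ?r)" by blast
      have "fst p = 0"
      proof -
        have "fst p mod int q = 0" using t(2) by simp
        moreover have "0 \<le> fst p" "fst p < int q" using p by auto
        hence "fst p mod int q = fst p" by (rule mod_pos_pos_trivial)
        ultimately show ?thesis by simp
      qed
      moreover obtain t' where t': "int q dvd t' * t - 1" using unit_inverse_mod[OF q t(1)] by blast
      have "vcong (int q) (t' *s snd p) (t' *s (t *s ?r))" using t(3) by (rule vcong_scale)
      moreover have "t' *s (t *s ?r) = (t' * t) *s ?r" by (simp add: vec_eq_iff)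
      moreover have "vcong (int q) ((t' * t) *s ?r) (1 *s ?r)" by (rule vcong_scale_left[OF t'(1)])
      ultimately have "vcong (int q) (t' *s snd p) v" using vcong_trans red_cong by (metis vector_smult_lid)
      hence "vcong (int q) v (t' *s snd p)" by (rule vcong_sym)
      thus "p \<in> (\<lambda>y. (0::int, y)) ` {y \<in> Yq q. \<exists>c. vcong (int q) v (c *s y)}"
        using p \<open>fst p = 0\<close> by (metis (no_types, lifting) imageI mem_Collect_eq mem_Sigma_iff prod.collapse)
    qed
  qed (auto intro: inj_onI)
  hence "card {y \<in> Yq q. \<exists>c. vcong (int q) v (c *s y)} = card ?F" by (rule bij_betw_same_card)
  also have "\<dots> = q - 1" using q0 by (intro fibre_card[OF q _ rY]) simp
  finally show ?thesis .
qed

text \<open>Write \<open>K y v0 = (s0, p0, t0)\<close>. Up to a unit, \<open>s0\<close> is the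
  pairing of \<open>v0\<close> with \<open>y\<close>. So the cases of \<open>nbr_cont\<close>
  become: \<open>y\<close> not orthogonal to \<open>v0\<close>; \<open>y\<close> orthogonal without
  further condition; \<open>v0\<close> on the line of \<open>y\<close> and \<open>q^2\<close>
  dividing \<open>Q0 v0\<close>. These classes have sizes \<open>card (Yq q) - V\<close>,
  \<open>V - C\<close> and \<open>C\<close>, and on each of them the content of the neighbour is
  constant.\<close>

lemma neighbour_sum:
  assumes f: "f \<in> maass_space S k" and q: "prime (q::nat)" and g: "good_sel q K x"
    and v: "nn v" "v = int e *s v0" "cont v0 = 1" "e > 0"
  defines "V \<equiv> card {y \<in> Yq q. int q dvd bil (S0 S) v0 y}"
    and "C \<equiv> (if (int q)\<^sup>2 dvd Q0 v0 then q - 1 else 0)"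
  shows "(\<Sum>y\<in>Yq q. if int q dvd (K y *v v) $ fst_ix then al f (nbr q (K y *v v)) else 0) =
     (of_nat (card (Yq q)) - of_nat V) * (if q dvd e then dsum (ac f) k (e div q) (Q0 v) else 0)
     + (of_nat V - of_nat C) * dsum (ac f) k e (Q0 v) + of_nat C * dsum (ac f) k (q * e) (Q0 v)"
proof -
  have q0: "q > 0" using prime_gt_0_nat[OF q] .
  have qp: "prime (int q)" using q by simp
  have v0: "v0 \<noteq> 0"
  proof
    assume "v0 = 0"
    hence "cont v0 = 0" by (simp add: cont_eq_0_iff)
    thus False using v(3) by simp
  qed
  have vn: "v \<noteq> 0" using v0 v(2,4) by (auto simp: vec_eq_iff)
  have nv0: "\<not> vcong (int q) v0 0" using v(3) dvd_cont_iff[of q v0] prime_gt_1_nat[OF q] by auto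
  define YV where "YV = {y \<in> Yq q. int q dvd bil (S0 S) v0 y}"
  define YC where "YC = {y \<in> Yq q. (int q)\<^sup>2 dvd Q0 v0 \<and> (\<exists>c. vcong (int q) v0 (c *s y))}"
  have cardC: "card YC = C"
  proof (cases "(int q)\<^sup>2 dvd Q0 v0")
    case True
    hence "int q dvd Q0 v0" by (metis dvd_mult_left power2_eq_square)
    thus ?thesis using True card_line[OF q nv0] by (simp add: YC_def C_def)
  qed (simp add: YC_def C_def)
  define trm where "trm = (\<lambda>y. if int q dvd (K y *v v) $ fst_ix then al f (nbr q (K y *v v)) else 0)"
  have sub: "YC \<subseteq> YV \<and> YV \<subseteq> Yq q \<and> (\<forall>y\<in>Yq q. trm y =
     (if y \<in> YC then dsum (ac f) k (q * e) (Q0 v) else if y \<in> YV then dsum (ac f) k e (Q0 v)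
      else if q dvd e then dsum (ac f) k (e div q) (Q0 v) else 0))"
  proof -
    have main: "(y \<in> YC \<longrightarrow> y \<in> YV) \<and> trm y =
     (if y \<in> YC then dsum (ac f) k (q * e) (Q0 v) else if y \<in> YV then dsum (ac f) k e (Q0 v)
      else if q dvd e then dsum (ac f) k (e div q) (Q0 v) else 0)" if y: "y \<in> Yq q" for y
    proof -
      obtain t where t: "K y \<in> KG" "\<not> int q dvd t" "vcong (int q) (K y *v y) (t *s bvec 0 0 1)"
        using g y unfolding good_sel_def by blast
      obtain K' where K': "K' ** K y = mat 1" "K y ** K' = mat 1" using t(1) by (auto simp: KG_def)
      obtain t' where t': "int q dvd t' * t - 1" "\<not> int q dvd t'" using unit_inverse_mod[OF q t(2)] by blast
      obtain s0 p0 t0 where u: "K y *v v0 = bvec s0 p0 t0" by (cases "K y *v v0")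
      have c1: "cont (bvec s0 p0 t0) = 1" using KG_cont[OF t(1), of v0] v(3) by (simp add: u)
      have Kv: "K y *v v = int e *s bvec s0 p0 t0" unfolding v(2) mv_scale u ..
      have nK: "nn (K y *v v)" using t(1) v(1) by (auto simp: KG_def)
      have Kn: "K y *v v \<noteq> 0"
      proof
        assume "K y *v v = 0"
        hence "K' *v (K y *v v) = 0" by simp
        thus False using vn by (simp add: matrix_vector_mul_assoc K')
      qed
      have QK: "Q0 (K y *v v) = Q0 v" by (rule KG_Q0[OF t(1)])
      have QQ: "s0 * t0 - qS p0 = Q0 v0" using KG_Q0[OF t(1), of v0] by (simp add: u Q0_bvec)
      have inV: "y \<in> YV \<longleftrightarrow> int q dvd s0"
      proof -
        have d': "int q dvd bil (S0 S) (K y *v v0) (K y *v y) - bil (S0 S) (K y *v v0) (t *s bvec 0 0 1)"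
          by (rule vcong_bil[OF t(3)])
        have d: "int q dvd bil (S0 S) v0 y - t * s0"
        proof -
          have "bil (S0 S) (K y *v v0) (t *s bvec 0 0 1) = t * s0" unfolding u by (simp add: bil_simps bil_S0)
          thus ?thesis using d' by (simp only: KG_bil[OF t(1)])
        qed
        have "int q dvd bil (S0 S) v0 y \<longleftrightarrow> int q dvd t * s0" using d by (metis dvd_diff_commute dvd_diff_right_iff dvd_diff_left_iff)
        also have "\<dots> \<longleftrightarrow> int q dvd s0" using qp t(2) by (simp add: prime_dvd_mult_iff)
        finally show ?thesis using y by (simp add: YV_def)
      qed
      have line: "(\<exists>c. vcong (int q) v0 (c *s y)) \<longleftrightarrow> int q dvd s0 \<and> vcong (int q) p0 0"
      proof
        assume "\<exists>c. vcong (int q) v0 (c *s y)"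
        then obtain c where c: "vcong (int q) v0 (c *s y)" by blast
        have "vcong (int q) (bvec s0 p0 t0) (c *s (K y *v y))"
          using vcong_mv[OF c, of "K y"] by (simp add: u mv_scale)
        hence "vcong (int q) (bvec s0 p0 t0) (c *s (t *s bvec 0 0 1))"
          using vcong_scale[OF t(3), of c] vcong_trans by blast
        thus "int q dvd s0 \<and> vcong (int q) p0 0" by (simp add: bvec_scale vcong_bvec)
      next
        assume a: "int q dvd s0 \<and> vcong (int q) p0 0"
        have "vcong (int q) (bvec s0 p0 t0) (t0 *s bvec 0 0 1)" using a by (simp add: bvec_scale vcong_bvec)
        moreover have "vcong (int q) (t0 *s bvec 0 0 1) ((t0 * t') *s (K y *v y))"
        proof -
          have "vcong (int q) ((t0 * t') *s (K y *v y)) ((t0 * t') *s (t *s bvec 0 0 1))" by (rule vcong_scale[OF t(3)])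
          moreover have "vcong (int q) ((t0 * t') *s (t *s bvec 0 0 1)) (t0 *s bvec 0 0 (1::int) :: int^'n bord)"
          proof -
            have "t0 * t' * t - t0 = t0 * (t' * t - 1)" by (simp add: algebra_simps)
            hence "int q dvd t0 * t' * t - t0" using t'(1) by simp
            thus ?thesis by (simp add: bvec_scale vcong_bvec)
          qed
          ultimately show ?thesis using vcong_trans vcong_sym by blast
        qed
        ultimately have "vcong (int q) (K y *v v0) (K y *v ((t0 * t') *s y))"
          unfolding u mv_scale using vcong_trans by blast
        from vcong_mv[OF this, of K'] show "\<exists>c. vcong (int q) v0 (c *s y)"
          by (auto simp: matrix_vector_mul_assoc K')
      qed
      have sq: "(int q)\<^sup>2 dvd qS p0" if "vcong (int q) p0 0"
      proof -
        have "\<exists>c. p0 $ i = int q * c" for i using that by (simp add: vcong_0 dvd_def)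
        then obtain c where "\<And>i. p0 $ i = int q * c i" by metis
        hence "p0 = int q *s (\<chi> i. c i)" by (simp add: vec_eq_iff)
        thus ?thesis by (simp add: qS_scale)
      qed
      \<comment> \<open>Here \<open>Q0 v0 = s0 t0 - qS p0\<close> and \<open>q^2\<close> divides
        \<open>qS p0\<close>. As \<open>v0\<close> is primitive, \<open>t0\<close> is a unit, so
        divisibility of the norm by \<open>q^2\<close> passes to \<open>s0\<close>.\<close>
      have inC: "y \<in> YC \<longleftrightarrow> (int q)\<^sup>2 dvd s0 \<and> vcong (int q) p0 0"
      proof
        assume "y \<in> YC"
        hence a: "(int q)\<^sup>2 dvd Q0 v0" "int q dvd s0" "vcong (int q) p0 0" using line by (auto simp: YC_def)
        have "(int q)\<^sup>2 dvd s0 * t0" using a(1) sq[OF a(3)] QQ by (metis dvd_add diff_add_cancel)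
        moreover have "\<not> int q dvd t0"
        proof
          assume "int q dvd t0"
          hence "vcong (int q) (bvec s0 p0 t0) 0" using a by (simp add: bvec_0 vcong_bvec)
          hence "q dvd 1" using c1 dvd_cont_iff by metis
          thus False using q by simp
        qed
        hence "coprime ((int q)\<^sup>2) t0" using qp by (simp add: prime_imp_coprime)
        ultimately show "(int q)\<^sup>2 dvd s0 \<and> vcong (int q) p0 0" using a by (simp add: coprime_dvd_mult_left_iff)
      next
        assume a: "(int q)\<^sup>2 dvd s0 \<and> vcong (int q) p0 0"
        have "(int q)\<^sup>2 dvd s0 * t0 - qS p0" using a sq by (intro dvd_diff) auto
        moreover have "int q dvd s0" using a by (metis dvd_mult_left power2_eq_square)
        ultimately show "y \<in> YC" using y a line QQ by (simp add: YC_def)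
      qed
      have CV: "y \<in> YC \<longrightarrow> y \<in> YV" unfolding inC inV by (metis dvd_mult_left power2_eq_square)
      have tm: "trm y = dsum (ac f) k (cont (nbr q (K y *v v))) (Q0 v)" if d: "int q dvd (K y *v v) $ fst_ix"
        using d nbr_props[OF q0 d] nK Kn QK by (simp add: trm_def maass_al[OF f])
      consider "y \<in> YC" | "y \<notin> YC" "y \<in> YV" | "y \<notin> YC" "y \<notin> YV" by blast
      thus ?thesis
      proof cases
        case 1
        have "int q dvd (K y *v v) $ fst_ix" using 1 CV inV by (simp add: Kv)
        moreover have "cont (nbr q (K y *v v)) = q * e" unfolding Kv using 1 inC by (intro nbr_cont(3)[OF q c1]) auto
        ultimately show ?thesis using 1 CV tm by simp
      next
        case 2
        have "int q dvd (K y *v v) $ fst_ix" using 2 inV by (simp add: Kv)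
        moreover have "cont (nbr q (K y *v v)) = e" unfolding Kv using 2 inC inV by (intro nbr_cont(2)[OF q c1]) auto
        ultimately show ?thesis using 2 tm by simp
      next
        case 3
        show ?thesis
        proof (cases "q dvd e")
          case True
          then obtain e' where e': "e = q * e'" by blast
          have "int q dvd (K y *v v) $ fst_ix" by (simp add: Kv e')
          moreover have "cont (nbr q (K y *v v)) = e'" unfolding Kv e' using 3 inV by (intro nbr_cont(1)[OF q c1]) auto
          ultimately show ?thesis using 3 tm e' q0 by simp
        next
          case False
          have "\<not> int q dvd (K y *v v) $ fst_ix" using 3 False inV qp by (simp add: Kv prime_dvd_mult_iff)
          thus ?thesis using 3 False by (simp add: trm_def)
        qed
      qed
    qed
    have "YC \<subseteq> YV" using main by (auto simp: YC_def)
    moreover have "YV \<subseteq> Yq q" by (auto simp: YV_def)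
    ultimately show ?thesis using main by blast
  qed
  let ?D2 = "dsum (ac f) k (q * e) (Q0 v)" and ?D1 = "dsum (ac f) k e (Q0 v)"
    and ?D0 = "if q dvd e then dsum (ac f) k (e div q) (Q0 v) else 0"
  have s1: "YC \<subseteq> YV" using sub by (rule conjunct1)
  have s2: "YV \<subseteq> Yq q" using sub[THEN conjunct2] by (rule conjunct1)
  have fin: "finite YV" "finite YC"
    using finite_subset[OF s2 finite_Yq] finite_subset[OF s1] by auto
  have "sum trm (Yq q) = sum trm (Yq q - YV) + sum trm (YV - YC) + sum trm YC"
    unfolding sum.subset_diff[OF s2 finite_Yq] sum.subset_diff[OF s1 fin(1)] by (simp only: add.assoc)
  also have "sum trm (Yq q - YV) = (\<Sum>y\<in>Yq q - YV. ?D0)" using sub by (intro sum.cong) auto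
  also have "sum trm (YV - YC) = (\<Sum>y\<in>YV - YC. ?D1)" using sub by (intro sum.cong) auto
  also have "sum trm YC = (\<Sum>y\<in>YC. ?D2)" using sub by (intro sum.cong) auto
  finally have "sum trm (Yq q) = of_nat (card (Yq q - YV)) * ?D0 + of_nat (card (YV - YC)) * ?D1 + of_nat (card YC) * ?D2"
    by simp
  moreover have "(of_nat (card (Yq q - YV)) :: complex) = of_nat (card (Yq q)) - of_nat V"
    using s2 fin by (simp add: card_Diff_subset V_def YV_def[symmetric] of_nat_diff card_mono)
  moreover have "(of_nat (card (YV - YC)) :: complex) = of_nat V - of_nat C"
    using card_mono[OF fin(1) s1] s1 fin cardC by (simp add: card_Diff_subset V_def YV_def[symmetric] of_nat_diff card_mono)
  ultimately show ?thesis unfolding trm_def using cardC by simp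
qed

text \<open>The difference of the two eigenvalues: the weighted number of isotropic vectors, minus
  the middle coefficient that \<open>bfun\<close> already contains.\<close>

definition b0 :: "int \<Rightarrow> nat \<Rightarrow> nat \<Rightarrow> complex" where
  "b0 k q m = of_nat q powi (1 - k) / of_nat (q - 1) * of_nat (card (Yq q)) - of_nat q powi (1 - (k - int m))"

text \<open>Split the content as \<open>q^j e'\<close>. The divisors \<open>d\<close> of
  \<open>e'\<close> are passive parameters, and for each of them the claim is
  \<open>hecke_recursion\<close> for the values \<open>a (q^(2 i) M d)\<close>. The two counts are
  used only in the equation for \<open>w A\<close>.\<close>

lemma beta_formula:
  assumes f: "f \<in> maass_space S k" and q: "prime (q::nat)" and g: "good_sel q K x"
    and v: "nn v" "v \<noteq> 0" and n: "CARD('n) = 2 * m"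
    and cY: "card (Yq q) + 1 = q ^ (2 * m + 1) + (q - 1) * q ^ m"
    and cV: "\<And>v0. \<not> vcong (int q) v0 0 \<Longrightarrow>
       card {y \<in> Yq q. int q dvd bil (S0 S) v0 y} + 1 = q ^ (2 * m) + (if int q dvd Q0 v0 then (q - 1) * q ^ m else 0)"
  shows "beta k q K f v = dsum (bfun (k - int m) q (ac f)) k (cont v) (Q0 v) + b0 k q m * al f v"
proof -
  have q0: "q > 0" using prime_gt_0_nat[OF q] .
  have q1: "q > 1" using prime_gt_1_nat[OF q] .
  have qc: "(of_nat q :: complex) \<noteq> 0" using q0 by simp
  obtain v0 where v0: "v = int (cont v) *s v0" "cont v0 = 1" by (rule cont_decomp[OF v(2)])
  define e where "e = cont v"
  have e0: "e > 0" using v(2) cont_eq_0_iff by (auto simp: e_def)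
  obtain j e' where je: "e = q ^ j * e'" "\<not> q dvd e'"
  proof -
    have "\<not> is_unit q" using q by auto
    then obtain e' where "e = q ^ multiplicity q e * e'" "\<not> q dvd e'"
      using e0 multiplicity_decompose'[of e q] by blast
    thus ?thesis using that by blast
  qed
  have v0': "v = int e *s v0" using v0 by (simp add: e_def)
  define N where "N = Q0 v"
  define N0 where "N0 = Q0 v0"
  have N: "N = (int e)\<^sup>2 * N0" by (simp add: N_def N0_def v0' Q0_scale)
  have nv0: "\<not> vcong (int q) v0 0" using v0(2) dvd_cont_iff[of q v0] q1 by auto
  define xx where "xx = (of_nat q :: complex) powi (k - 1)"
  define a where "a = ac f"
  define V where "V = card {y \<in> Yq q. int q dvd bil (S0 S) v0 y}"
  define C where "C = (if (int q)\<^sup>2 dvd Q0 v0 then q - 1 else 0)"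
  define w where "w = (of_nat q :: complex) powi (1 - k) / of_nat (q - 1)"
  define yy where "yy = (of_nat q :: complex) powi (1 - (k - int m))"
  define zz where "zz = (of_nat q :: complex) powi (2 - 2 * (k - int m))"
  define A where "A = (of_nat (card (Yq q)) :: complex) - of_nat V"
  let ?D = "{d. d dvd e'}"
  define M where "M = (\<lambda>d. (int (e' div d))\<^sup>2 * N0)"
  define X where "X = (\<lambda>d i. a ((int q) ^ (2 * i) * M d))"
  \<comment> \<open>The default 0 applies if \<open>M d / q^2\<close> is not integral. Since
    \<open>e' / d\<close> is prime to \<open>q\<close>, which case holds depends on
    \<open>N0\<close> alone.\<close>
  define Xm where "Xm = (\<lambda>d. if (int q)\<^sup>2 dvd M d then a (M d div (int q)\<^sup>2) else 0)"
  have divX: "(int (q ^ (i + r)))\<^sup>2 * (int e')\<^sup>2 * N0 div (int (q ^ i * d))\<^sup>2 = (int q) ^ (2 * r) * M d" if dd: "d dvd e'" for i r d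
  proof -
    obtain c where c: "e' = d * c" using dd by blast
    have d0: "d > 0" using je e0 c by (auto intro: Nat.gr0I)
    have "(int (q ^ (i + r)))\<^sup>2 * (int e')\<^sup>2 * N0 = (int (q ^ i * d))\<^sup>2 * ((int q) ^ (2 * r) * ((int c)\<^sup>2 * N0))"
      by (simp add: c power_mult_distrib power_add algebra_simps flip: power_mult)
    moreover have "(int (q ^ i * d))\<^sup>2 \<noteq> 0" using q0 d0 by simp
    ultimately have "(int (q ^ (i + r)))\<^sup>2 * (int e')\<^sup>2 * N0 div (int (q ^ i * d))\<^sup>2 = (int q) ^ (2 * r) * ((int c)\<^sup>2 * N0)"
      by (simp only: nonzero_mult_div_cancel_left not_False_eq_True)
    thus ?thesis using d0 by (simp add: M_def c)
  qed
  have N': "N = (int (q ^ j))\<^sup>2 * (int e')\<^sup>2 * N0" by (simp add: N je power_mult_distrib)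
  have Mq: "int q dvd M d \<longleftrightarrow> int q dvd N0" "(int q)\<^sup>2 dvd M d \<longleftrightarrow> (int q)\<^sup>2 dvd N0" if dd: "d dvd e'" for d
  proof -
    obtain c where c: "e' = d * c" using dd by blast
    have d0: "d > 0" using je e0 c by (auto intro: Nat.gr0I)
    have "\<not> q dvd c" using je(2) c by auto
    hence "coprime (int q) (int c)" using q by (metis coprime_int_iff prime_imp_coprime)
    hence cp: "coprime (int q) ((int c)\<^sup>2)" "coprime ((int q)\<^sup>2) ((int c)\<^sup>2)" by simp_all
    have "M d = (int c)\<^sup>2 * N0" using d0 by (simp add: M_def c)
    thus "int q dvd M d \<longleftrightarrow> int q dvd N0" "(int q)\<^sup>2 dvd M d \<longleftrightarrow> (int q)\<^sup>2 dvd N0"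
      using cp by (simp_all add: coprime_dvd_mult_right_iff)
  qed
  have sumX: "(\<Sum>i\<le>j. xx ^ i * h (N div (int (q ^ i * d))\<^sup>2)) = (\<Sum>i\<le>j. xx ^ i * h ((int q) ^ (2 * (j - i)) * M d))"
    if d: "d dvd e'" for d and h :: "int \<Rightarrow> complex"
  proof (rule sum.cong[OF refl])
    fix i assume "i \<in> {..j}"
    hence "N = (int (q ^ (i + (j - i))))\<^sup>2 * (int e')\<^sup>2 * N0" by (simp add: N')
    thus "xx ^ i * h (N div (int (q ^ i * d))\<^sup>2) = xx ^ i * h ((int q) ^ (2 * (j - i)) * M d)"
      by (simp only: divX[OF d])
  qed
  have L1: "dsum h k e N = (\<Sum>d\<in>?D. of_nat d powi (k - 1) * (\<Sum>i\<le>j. xx ^ i * h ((int q) ^ (2 * (j - i)) * M d)))" for h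
    unfolding je(1) dsum_prime_power[OF q je(2)] xx_def[symmetric]
    by (rule sum.cong[OF refl]) (simp only: sumX mem_Collect_eq)
  have L1a: "dsum a k e N = (\<Sum>d\<in>?D. of_nat d powi (k - 1) * (\<Sum>i\<le>j. xx ^ i * X d (j - i)))"
    unfolding L1 X_def ..
  have L0: "(if q dvd e then dsum a k (e div q) N else 0) = (\<Sum>d\<in>?D. of_nat d powi (k - 1) * (\<Sum>i<j. xx ^ i * X d (j - i)))"
  proof (cases j)
    case 0 thus ?thesis using je by simp
  next
    case (Suc l)
    have ed: "q dvd e" "e div q = q ^ l * e'" using q0 by (simp_all add: je Suc)
    have "dsum a k (q ^ l * e') N = (\<Sum>d\<in>?D. of_nat d powi (k - 1) * (\<Sum>i\<le>l. xx ^ i * X d (j - i)))"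
      unfolding dsum_prime_power[OF q je(2)] xx_def[symmetric]
    proof (intro sum.cong refl arg_cong2[of _ _ _ _ "(*)"])
      fix d i assume d: "d \<in> ?D" and i: "i \<in> {..l}"
      hence "N = (int (q ^ (i + (j - i))))\<^sup>2 * (int e')\<^sup>2 * N0" by (simp add: N' Suc)
      thus "a (N div (int (q ^ i * d))\<^sup>2) = X d (j - i)" using d by (simp only: divX X_def mem_Collect_eq)
    qed
    thus ?thesis using ed by (simp add: Suc lessThan_Suc_atMost)
  qed
  have Lm: "(if vcong (int q) v 0 then al f (vdiv q v) else 0) = (\<Sum>d\<in>?D. of_nat d powi (k - 1) * (\<Sum>i<j. xx ^ i * X d (j - 1 - i)))"
  proof (cases j)
    case 0
    have "\<not> q dvd cont v" using je 0 by (simp add: e_def)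
    thus ?thesis using 0 by (simp add: dvd_cont_iff)
  next
    case (Suc l)
    have "q dvd cont v" unfolding e_def[symmetric] je Suc by simp
    hence vc: "vcong (int q) v 0" by (simp add: dvd_cont_iff)
    have vd: "vdiv q v = int (q ^ l * e') *s v0"
      using q0 by (simp add: vdiv_def v0' je Suc vec_eq_iff)
    have v1: "v = int q *s vdiv q v" using vc by (simp add: vdiv_def vec_eq_iff vcong_0)
    have Q: "Q0 (vdiv q v) = (int (q ^ l))\<^sup>2 * (int e')\<^sup>2 * N0"
      by (simp add: vd Q0_scale N0_def power_mult_distrib)
    have nnv: "nn (vdiv q v)"
    proof -
      have "Q0 v = (int q)\<^sup>2 * Q0 (vdiv q v)" using v1 Q0_scale by metis
      moreover have "v $ i = int q * vdiv q v $ i" for i using v1 by (metis vector_smult_component)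
      ultimately show ?thesis using v(1) q0 unfolding nn_def by (simp add: zero_le_mult_iff)
    qed
    have "vdiv q v \<noteq> 0" using v(2) v1 by (metis vector_smult_rzero)
    moreover have "cont (vdiv q v) = q ^ l * e'" using v0(2) by (simp only: vd cont_scale mult_1_right)
    ultimately have "al f (vdiv q v) = dsum a k (q ^ l * e') (Q0 (vdiv q v))"
      using maass_al[OF f _ nnv] by (simp add: a_def)
    also have "\<dots> = (\<Sum>d\<in>?D. of_nat d powi (k - 1) * (\<Sum>i\<le>l. xx ^ i * X d (l - i)))"
      unfolding dsum_prime_power[OF q je(2)] xx_def[symmetric]
    proof (intro sum.cong refl arg_cong2[of _ _ _ _ "(*)"])
      fix d i assume d: "d \<in> ?D" and i: "i \<in> {..l}"
      hence "Q0 (vdiv q v) = (int (q ^ (i + (l - i))))\<^sup>2 * (int e')\<^sup>2 * N0" by (simp add: Q)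
      thus "a (Q0 (vdiv q v) div (int (q ^ i * d))\<^sup>2) = X d (l - i)" using d by (simp only: divX X_def mem_Collect_eq)
    qed
    finally show ?thesis using vc by (simp add: Suc lessThan_Suc_atMost)
  qed
  have Lp: "al f (int q *s v) = (\<Sum>d\<in>?D. of_nat d powi (k - 1) * (\<Sum>i\<le>Suc j. xx ^ i * X d (Suc j - i)))"
  proof -
    have Q: "Q0 (int q *s v) = (int (q ^ Suc j))\<^sup>2 * (int e')\<^sup>2 * N0"
      unfolding Q0_scale N_def[symmetric] N' by (simp add: power2_eq_square algebra_simps)
    have "nn (int q *s v)" using v(1) q0 by (simp add: nn_def Q0_scale)
    moreover have "int q *s v \<noteq> 0" using v(2) q0 by (auto simp: vec_eq_iff)
    moreover have "cont (int q *s v) = q ^ Suc j * e'" by (simp add: cont_scale e_def[symmetric] je)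
    ultimately have "al f (int q *s v) = dsum a k (q ^ Suc j * e') (Q0 (int q *s v))"
      using maass_al[OF f] by (simp add: a_def)
    also have "\<dots> = (\<Sum>d\<in>?D. of_nat d powi (k - 1) * (\<Sum>i\<le>Suc j. xx ^ i * X d (Suc j - i)))"
      unfolding dsum_prime_power[OF q je(2)] xx_def[symmetric]
    proof (intro sum.cong refl arg_cong2[of _ _ _ _ "(*)"])
      fix d i assume d: "d \<in> ?D" and i: "i \<in> {..Suc j}"
      hence "Q0 (int q *s v) = (int (q ^ (i + (Suc j - i))))\<^sup>2 * (int e')\<^sup>2 * N0" by (simp add: Q)
      thus "a (Q0 (int q *s v) div (int (q ^ i * d))\<^sup>2) = X d (Suc j - i)" using d by (simp only: divX X_def mem_Collect_eq)
    qed
    finally show ?thesis .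
  qed
  \<comment> \<open>The divisor sum with content \<open>q e\<close> reaches one step below
    \<open>N0\<close> and makes sense only if \<open>q^2\<close> divides \<open>N0\<close>. The
    factor \<open>C\<close> vanishes in the other case and is therefore kept on both sides.\<close>
  have L2: "of_nat C * dsum a k (q * e) N = of_nat C * (\<Sum>d\<in>?D. of_nat d powi (k - 1) * ((\<Sum>i\<le>j. xx ^ i * X d (j - i)) + xx ^ Suc j * Xm d))"
  proof (cases "(int q)\<^sup>2 dvd N0")
    case True
    have "dsum a k (q ^ Suc j * e') N = (\<Sum>d\<in>?D. of_nat d powi (k - 1) * ((\<Sum>i\<le>j. xx ^ i * X d (j - i)) + xx ^ Suc j * Xm d))"
      unfolding dsum_prime_power[OF q je(2)] xx_def[symmetric]
    proof (intro sum.cong refl arg_cong2[of _ _ _ _ "(*)"])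
      fix d assume d: "d \<in> ?D"
      hence dd: "d dvd e'" by simp
      have "a (N div (int (q ^ Suc j * d))\<^sup>2) = Xm d"
      proof -
        have "N div (int (q ^ Suc j * d))\<^sup>2 = N div (int (q ^ j * d))\<^sup>2 div (int q)\<^sup>2"
          by (simp add: zdiv_zmult2_eq[symmetric] power2_eq_square algebra_simps)
        also have "N div (int (q ^ j * d))\<^sup>2 = M d" using divX[OF dd, of j 0] by (simp add: N')
        finally show ?thesis using True Mq(2)[OF dd] by (simp add: Xm_def)
      qed
      thus "(\<Sum>i\<le>Suc j. xx ^ i * a (N div (int (q ^ i * d))\<^sup>2)) = (\<Sum>i\<le>j. xx ^ i * X d (j - i)) + xx ^ Suc j * Xm d"
        using sumX[OF dd, of a] by (simp add: X_def)
    qed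
    thus ?thesis by (simp add: je mult.assoc)
  next
    case False
    thus ?thesis by (simp add: C_def N0_def)
  qed
  have alv: "al f v = dsum a k e N" using maass_al[OF f v(2,1)] by (simp add: a_def e_def N_def)
  have LB: "dsum (bfun (k - int m) q a) k e N = (\<Sum>d\<in>?D. of_nat d powi (k - 1) * (\<Sum>i\<le>j. xx ^ i * bfun (k - int m) q a ((int q) ^ (2 * (j - i)) * M d)))"
    by (rule L1)
  have rec: "(\<Sum>i<j. xx ^ i * X d (j - 1 - i)) + zz * (\<Sum>i\<le>Suc j. xx ^ i * X d (Suc j - i))
    + w * (A * (\<Sum>i<j. xx ^ i * X d (j - i)) + (of_nat V - of_nat C) * (\<Sum>i\<le>j. xx ^ i * X d (j - i))
           + of_nat C * ((\<Sum>i\<le>j. xx ^ i * X d (j - i)) + xx ^ Suc j * Xm d))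
    = (\<Sum>i\<le>j. xx ^ i * bfun (k - int m) q a ((int q) ^ (2 * (j - i)) * M d)) + b0 k q m * (\<Sum>i\<le>j. xx ^ i * X d (j - i))"
    if dd: "d dvd e'" for d
  proof (rule hecke_recursion[where P = "int q dvd N0" and y = yy and Y = "of_nat (card (Yq q))" and
        B = "\<lambda>i. bfun (k - int m) q a ((int q) ^ (2 * i) * M d)"])
    show "bfun (k - int m) q a ((int q) ^ (2 * 0) * M d) = Xm d + (if int q dvd N0 then yy * X d 0 else 0) + zz * X d 1"
      using Mq(1)[OF dd] by (simp add: bfun_def Xm_def X_def yy_def zz_def)
    show "bfun (k - int m) q a ((int q) ^ (2 * Suc i) * M d) = X d i + yy * X d (Suc i) + zz * X d (Suc (Suc i))" for i
    proof -
      have 1: "(int q) ^ (2 * Suc i) * M d = (int q)\<^sup>2 * ((int q) ^ (2 * i) * M d)" by (simp add: power2_eq_square)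
      have 2: "(int q)\<^sup>2 * ((int q) ^ (2 * Suc i) * M d) = (int q) ^ (2 * Suc (Suc i)) * M d" by (simp add: power2_eq_square)
      have 3: "int q dvd (int q) ^ (2 * Suc i) * M d" by simp
      have 4: "(int q) ^ (2 * Suc i) * M d div (int q)\<^sup>2 = (int q) ^ (2 * i) * M d" unfolding 1 using q0 by simp
      have 5: "(int q)\<^sup>2 dvd (int q) ^ (2 * Suc i) * M d" unfolding 1 by simp
      show ?thesis unfolding bfun_def 2 4 X_def yy_def zz_def using 3 5 by simp
    qed
    show "w * of_nat (card (Yq q)) = yy + b0 k q m" by (simp add: w_def b0_def yy_def)
    show "A + of_nat V = of_nat (card (Yq q))" by (simp add: A_def)
    have q1c: "(of_nat (q - 1) :: complex) \<noteq> 0" using q1 by simp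
    have x1: "(of_nat q :: complex) powi (1 - k) * xx = 1"
      unfolding xx_def using qc by (subst power_int_add[symmetric]) auto
    show "w * of_nat C * xx * Xm d = Xm d"
    proof (cases "(int q)\<^sup>2 dvd N0")
      case True
      hence "w * of_nat C * xx = of_nat q powi (1 - k) * xx" using q1c by (simp add: C_def N0_def w_def del: of_nat_diff)
      thus ?thesis using x1 by simp
    next
      case False thus ?thesis using Mq(2)[OF dd] by (simp add: Xm_def)
    qed
    show "w * A = zz * xx + (if int q dvd N0 then 0 else yy)"
    proof -
      have "of_nat (card (Yq q) + 1) = (of_nat (q ^ (2 * m + 1) + (q - 1) * q ^ m) :: complex)" by (simp only: cY)
      hence 1: "(of_nat (card (Yq q)) :: complex) = of_nat q ^ (2 * m + 1) + of_nat (q - 1) * of_nat q ^ m - 1"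
        by (simp only: of_nat_add of_nat_mult of_nat_power of_nat_1 eq_diff_eq)
      have "of_nat (V + 1) = (of_nat (q ^ (2 * m) + (if int q dvd N0 then (q - 1) * q ^ m else 0)) :: complex)"
        using cV[OF nv0] by (simp only: V_def N0_def)
      hence 2: "(of_nat V :: complex) = of_nat q ^ (2 * m) + (if int q dvd N0 then of_nat (q - 1) * of_nat q ^ m else 0) - 1"
        by (cases "int q dvd N0") (simp_all only: of_nat_add of_nat_mult of_nat_power of_nat_1 of_nat_0 eq_diff_eq if_True if_False)
      have 3: "(of_nat q :: complex) = of_nat (q - 1) + 1" using q0 by simp
      \<comment> \<open>Difference of the two counts: the number of isotropic vectors not orthogonal
        to \<open>v0\<close>. Its factor \<open>q - 1\<close> cancels the denominator of
        \<open>w\<close>.\<close>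
      have "A = of_nat (q - 1) * (of_nat q ^ (2 * m) + (if int q dvd N0 then 0 else of_nat q ^ m))"
      proof -
        define rr where "rr = (of_nat (q - 1) :: complex)"
        have 4: "(of_nat q :: complex) ^ (2 * m + 1) = (rr + 1) * of_nat q ^ (2 * m)"
          unfolding rr_def 3[symmetric] by simp
        show ?thesis unfolding A_def 1 2 4 rr_def[symmetric]
          by (cases "int q dvd N0") (simp_all add: algebra_simps)
      qed
      hence "w * A = of_nat q powi (1 - k) * (of_nat q ^ (2 * m) + (if int q dvd N0 then 0 else of_nat q ^ m))"
        using q1c by (simp add: w_def del: of_nat_diff)
      also have "\<dots> = zz * xx + (if int q dvd N0 then 0 else yy)"
      proof -
        have "(of_nat q :: complex) powi (1 - k) * of_nat q ^ (2 * m) = zz * xx"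
          unfolding zz_def xx_def power_int_of_nat[symmetric] using qc
          by (subst (1 2) power_int_add[symmetric]) (auto simp: algebra_simps)
        moreover have "(of_nat q :: complex) powi (1 - k) * of_nat q ^ m = yy"
          unfolding yy_def power_int_of_nat[symmetric] using qc
          by (subst power_int_add[symmetric]) (auto simp: algebra_simps)
        ultimately show ?thesis by (simp add: distrib_left)
      qed
      finally show ?thesis .
    qed
  qed
  have n2: "int CARD('n) + 2 - 2 * k = 2 - 2 * (k - int m)" by (simp add: n)
  have "beta k q K f v = (if vcong (int q) v 0 then al f (vdiv q v) else 0) + zz * al f (int q *s v)
     + w * (A * (if q dvd e then dsum a k (e div q) N else 0) + (of_nat V - of_nat C) * dsum a k e N + of_nat C * dsum a k (q * e) N)"
    unfolding beta_def neighbour_sum[OF f q g v(1) v0' v0(2) e0]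
    unfolding n2 zz_def w_def A_def V_def C_def N_def a_def ..
  also have "\<dots> = (\<Sum>d\<in>?D. of_nat d powi (k - 1) * ((\<Sum>i<j. xx ^ i * X d (j - 1 - i)) + zz * (\<Sum>i\<le>Suc j. xx ^ i * X d (Suc j - i))
    + w * (A * (\<Sum>i<j. xx ^ i * X d (j - i)) + (of_nat V - of_nat C) * (\<Sum>i\<le>j. xx ^ i * X d (j - i))
           + of_nat C * ((\<Sum>i\<le>j. xx ^ i * X d (j - i)) + xx ^ Suc j * Xm d))))"
    unfolding Lm Lp L0 L1a L2
    by (simp only: sum_distrib_left sum.distrib distrib_left mult.left_commute)
  also have "\<dots> = (\<Sum>d\<in>?D. of_nat d powi (k - 1) * ((\<Sum>i\<le>j. xx ^ i * bfun (k - int m) q a ((int q) ^ (2 * (j - i)) * M d)) + b0 k q m * (\<Sum>i\<le>j. xx ^ i * X d (j - i))))"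
    by (rule sum.cong[OF refl]) (simp only: rec mem_Collect_eq)
  also have "\<dots> = dsum (bfun (k - int m) q a) k e N + b0 k q m * dsum a k e N"
    unfolding LB L1a by (simp only: sum_distrib_left sum.distrib distrib_left mult.left_commute)
  finally show ?thesis by (simp add: alv a_def e_def N_def)
qed

text \<open>The index 0 is fixed by every operation on indices, so all terms are multiples of
  \<open>al f 0\<close>. It needs its own formula because the divisor-sum relation excludes
  it.\<close>

lemma beta_zero:
  assumes q: "prime (q::nat)" and n: "CARD('n) = 2 * m"
  shows "beta k q K f 0 = (1 + of_nat q powi (1 - (k - int m)) + of_nat q powi (2 - 2 * (k - int m)) + b0 k q m) * al f 0"
proof -
  have z: "vdiv q 0 = 0" "nbr q 0 = 0" "int q *s 0 = (0 :: int^'n bord)"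
    by (simp_all add: vdiv_def nbr_def vec_eq_iff all_bord mid_0)
  have n2: "int CARD('n) + 2 - 2 * k = 2 - 2 * (k - int m)" by (simp add: n)
  show ?thesis unfolding beta_def n2 b0_def by (simp add: z algebra_simps)
qed

end

section \<open>Elliptic modular forms\<close>

lemma uhp_iff [simp]: "t \<in> upper_half_plane \<longleftrightarrow> Im t > 0"
  by (simp add: upper_half_plane_def)

lemma open_uhp: "open upper_half_plane"
  unfolding upper_half_plane_def by (rule open_halfspace_Im_gt)

lemma connected_uhp: "connected upper_half_plane"
  unfolding upper_half_plane_def by (intro convex_connected convex_halfspace_Im_gt)

text \<open>Weierstrass' test on a disc: frequencies are nonnegative, so the terms at half the
  height of the centre are a majorant.\<close>

lemma holomorphic_fourier:
  fixes c :: "'a \<Rightarrow> complex" and \<phi> :: "'a \<Rightarrow> nat"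
  assumes F: "\<And>t. Im t > 0 \<Longrightarrow> ((\<lambda>x. c x * ee (of_nat (\<phi> x) * t)) has_sum F t) A"
  shows "F holomorphic_on upper_half_plane"
  unfolding holomorphic_on_def
proof
  fix z assume "z \<in> upper_half_plane"
  hence z: "Im z > 0" by simp
  define \<delta> where "\<delta> = Im z / 2"
  have d: "\<delta> > 0" using z by (simp add: \<delta>_def)
  have Imt: "Im t \<ge> \<delta>" if "t \<in> cball z \<delta>" for t
  proof -
    have "\<bar>Im (z - t)\<bar> \<le> norm (z - t)" by (rule abs_Im_le_cmod)
    thus ?thesis using that by (simp add: dist_norm \<delta>_def)
  qed
  have n: "norm (c x * ee (of_nat (\<phi> x) * t)) = norm (c x) * exp (- 2 * pi * (of_nat (\<phi> x) * Im t))" for x t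
    by (simp add: norm_mult norm_ee)
  have "uniform_limit (cball z \<delta>) (\<lambda>X t. \<Sum>x\<in>X. c x * ee (of_nat (\<phi> x) * t)) F (finite_subsets_at_top A)"
  proof (rule Weierstrass_m_test_general'[where M = "\<lambda>x. norm (c x * ee (of_nat (\<phi> x) * (\<i> * of_real \<delta>)))"])
    fix x t assume "t \<in> cball z \<delta>"
    hence "of_nat (\<phi> x) * Im t \<ge> of_nat (\<phi> x) * \<delta>" using Imt by (intro mult_left_mono) auto
    thus "norm (c x * ee (of_nat (\<phi> x) * t)) \<le> norm (c x * ee (of_nat (\<phi> x) * (\<i> * of_real \<delta>)))"
      unfolding n by (intro mult_left_mono) auto
  next
    fix t assume "t \<in> cball z \<delta>"
    thus "((\<lambda>x. c x * ee (of_nat (\<phi> x) * t)) has_sum F t) A" using Imt d by (intro F) fastforce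
  next
    have "(\<lambda>x. c x * ee (of_nat (\<phi> x) * (\<i> * of_real \<delta>))) summable_on A"
      using F[of "\<i> * of_real \<delta>"] d by (auto simp: summable_on_def)
    thus "(\<lambda>x. norm (c x * ee (of_nat (\<phi> x) * (\<i> * of_real \<delta>)))) summable_on A"
      by (simp only: summable_on_iff_abs_summable_on_complex)
  qed
  then obtain "F holomorphic_on ball z \<delta>"
    by (rule holomorphic_uniform_limit[rotated])
       (auto intro!: always_eventually continuous_intros holomorphic_intros simp: ee_def)
  hence "F field_differentiable at z"
    using d by (intro holomorphic_on_imp_differentiable_at[of F "ball z \<delta>"]) auto
  thus "F field_differentiable at z within upper_half_plane" by (rule field_differentiable_at_within)
qed

lemma uhp_identity:
  assumes F: "F holomorphic_on upper_half_plane" and \<alpha>: "0 \<le> \<alpha>" "\<alpha> < \<beta>"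
    and z: "\<And>y::real. \<alpha> < y \<Longrightarrow> y < \<beta> \<Longrightarrow> F (\<i> * of_real y) = 0" and t: "Im t > 0"
  shows "F t = 0"
proof (rule analytic_continuation[OF F open_uhp connected_uhp])
  let ?U = "(\<lambda>y. \<i> * complex_of_real y) ` {\<alpha><..<\<beta>}"
  let ?m = "(\<alpha> + \<beta>) / 2"
  show "?U \<subseteq> upper_half_plane" using \<alpha> by auto
  show "\<i> * complex_of_real ?m \<in> upper_half_plane" using \<alpha> by simp
  have "?m islimpt {\<alpha><..<\<beta>}" using \<alpha> by (intro open_imp_islimpt) auto
  show "\<i> * complex_of_real ?m islimpt ?U"
    unfolding islimpt_approachable
  proof (intro allI impI)
    fix e :: real assume "e > 0"
    then obtain y where y: "y \<in> {\<alpha><..<\<beta>}" "y \<noteq> ?m" "dist y ?m < e"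
      using \<open>?m islimpt {\<alpha><..<\<beta>}\<close> unfolding islimpt_approachable by blast
    have "dist (\<i> * complex_of_real y) (\<i> * complex_of_real ?m) = dist y ?m"
    proof -
      have "\<i> * complex_of_real y - \<i> * complex_of_real ?m = \<i> * complex_of_real (y - ?m)" by (simp add: algebra_simps)
      hence "norm (\<i> * complex_of_real y - \<i> * complex_of_real ?m) = norm (\<i> * complex_of_real (y - ?m))" by (rule arg_cong)
      also have "\<dots> = \<bar>y - ?m\<bar>" by (simp only: norm_mult norm_ii norm_of_real mult_1)
      finally show ?thesis by (simp only: dist_norm real_norm_def)
    qed
    moreover have "\<i> * complex_of_real y \<noteq> \<i> * complex_of_real ?m" using y(2) by (simp del: of_real_divide of_real_add)
    ultimately show "\<exists>x'\<in>?U. x' \<noteq> \<i> * complex_of_real ?m \<and> dist x' (\<i> * complex_of_real ?m) < e"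
      using y by (auto simp del: of_real_divide of_real_add)
  qed
  show "t \<in> upper_half_plane" using t by simp
qed (use z in auto)

definition ell_modular :: "int \<Rightarrow> (complex \<Rightarrow> complex) \<Rightarrow> bool" where
  "ell_modular k h \<longleftrightarrow> (\<forall>a b c d :: int. \<forall>t. a * d - b * c = 1 \<longrightarrow> Im t > 0 \<longrightarrow>
     h ((of_int a * t + of_int b) / (of_int c * t + of_int d)) = (of_int c * t + of_int d) powi k * h t)"

lemma moebius_denom_nonzero:
  assumes "a * d - b * c > (0::int)" "Im t > 0"
  shows "of_int c * t + of_int d \<noteq> (0::complex)"
proof
  assume 0: "of_int c * t + of_int d = (0::complex)"
  hence "Im (of_int c * t + of_int d) = 0" by simp
  hence c: "c = 0" using assms(2) by simp
  hence "d = 0" using 0 by simp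
  thus False using assms(1) c by simp
qed

lemma Im_moebius:
  assumes "a * d - b * c > (0::int)" "Im t > 0"
  shows "Im ((of_int a * t + of_int b) / (of_int c * t + of_int d)) =
     of_int (a * d - b * c) * Im t / (norm (of_int c * t + of_int d))\<^sup>2"
proof -
  let ?z = "of_int a * t + of_int b" and ?w = "of_int c * t + of_int d"
  have "Im (?z / ?w) = (Im ?z * Re ?w - Re ?z * Im ?w) / ((Re ?w)\<^sup>2 + (Im ?w)\<^sup>2)"
    by (rule Im_divide)
  also have "Im ?z * Re ?w - Re ?z * Im ?w = of_int (a * d - b * c) * Im t"
    by (simp add: algebra_simps)
  finally show ?thesis by (simp add: cmod_power2)
qed

lemma Im_moebius_pos:
  assumes "a * d - b * c > (0::int)" "Im t > 0"
  shows "Im ((of_int a * t + of_int b) / (of_int c * t + of_int d)) > 0"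
proof -
  have "norm (of_int c * t + of_int d) > 0" using moebius_denom_nonzero[OF assms] by simp
  moreover have "real_of_int (a * d - b * c) > 0" using assms(1) by (simp only: of_int_0_less_iff)
  ultimately show ?thesis unfolding Im_moebius[OF assms] using assms(2) by (intro divide_pos_pos mult_pos_pos) auto
qed

text \<open>Euclid's algorithm in the first column: a translation replaces \<open>a\<close> by
  \<open>a mod c\<close>, and the inversion then moves it into the lower row, where it is smaller
  than \<open>c\<close> in absolute value. The case \<open>c = 0\<close> is a translation up to
  sign, and the sign disappears because the weight is even.\<close>

lemma ell_modularI:
  assumes T: "\<And>t. Im t > 0 \<Longrightarrow> h (t + 1) = h t"
    and S: "\<And>t. Im t > 0 \<Longrightarrow> h (- 1 / t) = t powi k * h t" and k: "even k"
  shows "ell_modular k h"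
proof -
  have Tn: "h (t + of_nat n) = h t" if "Im t > 0" for t n
    using that T[of "t + of_nat _"] by (induction n) (simp_all add: add.assoc[symmetric] add.commute[of 1])
  have Ti: "h (t + of_int n) = h t" if "Im t > 0" for t n
  proof (cases n)
    case (nonneg m) thus ?thesis using Tn that by simp
  next
    case (neg m)
    have "h (t + of_int n + of_nat (Suc m)) = h (t + of_int n)" using that by (intro Tn) simp
    thus ?thesis by (simp add: neg)
  qed
  have "h ((of_int a * t + of_int b) / (of_int c * t + of_int d)) = (of_int c * t + of_int d) powi k * h t"
    if "a * d - b * c = 1" "Im t > 0" for a b c d t
    using that
  proof (induction "nat \<bar>c\<bar>" arbitrary: a b c d rule: less_induct)
    case less
    show ?case
    proof (cases "c = 0")
      case True
      hence "a * d = 1" using less by simp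
      hence ad: "a = d" "d = 1 \<or> d = - 1" by (auto simp: zmult_eq_1_iff)
      hence "(of_int a * t + of_int b) / (of_int c * t + of_int d) = t + of_int (b * d)"
        using True by (auto simp: algebra_simps)
      moreover have "(of_int d :: complex) powi k = 1" using ad k by (auto simp: power_int_minus_left)
      ultimately show ?thesis using True Ti[OF less(3), of "b * d"] by simp
    next
      case False
      define m where "m = a div c"
      define a' where "a' = a - m * c"
      define b' where "b' = b - m * d"
      have "\<bar>a'\<bar> < \<bar>c\<bar>" using False by (simp add: a'_def m_def minus_div_mult_eq_mod abs_mod_less)
      hence lt: "nat \<bar>- a'\<bar> < nat \<bar>c\<bar>" by simp
      have det: "c * (- b') - d * (- a') = 1" using less(2) by (simp add: a'_def b'_def algebra_simps)
      have det': "c * (- b') - d * (- a') > 0" "a' * d - b' * c > 0" "a * d - b * c > 0" using det less(2) by (simp_all add: algebra_simps)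
      define u where "u = (of_int c * t + of_int d) / (of_int (- a') * t + of_int (- b'))"
      have IH: "h u = (of_int (- a') * t + of_int (- b')) powi k * h t"
        unfolding u_def by (rule less(1)[OF lt det less(3)])
      have u: "Im u > 0" unfolding u_def by (rule Im_moebius_pos[OF det'(1) less(3)])
      have nz: "of_int (- a') * t + of_int (- b') \<noteq> (0::complex)" "of_int c * t + of_int d \<noteq> (0::complex)"
        using moebius_denom_nonzero[OF det'(1) less(3)] moebius_denom_nonzero[OF det'(3) less(3)] by auto
      have e: "(of_int a * t + of_int b) / (of_int c * t + of_int d) = - 1 / u + of_int m"
        using nz by (simp add: u_def a'_def b'_def field_simps)
      have u': "Im (- 1 / u) > 0"
        using u Im_moebius_pos[of 0 0 "-1" 1 u] by simp
      have "h ((of_int a * t + of_int b) / (of_int c * t + of_int d)) = u powi k * h u"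
        unfolding e Ti[OF u'] S[OF u] ..
      also have "\<dots> = (u * (of_int (- a') * t + of_int (- b'))) powi k * h t"
        unfolding IH by (simp add: power_int_mult_distrib)
      also have "u * (of_int (- a') * t + of_int (- b')) = of_int c * t + of_int d"
        using nz by (simp add: u_def)
      finally show ?thesis .
    qed
  qed
  thus ?thesis unfolding ell_modular_def by blast
qed

text \<open>The relations \<open>S\<^sup>2 = 1\<close> and \<open>(ST)\<^sup>3 = 1\<close> in \<open>PSL\<^sub>2(\<int>)\<close> rule out a non-trivial multiplier.\<close>

lemma multiplier_trivial:
  assumes T: "\<And>t. Im t > 0 \<Longrightarrow> h (t + 1) = h t"
    and S: "\<And>t. Im t > 0 \<Longrightarrow> h (- 1 / t) = c * t powi k * h t"
    and nz: "Im t > 0" "h t \<noteq> 0"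
  shows "c = 1" "even k"
proof -
  have inv: "Im (- 1 / u) > 0" if "Im u > 0" for u
    using that Im_moebius_pos[of 0 0 "-1" 1 u] by simp
  have t0: "t \<noteq> 0" using nz by auto
  define e where "e = (- 1 :: complex) powi k"
  have e: "e = 1 \<or> e = -1" by (auto simp: e_def power_int_minus_left)
  have "h t = h (- 1 / (- 1 / t))" by simp
  also have "\<dots> = c * (- 1 / t) powi k * (c * t powi k * h t)"
    by (simp only: S[OF inv[OF nz(1)]] S[OF nz(1)])
  also have "\<dots> = c\<^sup>2 * ((- 1 / t) powi k * t powi k) * h t"
    by (simp only: power2_eq_square mult_ac)
  also have "(- 1 / t) powi k * t powi k = ((- 1 / t) * t) powi k" by (simp only: power_int_mult_distrib)
  also have "(- 1 / t) * t = - 1" using t0 by simp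
  finally have 1: "c\<^sup>2 * e = 1" using nz by (simp add: e_def)
  have U: "h (- 1 / (u + 1)) = c * (u + 1) powi k * h u" if "Im u > 0" for u
    using S[of "u + 1"] T[OF that] that by simp
  define u1 where "u1 = - 1 / (t + 1)"
  define u2 where "u2 = - 1 / (u1 + 1)"
  have I1: "Im u1 > 0" unfolding u1_def by (rule inv) (use nz in simp)
  have I2: "Im u2 > 0" unfolding u2_def by (rule inv) (use I1 in simp)
  have t1: "t + 1 \<noteq> 0"
  proof
    assume "t + 1 = 0" hence "Im (t + 1) = 0" by (simp only: zero_complex.simps)
    thus False using nz by simp
  qed
  have u1: "u1 + 1 = t / (t + 1)" using t1 by (simp add: u1_def field_simps)
  have u2: "u2 + 1 = - 1 / t" unfolding u2_def u1 using t0 t1 by (simp add: field_simps)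
  have "h t = h (- 1 / (u2 + 1))" unfolding u2 by simp
  also have "\<dots> = c * (u2 + 1) powi k * (c * (u1 + 1) powi k * (c * (t + 1) powi k * h t))"
    by (simp only: U[OF I2] U[OF I1, folded u2_def] U[OF nz(1), folded u1_def])
  also have "\<dots> = c ^ 3 * ((u2 + 1) * (u1 + 1) * (t + 1)) powi k * h t"
    by (simp add: power_int_mult_distrib power3_eq_cube)
  also have "(u2 + 1) * (u1 + 1) * (t + 1) = - 1" unfolding u1 u2 using t0 t1 by (simp add: field_simps)
  finally have 2: "c ^ 3 * e = 1" using nz by (simp add: e_def)
  have "c ^ 3 * e = c * (c\<^sup>2 * e)" by (simp add: power3_eq_cube power2_eq_square)
  thus c: "c = 1" using 1 2 by simp
  hence "e = 1" using 1 by simp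
  thus "even k" unfolding e_def power_int_minus_left by (auto split: if_splits)
qed

text \<open>Every point of height \<open>y \<le> 1\<close> is equivalent to one of height at least
  \<open>1/8\<close>, where \<open>h\<close> is bounded by \<open>B\<close>. Negative weight turns
  this into \<open>|h|^2 \<le> B^2 (8 y)^l\<close>. By \<open>fourier_bound\<close> each term of the
  expansion obeys the same bound, which tends to 0 with \<open>y\<close>.\<close>

lemma negative_weight_zero:
  assumes h: "ell_modular k h" and k: "k < 0"
    and F: "\<And>t. Im t > 0 \<Longrightarrow> ((\<lambda>N::int. a N * ee (of_int N * t)) has_sum h t) UNIV"
    and a: "\<And>N. N < 0 \<Longrightarrow> a N = 0"
  shows "a N = 0"
proof -
  \<comment> \<open>The height \<open>1/8\<close> matches the estimate
    \<open>|w|^2 \<le> 8 y\<close> for the denominator \<open>w\<close> below.\<close>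
  define t0 where "t0 = \<i> * complex_of_real (1/8)"
  define B where "B = infsum (\<lambda>N. norm (a N * ee (of_int N * t0))) UNIV"
  have sB: "(\<lambda>N. norm (a N * ee (of_int N * t0))) summable_on UNIV"
    using F[of t0] by (simp add: t0_def summable_on_iff_abs_summable_on_complex[symmetric] has_sum_imp_summable)
  have B: "norm (h t) \<le> B" if t: "Im t \<ge> 1/8" for t
    unfolding B_def
  proof (rule norm_infsum_le[OF F has_sum_infsum[OF sB]])
    show "Im t > 0" using t by simp
    fix M :: int
    show "norm (a M * ee (of_int M * t)) \<le> norm (a M * ee (of_int M * t0))"
    proof (cases "M < 0")
      case False
      hence "of_int M * Im t \<ge> of_int M * (1/8)" using t by (intro mult_left_mono) auto
      hence "norm (ee (of_int M * t)) \<le> norm (ee (of_int M * t0))" by (simp add: norm_ee t0_def)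
      thus ?thesis by (simp add: norm_mult mult_left_mono)
    qed (simp add: a)
  qed
  have B0: "B \<ge> 0" unfolding B_def by (rule infsum_nonneg) simp
  obtain l where l: "- k = int l" "l > 0" using k by (metis neg_0_less_iff_less pos_int_cases)
  have bound: "(norm (h t))\<^sup>2 \<le> B\<^sup>2 * (8 * Im t) ^ l" if t: "Im t > 0" "Im t \<le> 1" for t
  proof -
    define y where "y = Im t"
    have y: "0 < y" "y \<le> 1" using t by (simp_all add: y_def)
    \<comment> \<open>Dirichlet approximation with \<open>L\<close> of size
      \<open>1 / sqrt y\<close> balances both parts of \<open>w = k t - h\<close>: the real part is
      at most \<open>sqrt y\<close> and the imaginary part at most \<open>2 sqrt y\<close>.\<close>
    define L where "L = nat \<lceil>1 / sqrt y\<rceil>"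
    have sy: "sqrt y > 0" "sqrt y \<le> 1" using y by auto
    have L1: "real L \<ge> 1 / sqrt y" unfolding L_def using sy by (simp add: of_nat_nat) 
    have L2: "real L \<le> 2 / sqrt y"
    proof -
      have "1 / sqrt y \<ge> 1" using sy by simp
      moreover have "real L < 1 / sqrt y + 1" unfolding L_def using sy by (simp add: of_nat_nat) linarith
      ultimately show ?thesis by simp
    qed
    have L0: "L > 0" using L1 sy by (metis divide_pos_pos gr0I not_le of_nat_0 zero_less_one)
    obtain hh kk where hk: "coprime hh kk" "0 < kk" "kk \<le> int L" "\<bar>of_int kk * Re t - of_int hh\<bar> < 1 / real L"
      using Dirichlet_approx_coprime[OF L0] by blast
    obtain u v where uv: "u * hh + v * kk = 1" using bezout_int[of hh kk] hk(1) by auto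
    have det: "(- u) * (- hh) - v * (- kk) = 1" "(- u) * (- hh) - (- v) * kk = 1" using uv by (simp_all add: algebra_simps)
    have det1: "(- u) * (- hh) - (- v) * kk > 0" using det by simp
    define w where "w = of_int kk * t + of_int (- hh)"
    have wn: "(norm w)\<^sup>2 \<le> 8 * y"
    proof -
      have "1 / real L \<le> sqrt y" using L1 sy L0 by (simp add: field_simps)
      hence "\<bar>of_int kk * Re t - of_int hh\<bar> \<le> sqrt y" using hk(4) by linarith
      hence r: "(of_int kk * Re t - of_int hh)\<^sup>2 \<le> y" using y by (metis abs_ge_zero power2_abs power_mono real_sqrt_pow2 less_imp_le)
      have "of_int kk \<le> 2 / sqrt y" using hk(3) L2 by linarith
      hence "of_int kk * y \<le> 2 / sqrt y * y" using y by (intro mult_right_mono) auto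
      also have "2 / sqrt y * y = 2 * (y / sqrt y)" by simp
      also have "y / sqrt y = sqrt y" using y by (intro real_div_sqrt) simp
      finally have "(of_int kk * y)\<^sup>2 \<le> (2 * sqrt y)\<^sup>2" using hk(2) y by (intro power_mono) auto
      hence i: "(of_int kk * y)\<^sup>2 \<le> 4 * y" using y by (simp add: power_mult_distrib)
      have "(norm w)\<^sup>2 = (of_int kk * Re t - of_int hh)\<^sup>2 + (of_int kk * y)\<^sup>2" by (simp add: w_def cmod_power2 y_def)
      thus ?thesis using r i y by linarith
    qed
    have w0: "w \<noteq> 0" unfolding w_def by (rule moebius_denom_nonzero[OF det1 t(1)])
    let ?t' = "(of_int (- u) * t + of_int (- v)) / w"
    have "Im ?t' = y / (norm w)\<^sup>2" using Im_moebius[OF det1 t(1)]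
      by (simp only: det(2) of_int_1 mult_1 w_def y_def)
    moreover have "y / (norm w)\<^sup>2 \<ge> 1 / 8" using wn w0 y by (simp add: field_simps)
    ultimately have n1: "norm (h ?t') \<le> B" by (intro B) simp
    have "h ?t' = w powi k * h t" using h det(2) t(1) unfolding ell_modular_def w_def by blast
    hence "h t = w powi (- k) * h ?t'" using w0 by (simp add: power_int_minus)
    hence "(norm (h t))\<^sup>2 = ((norm w)\<^sup>2) ^ l * (norm (h ?t'))\<^sup>2"
      by (simp add: l norm_mult power_mult_distrib norm_power flip: power_mult) (simp add: mult.commute)
    also have "\<dots> \<le> (8 * y) ^ l * B\<^sup>2" using wn n1 y by (intro mult_mono power_mono) auto
    finally show ?thesis by (simp add: y_def mult.commute)
  qed
  have ub: "norm (a N * ee (of_int N * (\<i> * of_real y))) \<le> sqrt (B\<^sup>2 * (8 * y) ^ l)" if y: "0 < y" "y \<le> 1" for y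
  proof -
    have "norm (infsum (\<lambda>N. a N * ee (of_int N * (\<i> * of_real y))) {x \<in> UNIV. x = N}) \<le> sqrt (B\<^sup>2 * (8 * y) ^ l)"
    proof (rule fourier_bound[where r = "\<lambda>s. h (\<i> * of_real y + of_real s)"])
      fix s :: real
      have "((\<lambda>N. a N * ee (of_int N * (\<i> * of_real y + of_real s))) has_sum h (\<i> * of_real y + of_real s)) UNIV"
        using y by (intro F) simp
      thus "((\<lambda>x. a x * ee (of_int x * (\<i> * of_real y)) * ee (of_real s * of_int x)) has_sum h (\<i> * of_real y + of_real s)) UNIV"
        by (simp add: distrib_left ee_add mult.assoc mult.commute[of "of_real s"])
      have "(norm (h (\<i> * of_real y + of_real s)))\<^sup>2 \<le> B\<^sup>2 * (8 * y) ^ l"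
        using bound[of "\<i> * of_real y + of_real s"] y by simp
      thus "norm (h (\<i> * of_real y + of_real s)) \<le> sqrt (B\<^sup>2 * (8 * y) ^ l)" by (rule real_le_rsqrt)
    qed
    thus ?thesis by simp
  qed
  show ?thesis
  proof (cases "N < 0")
    case False
    have "norm (a N) * exp (- 2 * pi * of_int N) \<le> sqrt (B\<^sup>2 * (8 * y) ^ l)" if y: "0 < y" "y \<le> 1" for y
    proof -
      have "of_int N * y \<le> of_int N" using y False by (simp add: mult_left_le)
      hence "exp (- 2 * pi * of_int N) \<le> norm (ee (of_int N * (\<i> * of_real y)))" by (simp add: norm_ee)
      hence "norm (a N) * exp (- 2 * pi * of_int N) \<le> norm (a N * ee (of_int N * (\<i> * of_real y)))"
        unfolding norm_mult by (intro mult_left_mono) auto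
      thus ?thesis using ub[OF y] by linarith
    qed
    hence "eventually (\<lambda>y. norm (a N) * exp (- 2 * pi * of_int N) \<le> sqrt (B\<^sup>2 * (8 * y) ^ l)) (at_right 0)"
      by (intro eventually_mono[OF eventually_at_right_real[of 0 1]]) auto
    moreover have "((\<lambda>y. sqrt (B\<^sup>2 * (8 * y) ^ l)) \<longlongrightarrow> sqrt (B\<^sup>2 * (8 * 0) ^ l)) (at_right 0)"
      by (intro tendsto_intros)
    ultimately have "norm (a N) * exp (- 2 * pi * of_int N) \<le> sqrt (B\<^sup>2 * (8 * 0) ^ l)"
      by (intro tendsto_lowerbound) auto
    hence "norm (a N) * exp (- 2 * pi * of_int N) \<le> 0" using l by (simp add: power_0_left)
    thus ?thesis by (simp add: mult_le_0_iff)
  qed (simp add: a)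
qed

section \<open>The elliptic Hecke operator\<close>

definition m2 :: "int \<Rightarrow> int \<Rightarrow> int \<Rightarrow> int \<Rightarrow> int^2^2" where
  "m2 a b c d = vector [vector [a, b], vector [c, d]]"

lemma m2_nth [simp]: "m2 a b c d $ 1 $ 1 = a" "m2 a b c d $ 1 $ 2 = b" "m2 a b c d $ 2 $ 1 = c" "m2 a b c d $ 2 $ 2 = d"
  by (simp_all add: m2_def)

lemma m2_cases: obtains a b c d where "M = m2 a b c d"
proof -
  have "M = m2 (M$1$1) (M$1$2) (M$2$1) (M$2$2)" by (simp add: vec_eq_iff forall_2)
  thus ?thesis using that by blast
qed

lemma m2_eq_iff [simp]: "m2 a b c d = m2 a' b' c' d' \<longleftrightarrow> a = a' \<and> b = b' \<and> c = c' \<and> d = d'"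
  by (auto simp: vec_eq_iff forall_2)

lemma m2_mult: "m2 a b c d ** m2 a' b' c' d' = m2 (a*a'+b*c') (a*b'+b*d') (c*a'+d*c') (c*b'+d*d')"
  by (simp add: vec_eq_iff forall_2 matrix_matrix_mult_def sum_2)

lemma m2_det: "det (m2 a b c d) = a * d - b * c"
  by (simp add: det_2)

lemma slash_ell_m2: "slash_ell k h (m2 a b c d) t =
   h ((of_int a * t + of_int b) / (of_int c * t + of_int d)) * (of_int c * t + of_int d) powi (- k)"
  by (simp add: slash_ell_def)

lemma slash_ell_mult:
  assumes h: "ell_modular k h" and A: "det A = 1" and M: "det M = int m" "m > 0" and t: "Im t > 0"
  shows "slash_ell k h (A ** M) t = slash_ell k h M t"
proof -
  obtain a b c d where a: "A = m2 a b c d" by (rule m2_cases)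
  obtain p r s u where p: "M = m2 p r s u" by (rule m2_cases)
  have ad: "a * d - b * c = 1" using A by (simp add: a m2_det)
  have pu: "p * u - r * s > 0" using M by (simp add: p m2_det)
  define w where "w = (of_int s * t + of_int u :: complex)"
  have w: "w \<noteq> 0" unfolding w_def by (rule moebius_denom_nonzero[OF pu t])
  define z where "z = (of_int p * t + of_int r) / w"
  have z: "Im z > 0" unfolding z_def w_def by (rule Im_moebius_pos[OF pu t])
  have v: "of_int c * z + of_int d \<noteq> 0" using moebius_denom_nonzero[of a d b c z] ad z by simp
  have e1: "of_int (c * p + d * s) * t + of_int (c * r + d * u) = (of_int c * z + of_int d) * w"
    using w by (simp add: z_def field_simps) (simp add: w_def algebra_simps)
  have e2: "of_int (a * p + b * s) * t + of_int (a * r + b * u) = (of_int a * z + of_int b) * w"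
    using w by (simp add: z_def field_simps) (simp add: w_def algebra_simps)
  have "slash_ell k h (A ** M) t = h ((of_int a * z + of_int b) / (of_int c * z + of_int d)) * ((of_int c * z + of_int d) * w) powi (- k)"
    unfolding a p m2_mult slash_ell_m2 e1 e2 using w by simp
  also have "h ((of_int a * z + of_int b) / (of_int c * z + of_int d)) = (of_int c * z + of_int d) powi k * h z"
    using h ad z unfolding ell_modular_def by blast
  finally show ?thesis using v by (simp add: p slash_ell_m2 z_def w_def power_int_mult_distrib power_int_minus)
qed

text \<open>Representatives in Hermite normal form: left multiplication by a matrix from the
  extended gcd clears the lower left entry, and a unipotent factor reduces the upper right entry
  modulo \<open>d\<close>.\<close>

lemma hecke_ell_sum:
  assumes h: "ell_modular k h" and m: "m > 0" and t: "Im t > 0"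
  shows "hecke_ell k m h t = (\<Sum>d | d dvd m. \<Sum>b\<in>{0..<int d}.
     h ((of_nat (m div d) * t + of_int b) / of_nat d) * of_nat d powi (- k))"
proof -
  define G where "G = {M::int^2^2. det M = 1}"
  define cs where "cs = (\<lambda>M::int^2^2. (\<lambda>A. A ** M) ` G)"
  define R where "R = (SIGMA d:{d. d dvd m}. {0..<int d})"
  define rep where "rep = (\<lambda>(d, b). m2 (int (m div d)) b 0 (int d))"
  define val where "val = (\<lambda>C. slash_ell k h (SOME M. M \<in> C) t)"
  have G1: "mat 1 \<in> G" by (simp add: G_def)
  have Gm: "A ** B \<in> G" if "A \<in> G" "B \<in> G" for A B using that by (simp add: G_def det_mul)
  have inC: "M \<in> cs M" for M unfolding cs_def using G1 by (auto intro!: image_eqI[of _ _ "mat 1"])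
  have Ginv: "\<exists>B\<in>G. B ** A = mat 1 \<and> A ** B = mat 1" if A: "A \<in> G" for A
  proof -
    obtain a b c d where a: "A = m2 a b c d" by (rule m2_cases)
    have one: "(mat 1 :: int^2^2) = m2 1 0 0 1" by (simp add: vec_eq_iff forall_2 mat_def)
    have ad: "a * d - b * c = 1" using A by (simp add: G_def a m2_det)
    show ?thesis by (rule bexI[of _ "m2 d (- b) (- c) a"])
      (use ad in \<open>simp_all add: one a m2_mult G_def m2_det algebra_simps\<close>)
  qed
  have val: "val (cs M) = slash_ell k h M t" if M: "det M = int m" for M
  proof -
    have "(SOME M'. M' \<in> cs M) \<in> cs M" using inC someI by metis
    then obtain A where "A \<in> G" "(SOME M'. M' \<in> cs M) = A ** M" unfolding cs_def by blast
    thus ?thesis unfolding val_def using slash_ell_mult[OF h _ M m t] by (simp add: G_def)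
  qed
  have rdet: "det (rep x) = int m" if "x \<in> R" for x
    using that by (auto simp: rep_def R_def m2_det simp flip: of_nat_mult)
  have csA: "cs (A ** M) = cs M" if A: "A \<in> G" for A M
  proof -
    obtain B where B: "B \<in> G" "B ** A = mat 1" "A ** B = mat 1" using Ginv A by blast
    show ?thesis
    proof (intro equalityI subsetI)
      fix X assume "X \<in> cs (A ** M)"
      then obtain C where C: "C \<in> G" "X = C ** (A ** M)" unfolding cs_def by blast
      hence "X = (C ** A) ** M" by (simp add: matrix_mul_assoc)
      thus "X \<in> cs M" unfolding cs_def using Gm[OF C(1) A] by blast
    next
      fix X assume "X \<in> cs M"
      then obtain C where C: "C \<in> G" "X = C ** M" unfolding cs_def by blast
      hence "X = C ** (B ** A) ** M" by (simp add: B)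
      hence "X = (C ** B) ** (A ** M)" by (simp add: matrix_mul_assoc)
      thus "X \<in> cs (A ** M)" unfolding cs_def using Gm[OF C(1) B(1)] by blast
    qed
  qed
  have surj: "cs ` {M. det M = int m} = (\<lambda>x. cs (rep x)) ` R"
  proof (intro equalityI subsetI)
    fix C assume "C \<in> cs ` {M. det M = int m}"
    then obtain M where M: "det M = int m" "C = cs M" by blast
    obtain a b c d where a: "M = m2 a b c d" by (rule m2_cases)
    have dt: "a * d - b * c = int m" using M by (simp add: a m2_det)
    define g where "g = gcd a c"
    have g0: "g > 0" using dt m by (auto simp: g_def)
    obtain a' c' where ac: "a = g * a'" "c = g * c'" "coprime a' c'"
    proof -
      have "gcd a c \<noteq> 0" using g0 by (simp only: g_def less_imp_neq[symmetric] not_False_eq_True)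
      then obtain a' c' where "a = a' * gcd a c" "c = c' * gcd a c" "coprime a' c'"
        using gcd_coprime_exists by blast
      thus ?thesis using that unfolding g_def[symmetric] by (metis mult.commute)
    qed
    obtain x y where "x * a' + y * c' = gcd a' c'" using bezout_int by blast
    hence xy: "x * a' + y * c' = 1" using ac(3) by (simp only: coprime_iff_gcd_eq_1)
    define D where "D = a' * d - c' * b"
    have gD: "g * D = int m" using dt by (simp add: D_def ac algebra_simps)
    have D0: "D > 0" using gD g0 m by (metis of_nat_0_less_iff zero_less_mult_pos)
    have A1: "m2 x y (- c') a' \<in> G" using xy by (simp add: G_def m2_det algebra_simps)
    define s where "s = - ((x * b + y * d) div D)"
    have A2: "m2 1 s 0 1 \<in> G" by (simp add: G_def m2_det)
    have e1: "m2 x y (- c') a' ** M = m2 g (x * b + y * d) 0 D"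
      using arg_cong[OF xy, of "\<lambda>z. g * z"] by (simp add: a m2_mult ac D_def algebra_simps)
    have e2: "m2 1 s 0 1 ** (m2 x y (- c') a' ** M) = m2 g ((x * b + y * d) mod D) 0 D"
      unfolding e1 by (simp add: m2_mult s_def minus_div_mult_eq_mod)
    define dd where "dd = nat D"
    have dd: "int dd = D" "dd > 0" using D0 by (simp_all add: dd_def)
    have mg: "int m = g * int dd" using gD dd by simp
    hence dm: "dd dvd m" by (metis dvd_triv_right int_dvd_int_iff)
    have gi: "int (m div dd) = g" using mg dd by (simp add: zdiv_int)
    have "rep (dd, (x * b + y * d) mod D) = m2 1 s 0 1 ** (m2 x y (- c') a' ** M)"
      unfolding e2 by (simp add: rep_def gi dd)
    moreover have "(dd, (x * b + y * d) mod D) \<in> R" using dm D0 dd by (simp add: R_def)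
    ultimately show "C \<in> (\<lambda>x. cs (rep x)) ` R" using M(2) csA[OF A2] csA[OF A1] by (metis image_eqI)
  next
    fix C assume "C \<in> (\<lambda>x. cs (rep x)) ` R"
    thus "C \<in> cs ` {M. det M = int m}" using rdet by blast
  qed
  have inj: "inj_on (\<lambda>x. cs (rep x)) R"
  proof (rule inj_onI, clarify)
    fix d b d' b' assume x: "(d, b) \<in> R" "(d', b') \<in> R" "cs (rep (d, b)) = cs (rep (d', b'))"
    have "rep (d, b) \<in> cs (rep (d', b'))" using inC x(3) by metis
    then obtain A where A: "A \<in> G" "rep (d, b) = A ** rep (d', b')" unfolding cs_def by blast
    obtain p r s u where p: "A = m2 p r s u" by (rule m2_cases)
    have dm: "d dvd m" "d' dvd m" using x by (auto simp: R_def)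
    have pos: "m div d > 0" "m div d' > 0" using dm m by (auto simp: div_greater_zero_iff intro: dvd_imp_le dvd_pos_nat)
    have e: "int (m div d) = p * int (m div d')" "b = p * b' + r * int d'" "0 = s * int (m div d')" "int d = s * b' + u * int d'"
      using A(2) by (simp_all add: rep_def p m2_mult)
    have s: "s = 0" using e(3) pos by simp
    have "p * u = 1" using A(1) by (simp add: G_def p m2_det s)
    moreover have "p > 0" using e(1) pos by (metis of_nat_0_less_iff zero_less_mult_pos2)
    ultimately have pu: "p = 1" "u = 1" by (auto simp: zmult_eq_1_iff)
    have dd: "d = d'" using e(4) s pu by simp
    have "b mod int d = b' mod int d" using e(2) pu dd by simp
    hence "b = b'" using x dd by (simp add: R_def)
    thus "d = d' \<and> b = b'" using dd by simp
  qed
  have fin: "finite {d. d dvd m}" using m by simp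
  have "hecke_ell k m h t = (\<Sum>C\<in>cs ` {M. det M = int m}. val C)"
    unfolding hecke_ell_def coset_sum_def val_def cs_def G_def ..
  also have "\<dots> = (\<Sum>x\<in>R. val (cs (rep x)))" unfolding surj by (simp add: sum.reindex[OF inj])
  also have "\<dots> = (\<Sum>x\<in>R. slash_ell k h (rep x) t)" by (intro sum.cong refl val rdet)
  also have "\<dots> = (\<Sum>d | d dvd m. \<Sum>b\<in>{0..<int d}. slash_ell k h (rep (d, b)) t)"
    unfolding R_def using fin by (simp add: sum.Sigma case_prod_beta)
  finally show ?thesis by (simp add: rep_def slash_ell_m2)
qed

lemma divisors_prime_square: assumes "prime (q::nat)" shows "{d. d dvd q\<^sup>2} = {1, q, q\<^sup>2}"
proof -
  have "{d. d dvd q\<^sup>2} = (\<lambda>i. q ^ i) ` {..2}" using divides_primepow_nat[OF assms, of _ 2] by auto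
  also have "{..2::nat} = {0, 1, 2}" by auto
  finally show ?thesis by simp
qed

text \<open>The divisors \<open>1\<close>, \<open>q\<close>, \<open>q^2\<close> produce the three
  terms of \<open>bfun\<close>; in each, the sum over \<open>b\<close> is a character sum selecting
  the multiples of the divisor.\<close>

lemma hecke_ell_fourier:
  assumes h: "ell_modular k h" and q: "prime (q::nat)" and t: "Im t > 0"
    and F: "\<And>t. Im t > 0 \<Longrightarrow> ((\<lambda>N::int. a N * ee (of_int N * t)) has_sum h t) UNIV"
  shows "((\<lambda>N. bfun k q a N * ee (of_int N * t)) has_sum hecke_ell k (q\<^sup>2) h t) UNIV"
proof -
  have q0: "q > 0" using prime_gt_0_nat[OF q] .
  have q1: "q > 1" using prime_gt_1_nat[OF q] .
  have part: "((\<lambda>N. if int d dvd N then of_nat d powi (1 - k) * (a N * ee (of_int N * (of_nat e * t / of_nat d))) else 0) has_sum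
      (\<Sum>b\<in>{0..<int d}. h ((of_nat e * t + of_int b) / of_nat d) * of_nat d powi (- k))) UNIV"
    if d: "d > 0" "e > 0" for d e
  proof -
    have "((\<lambda>N. \<Sum>b\<in>{0..<int d}. a N * ee (of_int N * ((of_nat e * t + of_int b) / of_nat d)) * of_nat d powi (- k)) has_sum
      (\<Sum>b\<in>{0..<int d}. h ((of_nat e * t + of_int b) / of_nat d) * of_nat d powi (- k))) UNIV"
      using d t by (intro has_sum_sum has_sum_cmult_left F) auto
    moreover have "(\<Sum>b\<in>{0..<int d}. a N * ee (of_int N * ((of_nat e * t + of_int b) / of_nat d)) * of_nat d powi (- k)) =
       (if int d dvd N then of_nat d powi (1 - k) * (a N * ee (of_int N * (of_nat e * t / of_nat d))) else 0)" for N
    proof -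
      have "ee (of_int N * ((of_nat e * t + of_int b) / of_nat d)) = ee (of_int N * (of_nat e * t / of_nat d)) * ee (of_int (b * N) / of_nat d)" for b
        by (simp add: add_divide_distrib distrib_left ee_add mult.commute)
      hence "(\<Sum>b\<in>{0..<int d}. a N * ee (of_int N * ((of_nat e * t + of_int b) / of_nat d)) * of_nat d powi (- k)) =
        of_nat d powi (- k) * (a N * ee (of_int N * (of_nat e * t / of_nat d))) * (\<Sum>b\<in>{0..<int d}. ee (of_int (b * N) / of_nat d))"
        unfolding sum_distrib_left by (intro sum.cong refl) (simp only: mult_ac)
      moreover have "(of_nat d :: complex) powi (1 - k) = of_nat d powi (- k) * of_nat d"
        using d power_int_add[of "of_nat d :: complex" "- k" 1] by (simp add: add.commute)
      ultimately show ?thesis unfolding root_sum[OF d(1)] by simp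
    qed
    ultimately show ?thesis by simp
  qed
  have r1: "((\<lambda>N. (if (int q)\<^sup>2 dvd N then a (N div (int q)\<^sup>2) else 0) * ee (of_int N * t)) has_sum
      (\<Sum>b\<in>{0..<int 1}. h ((of_nat (q\<^sup>2) * t + of_int b) / of_nat 1) * of_nat 1 powi (- k))) UNIV"
  proof -
    have "((\<lambda>N. a N * ee (of_int N * (of_nat (q\<^sup>2) * t))) has_sum
      (\<Sum>b\<in>{0..<int 1}. h ((of_nat (q\<^sup>2) * t + of_int b) / of_nat 1) * of_nat 1 powi (- k))) UNIV"
      using part[of 1 "q\<^sup>2"] q0 by simp
    also have "?this \<longleftrightarrow> ((\<lambda>N. a (N div (int q)\<^sup>2) * ee (of_int N * t)) has_sum
      (\<Sum>b\<in>{0..<int 1}. h ((of_nat (q\<^sup>2) * t + of_int b) / of_nat 1) * of_nat 1 powi (- k))) {N. (int q)\<^sup>2 dvd N}"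
      by (rule has_sum_reindex_bij_witness[where i = "\<lambda>N. N div (int q)\<^sup>2" and j = "\<lambda>N. (int q)\<^sup>2 * N"])
         (use q0 in \<open>auto simp: mult_ac\<close>)
    also have "\<dots> \<longleftrightarrow> ?thesis" by (rule has_sum_cong_neutral) auto
    finally show ?thesis .
  qed
  have r2: "((\<lambda>N. (if int q dvd N then of_nat q powi (1 - k) * a N else 0) * ee (of_int N * t)) has_sum
      (\<Sum>b\<in>{0..<int q}. h ((of_nat q * t + of_int b) / of_nat q) * of_nat q powi (- k))) UNIV"
    by (rule has_sum_cong[THEN iffD1, OF _ part[of q q]]) (use q0 in auto)
  have r3: "((\<lambda>N. of_nat q powi (2 - 2 * k) * a ((int q)\<^sup>2 * N) * ee (of_int N * t)) has_sum
      (\<Sum>b\<in>{0..<int (q\<^sup>2)}. h ((of_nat 1 * t + of_int b) / of_nat (q\<^sup>2)) * of_nat (q\<^sup>2) powi (- k))) UNIV"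
  proof -
    have p: "(of_nat (q\<^sup>2) :: complex) powi (1 - k) = of_nat q powi (2 - 2 * k)"
    proof -
      have "(of_nat (q\<^sup>2) :: complex) powi (1 - k) = (of_nat q powi 2) powi (1 - k)" by simp
      also have "\<dots> = of_nat q powi (2 * (1 - k))" by (simp only: power_int_mult)
      finally show ?thesis by (simp add: algebra_simps)
    qed
    have "((\<lambda>N. of_nat q powi (2 - 2 * k) * (a N * ee (of_int N * (t / of_nat (q\<^sup>2))))) has_sum
      (\<Sum>b\<in>{0..<int (q\<^sup>2)}. h ((of_nat 1 * t + of_int b) / of_nat (q\<^sup>2)) * of_nat (q\<^sup>2) powi (- k))) {N. int (q\<^sup>2) dvd N}"
      by (rule has_sum_cong_neutral[THEN iffD1, OF _ _ _ part[of "q\<^sup>2" 1]])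
         (use q0 in \<open>auto simp: p[simplified]\<close>)
    also have "?this \<longleftrightarrow> ?thesis"
      by (rule has_sum_reindex_bij_witness[where i = "\<lambda>N. (int q)\<^sup>2 * N" and j = "\<lambda>N. N div (int q)\<^sup>2"])
         (use q0 in \<open>auto simp: mult_ac\<close>)
    finally show ?thesis .
  qed
  have "hecke_ell k (q\<^sup>2) h t = (\<Sum>d\<in>{1, q, q\<^sup>2}. \<Sum>b\<in>{0..<int d}. h ((of_nat (q\<^sup>2 div d) * t + of_int b) / of_nat d) * of_nat d powi (- k))"
    using hecke_ell_sum[OF h _ t, of "q\<^sup>2"] q0 unfolding divisors_prime_square[OF q] by simp
  also have "\<dots> = (\<Sum>b\<in>{0..<int 1}. h ((of_nat (q\<^sup>2 div 1) * t + of_int b) / of_nat 1) * of_nat 1 powi (- k))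
     + (\<Sum>b\<in>{0..<int q}. h ((of_nat (q\<^sup>2 div q) * t + of_int b) / of_nat q) * of_nat q powi (- k))
     + (\<Sum>b\<in>{0..<int (q\<^sup>2)}. h ((of_nat (q\<^sup>2 div q\<^sup>2) * t + of_int b) / of_nat (q\<^sup>2)) * of_nat (q\<^sup>2) powi (- k))"
  proof -
    have "1 \<noteq> q" "1 \<noteq> q\<^sup>2" "q \<noteq> q\<^sup>2" using q1 by (auto simp: power2_eq_square)
    hence "(\<Sum>d\<in>{1, q, q\<^sup>2}. g d) = g 1 + g q + g (q\<^sup>2)" for g :: "nat \<Rightarrow> complex" by simp
    thus ?thesis .
  qed
  also have "q\<^sup>2 div 1 = q\<^sup>2" by simp
  also have "q\<^sup>2 div q = q" using q0 by (simp add: power2_eq_square)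
  also have "q\<^sup>2 div q\<^sup>2 = 1" using q0 by simp
  also note E = calculation
  from has_sum_add[OF has_sum_add[OF r1 r2] r3] E show ?thesis
    unfolding bfun_def distrib_right by (simp only:)
qed

lemma uhp_fourier_zero:
  assumes F: "\<And>t. Im t > 0 \<Longrightarrow> ((\<lambda>N::int. c N * ee (of_int N * t)) has_sum 0) UNIV"
  shows "c N = 0"
proof -
  have "((\<lambda>N. c N * ee (of_int N * \<i>)) has_sum 0) {x \<in> UNIV. x = N}"
  proof (rule fourier_extract)
    fix s :: real
    have "((\<lambda>N. c N * ee (of_int N * (\<i> + of_real s))) has_sum 0) UNIV" by (rule F) simp
    thus "((\<lambda>x. c x * ee (of_int x * \<i>) * ee (of_real s * of_int x)) has_sum 0) UNIV"
      by (simp add: distrib_left ee_add mult.assoc mult.commute[of "of_real s"])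
  qed
  moreover have "((\<lambda>N. c N * ee (of_int N * \<i>)) has_sum c N * ee (of_int N * \<i>)) {x \<in> UNIV. x = N}"
    using has_sum_finite[of "{N}" "\<lambda>N. c N * ee (of_int N * \<i>)"] by simp
  ultimately have "c N * ee (of_int N * \<i>) = 0" using has_sum_unique by blast
  thus ?thesis by simp
qed

lemma eigen_iff_bfun:
  assumes h: "ell_modular k h" and q: "prime (q::nat)"
    and F: "\<And>t. Im t > 0 \<Longrightarrow> ((\<lambda>N::int. a N * ee (of_int N * t)) has_sum h t) UNIV"
  shows "eigenform_on upper_half_plane (hecke_ell k (q\<^sup>2)) h \<longleftrightarrow> (\<exists>c. \<forall>N. bfun k q a N = c * a N)"
proof -
  have "(\<forall>t\<in>upper_half_plane. hecke_ell k (q\<^sup>2) h t = c * h t) \<longleftrightarrow> (\<forall>N. bfun k q a N = c * a N)" for c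
  proof
    assume e: "\<forall>t\<in>upper_half_plane. hecke_ell k (q\<^sup>2) h t = c * h t"
    have "bfun k q a N - c * a N = 0" for N
    proof (rule uhp_fourier_zero)
      fix t :: complex assume t: "Im t > 0"
      have "((\<lambda>N. bfun k q a N * ee (of_int N * t) - c * (a N * ee (of_int N * t))) has_sum (hecke_ell k (q\<^sup>2) h t - c * h t)) UNIV"
        by (intro has_sum_diff has_sum_cmult_right hecke_ell_fourier[OF h q t F] F[OF t])
      thus "((\<lambda>N. (bfun k q a N - c * a N) * ee (of_int N * t)) has_sum 0) UNIV"
        using e t by (simp add: left_diff_distrib mult.assoc)
    qed
    thus "\<forall>N. bfun k q a N = c * a N" by simp
  next
    assume b: "\<forall>N. bfun k q a N = c * a N"
    show "\<forall>t\<in>upper_half_plane. hecke_ell k (q\<^sup>2) h t = c * h t"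
    proof
      fix t assume "t \<in> upper_half_plane"
      hence t: "Im t > 0" by simp
      have "((\<lambda>N. c * (a N * ee (of_int N * t))) has_sum c * h t) UNIV"
        by (intro has_sum_cmult_right F[OF t])
      moreover have "((\<lambda>N. c * (a N * ee (of_int N * t))) has_sum hecke_ell k (q\<^sup>2) h t) UNIV"
        using hecke_ell_fourier[OF h q t F] b by (simp add: mult.assoc)
      ultimately show "hecke_ell k (q\<^sup>2) h t = c * h t" using has_sum_unique by blast
    qed
  qed
  thus ?thesis unfolding eigenform_on_def by blast
qed

section \<open>The associated elliptic form and the theta series\<close>

lemma sum_residue_classes:
  fixes G :: "int^'m::finite \<Rightarrow> complex"
  assumes N: "N > 0" and G: "(G has_sum s) UNIV"
  shows "(\<Sum>r\<in>ibox N. infsum (\<lambda>v. G (r + int N *s v)) UNIV) = s"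
    and "\<And>r. (\<lambda>v. G (r + int N *s v)) summable_on UNIV"
proof -
  define B where "B = (\<lambda>r::int^'m. {v. vcong (int N) v r})"
  have sm: "G summable_on B r" for r
    using has_sum_imp_summable[OF G] by (rule summable_on_subset_banach) simp
  have re: "(G has_sum x) (B r) \<longleftrightarrow> ((\<lambda>v. G (r + int N *s v)) has_sum x) UNIV" for r x
  proof (rule has_sum_reindex_bij_witness[where i = "\<lambda>v. r + int N *s v" and j = "\<lambda>v. \<chi> i. (v $ i - r $ i) div int N"])
    fix v assume "v \<in> B r"
    thus 1: "r + int N *s (\<chi> i. (v $ i - r $ i) div int N) = v" by (simp add: B_def vcong_def vec_eq_iff)
    show "G (r + int N *s (\<chi> i. (v $ i - r $ i) div int N)) = G v" unfolding 1 ..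
  qed (use N in \<open>auto simp: B_def vcong_def vec_eq_iff\<close>)
  have sB: "((\<lambda>v. G (r + int N *s v)) has_sum infsum G (B r)) UNIV" for r
    using has_sum_infsum[OF sm[of r]] unfolding re .
  show "\<And>r. (\<lambda>v. G (r + int N *s v)) summable_on UNIV"
    using sB has_sum_imp_summable by blast
  have "(G has_sum (\<Sum>r\<in>ibox N. infsum G (B r))) (\<Union>r\<in>ibox N. B r)"
  proof (rule sum_has_sum)
    fix r r' :: "int^'m" assume r: "r \<in> ibox N" "r' \<in> ibox N" "r \<noteq> r'"
    show "B r \<inter> B r' = {}"
    proof (rule ccontr)
      assume "B r \<inter> B r' \<noteq> {}"
      then obtain v where "vcong (int N) v r" "vcong (int N) v r'" by (auto simp: B_def)
      hence "vcong (int N) r r'" using vcong_sym vcong_trans by blast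
      thus False using box_eqI r by blast
    qed
  qed (use sm in \<open>auto simp: has_sum_infsum\<close>)
  moreover have "(\<Union>r\<in>ibox N. B r) = UNIV"
  proof -
    have "v \<in> B (red N v)" for v by (simp add: B_def vcong_sym red_cong)
    thus ?thesis using red_box[OF N] by blast
  qed
  ultimately have "(\<Sum>r\<in>ibox N. infsum G (B r)) = s" using G has_sum_unique by metis
  moreover have "infsum G (B r) = infsum (\<lambda>v. G (r + int N *s v)) UNIV" for r
    using infsumI[OF sB[of r]] by simp
  ultimately show "(\<Sum>r\<in>ibox N. infsum (\<lambda>v. G (r + int N *s v)) UNIV) = s" by simp
qed

lemma infsum_complex_of_real: "infsum (\<lambda>x. complex_of_real (g x)) A = of_real (infsum g A)"
proof (cases "g summable_on A")
  case True
  thus ?thesis by (intro infsumI has_sum_of_real has_sum_infsum)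
next
  case False
  have "\<not> (\<lambda>x. complex_of_real (g x)) summable_on A"
  proof
    assume "(\<lambda>x. complex_of_real (g x)) summable_on A"
    hence "(\<lambda>x. Re (complex_of_real (g x))) summable_on A" by (rule summable_on_Re)
    thus False using False by simp
  qed
  thus ?thesis using False by (simp add: infsum_not_exists)
qed

text \<open>Holomorphic functions on a connected set have no zero divisors. This allows cancelling
  \<open>h\<close> from an identity although its zeros are not known.\<close>

lemma uhp_product_zero:
  assumes F: "F holomorphic_on upper_half_plane" and G: "G holomorphic_on upper_half_plane"
    and FG: "\<And>t. Im t > 0 \<Longrightarrow> F t * G t = 0" and t0: "Im t0 > 0" "G t0 \<noteq> 0" and t: "Im t > 0"
  shows "F t = 0"
proof -
  have "continuous_on upper_half_plane G" using G by (rule holomorphic_on_imp_continuous_on)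
  hence "isCont G t0" using open_uhp t0 by (simp add: continuous_on_eq_continuous_at)
  then obtain e where e: "e > 0" "\<And>u. dist u t0 < e \<Longrightarrow> G u \<noteq> 0"
    using t0(2) continuous_at_avoid[of t0 G 0] by (auto simp: dist_commute)
  define U where "U = ball t0 e \<inter> upper_half_plane"
  have oU: "open U" unfolding U_def using open_uhp by auto
  have "t0 \<in> U" using e t0 by (simp add: U_def)
  show ?thesis
  proof (rule analytic_continuation[OF F open_uhp connected_uhp, where U = U and \<xi> = t0])
    show "t0 islimpt U" using oU \<open>t0 \<in> U\<close> by (rule open_imp_islimpt)
    fix z assume "z \<in> U"
    thus "F z = 0" using FG[of z] e(2)[of z] by (auto simp: U_def dist_commute)
  qed (use t t0 U_def in auto)
qed

lemma power_int_diff_nat: "z \<noteq> 0 \<Longrightarrow> (z::complex) powi (l - int n) * z ^ n = z powi l"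
  using power_int_add[of z "l - int n" "int n"] by simp

locale maass_form = even_unimodular S for S :: "int^'n^'n::finite" +
  fixes k :: int and f :: "complex^'n bord \<Rightarrow> complex"
  assumes f: "f \<in> maass_space S k"
begin

abbreviation a :: "int \<Rightarrow> complex" where "a \<equiv> ac f"
abbreviation h :: "complex \<Rightarrow> complex" where "h \<equiv> star S f"

lemmas fm = maass_modular[OF f]

text \<open>General term of the Jacobi theta series of \<open>S\<close>; at \<open>z = 0\<close> the
  sum over \<open>\<mu>\<close> is the theta series \<open>Th\<close>.\<close>

definition jt :: "complex \<Rightarrow> complex^'n \<Rightarrow> int^'n \<Rightarrow> complex" where
  "jt t z \<mu> = ee (of_int (qS \<mu>) * t - bS S (ivec \<mu>) z)"

lemma fx_last:
  "fx (bvec (N + qS \<mu>) \<mu> 1) (bvec c z t) = ee (of_int N * t) * jt t z \<mu> * ee c"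
proof -
  have "bil (S0 S) (ivec (bvec (N + qS \<mu>) \<mu> 1)) (bvec c z t) = of_int N * t + (of_int (qS \<mu>) * t - bS S (ivec \<mu>) z) + c"
    by (simp add: bil_S0 algebra_simps)
  thus ?thesis by (simp only: fx_def jt_def ee_add)
qed

text \<open>By \<open>al_last\<close> the coefficient at \<open>(N, \<mu>, 1)\<close> depends on
  \<open>N - qS \<mu>\<close> only. Replacing \<open>N\<close> by \<open>N + qS \<mu>\<close>
  separates the variables, so the terms of Fourier-Jacobi index 1 are those of the product of
  \<open>star S f\<close> and the Jacobi theta series.\<close>

lemma jacobi_reindex:
  "((\<lambda>v. al f v * fx v (bvec c z t)) has_sum x) {v. v $ lst_ix = 1} \<longleftrightarrow>
   ((\<lambda>(N, \<mu>). a N * ee (of_int N * t) * jt t z \<mu> * ee c) has_sum x) (UNIV \<times> UNIV)"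
proof (rule has_sum_reindex_bij_witness[where j = "\<lambda>v. (v $ fst_ix - qS (mid v), mid v)" and i = "\<lambda>(N, \<mu>). bvec (N + qS \<mu>) \<mu> 1"])
  fix v :: "int^'n bord" assume "v \<in> {v. v $ lst_ix = 1}"
  then obtain N p where v: "v = bvec N p 1" by (cases v) auto
  have 1: "bvec (N - qS p + qS p) p 1 = bvec N p 1" by simp
  show "(case (v $ fst_ix - qS (mid v), mid v) of (N, \<mu>) \<Rightarrow> a N * ee (of_int N * t) * jt t z \<mu> * ee c) = al f v * fx v (bvec c z t)"
    using fx_last[of "N - qS p" p c z t] by (simp add: v al_last[OF f] mult.assoc)
qed (auto simp: bvec_surj, metis bvec_surj)

lemma al_summable: "w \<in> half_space S \<Longrightarrow> (\<lambda>v. al f v * fx v w) summable_on A"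
  using has_sum_imp_summable[OF al_has_sum[OF fm]] by (rule summable_on_subset_banach) auto

lemma jacobi_summable:
  assumes "bvec c z t \<in> half_space S"
  shows "(\<lambda>(N, \<mu>). a N * ee (of_int N * t) * jt t z \<mu> * ee c) summable_on (UNIV \<times> UNIV)"
  using al_summable[OF assms, of "{v. v $ lst_ix = 1}"] jacobi_reindex[of c z t] by (auto simp: summable_on_def)

text \<open>Convergence of theta is inherited from \<open>f\<close>: for a single nonzero
  \<open>a N\<close> the theta terms are, up to a constant, a subfamily of the absolutely convergent
  expansion of \<open>f\<close>.\<close>

lemma jt_summable:
  assumes N: "a N \<noteq> 0" and w: "bvec c z t \<in> half_space S"
  shows "jt t z summable_on UNIV"
proof -
  have "(\<lambda>\<mu>. a N * ee (of_int N * t) * jt t z \<mu> * ee c) summable_on UNIV"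
    using summable_on_SigmaD1[OF jacobi_summable[OF w], of N] by simp
  hence "(\<lambda>\<mu>. inverse (a N * ee (of_int N * t) * ee c) * (a N * ee (of_int N * t) * jt t z \<mu> * ee c)) summable_on UNIV"
    by (rule summable_on_cmult_right)
  moreover have "inverse (a N * ee (of_int N * t) * ee c) * (a N * ee (of_int N * t) * jt t z \<mu> * ee c) = jt t z \<mu>" for \<mu>
  proof -
    have nz: "a N * ee (of_int N * t) * ee c \<noteq> 0" using N by simp
    have eq: "a N * ee (of_int N * t) * jt t z \<mu> * ee c = (a N * ee (of_int N * t) * ee c) * jt t z \<mu>"
      by (simp only: mult_ac)
    have c: "inverse X * (X * j) = j" if "X \<noteq> 0" for X j :: complex using that by simp
    show ?thesis unfolding eq by (rule c[OF nz])
  qed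
  ultimately show ?thesis by (simp only:)
qed

lemma half_space_diag: "Im t > 0 \<Longrightarrow> bvec (\<i> + of_real s) 0 t \<in> half_space S"
  by (simp add: half_space_iff Hpm_def bil_S0 vmap_0)

lemma half_space_diag': "y > 0 \<Longrightarrow> bvec (\<i> + of_real s) (vmap of_real x) (\<i> * of_real y) \<in> half_space S"
proof -
  have "vmap Im (vmap complex_of_real x) = (0 :: real^'n)" by (simp add: vec_eq_iff)
  thus "y > 0 \<Longrightarrow> ?thesis" by (simp add: half_space_iff Hpm_def bil_S0)
qed

text \<open>The terms with \<open>\<mu> = 0\<close> form a subfamily of the expansion of
  \<open>f\<close> at \<open>(i, 0, t)\<close>, so the series defining \<open>star\<close> converges
  absolutely.\<close>

lemma h_has_sum: assumes t: "Im t > 0"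
  shows "((\<lambda>N. a N * ee (of_int N * t)) has_sum h t) UNIV"
proof -
  have w: "bvec \<i> 0 t \<in> half_space S" using half_space_diag[OF t, of 0] by simp
  have "(\<lambda>N. (case (N, 0) of (N, \<mu>) \<Rightarrow> a N * ee (of_int N * t) * jt t 0 \<mu> * ee \<i>)) summable_on UNIV"
  proof -
    have "(\<lambda>(N, \<mu>). a N * ee (of_int N * t) * jt t 0 \<mu> * ee \<i>) summable_on (\<lambda>N. (N, 0)) ` UNIV"
      using jacobi_summable[OF w] by (rule summable_on_subset_banach) auto
    also have "?this \<longleftrightarrow> (\<lambda>(N, \<mu>). a N * ee (of_int N * t) * jt t 0 \<mu> * ee \<i>) \<circ> (\<lambda>N. (N, 0)) summable_on UNIV"
      by (rule summable_on_reindex) (auto intro: inj_onI)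
    finally show ?thesis by (simp add: o_def)
  qed
  hence "(\<lambda>N. inverse (ee \<i>) * (a N * ee (of_int N * t) * ee \<i>)) summable_on UNIV"
    by (intro summable_on_cmult_right) (simp add: jt_def)
  hence sm: "(\<lambda>N. a N * ee (of_int N * t)) summable_on UNIV" by (simp add: field_simps)
  then obtain s where s: "((\<lambda>N. a N * ee (of_int N * t)) has_sum s) UNIV" by (auto simp: summable_on_def)
  also have "?this \<longleftrightarrow> ((\<lambda>N. a N * ee (of_int N * t)) has_sum s) (range int)"
  proof (rule has_sum_cong_neutral)
    fix N assume "N \<in> UNIV - range int"
    hence "N < 0" by (metis DiffD2 not_le nonneg_int_cases rangeI)
    thus "a N * ee (of_int N * t) = 0" using ac_neg[OF f] by simp
  qed auto
  also have "\<dots> \<longleftrightarrow> ((\<lambda>N. a N * ee (of_int N * t)) \<circ> int has_sum s) UNIV"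
    by (rule has_sum_reindex) (simp add: inj_on_def)
  finally have "((\<lambda>l. a (int l) * ee (of_nat l * t)) has_sum s) UNIV" by (simp add: o_def)
  from has_sum_imp_sums[OF this] have "s = (\<Sum>l. a (int l) * ee (of_nat l * t))" by (rule sums_unique)
  also have "\<dots> = h t" by (simp add: star_def ac_def al_def ee_def mult.assoc)
  finally show ?thesis using s by simp
qed

lemma h_period: "Im t > 0 \<Longrightarrow> h (t + 1) = h t"
proof -
  assume t: "Im t > 0"
  have "ee (of_int N * (t + 1)) = ee (of_int N * t)" for N :: int
    by (simp add: distrib_left ee_add)
  hence "((\<lambda>N. a N * ee (of_int N * t)) has_sum h (t + 1)) UNIV" using h_has_sum[of "t + 1"] t by simp
  thus ?thesis using h_has_sum[OF t] has_sum_unique by blast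
qed

lemma holomorphic_h: "h holomorphic_on upper_half_plane"
proof -
  have "((\<lambda>N. (if N < 0 then 0 else a N) * ee (of_nat (nat N) * t)) has_sum h t) UNIV" if "Im t > 0" for t
  proof -
    have "(if N < 0 then 0 else a N) * ee (of_nat (nat N) * t) = a N * ee (of_int N * t)" for N
      using ac_neg[OF f, of N] by (simp add: of_nat_nat)
    thus ?thesis using h_has_sum[OF that] by simp
  qed
  thus ?thesis by (rule holomorphic_fourier)
qed

lemma jacobi_value:
  assumes N: "a N0 \<noteq> 0" and w: "bvec c z t \<in> half_space S" and t: "Im t > 0"
    and s: "((\<lambda>v. al f v * fx v (bvec c z t)) has_sum s) {v. v $ lst_ix = 1}"
  shows "s = h t * infsum (jt t z) UNIV * ee c"
proof -
  have "((\<lambda>N. a N * ee (of_int N * t) * infsum (jt t z) UNIV * ee c) has_sum s) UNIV"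
  proof (rule has_sum_SigmaD)
    show "((\<lambda>(N, \<mu>). a N * ee (of_int N * t) * jt t z \<mu> * ee c) has_sum s) (UNIV \<times> UNIV)"
      using s jacobi_reindex by blast
    fix N
    show "((\<lambda>\<mu>. case (N, \<mu>) of (N, \<mu>) \<Rightarrow> a N * ee (of_int N * t) * jt t z \<mu> * ee c) has_sum
       (a N * ee (of_int N * t) * infsum (jt t z) UNIV * ee c)) UNIV"
      using has_sum_infsum[OF jt_summable[OF N w]]
      by (auto intro!: has_sum_cmult_left has_sum_cmult_right)
  qed
  moreover have "((\<lambda>N. a N * ee (of_int N * t) * infsum (jt t z) UNIV * ee c) has_sum (h t * infsum (jt t z) UNIV * ee c)) UNIV"
    by (intro has_sum_cmult_left h_has_sum t)
  ultimately show ?thesis using has_sum_unique by blast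
qed

text \<open>General term of the theta series of the lattice shifted by \<open>x\<close>, on the
  imaginary axis: the other side of the Poisson formula for \<open>jt\<close>.\<close>

definition pt :: "real \<Rightarrow> real^'n \<Rightarrow> int^'n \<Rightarrow> complex" where
  "pt y x \<mu> = of_real (exp (- pi * y * bS S (ivec \<mu> + x) (ivec \<mu> + x)))"

text \<open>The inversion \<open>sig\<close> at points with \<open>tau' = i y\<close> and real
  \<open>z = x\<close>. The real shift \<open>s\<close> of the first coordinate passes through
  unchanged and is the free parameter of the next extraction.\<close>

lemma sig_step:
  assumes y: "y > 0"
  defines "w' \<equiv> \<lambda>s x. bvec (\<i> + of_real s + \<i> * of_real (bS S x x / (2 * y))) ((- \<i> / of_real y) *s vmap of_real x) (\<i> * of_real (1 / y)) :: complex^'n bord"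
    and "w \<equiv> \<lambda>s x. bvec (\<i> + of_real s) (vmap of_real x) (\<i> * of_real y) :: complex^'n bord"
  shows "w' s x \<in> half_space S" "f (w' s x) = (\<i> * of_real y) powi k * f (w s x)"
proof -
  have yc: "\<i> * complex_of_real y \<noteq> 0" using y by simp
  have w: "w s x \<in> half_space S" unfolding w_def by (rule half_space_diag'[OF y])
  have e: "orth_act S sig (w s x) = w' s x"
  proof -
    have 1: "bS S (vmap of_real x) (vmap of_real x) = complex_of_real (bS S x x)" by (rule hom_real.h_bS[symmetric])
    have 2: "inverse (\<i> * complex_of_real y) = - \<i> / of_real y" "- 1 / (\<i> * complex_of_real y) = \<i> * of_real (1 / y)"
      using y by (simp_all add: field_simps)
    have 3: "- (complex_of_real (bS S x x) / (2 * (\<i> * of_real y))) = \<i> * of_real (bS S x x / (2 * y))"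
      using y by (simp add: field_simps)
    show ?thesis unfolding w_def w'_def act_sig(2)[OF yc] 1 2 using 3 by (simp add: diff_conv_add_uminus)
  qed
  show "w' s x \<in> half_space S"
    unfolding e[symmetric] by (rule SO_plusD(3)[OF Gamma_S_SO[OF sig_Gamma] w])
  have "slash S k f sig (w s x) = f (w s x)" by (rule modular[OF fm sig_Gamma w])
  hence "f (w' s x) * (\<i> * of_real y) powi (- k) = f (w s x)"
    by (simp only: slash_def e) (simp only: w_def act_sig(1)[OF yc])
  thus "f (w' s x) = (\<i> * of_real y) powi k * f (w s x)"
    using yc by (auto simp: power_int_minus field_simps)
qed

lemma fx_shift: "fx v (bvec (c + of_real s + d) z t) = fx v (bvec (c + d) z t) * ee (of_real s * of_int (v $ lst_ix))"
proof -
  have "bil (S0 S) (ivec v) (bvec (c + of_real s + d) z t) = bil (S0 S) (ivec v) (bvec (c + d) z t) + of_real s * of_int (v $ lst_ix)"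
    by (simp add: bil_S0' algebra_simps)
  thus ?thesis by (simp only: fx_def ee_add)
qed

text \<open>On both sides \<open>s\<close> enters only through a character of the last coordinate of
  the index, so the transformation law splits by Fourier-Jacobi index.\<close>

lemma sig_extract:
  fixes x :: "real^'n"
  assumes y: "y > 0"
  defines "w' \<equiv> bvec (\<i> + \<i> * of_real (bS S x x / (2 * y))) ((- \<i> / of_real y) *s vmap of_real x) (\<i> * of_real (1 / y)) :: complex^'n bord"
    and "w \<equiv> bvec \<i> (vmap of_real x) (\<i> * of_real y) :: complex^'n bord"
  shows "((\<lambda>v. al f v * fx v w' - (\<i> * of_real y) powi k * (al f v * fx v w)) has_sum 0) {v. v $ lst_ix = m}"
proof -
  have "((\<lambda>v. al f v * fx v w' - (\<i> * of_real y) powi k * (al f v * fx v w)) has_sum 0) {v \<in> UNIV. v $ lst_ix = m}"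
  proof (rule fourier_extract)
    fix s :: real
    let ?w' = "bvec (\<i> + of_real s + \<i> * of_real (bS S x x / (2 * y))) ((- \<i> / of_real y) *s vmap of_real x) (\<i> * of_real (1 / y)) :: complex^'n bord"
    let ?w = "bvec (\<i> + of_real s) (vmap of_real x) (\<i> * of_real y) :: complex^'n bord"
    have "((\<lambda>v. al f v * fx v ?w' - (\<i> * of_real y) powi k * (al f v * fx v ?w)) has_sum (f ?w' - (\<i> * of_real y) powi k * f ?w)) UNIV"
      by (intro has_sum_diff has_sum_cmult_right al_has_sum[OF fm] sig_step[OF y] half_space_diag'[OF y])
    moreover have "f ?w' - (\<i> * of_real y) powi k * f ?w = 0" using sig_step(2)[OF y] by simp
    moreover have "fx v ?w' = fx v w' * ee (of_real s * of_int (v $ lst_ix))" for v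
      unfolding w'_def by (rule fx_shift)
    moreover have "fx v ?w = fx v w * ee (of_real s * of_int (v $ lst_ix))" for v
      unfolding w_def using fx_shift[of v \<i> s 0] by simp
    ultimately show "((\<lambda>v. (al f v * fx v w' - (\<i> * of_real y) powi k * (al f v * fx v w)) * ee (of_real s * of_int (v $ lst_ix))) has_sum 0) UNIV"
      by (simp add: left_diff_distrib mult.assoc)
  qed
  thus ?thesis by simp
qed

text \<open>The summand \<open>S[x] / (2 y)\<close> that \<open>sig\<close> adds to the first
  coordinate is exactly what completes the square in \<open>\<mu> + x\<close>.\<close>

lemma pt_jt:
  assumes y: "y > 0"
  shows "pt (1 / y) x \<mu> = ee (\<i> * of_real (bS S x x / (2 * y))) * jt (\<i> * of_real (1 / y)) ((- \<i> / of_real y) *s vmap of_real x) \<mu>"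
proof -
  have 1: "bS S (ivec \<mu>) (vmap of_real x) = complex_of_real (bS S (ivec \<mu>) x)"
    by (simp add: hom_real.h_bS)
  have 2: "real_of_int (qS \<mu>) = bS S (ivec \<mu>) (ivec \<mu>) / 2" by (rule qS_real)
  have 3: "bS S (ivec \<mu> + x) (ivec \<mu> + x) = bS S (ivec \<mu>) (ivec \<mu>) + 2 * bS S (ivec \<mu>) x + bS S x x"
    by (simp add: bil_simps bS_commute[of x "ivec \<mu>"])
  have "of_int (qS \<mu>) * (\<i> * of_real (1 / y)) - bS S (ivec \<mu>) ((- \<i> / of_real y) *s vmap of_real x) + \<i> * of_real (bS S x x / (2 * y))
     = \<i> * of_real (1 / y * bS S (ivec \<mu> + x) (ivec \<mu> + x) / 2)"
    unfolding bil_scale 1 3 of_real_of_int_eq[where 'a = complex, symmetric] 2 using y by (simp add: field_simps)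
  hence "ee (\<i> * of_real (bS S x x / (2 * y))) * jt (\<i> * of_real (1 / y)) ((- \<i> / of_real y) *s vmap of_real x) \<mu>
    = ee (\<i> * of_real (1 / y * bS S (ivec \<mu> + x) (ivec \<mu> + x) / 2))"
    unfolding jt_def ee_add[symmetric] by (simp only: add.commute)
  also have "\<dots> = exp (of_real (- pi * (1 / y) * bS S (ivec \<mu> + x) (ivec \<mu> + x)))"
    unfolding ee_def by (rule arg_cong[of _ _ exp]) (simp add: complex_eq_iff)
  finally show ?thesis by (simp only: pt_def exp_of_real)
qed

text \<open>Consider Fourier-Jacobi index 0. There \<open>nn\<close> forces norm 0, so for nonzero
  indices all terms of the divisor sum contain \<open>a 0 = 0\<close>. Only the constant term is
  left, and \<open>sig\<close> at \<open>tau' = 2 i\<close> multiplies it by \<open>(2 i)^k\<close>,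
  whose absolute value is not 1.\<close>

lemma constant_coeff_zero:
  assumes a0: "a 0 = 0" and k: "k \<noteq> 0" shows "al f 0 = 0"
proof -
  have y: "(2::real) > 0" by simp
  let ?w' = "bvec (\<i> + \<i> * of_real (bS S 0 0 / (2 * 2))) ((- \<i> / of_real 2) *s vmap of_real 0) (\<i> * of_real (1 / 2)) :: complex^'n bord"
  let ?w = "bvec \<i> (vmap of_real 0) (\<i> * of_real 2) :: complex^'n bord"
  have "((\<lambda>v. al f v * fx v ?w' - (\<i> * of_real 2) powi k * (al f v * fx v ?w)) has_sum 0) {v. v $ lst_ix = 0}"
    by (rule sig_extract[OF y])
  moreover have "al f v = 0" if "v $ lst_ix = 0" "v \<noteq> 0" for v
  proof (cases "nn v")
    case True
    obtain s p t where v: "v = bvec s p t" by (cases v)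
    have t: "t = 0" using that by (simp add: v)
    have "qS p \<le> 0" using True by (simp add: v t nn_def Q0_bvec)
    hence "Q0 v = 0" using qS_nonneg[of p] by (simp add: v t Q0_bvec)
    thus ?thesis using maass_al[OF f that(2) True] by (simp add: dsum_def a0)
  next
    case False thus ?thesis using al_nn[OF fm] by blast
  qed
  ultimately have "((\<lambda>v. al f v * fx v ?w' - (\<i> * of_real 2) powi k * (al f v * fx v ?w)) has_sum 0) {0}"
    by (subst has_sum_cong_neutral[where T = "{v. v $ lst_ix = 0}"
        and g = "\<lambda>v. al f v * fx v ?w' - (\<i> * of_real 2) powi k * (al f v * fx v ?w)"]) auto
  moreover have "((\<lambda>v. al f v * fx v ?w' - (\<i> * of_real 2) powi k * (al f v * fx v ?w)) has_sum
     (al f 0 * fx 0 ?w' - (\<i> * of_real 2) powi k * (al f 0 * fx 0 ?w))) {0}"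
    using has_sum_finite[of "{0}" "\<lambda>v. al f v * fx v ?w' - (\<i> * of_real 2) powi k * (al f v * fx v ?w)"] by simp
  ultimately have "al f 0 * fx 0 ?w' - (\<i> * of_real 2) powi k * (al f 0 * fx 0 ?w) = 0"
    using has_sum_unique by blast
  hence "al f 0 * (1 - (2 * \<i>) powi k) = 0" by (simp add: fx_def algebra_simps)
  moreover have "(2 * \<i>) powi k \<noteq> 1"
  proof
    assume "(2 * \<i>) powi k = 1"
    hence "norm ((2 * \<i>) powi k) = 1" by simp
    hence p: "(2::real) powi k = 1" by (simp add: norm_power_int norm_mult)
    obtain n where n: "k = int n \<or> k = - int n" by (cases k rule: int_cases2) auto
    hence "(2::real) ^ n = 1" using p by (auto simp: power_int_minus)
    moreover have "n > 0" using n k by auto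
    hence "(1::real) < 2 ^ n" by (intro one_less_power) auto
    ultimately show False by simp
  qed
  ultimately show ?thesis by simp
qed

end

locale maass_form_nonzero = maass_form S k f
    for S :: "int^'n^'n::finite" and k f +
  fixes N0 assumes N0: "ac f N0 \<noteq> 0"
begin

lemma h_nonzero: "\<exists>t. Im t > 0 \<and> h t \<noteq> 0"
proof (rule ccontr)
  assume "\<nexists>t. Im t > 0 \<and> h t \<noteq> 0"
  hence "((\<lambda>N. a N * ee (of_int N * t)) has_sum 0) UNIV" if "Im t > 0" for t
    using h_has_sum[OF that] that by force
  hence "a N0 = 0" by (rule uhp_fourier_zero)
  thus False using N0 by simp
qed

lemma h_nonzero_ray: "0 \<le> \<alpha> \<Longrightarrow> \<alpha> < \<beta> \<Longrightarrow> \<exists>y>\<alpha>. y < \<beta> \<and> h (\<i> * of_real y) \<noteq> 0"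
  using uhp_identity[OF holomorphic_h, of \<alpha> \<beta>] h_nonzero by blast

lemma pt_summable: assumes "y > 0" shows "pt y x summable_on UNIV"
proof -
  have y: "1 / y > 0" using assms by simp
  have "jt (\<i> * of_real (1 / (1 / y))) ((- \<i> / of_real (1 / y)) *s vmap of_real x) summable_on UNIV"
    using sig_step(1)[OF y] by (intro jt_summable[OF N0])
  hence "(\<lambda>\<mu>. ee (\<i> * of_real (bS S x x / (2 * (1 / y)))) * jt (\<i> * of_real (1 / (1 / y))) ((- \<i> / of_real (1 / y)) *s vmap of_real x) \<mu>) summable_on UNIV"
    by (rule summable_on_cmult_right)
  thus ?thesis unfolding pt_jt[OF y, symmetric] by simp
qed

lemma jt_summable_diag: "y > 0 \<Longrightarrow> jt (\<i> * of_real y) (vmap of_real x) summable_on UNIV"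
  using half_space_diag'[of y 0 x] by (intro jt_summable[OF N0]) simp_all

text \<open>Index 1 of \<open>sig_extract\<close>, with both sides factored by
  \<open>jacobi_value\<close>. At this stage \<open>h\<close> and theta transform only as a
  product.\<close>

lemma jacobi_transform:
  assumes y: "y > 0"
  shows "h (\<i> * of_real (1 / y)) * infsum (pt (1 / y) x) UNIV =
     (\<i> * of_real y) powi k * h (\<i> * of_real y) * infsum (jt (\<i> * of_real y) (vmap of_real x)) UNIV"
proof -
  let ?w' = "bvec (\<i> + \<i> * of_real (bS S x x / (2 * y))) ((- \<i> / of_real y) *s vmap of_real x) (\<i> * of_real (1 / y)) :: complex^'n bord"
  let ?w = "bvec \<i> (vmap of_real x) (\<i> * of_real y) :: complex^'n bord"
  have w': "?w' \<in> half_space S" using sig_step(1)[OF y, of 0 x] by simp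
  have w: "?w \<in> half_space S" using half_space_diag'[OF y, of 0 x] by simp
  obtain s' where s': "((\<lambda>v. al f v * fx v ?w') has_sum s') {v. v $ lst_ix = 1}"
    using al_summable[OF w'] by (auto simp: summable_on_def)
  obtain s where s: "((\<lambda>v. al f v * fx v ?w) has_sum s) {v. v $ lst_ix = 1}"
    using al_summable[OF w] by (auto simp: summable_on_def)
  have "((\<lambda>v. al f v * fx v ?w' - (\<i> * of_real y) powi k * (al f v * fx v ?w)) has_sum (s' - (\<i> * of_real y) powi k * s)) {v. v $ lst_ix = 1}"
    by (intro has_sum_diff has_sum_cmult_right s s')
  hence "s' - (\<i> * of_real y) powi k * s = 0" using sig_extract[OF y] has_sum_unique by blast
  hence ss: "s' = (\<i> * of_real y) powi k * s" by simp
  have 1: "s' = h (\<i> * of_real (1 / y)) * infsum (jt (\<i> * of_real (1 / y)) ((- \<i> / of_real y) *s vmap of_real x)) UNIV * ee (\<i> + \<i> * of_real (bS S x x / (2 * y)))"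
    using y by (intro jacobi_value[OF N0 w' _ s']) simp
  have 2: "s = h (\<i> * of_real y) * infsum (jt (\<i> * of_real y) (vmap of_real x)) UNIV * ee \<i>"
    using y by (intro jacobi_value[OF N0 w _ s]) simp
  have 3: "infsum (pt (1 / y) x) UNIV = ee (\<i> * of_real (bS S x x / (2 * y))) * infsum (jt (\<i> * of_real (1 / y)) ((- \<i> / of_real y) *s vmap of_real x)) UNIV"
    unfolding pt_jt[OF y] by (rule infsum_cmult_right')
  have "h (\<i> * of_real (1 / y)) * infsum (pt (1 / y) x) UNIV * ee \<i> = s'"
    unfolding 1 3 ee_add by (simp only: mult_ac)
  also have "\<dots> = (\<i> * of_real y) powi k * h (\<i> * of_real y) * infsum (jt (\<i> * of_real y) (vmap of_real x)) UNIV * ee \<i>"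
    unfolding ss 2 by (simp only: mult_ac)
  finally show ?thesis by simp
qed

section \<open>The theta series of \<open>S\<close> and its inversion on the imaginary axis\<close>

definition Th :: "complex \<Rightarrow> complex" where
  "Th t = infsum (\<lambda>\<mu>. ee (of_int (qS \<mu>) * t)) UNIV"

lemma Th_has_sum: assumes t: "Im t > 0" shows "((\<lambda>\<mu>. ee (of_int (qS \<mu>) * t)) has_sum Th t) UNIV"
proof -
  have "jt t 0 summable_on UNIV" using half_space_diag[OF t, of 0] by (intro jt_summable[OF N0]) simp
  moreover have "jt t 0 = (\<lambda>\<mu>. ee (of_int (qS \<mu>) * t))" by (simp add: jt_def fun_eq_iff)
  ultimately show ?thesis unfolding Th_def by (intro has_sum_infsum) simp
qed

lemma holomorphic_Th: "Th holomorphic_on upper_half_plane"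
proof (rule holomorphic_fourier[where c = "\<lambda>_. 1" and \<phi> = "\<lambda>\<mu>. nat (qS \<mu>)"])
  fix t :: complex assume "Im t > 0"
  thus "((\<lambda>\<mu>. 1 * ee (of_nat (nat (qS \<mu>)) * t)) has_sum Th t) UNIV"
    using Th_has_sum qS_nonneg by (simp add: of_nat_nat)
qed

lemma Th_period: "Im t > 0 \<Longrightarrow> Th (t + 1) = Th t"
  by (simp add: Th_def distrib_left ee_add)

lemma pt_0: "pt y 0 \<mu> = ee (of_int (qS \<mu>) * (\<i> * of_real y))"
proof -
  have "2 * of_real pi * \<i> * (of_int (qS \<mu>) * (\<i> * of_real y)) = complex_of_real (- pi * y * bS S (ivec \<mu>) (ivec \<mu>))"
    unfolding of_real_of_int_eq[where 'a = complex, symmetric] qS_real by (simp add: complex_eq_iff)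
  thus ?thesis unfolding pt_def ee_def exp_of_real[symmetric] by simp
qed

lemma Th_pt: "Th (\<i> * of_real y) = infsum (pt y 0) UNIV"
  unfolding Th_def pt_0 ..

definition th :: "real \<Rightarrow> real" where
  "th y = infsum (\<lambda>\<mu>. exp (- pi * y * bS S (ivec \<mu>) (ivec \<mu>))) UNIV"

lemma th_summable: "y > 0 \<Longrightarrow> (\<lambda>\<mu>. exp (- pi * y * bS S (ivec \<mu>) (ivec \<mu>))) summable_on UNIV"
proof -
  assume "y > 0"
  hence "(\<lambda>\<mu>. norm (pt y 0 \<mu>)) summable_on UNIV"
    using pt_summable by (simp only: summable_on_iff_abs_summable_on_complex[symmetric])
  thus ?thesis by (simp add: pt_def)
qed

lemma Th_th: "Th (\<i> * of_real y) = of_real (th y)"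
proof -
  have "pt y 0 = (\<lambda>\<mu>. complex_of_real (exp (- pi * y * bS S (ivec \<mu>) (ivec \<mu>))))"
    by (simp add: pt_def fun_eq_iff)
  thus ?thesis by (simp only: Th_pt th_def infsum_complex_of_real)
qed

lemma th_ge_1: assumes "y > 0" shows "th y \<ge> 1"
proof -
  have "infsum (\<lambda>\<mu>. exp (- pi * y * bS S (ivec \<mu>) (ivec \<mu>))) {0} \<le> th y"
    unfolding th_def using th_summable[OF assms] by (intro infsum_mono2) auto
  thus ?thesis by simp
qed

lemma qS_ge_1: "\<mu> \<noteq> 0 \<Longrightarrow> bS S (ivec \<mu>) (ivec \<mu>) \<ge> (2::real)"
proof -
  assume "\<mu> \<noteq> 0"
  hence "qS \<mu> \<ge> 1" using qS_nonneg[of \<mu>] qS_eq_0[of \<mu>] by linarith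
  hence "real_of_int (qS \<mu>) \<ge> 1" by simp
  thus ?thesis unfolding qS_real by simp
qed

lemma th_tail:
  assumes y: "y > 0"
  shows "infsum (\<lambda>\<mu>. exp (- pi * y * bS S (ivec \<mu>) (ivec \<mu>))) (- {0}) = th y - 1"
proof -
  have "th y = infsum (\<lambda>\<mu>. exp (- pi * y * bS S (ivec \<mu>) (ivec \<mu>))) ({0} \<union> - {0})"
    unfolding th_def by (rule arg_cong) auto
  also have "\<dots> = infsum (\<lambda>\<mu>. exp (- pi * y * bS S (ivec \<mu>) (ivec \<mu>))) {0} + infsum (\<lambda>\<mu>. exp (- pi * y * bS S (ivec \<mu>) (ivec \<mu>))) (- {0})"
    using th_summable[OF y] by (intro infsum_Un_disjoint) (auto intro: summable_on_subset_banach)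
  finally show ?thesis by simp
qed

text \<open>Nonzero vectors have \<open>S[\<mu>] \<ge> 2\<close>, so a factor
  \<open>exp (- 2 pi (y - 1))\<close> splits off from every term of the tail.\<close>

lemma th_decay: assumes y: "y \<ge> 1" shows "th y - 1 \<le> exp (- 2 * pi * (y - 1)) * th 1"
proof -
  let ?g = "\<lambda>\<mu>. exp (- 2 * pi * (y - 1)) * exp (- pi * 1 * bS S (ivec \<mu>) (ivec \<mu>))"
  have s1: "?g summable_on UNIV" by (intro summable_on_cmult_right th_summable) simp
  have "th y - 1 = infsum (\<lambda>\<mu>. exp (- pi * y * bS S (ivec \<mu>) (ivec \<mu>))) (- {0})"
    using y by (intro th_tail[symmetric]) simp
  also have "\<dots> \<le> infsum ?g (- {0})"
  proof (rule infsum_mono)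
    show "(\<lambda>\<mu>. exp (- pi * y * bS S (ivec \<mu>) (ivec \<mu>))) summable_on - {0}"
      using th_summable[of y] y by (auto intro: summable_on_subset_banach)
    show "?g summable_on - {0}" using s1 by (rule summable_on_subset_banach) auto
    fix \<mu> :: "int^'n" assume "\<mu> \<in> - {0}"
    hence "(y - 1) * 2 \<le> (y - 1) * bS S (ivec \<mu>) (ivec \<mu>)" using qS_ge_1[of \<mu>] y by (intro mult_left_mono) auto
    hence "pi * ((y - 1) * 2) \<le> pi * ((y - 1) * bS S (ivec \<mu>) (ivec \<mu>))" by (rule mult_left_mono) auto
    thus "exp (- pi * y * bS S (ivec \<mu>) (ivec \<mu>)) \<le> ?g \<mu>"
      unfolding exp_add[symmetric] by (simp add: algebra_simps)
  qed
  also have "\<dots> \<le> infsum ?g UNIV"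
    using s1 by (intro infsum_mono2 summable_on_subset_banach[OF s1]) auto
  also have "\<dots> = exp (- 2 * pi * (y - 1)) * th 1" unfolding th_def by (rule infsum_cmult_right')
  finally show ?thesis .
qed

lemma near_1:
  fixes g :: "int^'n \<Rightarrow> complex"
  assumes y: "y > 0" and g: "\<And>\<mu>. norm (g \<mu>) = exp (- pi * y * bS S (ivec \<mu>) (ivec \<mu>))" "g 0 = 1"
  shows "norm (infsum g UNIV - 1) \<le> th y - 1"
proof -
  have "(\<lambda>\<mu>. norm (g \<mu>)) summable_on UNIV" unfolding g using th_summable[OF y] .
  hence sg: "g summable_on UNIV" by (simp only: summable_on_iff_abs_summable_on_complex)
  have sg': "g summable_on (- {0})" using sg by (rule summable_on_subset_banach) auto
  have "infsum g UNIV = infsum g ({0} \<union> - {0})" by (rule arg_cong) auto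
  also have "\<dots> = infsum g {0} + infsum g (- {0})" using sg' by (intro infsum_Un_disjoint) auto
  finally have "infsum g UNIV - 1 = infsum g (- {0})" using g(2) by simp
  moreover have "norm (infsum g (- {0})) \<le> infsum (\<lambda>\<mu>. exp (- pi * y * bS S (ivec \<mu>) (ivec \<mu>))) (- {0})"
  proof (rule norm_infsum_le[OF has_sum_infsum[OF sg'] has_sum_infsum])
    show "(\<lambda>\<mu>. exp (- pi * y * bS S (ivec \<mu>) (ivec \<mu>))) summable_on - {0}"
      using th_summable[OF y] by (rule summable_on_subset_banach) auto
  qed (simp add: g)
  ultimately show ?thesis using th_tail[OF y] by simp
qed

lemma jt_norm: "norm (jt (\<i> * of_real y) (vmap of_real x) \<mu>) = exp (- pi * y * bS S (ivec \<mu>) (ivec \<mu>))"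
  and jt_0: "jt t z 0 = 1"
proof -
  have "bS S (ivec \<mu>) (vmap of_real x) = complex_of_real (bS S (ivec \<mu>) x)" by (simp add: hom_real.h_bS)
  hence "norm (jt (\<i> * of_real y) (vmap of_real x) \<mu>) = exp (- 2 * pi * (real_of_int (qS \<mu>) * y))"
    by (simp add: jt_def norm_ee)
  thus "norm (jt (\<i> * of_real y) (vmap of_real x) \<mu>) = exp (- pi * y * bS S (ivec \<mu>) (ivec \<mu>))"
    unfolding qS_real by (simp add: mult_ac)
qed (simp add: jt_def)

text \<open>Quotient of \<open>jacobi_transform\<close> at \<open>x\<close> and at \<open>0\<close>:
  weight and \<open>h\<close> cancel, and the dependence on \<open>x\<close> of the Poisson formula
  remains. That \<open>h\<close> is nonzero at \<open>i / y\<close> as well follows from the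
  relation at 0, because theta does not vanish on the ray.\<close>

lemma poisson:
  assumes y: "y > 0" and hy: "h (\<i> * of_real y) \<noteq> 0"
  shows "infsum (pt (1 / y) x) UNIV * Th (\<i> * of_real y) =
     Th (\<i> * of_real (1 / y)) * infsum (jt (\<i> * of_real y) (vmap of_real x)) UNIV"
proof -
  have j0: "jt (\<i> * of_real y) (vmap of_real 0) = (\<lambda>\<mu>. ee (of_int (qS \<mu>) * (\<i> * of_real y)))"
    by (simp add: jt_def vmap_0 fun_eq_iff)
  have 0: "h (\<i> * of_real (1 / y)) * Th (\<i> * of_real (1 / y)) = (\<i> * of_real y) powi k * h (\<i> * of_real y) * Th (\<i> * of_real y)"
    using jacobi_transform[OF y, of 0] unfolding Th_pt[symmetric] j0 Th_def[symmetric] .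
  have yc: "(\<i> * complex_of_real y) powi k \<noteq> 0" using y by simp
  have Tn: "Th (\<i> * of_real y') \<noteq> 0" if "y' > 0" for y' using th_ge_1[OF that] by (simp add: Th_th)
  have "h (\<i> * of_real (1 / y)) \<noteq> 0"
  proof
    assume "h (\<i> * of_real (1 / y)) = 0"
    thus False using 0 yc hy Tn[OF y] by simp
  qed
  moreover have "h (\<i> * of_real (1 / y)) * (infsum (pt (1 / y) x) UNIV * Th (\<i> * of_real y)) =
     h (\<i> * of_real (1 / y)) * (Th (\<i> * of_real (1 / y)) * infsum (jt (\<i> * of_real y) (vmap of_real x)) UNIV)"
  proof -
    have "h (\<i> * of_real (1 / y)) * (infsum (pt (1 / y) x) UNIV * Th (\<i> * of_real y)) =
      (h (\<i> * of_real (1 / y)) * infsum (pt (1 / y) x) UNIV) * Th (\<i> * of_real y)" by (simp only: mult_ac)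
    also have "\<dots> = ((\<i> * of_real y) powi k * h (\<i> * of_real y) * Th (\<i> * of_real y)) * infsum (jt (\<i> * of_real y) (vmap of_real x)) UNIV"
      unfolding jacobi_transform[OF y] by (simp only: mult_ac)
    also have "\<dots> = h (\<i> * of_real (1 / y)) * (Th (\<i> * of_real (1 / y)) * infsum (jt (\<i> * of_real y) (vmap of_real x)) UNIV)"
      unfolding 0[symmetric] by (simp only: mult_ac)
    finally show ?thesis .
  qed
  ultimately show ?thesis by simp
qed

text \<open>Averaging over the \<open>N\<close>-division points determines how \<open>Th (\<i> / y) / Th (\<i> y)\<close> scales with \<open>y\<close>;
  no Poisson summation is needed.\<close>

lemma Th_scale_ray:
  assumes y: "y > 0" and hy: "h (\<i> * of_real y) \<noteq> 0" and N: "N > 0"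
  shows "Th (\<i> * of_real (1 / (y * (real N)\<^sup>2))) * Th (\<i> * of_real y) =
     of_nat N ^ CARD('n) * (Th (\<i> * of_real (1 / y)) * Th (\<i> * of_real (y * (real N)\<^sup>2)))"
proof -
  have N2: "y * (real N)\<^sup>2 > 0" using y N by simp
  let ?x = "\<lambda>r::int^'n. (1 / real N) *s ivec r :: real^'n"
  \<comment> \<open>The translates of the lattice by all \<open>N\<close>-division points fill the
    lattice scaled by \<open>1 / N\<close>.\<close>
  have L: "(\<Sum>r\<in>ibox N. infsum (pt (1 / y) (?x r)) UNIV) = Th (\<i> * of_real (1 / (y * (real N)\<^sup>2)))"
  proof -
    have "pt (1 / (y * (real N)\<^sup>2)) 0 (r + int N *s v) = pt (1 / y) (?x r) v" for r v
    proof -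
      have "ivec (r + int N *s v) + 0 = real N *s (ivec v + ?x r)"
        using N by (simp add: vec_eq_iff field_simps)
      moreover have "- pi * (1 / (y * (real N)\<^sup>2)) * (real N * (real N * B)) = - pi * (1 / y) * B" for B
        using y N by (simp add: power2_eq_square)
      ultimately show ?thesis by (simp only: pt_def bil_scale)
    qed
    moreover have "(pt (1 / (y * (real N)\<^sup>2)) 0 has_sum Th (\<i> * of_real (1 / (y * (real N)\<^sup>2)))) UNIV"
      unfolding Th_pt using N2 by (intro has_sum_infsum pt_summable) simp
    ultimately show ?thesis using sum_residue_classes(1)[OF N, of "pt (1 / (y * (real N)\<^sup>2)) 0"] by simp
  qed
  have R: "(\<Sum>r\<in>ibox N. infsum (jt (\<i> * of_real y) (vmap of_real (?x r))) UNIV) = of_nat N ^ CARD('n) * Th (\<i> * of_real (y * (real N)\<^sup>2))"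
  proof -
    let ?g = "\<lambda>\<mu>. ee (of_int (qS \<mu>) * (\<i> * of_real y))"
    have jx: "jt (\<i> * of_real y) (vmap of_real (?x r)) \<mu> = ?g \<mu> * ee (of_int (- bS S \<mu> r) / of_nat N)" for r \<mu>
    proof -
      have "bS S (ivec \<mu>) (vmap of_real (?x r)) = (of_int (bS S \<mu> r) / of_nat N :: complex)"
      proof -
        have "bS S (ivec \<mu>) (vmap complex_of_real (?x r)) = bS S (ivec \<mu>) ((1 / of_nat N) *s ivec r)"
          by (rule arg_cong) (simp add: vec_eq_iff)
        thus ?thesis by (simp only: bil_scale of_int_bS times_divide_eq_left mult_1)
      qed
      thus ?thesis unfolding jt_def by (simp add: ee_add[symmetric])
    qed
    \<comment> \<open>Orthogonality of characters: by unimodularity only \<open>\<mu>\<close>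
      divisible by \<open>N\<close> survive, which rescales \<open>y\<close> by
      \<open>N^2\<close>.\<close>
    have ch: "(\<Sum>r\<in>ibox N. ee (of_int (- bS S \<mu> r) / of_nat N)) = (if vcong (int N) \<mu> 0 then of_nat N ^ CARD('n) else 0)" for \<mu>
    proof -
      let ?s = "S *v \<mu>"
      have "(\<Sum>r\<in>ibox N. ee (of_int (- bS S \<mu> r) / of_nat N)) = (\<Sum>r\<in>ibox N. \<Prod>i\<in>UNIV. ee (of_int (r $ i * (- ?s $ i)) / of_nat N))"
      proof (rule sum.cong[OF refl])
        fix r :: "int^'n"
        have "- bS S \<mu> r = (\<Sum>i\<in>UNIV. r $ i * (- ?s $ i))"
          unfolding vdot_S[symmetric] vdot_def by (simp add: mult.commute sum_negf)
        hence "of_int (- bS S \<mu> r) / (of_nat N :: complex) = (\<Sum>i\<in>UNIV. of_int (r $ i * (- ?s $ i)) / of_nat N)"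
          by (simp only: of_int_sum sum_divide_distrib)
        thus "ee (of_int (- bS S \<mu> r) / of_nat N) = (\<Prod>i\<in>UNIV. ee (of_int (r $ i * (- ?s $ i)) / of_nat N))"
          by (simp only: ee_sum)
      qed
      also have "\<dots> = (\<Prod>i\<in>UNIV. \<Sum>b\<in>{0..<int N}. ee (of_int (b * (- ?s $ i)) / of_nat N))" by (rule sum_box_prod)
      also have "\<dots> = (\<Prod>i\<in>(UNIV::'n set). if int N dvd - ?s $ i then of_nat N else 0)" by (simp only: root_sum[OF N])
      also have "\<dots> = (if vcong (int N) \<mu> 0 then of_nat N ^ CARD('n) else 0)"
      proof (cases "vcong (int N) \<mu> 0")
        case True
        hence "int N dvd ?s $ i" for i using vcong_mv[OF True, of S] by (simp add: vcong_0)
        thus ?thesis using True by simp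
      next
        case False
        then obtain z where z: "\<not> int N dvd bS S z \<mu>" using unimodular_mod by blast
        have "\<exists>i. \<not> int N dvd ?s $ i"
        proof (rule ccontr)
          assume "\<nexists>i. \<not> int N dvd ?s $ i"
          hence "int N dvd vdot z ?s" unfolding vdot_def by (intro dvd_sum) auto
          thus False using z by (simp add: bil_def)
        qed
        thus ?thesis using False by (auto intro!: prod_zero)
      qed
      finally show ?thesis .
    qed
    have "((\<lambda>\<mu>. \<Sum>r\<in>ibox N. jt (\<i> * of_real y) (vmap of_real (?x r)) \<mu>) has_sum
      (\<Sum>r\<in>ibox N. infsum (jt (\<i> * of_real y) (vmap of_real (?x r))) UNIV)) UNIV"
      by (intro has_sum_sum has_sum_infsum jt_summable_diag y) auto
    moreover have "(\<Sum>r\<in>ibox N. jt (\<i> * of_real y) (vmap of_real (?x r)) \<mu>) = (if vcong (int N) \<mu> 0 then of_nat N ^ CARD('n) * ?g \<mu> else 0)" for \<mu>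
      unfolding jx sum_distrib_left[symmetric] ch by simp
    ultimately have "((\<lambda>\<mu>. if vcong (int N) \<mu> 0 then of_nat N ^ CARD('n) * ?g \<mu> else 0) has_sum
      (\<Sum>r\<in>ibox N. infsum (jt (\<i> * of_real y) (vmap of_real (?x r))) UNIV)) UNIV" by simp
    also have "?this \<longleftrightarrow> ((\<lambda>\<mu>. of_nat N ^ CARD('n) * ?g \<mu>) has_sum
      (\<Sum>r\<in>ibox N. infsum (jt (\<i> * of_real y) (vmap of_real (?x r))) UNIV)) {\<mu>. vcong (int N) \<mu> 0}"
      by (rule has_sum_cong_neutral) auto
    also have "\<dots> \<longleftrightarrow> ((\<lambda>\<mu>. of_nat N ^ CARD('n) * ee (of_int (qS \<mu>) * (\<i> * of_real (y * (real N)\<^sup>2)))) has_sum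
      (\<Sum>r\<in>ibox N. infsum (jt (\<i> * of_real y) (vmap of_real (?x r))) UNIV)) UNIV"
    proof (rule has_sum_reindex_bij_witness[where i = "\<lambda>v. int N *s v" and j = "\<lambda>v. \<chi> i. v $ i div int N"])
      fix v :: "int^'n" assume "v \<in> {\<mu>. vcong (int N) \<mu> 0}"
      thus 1: "int N *s (\<chi> i. v $ i div int N) = v" by (simp add: vcong_0 vec_eq_iff)
      have "qS v = (int N)\<^sup>2 * qS (\<chi> i. v $ i div int N)" using qS_scale[of "int N" "\<chi> i. v $ i div int N"] 1 by simp
      thus "of_nat N ^ CARD('n) * ee (of_int (qS (\<chi> i. v $ i div int N)) * (\<i> * of_real (y * (real N)\<^sup>2))) = of_nat N ^ CARD('n) * ?g v"
        by (simp add: mult_ac)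
    qed (use N in \<open>auto simp: vcong_0 vec_eq_iff\<close>)
    finally have "((\<lambda>\<mu>. of_nat N ^ CARD('n) * ee (of_int (qS \<mu>) * (\<i> * of_real (y * (real N)\<^sup>2)))) has_sum
      (\<Sum>r\<in>ibox N. infsum (jt (\<i> * of_real y) (vmap of_real (?x r))) UNIV)) UNIV" .
    moreover have "((\<lambda>\<mu>. of_nat N ^ CARD('n) * ee (of_int (qS \<mu>) * (\<i> * of_real (y * (real N)\<^sup>2)))) has_sum
      of_nat N ^ CARD('n) * Th (\<i> * of_real (y * (real N)\<^sup>2))) UNIV"
      using N2 by (intro has_sum_cmult_right Th_has_sum) simp
    ultimately show ?thesis using has_sum_unique by blast
  qed
  have "Th (\<i> * of_real (1 / (y * (real N)\<^sup>2))) * Th (\<i> * of_real y) = (\<Sum>r\<in>ibox N. infsum (pt (1 / y) (?x r)) UNIV * Th (\<i> * of_real y))"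
    unfolding L[symmetric] by (rule sum_distrib_right)
  also have "\<dots> = (\<Sum>r\<in>ibox N. Th (\<i> * of_real (1 / y)) * infsum (jt (\<i> * of_real y) (vmap of_real (?x r))) UNIV)"
    by (simp only: poisson[OF y hy])
  also have "\<dots> = Th (\<i> * of_real (1 / y)) * (of_nat N ^ CARD('n) * Th (\<i> * of_real (y * (real N)\<^sup>2)))"
    unfolding R[symmetric] by (rule sum_distrib_left[symmetric])
  finally show ?thesis by (simp only: mult_ac)
qed

lemma holomorphic_compose_uhp:
  assumes "F holomorphic_on upper_half_plane" "g holomorphic_on upper_half_plane" "\<And>t. Im t > 0 \<Longrightarrow> Im (g t) > 0"
  shows "(\<lambda>t. F (g t)) holomorphic_on upper_half_plane"
proof -
  have "g ` upper_half_plane \<subseteq> upper_half_plane" using assms(3) by auto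
  from holomorphic_on_compose_gen[OF assms(2,1) this] show ?thesis by (simp add: o_def)
qed

lemma uhp_inv: "Im t > 0 \<Longrightarrow> Im (- 1 / t) > 0"
  using Im_moebius_pos[of 0 0 "-1" 1 t] by simp

lemma holomorphic_inv: "(\<lambda>t. - 1 / t) holomorphic_on upper_half_plane"
  by (intro holomorphic_intros) auto

text \<open>On the ray the relation is known only where \<open>h\<close> does not vanish. Multiplied
  by \<open>h\<close> it holds on the whole ray, hence on the half-plane, and there \<open>h\<close>
  is cancelled as a holomorphic factor.\<close>

lemma Th_scale:
  assumes y: "y > 0" and N: "N > 0"
  shows "Th (\<i> * of_real (1 / (y * (real N)\<^sup>2))) * Th (\<i> * of_real y) =
     of_nat N ^ CARD('n) * (Th (\<i> * of_real (1 / y)) * Th (\<i> * of_real (y * (real N)\<^sup>2)))"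
proof -
  define D where "D = (\<lambda>t. Th (- 1 / (of_real ((real N)\<^sup>2) * t)) * Th t - of_nat N ^ CARD('n) * (Th (- 1 / t) * Th (of_real ((real N)\<^sup>2) * t)))"
  have N2: "(real N)\<^sup>2 > 0" using N by simp
  have sc: "Im (of_real ((real N)\<^sup>2) * t) > 0" if "Im t > 0" for t using that N2 by simp
  have hs: "(\<lambda>t. complex_of_real ((real N)\<^sup>2) * t) holomorphic_on upper_half_plane" by (intro holomorphic_intros)
  have "(\<lambda>t. Th (- 1 / (of_real ((real N)\<^sup>2) * t))) holomorphic_on upper_half_plane"
    by (rule holomorphic_compose_uhp[OF holomorphic_compose_uhp[OF holomorphic_Th holomorphic_inv uhp_inv] hs sc])
  moreover have "(\<lambda>t. Th (- 1 / t)) holomorphic_on upper_half_plane"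
    by (rule holomorphic_compose_uhp[OF holomorphic_Th holomorphic_inv uhp_inv])
  moreover have "(\<lambda>t. Th (of_real ((real N)\<^sup>2) * t)) holomorphic_on upper_half_plane"
    by (rule holomorphic_compose_uhp[OF holomorphic_Th hs sc])
  ultimately have hD: "D holomorphic_on upper_half_plane"
    unfolding D_def by (intro holomorphic_intros holomorphic_Th)
  have e: "- 1 / (\<i> * of_real y) = \<i> * of_real (1 / y)" "of_real ((real N)\<^sup>2) * (\<i> * of_real y) = \<i> * of_real (y * (real N)\<^sup>2)" for y
    by (cases "y = 0"; simp add: field_simps)+
  have "(\<lambda>t. D t * h t) t = 0" if "Im t > 0" for t
  proof (rule uhp_identity[where F = "\<lambda>t. D t * h t" and \<alpha> = 0 and \<beta> = 1])
    show "(\<lambda>t. D t * h t) holomorphic_on upper_half_plane" by (intro holomorphic_intros hD holomorphic_h)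
    fix y :: real assume "0 < y"
    show "D (\<i> * of_real y) * h (\<i> * of_real y) = 0"
      using Th_scale_ray[OF \<open>0 < y\<close> _ N] unfolding D_def e by auto
  qed (use that in auto)
  moreover obtain t0 where "Im t0 > 0" "h t0 \<noteq> 0" using h_nonzero by blast
  ultimately have "D (\<i> * of_real y) = 0" using y by (intro uhp_product_zero[OF hD holomorphic_h]) auto
  thus ?thesis unfolding D_def e by simp
qed

lemma th_scale:
  assumes "y > 0" "N > 0"
  shows "th (1 / (y * (real N)\<^sup>2)) * th y = real N ^ CARD('n) * (th (1 / y) * th (y * (real N)\<^sup>2))"
proof -
  have "complex_of_real (th (1 / (y * (real N)\<^sup>2)) * th y) = complex_of_real (real N ^ CARD('n) * (th (1 / y) * th (y * (real N)\<^sup>2)))"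
    using Th_scale[OF assms] unfolding Th_th by simp
  thus ?thesis by (simp only: of_real_eq_iff)
qed

lemma continuous_th: "continuous_on {0<..} th"
proof -
  have "continuous_on {0<..} (\<lambda>y. Re (Th (\<i> * of_real y)))"
    by (intro continuous_on_Re continuous_on_compose2[OF holomorphic_on_imp_continuous_on[OF holomorphic_Th]] continuous_intros) auto
  thus ?thesis by (simp add: Th_th)
qed

text \<open>By \<open>th_scale\<close> the quotient \<open>th (1 / y) / th y\<close> gains the
  factor \<open>N^n\<close> when \<open>y\<close> is multiplied by \<open>N^2\<close>, and it equals
  1 at \<open>y = 1\<close>. This fixes it at squares of integers, then at squares of rationals, and
  by continuity everywhere.\<close>

lemma th_inversion: assumes s: "s > 0" shows "th (1 / s\<^sup>2) = s ^ CARD('n) * th (s\<^sup>2)"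
proof -
  have pos: "th y > 0" if "y > 0" for y using th_ge_1[OF that] by simp
  have rat: "th (1 / s\<^sup>2) = s ^ CARD('n) * th (s\<^sup>2)" if s: "s \<in> \<rat>" "s > 0" for s
  proof -
    obtain p q where pq: "q > 0" "s = of_int p / of_int q" by (rule Rats_cases'[OF s(1)])
    have p0: "p > 0" using s(2) pq by (simp add: zero_less_divide_iff)
    define P where "P = nat p" define Q where "Q = nat q"
    have PQ: "P > 0" "Q > 0" "s = real P / real Q" using p0 pq by (simp_all add: P_def Q_def)
    have 1: "th (1 / (real P)\<^sup>2) = real P ^ CARD('n) * th ((real P)\<^sup>2)"
      using th_scale[of 1 P] PQ pos[of 1] by simp
    have s2: "s\<^sup>2 > 0" "s\<^sup>2 * (real Q)\<^sup>2 = (real P)\<^sup>2" using s PQ by (simp_all add: power_divide)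
    have "th (1 / (real P)\<^sup>2) * th (s\<^sup>2) = real Q ^ CARD('n) * (th (1 / s\<^sup>2) * th ((real P)\<^sup>2))"
      using th_scale[OF s2(1) PQ(2)] unfolding s2(2) .
    hence "(real P ^ CARD('n) * th (s\<^sup>2)) * th ((real P)\<^sup>2) = (real Q ^ CARD('n) * th (1 / s\<^sup>2)) * th ((real P)\<^sup>2)"
      unfolding 1 by (simp only: mult_ac)
    hence "real P ^ CARD('n) * th (s\<^sup>2) = real Q ^ CARD('n) * th (1 / s\<^sup>2)" using pos[of "(real P)\<^sup>2"] PQ(1) by simp
    moreover have sPQ: "real P ^ CARD('n) = s ^ CARD('n) * real Q ^ CARD('n)" using PQ by (simp add: power_divide)
    ultimately have "real Q ^ CARD('n) * th (1 / s\<^sup>2) = real Q ^ CARD('n) * (s ^ CARD('n) * th (s\<^sup>2))"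
      by (simp only: mult_ac)
    thus ?thesis using PQ(2) by simp
  qed
  define F where "F = (\<lambda>s. th (1 / s\<^sup>2) - s ^ CARD('n) * th (s\<^sup>2))"
  have cF: "continuous_on {0<..} F"
    unfolding F_def by (intro continuous_intros continuous_on_compose2[OF continuous_th]) auto
  have "F s = 0"
  proof (rule ccontr)
    assume ne: "F s \<noteq> 0"
    have "isCont F s" using cF s by (simp add: continuous_on_eq_continuous_at)
    then obtain e where e: "e > 0" "\<And>u. dist s u < e \<Longrightarrow> F u \<noteq> 0"
      using ne continuous_at_avoid[of s F 0] by auto
    obtain u where u: "u \<in> \<rat>" "s < u" "u < s + e" using Rats_dense_in_real[of s "s + e"] e(1) by auto
    have "F u = 0" using rat[OF u(1)] u s by (simp add: F_def)
    moreover have "dist s u < e" using u by (simp add: dist_real_def)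
    ultimately show False using e(2) by blast
  qed
  thus ?thesis by (simp add: F_def)
qed

section \<open>Modularity of \<open>star S f\<close>\<close>

lemma h_ray:
  assumes s: "s > 0"
  shows "h (\<i> * of_real (1 / s\<^sup>2)) * of_real s ^ CARD('n) = (\<i> * of_real (s\<^sup>2)) powi k * h (\<i> * of_real (s\<^sup>2))"
proof -
  have y: "s\<^sup>2 > 0" using s by simp
  have j0: "jt (\<i> * of_real y) (vmap of_real 0) = (\<lambda>\<mu>. ee (of_int (qS \<mu>) * (\<i> * of_real y)))" for y
    by (simp add: jt_def vmap_0 fun_eq_iff)
  have "h (\<i> * of_real (1 / s\<^sup>2)) * Th (\<i> * of_real (1 / s\<^sup>2)) = (\<i> * of_real (s\<^sup>2)) powi k * h (\<i> * of_real (s\<^sup>2)) * Th (\<i> * of_real (s\<^sup>2))"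
    using jacobi_transform[OF y, of 0] unfolding Th_pt[symmetric] j0 Th_def[symmetric] .
  moreover have "Th (\<i> * of_real (1 / s\<^sup>2)) = of_real s ^ CARD('n) * Th (\<i> * of_real (s\<^sup>2))"
    unfolding Th_th th_inversion[OF s] by simp
  moreover have "Th (\<i> * of_real (s\<^sup>2)) \<noteq> 0" using th_ge_1[OF y] by (simp only: Th_th) simp
  ultimately show ?thesis by simp
qed

lemma inversion_from_ray:
  assumes F: "F holomorphic_on upper_half_plane"
    and ray: "\<And>y::real. y > 0 \<Longrightarrow> F (\<i> * of_real (1 / y)) = c * (\<i> * of_real y) powi l * F (\<i> * of_real y)"
    and t: "Im t > 0"
  shows "F (- 1 / t) = c * t powi l * F t"
proof -
  have "F (- 1 / t) - c * t powi l * F t = 0"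
  proof (rule uhp_identity[where F = "\<lambda>t. F (- 1 / t) - c * t powi l * F t" and \<alpha> = 0 and \<beta> = 1])
    have "(\<lambda>t. F (- 1 / t)) holomorphic_on upper_half_plane"
      by (rule holomorphic_compose_uhp[OF F holomorphic_inv uhp_inv])
    thus "(\<lambda>t. F (- 1 / t) - c * t powi l * F t) holomorphic_on upper_half_plane"
      by (intro holomorphic_intros F) auto
    fix y :: real assume y: "0 < y"
    have "- 1 / (\<i> * complex_of_real y) = \<i> * of_real (1 / y)" using y by (simp add: field_simps)
    thus "F (- 1 / (\<i> * of_real y)) - c * (\<i> * of_real y) powi l * F (\<i> * of_real y) = 0"
      using ray[OF y] by simp
  qed (use t in auto)
  thus ?thesis by simp
qed

text \<open>As long as \<open>n\<close> may be odd, \<open>h\<close> itself has no integral weight.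
  Its square has weight \<open>2 k - n\<close> and multiplier \<open>i^n\<close>, which
  \<open>multiplier_trivial\<close> forces to be 1.\<close>

lemma rank_mod_4: "4 dvd CARD('n)"
proof -
  define n where "n = CARD('n)"
  obtain t where t: "Im t > 0" "h t \<noteq> 0" using h_nonzero by blast
  have "(\<i> ^ n :: complex) = 1"
  proof (rule multiplier_trivial(1)[where h = "\<lambda>t. (h t)\<^sup>2" and k = "2 * k - int n"])
    fix t :: complex assume t: "Im t > 0"
    show "(h (t + 1))\<^sup>2 = (h t)\<^sup>2" using h_period[OF t] by simp
    show "(h (- 1 / t))\<^sup>2 = \<i> ^ n * t powi (2 * k - int n) * (h t)\<^sup>2"
    proof (rule inversion_from_ray[where F = "\<lambda>t. (h t)\<^sup>2", OF _ _ t])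
      show "(\<lambda>t. (h t)\<^sup>2) holomorphic_on upper_half_plane" by (intro holomorphic_intros holomorphic_h)
      fix y :: real assume y: "y > 0"
      define s where "s = sqrt y"
      have s: "s > 0" "s\<^sup>2 = y" using y by (simp_all add: s_def)
      have yc: "\<i> * complex_of_real y \<noteq> 0" using y by simp
      have "(h (\<i> * of_real (1 / y)) * of_real s ^ n)\<^sup>2 = ((\<i> * of_real y) powi k * h (\<i> * of_real y))\<^sup>2"
        using h_ray[OF s(1)] unfolding s(2) n_def by simp
      moreover have "(complex_of_real s ^ n)\<^sup>2 = of_real y ^ n"
        unfolding s(2)[symmetric] by (simp flip: power_mult add: mult.commute)
      moreover have "((\<i> * complex_of_real y) powi k)\<^sup>2 = (\<i> * of_real y) powi (2 * k)"
        using yc by (simp add: power_int_mult[symmetric] mult.commute power2_eq_square flip: power_int_add)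
      ultimately have e: "(h (\<i> * of_real (1 / y)))\<^sup>2 * of_real y ^ n = (\<i> * of_real y) powi (2 * k) * (h (\<i> * of_real y))\<^sup>2"
        by (simp only: power_mult_distrib)
      have "\<i> ^ n * (\<i> * complex_of_real y) powi (2 * k - int n) * of_real y ^ n = (\<i> * of_real y) powi (2 * k - int n) * (\<i> * complex_of_real y) ^ n"
        by (simp add: power_mult_distrib)
      also have "\<dots> = (\<i> * of_real y) powi (2 * k)" by (rule power_int_diff_nat[OF yc])
      finally have "(\<i> ^ n * (\<i> * complex_of_real y) powi (2 * k - int n) * of_real y ^ n) * (h (\<i> * of_real y))\<^sup>2 = (h (\<i> * of_real (1 / y)))\<^sup>2 * of_real y ^ n"
        unfolding e by (rule arg_cong)
      hence "\<i> ^ n * (\<i> * complex_of_real y) powi (2 * k - int n) * (h (\<i> * of_real y))\<^sup>2 * of_real y ^ n = (h (\<i> * of_real (1 / y)))\<^sup>2 * of_real y ^ n"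
        by (simp only: mult_ac)
      thus "(h (\<i> * of_real (1 / y)))\<^sup>2 = \<i> ^ n * (\<i> * of_real y) powi (2 * k - int n) * (h (\<i> * of_real y))\<^sup>2"
        using y by simp
    qed
  qed (use t in auto)
  hence 1: "\<i> ^ (n mod 4) = (1::complex)"
  proof -
    have "\<i> ^ n = (\<i> ^ 4) ^ (n div 4) * \<i> ^ (n mod 4)" unfolding power_mult[symmetric] power_add[symmetric] by simp
    moreover have "\<i> ^ 4 = (1::complex)" by (simp add: power4_eq_xxxx)
    ultimately show ?thesis using \<open>\<i> ^ n = 1\<close> by simp
  qed
  have "n mod 4 < 4" by simp
  hence "n mod 4 = 0 \<or> n mod 4 = 1 \<or> n mod 4 = 2 \<or> n mod 4 = 3" by linarith
  hence "n mod 4 = 0" using 1 by (auto simp: power2_eq_square power3_eq_cube complex_eq_iff)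
  thus ?thesis by (auto simp: n_def)
qed

definition m :: nat where "m = CARD('n) div 2"

lemma card_m: "CARD('n) = 2 * m" and even_m: "even m" and m_pos: "m > 0"
proof -
  obtain c where c: "CARD('n) = 4 * c" using rank_mod_4 by blast
  show "CARD('n) = 2 * m" "even m" by (simp_all add: m_def c)
  have "CARD('n) > 0" by simp
  thus "m > 0" by (simp add: m_def c)
qed

lemma s_power: "s \<ge> 0 \<Longrightarrow> y = s\<^sup>2 \<Longrightarrow> complex_of_real s ^ CARD('n) = of_real y ^ m"
  by (simp add: card_m power_mult)

text \<open>The same argument for \<open>h\<close> itself, now that \<open>m = n / 2\<close> is an
  integer: its multiplier is \<open>i^m\<close>. Triviality also yields the even weight required by
  \<open>ell_modularI\<close>.\<close>

lemma i_m: "\<i> ^ m = (1::complex)" and even_weight: "even (k - int m)"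
  and h_inversion: "Im t > 0 \<Longrightarrow> h (- 1 / t) = t powi (k - int m) * h t"
proof -
  have inv: "h (- 1 / t) = \<i> ^ m * t powi (k - int m) * h t" if t: "Im t > 0" for t
  proof (rule inversion_from_ray[OF holomorphic_h _ t])
    fix y :: real assume y: "y > 0"
    define s where "s = sqrt y"
    have s: "s > 0" "s\<^sup>2 = y" using y by (simp_all add: s_def)
    have yc: "\<i> * complex_of_real y \<noteq> 0" using y by simp
    have e: "h (\<i> * of_real (1 / y)) * of_real y ^ m = (\<i> * of_real y) powi k * h (\<i> * of_real y)"
      using h_ray[OF s(1)] s_power[of s y] s by simp
    have "\<i> ^ m * (\<i> * complex_of_real y) powi (k - int m) * of_real y ^ m = (\<i> * of_real y) powi (k - int m) * (\<i> * complex_of_real y) ^ m"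
      by (simp add: power_mult_distrib)
    also have "\<dots> = (\<i> * of_real y) powi k" by (rule power_int_diff_nat[OF yc])
    finally have "(\<i> ^ m * (\<i> * complex_of_real y) powi (k - int m) * of_real y ^ m) * h (\<i> * of_real y) = h (\<i> * of_real (1 / y)) * of_real y ^ m"
      unfolding e by (rule arg_cong)
    hence "\<i> ^ m * (\<i> * complex_of_real y) powi (k - int m) * h (\<i> * of_real y) * of_real y ^ m = h (\<i> * of_real (1 / y)) * of_real y ^ m"
      by (simp only: mult_ac)
    thus "h (\<i> * of_real (1 / y)) = \<i> ^ m * (\<i> * of_real y) powi (k - int m) * h (\<i> * of_real y)"
      using y by simp
  qed
  obtain t0 where t: "Im t0 > 0" "h t0 \<noteq> 0" using h_nonzero by blast
  show im: "\<i> ^ m = (1::complex)" by (rule multiplier_trivial(1)[OF h_period inv t])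
  show "even (k - int m)" by (rule multiplier_trivial(2)[OF h_period inv t])
  show "Im t > 0 \<Longrightarrow> h (- 1 / t) = t powi (k - int m) * h t" using inv im by simp
qed

lemma h_modular: "ell_modular (k - int m) h"
  by (rule ell_modularI[OF h_period h_inversion even_weight])

lemma Th_ray: "y > 0 \<Longrightarrow> Th (\<i> * of_real (1 / y)) = of_real y ^ m * Th (\<i> * of_real y)"
proof -
  assume y: "y > 0"
  define s where "s = sqrt y"
  have s: "s > 0" "s\<^sup>2 = y" using y by (simp_all add: s_def)
  show ?thesis using th_inversion[OF s(1)] s_power[of s y] s unfolding Th_th by (simp flip: of_real_power)
qed

lemma Th_modular: "ell_modular (int m) Th"
proof (rule ell_modularI)
  show "Th (t + 1) = Th t" if "Im t > 0" for t using that by (rule Th_period)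
  fix t :: complex assume t: "Im t > 0"
  have "Th (- 1 / t) = 1 * t powi int m * Th t"
  proof (rule inversion_from_ray[OF holomorphic_Th _ t])
    fix y :: real assume y: "y > 0"
    have "(\<i> * complex_of_real y) powi (int m) = of_real y ^ m" by (simp add: power_mult_distrib i_m)
    thus "Th (\<i> * of_real (1 / y)) = 1 * (\<i> * of_real y) powi int m * Th (\<i> * of_real y)"
      using Th_ray[OF y] by simp
  qed
  thus "Th (- 1 / t) = t powi int m * Th t" by simp
qed (use even_m in auto)

text \<open>Evaluate \<open>Th\<close> above the rational point \<open>u / q\<close> in two ways.
  Residue classes modulo \<open>q\<close> and \<open>poisson\<close> give the Gauss sum with weights
  tending to 1; the modular matrix with first column \<open>(u, q)\<close> gives \<open>q^m\<close>
  times a theta value tending to 1. The common factor \<open>y^m\<close> drops out as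
  \<open>y\<close> grows. Since \<open>poisson\<close> needs \<open>h (i y) \<noteq> 0\<close>, the
  limit is taken along such \<open>y\<close>, which exist at arbitrary height.\<close>

lemma gauss_sum:
  assumes q: "prime (q::nat)" and u: "\<not> int q dvd u"
  shows "(\<Sum>r\<in>ibox q. ee (of_int (u * qS r) / of_nat q)) = of_nat q ^ m"
proof -
  have q0: "q > 0" using prime_gt_0_nat[OF q] .
  obtain d' where d': "int q dvd d' * u - 1" using unit_inverse_mod[OF q u] by blast
  then obtain b where b: "d' * u - 1 = int q * b" by blast
  have det: "u * d' - b * int q = 1" using b by (simp add: algebra_simps)
  define G where "G = (\<Sum>r\<in>ibox q. ee (of_int (u * qS r) / of_nat q))"
  define Cn where "Cn = real (card (ibox q :: (int^'n) set)) + real q ^ m"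
  have main: "norm (G - of_nat q ^ m) \<le> Cn * (th y - 1)" if y: "y > 0" and hy: "h (\<i> * of_real y) \<noteq> 0" for y
  proof -
    \<comment> \<open>Chosen to make \<open>q t + d'\<close> equal to \<open>i q y\<close>; the
      image of \<open>t\<close> then lies above \<open>u / q\<close> at height
      \<open>1 / (q^2 y)\<close>.\<close>
    define t where "t = - (of_int d' / of_nat q) + \<i> * complex_of_real y"
    have t: "Im t > 0" using y q0 by (simp add: t_def)
    have den: "of_int (int q) * t + of_int d' = \<i> * complex_of_real (real q * y)"
      using q0 by (simp add: t_def field_simps)
    have num: "(of_int u * t + of_int b) / (of_int (int q) * t + of_int d') = of_int u / of_nat q + \<i> * complex_of_real (1 / ((real q)\<^sup>2 * y))"
    proof -
      have "complex_of_int (u * d' - b * int q) = 1" unfolding det by simp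
      hence ud: "complex_of_int u * of_int d' = of_int b * of_nat q + 1" by (simp add: algebra_simps)
      have ud': "of_int d' * (of_int u * X) = X + of_int b * (of_nat q * X)" for X :: complex
      proof -
        have "of_int d' * (of_int u * X) = (of_int u * of_int d') * X" by (simp only: mult_ac)
        thus ?thesis unfolding ud by (simp add: algebra_simps)
      qed
      show ?thesis unfolding den using q0 y by (simp add: t_def field_simps power2_eq_square) (simp only: ud')
    qed
    have "Th (of_int u / of_nat q + \<i> * complex_of_real (1 / ((real q)\<^sup>2 * y))) = (\<i> * complex_of_real (real q * y)) powi int m * Th t"
      using Th_modular det t unfolding ell_modular_def num[symmetric] den[symmetric] by blast
    also have "(\<i> * complex_of_real (real q * y)) powi int m = of_nat q ^ m * of_real y ^ m"
      by (simp add: power_mult_distrib i_m)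
    finally have A: "Th (of_int u / of_nat q + \<i> * complex_of_real (1 / ((real q)\<^sup>2 * y))) = of_nat q ^ m * of_real y ^ m * Th t" .
    let ?x = "\<lambda>r::int^'n. (1 / real q) *s ivec r :: real^'n"
    let ?T = "of_int u / of_nat q + \<i> * complex_of_real (1 / ((real q)\<^sup>2 * y))"
    have T: "Im ?T > 0" using q0 y by simp
    have "ee (of_int (qS (r + int q *s v)) * ?T) = ee (of_int (u * qS r) / of_nat q) * pt (1 / y) (?x r) v" for r v
    proof -
      have "of_int (qS (r + int q *s v)) * ?T = of_int (u * qS (r + int q *s v)) / of_nat q + of_int (qS (r + int q *s v)) * (\<i> * complex_of_real (1 / ((real q)\<^sup>2 * y)))"
        by (simp add: distrib_left mult.commute)
      hence "ee (of_int (qS (r + int q *s v)) * ?T) = ee (of_int (u * qS (r + int q *s v)) / of_nat q) * pt (1 / ((real q)\<^sup>2 * y)) 0 (r + int q *s v)"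
        by (simp only: ee_add pt_0)
      also have "ee (of_int (u * qS (r + int q *s v)) / of_nat q) = ee (of_int (u * qS r) / of_nat q)"
      proof (rule ee_frac_cong[OF _ q0])
        have "vcong (int q) (r + int q *s v) r" by (simp add: vcong_def)
        hence "int q dvd qS (r + int q *s v) - qS r" by (rule qS_cong)
        thus "int q dvd u * qS (r + int q *s v) - u * qS r" by (simp flip: right_diff_distrib)
      qed
      also have "pt (1 / ((real q)\<^sup>2 * y)) 0 (r + int q *s v) = pt (1 / y) (?x r) v"
      proof -
        have "ivec (r + int q *s v) + 0 = real q *s (ivec v + ?x r)" using q0 by (simp add: vec_eq_iff field_simps)
        moreover have "- pi * (1 / ((real q)\<^sup>2 * y)) * (real q * (real q * B)) = - pi * (1 / y) * B" for B
          using y q0 by (simp add: power2_eq_square)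
        ultimately show ?thesis by (simp only: pt_def bil_scale)
      qed
      finally show ?thesis .
    qed
    hence "Th ?T = (\<Sum>r\<in>ibox q. infsum (\<lambda>v. ee (of_int (u * qS r) / of_nat q) * pt (1 / y) (?x r) v) UNIV)"
      using sum_residue_classes(1)[OF q0 Th_has_sum[OF T]] by simp
    also have "\<dots> = (\<Sum>r\<in>ibox q. ee (of_int (u * qS r) / of_nat q) * infsum (pt (1 / y) (?x r)) UNIV)"
      by (simp only: infsum_cmult_right')
    also have "\<dots> = (\<Sum>r\<in>ibox q. ee (of_int (u * qS r) / of_nat q) * (of_real y ^ m * infsum (jt (\<i> * of_real y) (vmap of_real (?x r))) UNIV))"
    proof (rule sum.cong[OF refl])
      fix r :: "int^'n"
      have "Th (\<i> * of_real y) \<noteq> 0" using th_ge_1[OF y] by (simp add: Th_th)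
      hence "infsum (pt (1 / y) (?x r)) UNIV = of_real y ^ m * infsum (jt (\<i> * of_real y) (vmap of_real (?x r))) UNIV"
        using poisson[OF y hy, of "?x r"] unfolding Th_ray[OF y] by simp
      thus "ee (of_int (u * qS r) / of_nat q) * infsum (pt (1 / y) (?x r)) UNIV =
        ee (of_int (u * qS r) / of_nat q) * (of_real y ^ m * infsum (jt (\<i> * of_real y) (vmap of_real (?x r))) UNIV)" by simp
    qed
    also have "\<dots> = of_real y ^ m * (\<Sum>r\<in>ibox q. ee (of_int (u * qS r) / of_nat q) * infsum (jt (\<i> * of_real y) (vmap of_real (?x r))) UNIV)"
      unfolding sum_distrib_left by (simp only: mult_ac)
    finally have B: "(\<Sum>r\<in>ibox q. ee (of_int (u * qS r) / of_nat q) * infsum (jt (\<i> * of_real y) (vmap of_real (?x r))) UNIV) = of_nat q ^ m * Th t"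
      unfolding A using y by simp
    have n1: "norm (infsum (jt (\<i> * of_real y) (vmap of_real (?x r))) UNIV - 1) \<le> th y - 1" for r
      by (rule near_1[OF y jt_norm jt_0])
    have n2: "norm (Th t - 1) \<le> th y - 1"
      unfolding Th_def
    proof (rule near_1[OF y])
      fix \<mu> :: "int^'n"
      have "norm (ee (of_int (qS \<mu>) * t)) = exp (- 2 * pi * (real_of_int (qS \<mu>) * y))"
        by (simp add: norm_ee t_def)
      thus "norm (ee (of_int (qS \<mu>) * t)) = exp (- pi * y * bS S (ivec \<mu>) (ivec \<mu>))"
        unfolding qS_real by (simp add: mult_ac)
    qed simp
    \<comment> \<open>Both terms on the right measure the distance of theta values from their common
      limit 1.\<close>
    have "G - of_nat q ^ m = of_nat q ^ m * (Th t - 1) - (\<Sum>r\<in>ibox q. ee (of_int (u * qS r) / of_nat q) * (infsum (jt (\<i> * of_real y) (vmap of_real (?x r))) UNIV - 1))"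
      unfolding right_diff_distrib sum_subtractf B by (simp add: G_def)
    also have "norm \<dots> \<le> norm (of_nat q ^ m * (Th t - 1)) + norm (\<Sum>r\<in>ibox q. ee (of_int (u * qS r) / of_nat q) * (infsum (jt (\<i> * of_real y) (vmap of_real (?x r))) UNIV - 1))"
      by (rule norm_triangle_ineq4)
    also have "norm (of_nat q ^ m * (Th t - 1)) \<le> real q ^ m * (th y - 1)"
      using n2 by (simp add: norm_mult norm_power mult_left_mono)
    also have "norm (\<Sum>r\<in>ibox q. ee (of_int (u * qS r) / of_nat q) * (infsum (jt (\<i> * of_real y) (vmap of_real (?x r))) UNIV - 1)) \<le> (\<Sum>r\<in>(ibox q :: (int^'n) set). th y - 1)"
    proof (rule sum_norm_le)
      fix r :: "int^'n"
      show "norm (ee (of_int (u * qS r) / of_nat q) * (infsum (jt (\<i> * of_real y) (vmap of_real (?x r))) UNIV - 1)) \<le> th y - 1"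
        using n1[of r] by (simp add: norm_mult norm_ee)
    qed
    finally show ?thesis by (simp add: Cn_def algebra_simps)
  qed
  have Cn0: "Cn \<ge> 0" by (simp add: Cn_def)
  have "norm (G - of_nat q ^ m) \<le> 0 + e" if e: "e > 0" for e
  proof -
    have "((\<lambda>y. Cn * (exp (- 2 * pi * (y - 1)) * th 1)) \<longlongrightarrow> Cn * (0 * th 1)) at_top"
    proof (intro tendsto_intros)
      have "filterlim (\<lambda>y::real. - 1 + y) at_top at_top"
        by (rule filterlim_tendsto_add_at_top[OF tendsto_const filterlim_ident])
      from filterlim_tendsto_pos_mult_at_top[OF tendsto_const _ this, of "2 * pi"]
      have "filterlim (\<lambda>y::real. 2 * pi * (- 1 + y)) at_top at_top" by simp
      hence "filterlim (\<lambda>y::real. - (2 * pi * (- 1 + y))) at_bot at_top" by (simp add: filterlim_uminus_at_top)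
      from filterlim_compose[OF exp_at_bot this] show "((\<lambda>y. exp (- 2 * pi * (y - 1))) \<longlongrightarrow> 0) at_top" by simp
    qed
    hence "eventually (\<lambda>y. Cn * (exp (- 2 * pi * (y - 1)) * th 1) < e) at_top"
      using e by (intro order_tendstoD(2)) auto
    then obtain Y where Y: "\<And>y. y \<ge> Y \<Longrightarrow> Cn * (exp (- 2 * pi * (y - 1)) * th 1) < e"
      by (auto simp: eventually_at_top_linorder)
    obtain y where y: "y > max 1 Y" "h (\<i> * of_real y) \<noteq> 0"
    proof -
      have "\<exists>y>max 1 Y. y < max 1 Y + 1 \<and> h (\<i> * of_real y) \<noteq> 0" by (rule h_nonzero_ray) auto
      thus ?thesis using that by blast
    qed
    have "norm (G - of_nat q ^ m) \<le> Cn * (th y - 1)" using y by (intro main) auto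
    also have "\<dots> \<le> Cn * (exp (- 2 * pi * (y - 1)) * th 1)"
      using y Cn0 by (intro mult_left_mono th_decay) auto
    also have "\<dots> < e" using y by (intro Y) auto
    finally show ?thesis by simp
  qed
  hence "norm (G - of_nat q ^ m) \<le> 0" by (rule field_le_epsilon)
  thus ?thesis by (simp add: G_def)
qed

end

section \<open>Counting isotropic vectors modulo a prime\<close>

lemma sum_bord_box:
  "(\<Sum>y\<in>(ibox q :: (int^'m::finite bord) set). F y) = (\<Sum>s\<in>{0..<int q}. \<Sum>p\<in>ibox q. \<Sum>t\<in>{0..<int q}. F (bvec s p t))"
proof -
  have m: "mid y $ i = y $ mid_ix i" for y :: "int^'m bord" and i by (simp add: mid_def)
  have "(\<Sum>s\<in>{0..<int q}. \<Sum>p\<in>(ibox q :: (int^'m) set). \<Sum>t\<in>{0..<int q}. F (bvec s p t)) = (\<Sum>(s, p, t)\<in>{0..<int q} \<times> ibox q \<times> {0..<int q}. F (bvec s p t))"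
    by (simp add: sum.cartesian_product case_prod_unfold)
  also have "\<dots> = (\<Sum>y\<in>ibox q. F y)"
    by (rule sum.reindex_bij_witness[where i = "\<lambda>y. (y $ fst_ix, mid y, y $ lst_ix)" and j = "\<lambda>(s, p, t). bvec s p t"])
       (auto simp: ibox_def all_bord bvec_surj m)
  finally show ?thesis ..
qed

lemma sum_box_shift:
  fixes F :: "int^'m::finite \<Rightarrow> complex"
  assumes q: "q > 0" and F: "\<And>x y. vcong (int q) x y \<Longrightarrow> F x = F y"
  shows "(\<Sum>y\<in>ibox q. F (y + c)) = (\<Sum>y\<in>ibox q. F y)"
proof (rule sum.reindex_bij_witness[where i = "\<lambda>y. red q (y - c)" and j = "\<lambda>y. red q (y + c)"])
  have r: "red q (red q x + d) = red q (x + d)" for x d :: "int^'m"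
    unfolding red_eq_iff[OF q] by (rule vcong_add[OF red_cong vcong_refl])
  fix y :: "int^'m" assume y: "y \<in> ibox q"
  have "red q y = y" using box_eqI[OF red_box[OF q] y red_cong] .
  thus "red q (red q (y + c) - c) = y" "red q (red q (y - c) + c) = y"
    using r[of "y + c" "- c"] r[of "y - c" c] by simp_all
  show "red q (y + c) \<in> ibox q" "red q (y - c) \<in> ibox q" by (rule red_box[OF q])+
  show "F (red q (y + c)) = F (y + c)" by (rule F[OF red_cong])
qed

lemma root_sum_nonzero:
  assumes "N > 0"
  shows "(\<Sum>u\<in>{0..<int N} - {0}. ee (of_int (u * d) / of_nat N)) = (if int N dvd d then of_nat N else 0) - 1"
  using root_sum[OF assms, of d] assms by (simp add: sum_diff1)

lemma not_dvd_interval: "u \<in> {0..<int q} - {0} \<Longrightarrow> \<not> int q dvd u"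
  by (auto dest: zdvd_imp_le)

context maass_form_nonzero
begin

text \<open>The sum over \<open>t\<close> leaves only \<open>s = 0\<close>, so the hyperbolic plane
  contributes \<open>q\<close>; the rest is the Gauss sum of \<open>S\<close> for
  \<open>- u\<close>.\<close>

lemma gauss_sum_Q0:
  assumes q: "prime (q::nat)" and u: "\<not> int q dvd u"
  shows "(\<Sum>y\<in>ibox q. ee (of_int (u * Q0 y) / of_nat q)) = of_nat q ^ (m + 1)"
proof -
  have q0: "q > 0" using prime_gt_0_nat[OF q] .
  have u': "\<not> int q dvd - u" using u by simp
  have "ee (of_int (u * Q0 (bvec s p t)) / of_nat q) = ee (of_int (- u * qS p) / of_nat q) * ee (of_int (t * (u * s)) / of_nat q)" for s p t
  proof -
    have "of_int (u * Q0 (bvec s p t)) / (of_nat q :: complex) = of_int (- u * qS p) / of_nat q + of_int (t * (u * s)) / of_nat q"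
      by (simp add: Q0_bvec algebra_simps diff_divide_distrib)
    thus ?thesis by (simp only: ee_add)
  qed
  hence "(\<Sum>y\<in>ibox q. ee (of_int (u * Q0 y) / of_nat q)) =
    (\<Sum>s\<in>{0..<int q}. \<Sum>p\<in>ibox q. ee (of_int (- u * qS p) / of_nat q) * (\<Sum>t\<in>{0..<int q}. ee (of_int (t * (u * s)) / of_nat q)))"
    unfolding sum_bord_box by (simp only: sum_distrib_left)
  also have "\<dots> = (\<Sum>s\<in>{0..<int q}. of_nat q ^ m * (if s = 0 then of_nat q else 0))"
  proof (rule sum.cong[OF refl])
    fix s assume s: "s \<in> {0..<int q}"
    have "int q dvd u * s \<longleftrightarrow> int q dvd s" using q u by (simp add: prime_dvd_mult_iff)
    also have "\<dots> \<longleftrightarrow> s = 0" using s not_dvd_interval[of s q] by auto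
    finally show "(\<Sum>p\<in>ibox q. ee (of_int (- u * qS p) / of_nat q) * (\<Sum>t\<in>{0..<int q}. ee (of_int (t * (u * s)) / of_nat q))) =
      of_nat q ^ m * (if s = 0 then of_nat q else 0)"
      unfolding root_sum[OF q0] sum_distrib_right[symmetric] gauss_sum[OF q u'] by simp
  qed
  also have "\<dots> = of_nat q ^ (m + 1)" using q0 by (simp add: sum_distrib_left[symmetric])
  finally show ?thesis .
qed

lemma card_box: "(\<Sum>y\<in>(ibox q :: (int^'n bord) set). 1) = (of_nat q ^ (2 * m + 2) :: complex)" if "q > 0"
  using sum_box_fx[OF that, of 0] by (simp add: vcong_refl card_m of_nat_power)

text \<open>Detect \<open>Q0 y = 0\<close> modulo \<open>q\<close> by additive characters: the
  trivial one counts all \<open>q^(2 m + 2)\<close> vectors, each of the other \<open>q - 1\<close>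
  contributes a Gauss sum. The zero vector is counted but is not in \<open>Yq\<close>, whence the
  \<open>+ 1\<close>.\<close>

lemma card_isotropic:
  assumes q: "prime (q::nat)"
  shows "card (Yq q) + 1 = q ^ (2 * m + 1) + (q - 1) * q ^ m"
proof -
  have q0: "q > 0" using prime_gt_0_nat[OF q] .
  define W where "W = {y \<in> ibox q. int q dvd Q0 y}"
  have "of_nat q * of_nat (card W) = (\<Sum>y\<in>ibox q. if int q dvd Q0 y then of_nat q else (0::complex))"
    by (simp add: sum.If_cases W_def Int_def)
  also have "\<dots> = (\<Sum>y\<in>ibox q. \<Sum>u\<in>{0..<int q}. ee (of_int (u * Q0 y) / of_nat q))" by (simp only: root_sum[OF q0])
  also have "\<dots> = (\<Sum>u\<in>{0..<int q}. \<Sum>y\<in>ibox q. ee (of_int (u * Q0 y) / of_nat q))" by (rule sum.swap)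
  also have "\<dots> = of_nat q ^ (2 * m + 2) + (\<Sum>u\<in>{0..<int q} - {0}. \<Sum>y\<in>ibox q. ee (of_int (u * Q0 y) / of_nat q))"
    using q0 card_box[OF q0] by (subst sum.remove[of _ 0]) auto
  also have "(\<Sum>u\<in>{0..<int q} - {0}. \<Sum>y\<in>ibox q. ee (of_int (u * Q0 y) / of_nat q)) = (\<Sum>u\<in>{0..<int q} - {0}. of_nat q ^ (m + 1))"
    by (intro sum.cong refl gauss_sum_Q0[OF q] not_dvd_interval)
  also have "\<dots> = of_nat ((q - 1) * q ^ (m + 1))" using q0 by (simp add: card_Diff_singleton)
  finally have "of_nat (q * card W) = (of_nat (q * q ^ (2 * m + 1) + (q - 1) * (q * q ^ m)) :: complex)"
    by simp
  hence "q * card W = q * (q ^ (2 * m + 1) + (q - 1) * q ^ m)"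
    by (simp only: of_nat_eq_iff distrib_left mult.left_commute[of q "q - 1"])
  hence "card W = q ^ (2 * m + 1) + (q - 1) * q ^ m" using q0 by simp
  moreover have "W = insert 0 (Yq q)" using zero_box[OF q0] by (auto simp: W_def Yq_def Q0_def mid_0)
  moreover have "0 \<notin> Yq q" by (simp add: Yq_def)
  ultimately show ?thesis by simp
qed

text \<open>Orthogonality is detected by characters with parameter \<open>t u\<close> instead of
  \<open>t\<close>. The linear term is then absorbed by the shift \<open>y + t v0\<close>, which
  leaves \<open>- t^2 Q0 v0\<close>.\<close>

lemma sum_gauss_orthogonal:
  assumes q: "prime (q::nat)" and u: "\<not> int q dvd u"
  shows "of_nat q * (\<Sum>y\<in>ibox q. if int q dvd bil (S0 S) v0 y then ee (of_int (u * Q0 y) / of_nat q) else 0) =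
    of_nat q ^ (m + 1) * (\<Sum>t\<in>{0..<int q}. ee (of_int (u * (- (t\<^sup>2 * Q0 v0))) / of_nat q))"
proof -
  have q0: "q > 0" using prime_gt_0_nat[OF q] .
  let ?e = "\<lambda>x. ee (of_int x / of_nat q)"
  have dv: "int q dvd u * x \<longleftrightarrow> int q dvd x" for x using q u by (simp add: prime_dvd_mult_iff)
  have "of_nat q * (\<Sum>y\<in>ibox q. if int q dvd bil (S0 S) v0 y then ?e (u * Q0 y) else 0) =
    (\<Sum>y\<in>ibox q. (\<Sum>t\<in>{0..<int q}. ?e (t * (u * bil (S0 S) v0 y))) * ?e (u * Q0 y))"
    unfolding sum_distrib_left root_sum[OF q0] dv by (intro sum.cong refl) simp
  also have "\<dots> = (\<Sum>t\<in>{0..<int q}. \<Sum>y\<in>ibox q. ?e (t * (u * bil (S0 S) v0 y)) * ?e (u * Q0 y))"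
    unfolding sum_distrib_right by (rule sum.swap)
  also have "\<dots> = (\<Sum>t\<in>{0..<int q}. of_nat q ^ (m + 1) * ?e (u * (- (t\<^sup>2 * Q0 v0))))"
  proof (rule sum.cong[OF refl])
    fix t
    have "?e (t * (u * bil (S0 S) v0 y)) * ?e (u * Q0 y) = ?e (u * Q0 (y + t *s v0)) * ?e (u * (- (t\<^sup>2 * Q0 v0)))" for y
    proof -
      have "t * (u * bil (S0 S) v0 y) + u * Q0 y = u * Q0 (y + t *s v0) + u * (- (t\<^sup>2 * Q0 v0))"
        by (simp add: Q0_add Q0_scale bil_simps bS0_commute[of y v0] algebra_simps)
      hence "of_int (t * (u * bil (S0 S) v0 y)) / (of_nat q :: complex) + of_int (u * Q0 y) / of_nat q =
        of_int (u * Q0 (y + t *s v0)) / of_nat q + of_int (u * (- (t\<^sup>2 * Q0 v0))) / of_nat q"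
        by (simp only: add_divide_distrib[symmetric] of_int_add[symmetric])
      thus ?thesis by (simp only: ee_add[symmetric])
    qed
    hence "(\<Sum>y\<in>ibox q. ?e (t * (u * bil (S0 S) v0 y)) * ?e (u * Q0 y)) = (\<Sum>y\<in>ibox q. ?e (u * Q0 (y + t *s v0))) * ?e (u * (- (t\<^sup>2 * Q0 v0)))"
      by (simp only: sum_distrib_right)
    also have "(\<Sum>y\<in>ibox q. ?e (u * Q0 (y + t *s v0))) = (\<Sum>y\<in>ibox q. ?e (u * Q0 y))"
    proof (rule sum_box_shift[OF q0])
      fix x y :: "int^'n bord" assume "vcong (int q) x y"
      hence "int q dvd Q0 x - Q0 y" by (rule Q0_cong)
      hence "int q dvd u * Q0 x - u * Q0 y" by (simp flip: right_diff_distrib)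
      thus "?e (u * Q0 x) = ?e (u * Q0 y)" using q0 by (rule ee_frac_cong)
    qed
    finally show "(\<Sum>y\<in>ibox q. ?e (t * (u * bil (S0 S) v0 y)) * ?e (u * Q0 y)) = of_nat q ^ (m + 1) * ?e (u * (- (t\<^sup>2 * Q0 v0)))"
      unfolding gauss_sum_Q0[OF q u] .
  qed
  finally show ?thesis by (simp only: sum_distrib_left)
qed

lemma card_orthogonal:
  assumes q: "prime (q::nat)" and v0: "\<not> vcong (int q) v0 0"
  shows "of_nat q * (\<Sum>y\<in>ibox q. if int q dvd bil (S0 S) v0 y then 1 else 0) = (of_nat q ^ (2 * m + 2) :: complex)"
proof -
  have q0: "q > 0" using prime_gt_0_nat[OF q] .
  have "of_nat q * (\<Sum>y\<in>ibox q. if int q dvd bil (S0 S) v0 y then 1 else (0::complex)) =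
    (\<Sum>y\<in>ibox q. \<Sum>t\<in>{0..<int q}. ee (of_int (t * bil (S0 S) v0 y) / of_nat q))"
    unfolding sum_distrib_left root_sum[OF q0] by (intro sum.cong refl) simp
  also have "\<dots> = (\<Sum>t\<in>{0..<int q}. \<Sum>y\<in>ibox q. ee (of_int (bil (S0 S) (t *s v0) y) / of_nat q))"
    by (subst sum.swap) (simp add: bil_simps)
  also have "\<dots> = (\<Sum>t\<in>{0..<int q}. if t = 0 then of_nat q ^ (2 * m + 2) else 0)"
  proof (rule sum.cong[OF refl])
    fix t assume t: "t \<in> {0..<int q}"
    have "vcong (int q) (t *s v0) 0 \<longleftrightarrow> int q dvd t"
      using v0 q by (auto simp: vcong_0 prime_dvd_mult_iff)
    also have "\<dots> \<longleftrightarrow> t = 0" using t not_dvd_interval[of t q] by auto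
    finally show "(\<Sum>y\<in>ibox q. ee (of_int (bil (S0 S) (t *s v0) y) / of_nat q)) = (if t = 0 then of_nat q ^ (2 * m + 2) else 0)"
      by (simp only: sum_box_fx[OF q0]) (simp add: card_m)
  qed
  also have "\<dots> = of_nat q ^ (2 * m + 2)" using q0 by simp
  finally show ?thesis .
qed

text \<open>Characters in \<open>u\<close> detect isotropy; the trivial one counts the hyperplane.
  For the others, the square completed in \<open>sum_gauss_orthogonal\<close> is summed over
  \<open>u\<close> first: every \<open>t\<close> contributes \<open>q - 1\<close> if
  \<open>q\<close> divides \<open>Q0 v0\<close>; otherwise \<open>t = 0\<close> contributes
  \<open>q - 1\<close>, the remaining \<open>t\<close> contribute \<open>- 1\<close> each, and the
  total is 0.\<close>

lemma card_isotropic_orthogonal: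
  assumes q: "prime (q::nat)" and v0: "\<not> vcong (int q) v0 0"
  shows "card {y \<in> Yq q. int q dvd bil (S0 S) v0 y} + 1 =
    q ^ (2 * m) + (if int q dvd Q0 v0 then (q - 1) * q ^ m else 0)"
proof -
  have q0: "q > 0" using prime_gt_0_nat[OF q] .
  let ?e = "\<lambda>x. ee (of_int x / of_nat q)"
  let ?B = "\<lambda>y. int q dvd bil (S0 S) v0 y"
  define W where "W = {y \<in> ibox q. int q dvd Q0 y \<and> ?B y}"
  define r where "r = q - 1"
  have "of_nat q * of_nat (card W) = (\<Sum>y\<in>ibox q. if int q dvd Q0 y \<and> ?B y then of_nat q else (0::complex))"
    by (simp add: sum.If_cases W_def Int_def)
  also have "\<dots> = (\<Sum>y\<in>ibox q. \<Sum>u\<in>{0..<int q}. if ?B y then ?e (u * Q0 y) else 0)"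
  proof (rule sum.cong[OF refl])
    fix y
    show "(if int q dvd Q0 y \<and> ?B y then of_nat q else 0) = (\<Sum>u\<in>{0..<int q}. if ?B y then ?e (u * Q0 y) else 0)"
      using root_sum[OF q0, of "Q0 y"] by (cases "?B y") simp_all
  qed
  also have "\<dots> = (\<Sum>u\<in>{0..<int q}. \<Sum>y\<in>ibox q. if ?B y then ?e (u * Q0 y) else 0)" by (rule sum.swap)
  also have "\<dots> = (\<Sum>y\<in>ibox q. if ?B y then 1 else 0) + (\<Sum>u\<in>{0..<int q} - {0}. \<Sum>y\<in>ibox q. if ?B y then ?e (u * Q0 y) else 0)"
    using q0 by (subst sum.remove[of "{0..<int q}" 0]) (auto intro!: sum.cong)
  finally have "of_nat q * (of_nat q * of_nat (card W)) = of_nat q * (\<Sum>y\<in>ibox q. if ?B y then 1 else 0) +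
      (\<Sum>u\<in>{0..<int q} - {0}. of_nat q * (\<Sum>y\<in>ibox q. if ?B y then ?e (u * Q0 y) else 0))"
    by (simp only: distrib_left sum_distrib_left)
  also have "(\<Sum>u\<in>{0..<int q} - {0}. of_nat q * (\<Sum>y\<in>ibox q. if ?B y then ?e (u * Q0 y) else 0)) =
      (\<Sum>u\<in>{0..<int q} - {0}. of_nat q ^ (m + 1) * (\<Sum>t\<in>{0..<int q}. ?e (u * (- (t\<^sup>2 * Q0 v0)))))"
    by (intro sum.cong refl sum_gauss_orthogonal[OF q] not_dvd_interval)
  also have "\<dots> = of_nat q ^ (m + 1) * (\<Sum>t\<in>{0..<int q}. \<Sum>u\<in>{0..<int q} - {0}. ?e (u * (- (t\<^sup>2 * Q0 v0))))"
    unfolding sum_distrib_left[symmetric] by (rule arg_cong[OF sum.swap])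
  also have "(\<Sum>t\<in>{0..<int q}. \<Sum>u\<in>{0..<int q} - {0}. ?e (u * (- (t\<^sup>2 * Q0 v0)))) =
      (if int q dvd Q0 v0 then of_nat q * of_nat (q - 1) else 0)"
  proof -
    have "(\<Sum>t\<in>{0..<int q}. \<Sum>u\<in>{0..<int q} - {0}. ?e (u * (- (t\<^sup>2 * Q0 v0)))) =
      (\<Sum>t\<in>{0..<int q}. (if t = 0 \<or> int q dvd Q0 v0 then of_nat q else 0) - 1)"
    proof (rule sum.cong[OF refl])
      fix t assume t: "t \<in> {0..<int q}"
      have "int q dvd - (t\<^sup>2 * Q0 v0) \<longleftrightarrow> int q dvd t \<or> int q dvd Q0 v0"
        using q by (simp add: prime_dvd_mult_iff prime_dvd_power_iff)
      also have "int q dvd t \<longleftrightarrow> t = 0" using t not_dvd_interval[of t q] by auto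
      finally show "(\<Sum>u\<in>{0..<int q} - {0}. ?e (u * (- (t\<^sup>2 * Q0 v0)))) = (if t = 0 \<or> int q dvd Q0 v0 then of_nat q else 0) - 1"
        by (simp only: root_sum_nonzero[OF q0])
    qed
    also have "\<dots> = (\<Sum>t\<in>{0..<int q}. if t = 0 \<or> int q dvd Q0 v0 then of_nat q else 0) - of_nat q"
      by (simp add: sum_subtractf)
    also have "\<dots> = (if int q dvd Q0 v0 then of_nat q * of_nat (q - 1) else 0)"
      using q0 by (cases "int q dvd Q0 v0") (simp_all add: of_nat_diff algebra_simps)
    finally show ?thesis .
  qed
  also have "of_nat q * (\<Sum>y\<in>ibox q. if ?B y then 1 else 0) = (of_nat q ^ (2 * m + 2) :: complex)"
    by (rule card_orthogonal[OF q v0])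
  finally have "of_nat (q * (q * card W)) = (of_nat (q * (q * (q ^ (2 * m) + (if int q dvd Q0 v0 then r * q ^ m else 0)))) :: complex)"
    unfolding r_def[symmetric] by (simp add: algebra_simps split: if_splits)
  hence "card W = q ^ (2 * m) + (if int q dvd Q0 v0 then (q - 1) * q ^ m else 0)"
    using q0 unfolding of_nat_eq_iff r_def by simp
  moreover have "W = insert 0 {y \<in> Yq q. ?B y}"
    using zero_box[OF q0] by (auto simp: W_def Yq_def Q0_def mid_0)
  moreover have "0 \<notin> {y \<in> Yq q. ?B y}" "finite {y \<in> Yq q. ?B y}" by (simp_all add: Yq_def)
  ultimately show ?thesis by simp
qed

end

section \<open>Comparing eigenforms\<close>

context even_unimodular
begin

lemma nn_scale: "q > 0 \<Longrightarrow> nn (int q *s v) \<longleftrightarrow> nn v"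
  by (simp add: nn_def Q0_scale zero_le_mult_iff)

lemma nn_nbr:
  assumes q: "q > 0" and v: "int q dvd v $ fst_ix" and n: "nn (nbr q v)"
  shows "nn v"
proof -
  have "v $ fst_ix = int q * (v $ fst_ix div int q)" using v by simp
  moreover have "v $ fst_ix div int q \<ge> 0" using n by (simp add: nn_def nbr_def)
  ultimately have "v $ fst_ix \<ge> 0" by (metis mult_nonneg_nonneg of_nat_0_le_iff)
  moreover have "v $ lst_ix \<ge> 0" using n q by (simp add: nn_def nbr_def zero_le_mult_iff)
  ultimately show ?thesis using n nbr_props(1)[OF q v] by (simp add: nn_def)
qed

lemma beta_eq_0:
  assumes g: "good_sel q K x"
    and 1: "\<And>w. int q *s w = v \<Longrightarrow> al f w = 0" and 2: "al f (int q *s v) = 0"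
    and 3: "\<And>L. L \<in> KG \<Longrightarrow> int q dvd (L *v v) $ fst_ix \<Longrightarrow> al f (nbr q (L *v v)) = 0"
  shows "beta k q K f v = 0"
proof -
  have "al f (vdiv q v) = 0" if "vcong (int q) v 0"
    using that by (intro 1) (simp add: vdiv_def vcong_0 vec_eq_iff)
  moreover have "(\<Sum>y\<in>Yq q. if int q dvd (K y *v v) $ fst_ix then al f (nbr q (K y *v v)) else 0) = 0"
    using g 3 by (intro sum.neutral) (auto simp: good_sel_def)
  ultimately show ?thesis unfolding beta_def using 2 by simp
qed

end

context maass_form
begin

text \<open>Only the coefficient at 0 can be nonzero, and 0 is fixed by all operations on indices,
  so the eigenvalue \<open>c\<close> is read off from \<open>beta\<close>; \<open>h\<close> vanishes
  on the half-plane. The weight \<open>l\<close> is arbitrary because the theta argument, which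
  settles the parity of the rank, has no nonzero coefficient to start from.\<close>

lemma trivial_eigenforms:
  assumes a: "\<And>N. a N = 0" and q: "prime (q::nat)"
  shows "eigenform_on (half_space S) (hecke_S S k q) f"
    and "eigenform_on upper_half_plane (hecke_ell l (q\<^sup>2)) h"
proof -
  have q0: "q > 0" using prime_gt_0_nat[OF q] .
  have al0: "al f v = 0" if "v \<noteq> 0" for v
    using maass_al[OF f that] al_nn[OF fm, of v] by (cases "nn v") (simp_all add: dsum_def a)
  obtain K x where g: "good_sel q K x" using good_sel_exists[OF q] .
  define c where "c = 1 + of_nat q powi (int CARD('n) + 2 - 2 * k) + of_nat q powi (1 - k) / of_nat (q - 1) * (of_nat (card (Yq q)) :: complex)"
  have "beta k q K f v = c * al f v" for v
  proof (cases "v = 0")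
    case True
    have z: "vdiv q 0 = 0" "nbr q 0 = 0" "int q *s 0 = (0 :: int^'n bord)"
      by (simp_all add: vdiv_def nbr_def vec_eq_iff all_bord mid_0)
    show ?thesis unfolding True beta_def c_def by (simp add: z algebra_simps)
  next
    case False
    have "beta k q K f v = 0"
    proof (rule beta_eq_0[OF g])
      show "al f w = 0" if "int q *s w = v" for w using that False by (intro al0) auto
      show "al f (int q *s v) = 0" using False q0 by (intro al0) simp
      fix L assume L: "L \<in> KG" "int q dvd (L *v v) $ fst_ix"
      then obtain L' where "L' ** L = mat 1" by (auto simp: KG_def)
      hence "L' *v (L *v v) = v" by (simp add: matrix_vector_mul_assoc)
      hence "L *v v \<noteq> 0" using False by auto
      thus "al f (nbr q (L *v v)) = 0" using nbr_props(3)[OF q0 L(2)] by (intro al0)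
    qed
    thus ?thesis using al0[OF False] by simp
  qed
  thus "eigenform_on (half_space S) (hecke_S S k q) f" unfolding eigen_iff_beta[OF fm q g] by blast
  have h0: "h t = 0" if "Im t > 0" for t
  proof -
    have "((\<lambda>N::int. 0) has_sum h t) UNIV" using h_has_sum[OF that] by (simp add: a)
    thus ?thesis using has_sum_unique[OF _ has_sum_0] by blast
  qed
  have "ell_modular l h"
    unfolding ell_modular_def using Im_moebius_pos h0 by simp
  moreover have "bfun l q a N = 0 * a N" for N by (simp add: bfun_def a)
  ultimately show "eigenform_on upper_half_plane (hecke_ell l (q\<^sup>2)) h"
    using eigen_iff_bfun[OF _ q h_has_sum] by blast
qed

end

context maass_form_nonzero
begin

text \<open>If \<open>a 0\<close> is nonzero, the relation at \<open>N = 0\<close> identifies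
  \<open>c\<close>. Otherwise \<open>al f 0\<close> vanishes by \<open>constant_coeff_zero\<close>.
  The exponent \<open>k = 0\<close> is impossible, as \<open>h\<close> would have the negative
  weight \<open>- m\<close>.\<close>

lemma al_0_eigenvalue:
  assumes q: "prime (q::nat)" and c: "\<And>N. bfun (k - int m) q a N = c * a N"
  shows "(1 + of_nat q powi (1 - (k - int m)) + of_nat q powi (2 - 2 * (k - int m))) * al f 0 = c * al f 0"
proof (cases "a 0 = 0")
  case False
  have "(1 + of_nat q powi (1 - (k - int m)) + of_nat q powi (2 - 2 * (k - int m))) * a 0 = c * a 0"
    using c[of 0] by (simp add: bfun_def algebra_simps)
  thus ?thesis using False by simp
next
  case True
  have "k \<noteq> 0"
  proof
    assume "k = 0"
    hence "k - int m < 0" using m_pos by simp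
    hence "a N0 = 0" using h_has_sum ac_neg[OF f] by (rule negative_weight_zero[OF h_modular])
    thus False using N0 by simp
  qed
  thus ?thesis using constant_coeff_zero[OF True] by simp
qed

lemma eigenform_iff:
  assumes q: "prime (q::nat)"
  shows "eigenform_on (half_space S) (hecke_S S k q) f \<longleftrightarrow>
    eigenform_on upper_half_plane (hecke_ell (k - int m) (q\<^sup>2)) h"
proof -
  have q0: "q > 0" using prime_gt_0_nat[OF q] .
  obtain K x where g: "good_sel q K x" using good_sel_exists[OF q] .
  have beta: "beta k q K f v = dsum (bfun (k - int m) q a) k (cont v) (Q0 v) + b0 k q m * al f v" if "nn v" "v \<noteq> 0" for v
    using beta_formula[OF f q g that card_m card_isotropic[OF q] card_isotropic_orthogonal[OF q]] .
  have "(\<exists>c. \<forall>v. beta k q K f v = c * al f v) \<longleftrightarrow> (\<exists>c. \<forall>N. bfun (k - int m) q a N = c * a N)"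
  proof
    assume "\<exists>c. \<forall>v. beta k q K f v = c * al f v"
    then obtain c where c: "\<And>v. beta k q K f v = c * al f v" by blast
    have "bfun (k - int m) q a N = (c - b0 k q m) * a N" for N
    proof (cases "N \<ge> 0")
      case True
      \<comment> \<open>Content 1 and norm \<open>N\<close>: the divisor sum is a single term, so
        \<open>beta\<close> returns \<open>bfun\<close> coefficient by coefficient.\<close>
      let ?v = "bvec N 0 1 :: int^'n bord"
      have v: "nn ?v" "?v \<noteq> 0" using True by (simp_all add: nn_def Q0_bvec bvec_0)
      have "cont ?v = 1" by (rule cont_one[of _ lst_ix]) simp
      hence "dsum (bfun (k - int m) q a) k (cont ?v) (Q0 ?v) = bfun (k - int m) q a N" by (simp add: dsum_def Q0_bvec)
      thus ?thesis using beta[OF v] c[of ?v] by (simp add: ac_def algebra_simps)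
    next
      case False
      have "N div (int q)\<^sup>2 < 0" using False q0 by (intro div_neg_pos_less0) auto
      moreover have "(int q)\<^sup>2 * N < 0" using False q0 by (intro mult_pos_neg) auto
      ultimately show ?thesis using False ac_neg[OF f] by (simp add: bfun_def)
    qed
    thus "\<exists>c. \<forall>N. bfun (k - int m) q a N = c * a N" by blast
  next
    assume "\<exists>c. \<forall>N. bfun (k - int m) q a N = c * a N"
    then obtain c where c: "\<And>N. bfun (k - int m) q a N = c * a N" by blast
    have "beta k q K f v = (c + b0 k q m) * al f v" for v
    proof -
      consider "v = 0" | "v \<noteq> 0" "nn v" | "\<not> nn v" by blast
      thus ?thesis
      proof cases
        case 1
        show ?thesis
          unfolding 1 beta_zero[OF q card_m] distrib_right[of _ "b0 k q m"] al_0_eigenvalue[OF q c] ..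
      next
        case 2
        \<comment> \<open>Divisor sums are linear in the coefficient function, so an eigenvalue
          relation for \<open>a\<close> passes to every index.\<close>
        have "dsum (bfun (k - int m) q a) k (cont v) (Q0 v) = c * al f v"
          unfolding maass_al[OF f 2] dsum_def c sum_distrib_left by (simp only: mult.left_commute)
        thus ?thesis using beta[OF 2(2,1)] by (simp add: algebra_simps)
      next
        case 3
        have "beta k q K f v = 0"
        proof (rule beta_eq_0[OF g])
          show "al f w = 0" if "int q *s w = v" for w using that 3 nn_scale[OF q0, of w] by (intro al_nn[OF fm]) auto
          show "al f (int q *s v) = 0" using 3 nn_scale[OF q0] by (intro al_nn[OF fm]) auto
          fix L assume L: "L \<in> KG" "int q dvd (L *v v) $ fst_ix"
          show "al f (nbr q (L *v v)) = 0" using 3 nn_nbr[OF q0 L(2)] L(1) by (intro al_nn[OF fm]) (auto simp: KG_def)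
        qed
        thus ?thesis using al_nn[OF fm 3] by simp
      qed
    qed
    thus "\<exists>c. \<forall>v. beta k q K f v = c * al f v" by blast
  qed
  thus ?thesis
    unfolding eigen_iff_beta[OF fm q g] using eigen_iff_bfun[OF h_modular q h_has_sum] by simp
qed

end

theorem theorem3:
  fixes S :: "int^'n^'n::finite" and k :: int and q :: nat
    and f :: "complex^'n bord \<Rightarrow> complex"
  assumes "transpose S = S" and "pos_def S" and "maximal_even S" and "det S = 1"
    and "f \<in> maass_space S k"
    and "prime q" and "\<not> int q dvd det S"
  shows "eigenform_on (half_space S) (hecke_S S k q) f \<longleftrightarrow>
         eigenform_on upper_half_plane (hecke_ell (ell_weight S k) (q\<^sup>2)) (star S f)"
proof -
  interpret maass_form S k f
    using assms by unfold_locales (simp_all add: maximal_even_def)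
  show ?thesis
  proof (cases "\<forall>N. ac f N = 0")
    case True
    thus ?thesis using trivial_eigenforms \<open>prime q\<close> by blast
  next
    case False
    then obtain N0 where "ac f N0 \<noteq> 0" by blast
    then interpret maass_form_nonzero S k f N0 by unfold_locales
    \<comment> \<open>The integer division is exact because \<open>n = 2 m\<close>.\<close>
    have "ell_weight S k = k - int m" by (simp add: ell_weight_def card_m)
    thus ?thesis using eigenform_iff[OF \<open>prime q\<close>] by simp
  qed
qed

end
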